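(* For every $\ell\ge 1$, all the zeros of $g_{k,1}(\tau)=q+O(q^{\ell+1})$ in the fundamental domain $\mathcal{F}$ lie on the arc $\mathcal{A}=\{e^{i\theta}:\frac{\pi}{2}\le\theta\le\frac{2\pi}{3}\}$.
   Context: Let $k\ge 0$ be an even integer and write $k=12\ell+k'$ with $k'\in\{0,4,6,8,10,14\}$. Let $M_k$ denote the space of holomorphic modular forms of weight $k$ for $\mathrm{PSL}_2(\mathbb{Z})$, with $q=e^{2\pi i\tau}$, $\tau$ in the upper half plane $\mathbb{H}$. The Miller basis $\{g_{k,m}\}_{m=0}^{\ell}$ of $M_k$ is defined by requiring, for each $0\le m\le\ell$, that $g_{k,m}\in M_k$ satisfies $g_{k,m}(\tau)=q^m+O(q^{\ell+1})$; in particular $g_{k,1}$ is the cusp form in $M_k$ with $g_{k,1}(\tau)=q+O(q^{\ell+1})$. The fundamental domain is $\mathcal{F}=\{z\in\mathbb{H}:|z|\ge 1,\,-\frac12\le\Re(z)\le 0\}\cup\{z\in\mathbb{H}:|z|>1,\,0<\Re(z)<\frac12\}$. *)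

theory Defs
  imports "HOL-Complex_Analysis.Complex_Analysis"
begin

definition upper_half_plane :: "complex set" where
  "upper_half_plane = {z. Im z > 0}"

definition qpar :: "complex \<Rightarrow> complex" where
  "qpar \<tau> = exp (2 * of_real pi * \<i> * \<tau>)"

definition has_q_expansion :: "(complex \<Rightarrow> complex) \<Rightarrow> (nat \<Rightarrow> complex) \<Rightarrow> bool" where
  "has_q_expansion f a \<longleftrightarrow>
     (\<forall>\<tau>\<in>upper_half_plane. (\<lambda>n. a n * qpar \<tau> ^ n) sums f \<tau>)"

definition modular_form :: "nat \<Rightarrow> (complex \<Rightarrow> complex) \<Rightarrow> bool" where
  "modular_form k f \<longleftrightarrow>
     f holomorphic_on upper_half_plane \<and>
     (\<forall>a b c d :: int. a * d - b * c = 1 \<longrightarrow>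
        (\<forall>\<tau>\<in>upper_half_plane.
           f ((of_int a * \<tau> + of_int b) / (of_int c * \<tau> + of_int d))
             = (of_int c * \<tau> + of_int d) ^ k * f \<tau>)) \<and>
     (\<exists>a. has_q_expansion f a)"

(* k = 12 l + k' with k' in {0,4,6,8,10,14} *)
definition ell :: "nat \<Rightarrow> nat" where
  "ell k = (if k mod 12 = 2 then k div 12 - 1 else k div 12)"

definition fund_domain :: "complex set" where
  "fund_domain = {z. Im z > 0 \<and> cmod z \<ge> 1 \<and> -1/2 \<le> Re z \<and> Re z \<le> 0}
               \<union> {z. Im z > 0 \<and> cmod z > 1 \<and> 0 < Re z \<and> Re z < 1/2}"

definition arc_A :: "complex set" where
  "arc_A = {z. \<exists>\<theta>::real. pi/2 \<le> \<theta> \<and> \<theta> \<le> 2*pi/3 \<and> z = exp (\<i> * of_real \<theta>)}"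

end

theory Submission
  imports Defs
begin

text \<open>
  With \<open>k = 12 l + 4 a + 6 b\<close>, \<open>a \<le> 2\<close>, \<open>b \<le> 1\<close>, the cusp form is \<open>\<Delta>^l E4^a E6^b P(j)\<close> for a polynomial \<open>P\<close>
  of degree at most \<open>l - 1\<close>. Lagrange inversion expresses \<open>P(x)\<close> as a coefficient of
  \<open>E4^(2-a) E6^(1-b) / (\<Delta>^l (j - x))\<close>, up to normalisation. For \<open>x = j(e^(i\<theta>))\<close> on the arc, moving the contour
  towards \<open>|q| = 1\<close> picks up residues at \<open>z\<close>, \<open>-1/z\<close> and possibly \<open>-1/(z+1)\<close>. After multiplication by a
  real function that does not vanish on the open arc, the first two give
  \<open>2 cos (k\<theta>/2 + 2\<pi> cos \<theta>)\<close>, while for \<open>l \<ge> 10\<close> everything else is at most \<open>6/5\<close>. The \<open>l\<close> points where the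
  cosine is \<open>\<plusminus>1\<close> yield \<open>l - 1\<close> sign changes of \<open>P\<close> on \<open>[0, 1728]\<close>, hence all its zeros; for \<open>l \<le> 9\<close> the sign
  changes are found by integer arithmetic. Finally a point of the fundamental domain with
  \<open>j \<in> [0, 1728]\<close> lies on the unit circle.
\<close>

text \<open>The third pole -1/(z+1) is what shapes the estimate. Its height sin \<theta> / (2 (1 +
  cos \<theta>)) is 1/2 at z = i and grows to sqrt 3 / 2, the height of z itself, at the other end
  of the arc. A contour at height 1/2 has all three poles above it but meets the third one as z
  tends to i; a higher contour meets it further along. Hence two contours, at height 1/2 for j \<le>
  1300 and at height 13/20 for j \<ge> 1300. Inversion carries both to |q| \<le> 0.0024, where short
  Taylor polynomials of E4 and E6 are accurate. The remainder contains the l-th power of the ratio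
  of Delta at z to Delta on the contour, at most 1/2; l = 10 is where the resulting bound falls
  below the amplitude 2 of the cosine.

  The theory of the forms rests on growth and on comparison of few coefficients: a crude Sturm bound
  identifies E4, E6 and a Ramanujan relation, this relation shows that Delta has no zeros, and that
  in turn yields the sharp Sturm bound.\<close>

lemma norm_qpar: "norm (qpar \<tau>) = exp (- (2 * pi * Im \<tau>))"
  unfolding qpar_def by (simp add: norm_exp_eq_Re)

lemma norm_qpar_less_1: "Im \<tau> > 0 \<Longrightarrow> norm (qpar \<tau>) < 1"
  by (simp add: norm_qpar)

lemma qpar_nonzero [simp]: "qpar \<tau> \<noteq> 0"
  by (simp add: qpar_def)

lemma qpar_eq_iff: "qpar z = qpar w \<longleftrightarrow> (\<exists>n::int. z = w + of_int n)"
proof -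
  have "qpar z = qpar w \<longleftrightarrow> (\<exists>n::int. 2 * of_real pi * \<i> * z = 2 * of_real pi * \<i> * w + of_int (2 * n) * pi * \<i>)"
    unfolding qpar_def exp_eq by simp
  also have "\<dots> \<longleftrightarrow> (\<exists>n::int. z = w + of_int n)"
  proof (rule arg_cong[of _ _ Ex], rule ext)
    fix n :: int
    have "(2 * of_real pi * \<i> * z = 2 * of_real pi * \<i> * w + of_int (2 * n) * pi * \<i>) \<longleftrightarrow>
          (2 * of_real pi * \<i>) * z = (2 * of_real pi * \<i>) * (w + of_int n)"
      by (simp add: algebra_simps)
    also have "\<dots> \<longleftrightarrow> z = w + of_int n"
      by simp
    finally show "(2 * of_real pi * \<i> * z = 2 * of_real pi * \<i> * w + of_int (2 * n) * pi * \<i>) = (z = w + of_int n)" .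
  qed
  finally show ?thesis .
qed

lemma qpar_add_int [simp]: "qpar (z + of_int n) = qpar z"
  by (subst qpar_eq_iff) auto

lemma qpar_surj:
  assumes "q \<noteq> 0" "norm q < 1"
  obtains \<tau> where "Im \<tau> > 0" "\<bar>Re \<tau>\<bar> \<le> 1/2" "qpar \<tau> = q"
proof
  let ?t = "Ln q / (2 * of_real pi * \<i>)"
  have eq: "?t = Complex (Im (Ln q) / (2*pi)) (- Re (Ln q) / (2 * pi))"
    by (simp add: complex_eq_iff Re_divide Im_divide power2_eq_square)
  show "Im ?t > 0"
    unfolding eq using assms by (simp add: field_simps)
  have "\<bar>Im (Ln q)\<bar> \<le> pi"
    using Im_Ln_le_pi[of q] mpi_less_Im_Ln[of q] assms by auto
  thus "\<bar>Re ?t\<bar> \<le> 1/2"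
    unfolding eq by (simp add: field_simps abs_le_iff)
  show "qpar ?t = q"
    using assms by (simp add: qpar_def)
qed

lemma qpar_cnj: "qpar (- cnj z) = cnj (qpar z)"
  by (simp add: qpar_def exp_cnj)

lemma holomorphic_qpar [holomorphic_intros]: "qpar holomorphic_on A"
  unfolding qpar_def by (intro holomorphic_intros)

lemma deriv_qpar: "(qpar has_field_derivative (2 * of_real pi * \<i> * qpar z)) (at z)"
  unfolding qpar_def by (auto intro!: derivative_eq_intros)

subsection \<open>The action of the modular group\<close>

lemma moebius_denom_nonzero:
  fixes a b c d :: int
  assumes "a * d - b * c = 1" "Im \<tau> > 0"
  shows "of_int c * \<tau> + of_int d \<noteq> (0::complex)"
proof
  assume *: "of_int c * \<tau> + of_int d = (0::complex)"
  hence "Im (of_int c * \<tau> + of_int d) = 0" by simp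
  hence "c = 0" using assms by simp
  with * have "d = 0" by simp
  with \<open>c = 0\<close> assms show False by simp
qed

lemma Im_moebius:
  fixes a b c d :: int
  assumes "a * d - b * c = 1" "Im \<tau> > 0"
  shows "Im ((of_int a * \<tau> + of_int b) / (of_int c * \<tau> + of_int d)) = Im \<tau> / norm (of_int c * \<tau> + of_int d) ^ 2"
proof -
  have "(of_int a * of_int d - of_int b * of_int c :: real) = of_int (a * d - b * c)" by simp
  hence *: "(of_int a * of_int d - of_int b * of_int c :: real) = 1" using assms by simp
  have "Im ((of_int a * \<tau> + of_int b) / (of_int c * \<tau> + of_int d)) =
     (of_int a * of_int d - of_int b * of_int c) * Im \<tau> / norm (of_int c * \<tau> + of_int d) ^ 2"
    by (simp add: Im_divide cmod_power2 algebra_simps)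
  thus ?thesis by (simp add: *)
qed

lemma Im_moebius_pos:
  fixes a b c d :: int
  assumes "a * d - b * c = 1" "Im \<tau> > 0"
  shows "Im ((of_int a * \<tau> + of_int b) / (of_int c * \<tau> + of_int d)) > 0"
  using moebius_denom_nonzero[OF assms] assms by (simp add: Im_moebius)

lemma finite_lattice_le:
  assumes "Im \<tau> > 0"
  shows "finite {(c::int, d::int). norm (of_int c * \<tau> + of_int d) \<le> R}"
proof -
  define B where "B = \<lceil>R / Im \<tau>\<rceil>"
  define C where "C = \<lceil>R + \<bar>of_int B\<bar> * norm \<tau>\<rceil>"
  have "{(c::int, d::int). norm (of_int c * \<tau> + of_int d) \<le> R} \<subseteq> {-B..B} \<times> {-C..C}"
  proof safe
    fix c d :: int
    assume *: "norm (of_int c * \<tau> + of_int d) \<le> R"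
    have "\<bar>of_int c\<bar> * Im \<tau> = \<bar>Im (of_int c * \<tau> + of_int d)\<bar>" using assms by (simp add: abs_mult)
    also have "\<dots> \<le> R" using * abs_Im_le_cmod order_trans by blast
    finally have "\<bar>of_int c\<bar> \<le> R / Im \<tau>" using assms by (simp add: field_simps)
    hence c: "\<bar>c\<bar> \<le> B" unfolding B_def by linarith
    thus "c \<in> {-B..B}" by auto
    have "norm (of_int d :: complex) \<le> norm (of_int c * \<tau> + of_int d) + norm (of_int c * \<tau>)"
      by (metis add_diff_cancel_left' norm_triangle_ineq4 add.commute)
    also have "\<dots> \<le> R + \<bar>of_int B\<bar> * norm \<tau>"
      using * c by (intro add_mono) (auto simp: norm_mult intro!: mult_right_mono)
    finally have "\<bar>of_int d\<bar> \<le> R + \<bar>of_int B\<bar> * norm \<tau>" by simp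
    hence "\<bar>d\<bar> \<le> C" unfolding C_def by linarith
    thus "d \<in> {-C..C}" by auto
  qed
  thus ?thesis by (rule finite_subset) auto
qed

text \<open>A coprime pair (c, d) with |c \<tau> + d| minimal maximizes the height of the image.
  Bezout completes it to a matrix, and multiples of the bottom row may be subtracted from the top
  row to centre the real part. The top row is coprime as well, so minimality gives |a \<tau> + b|
  \<ge> |c \<tau> + d|, that is norm at least 1.\<close>

lemma moebius_to_fundamental_domain:
  assumes "Im \<tau> > 0"
  obtains a b c d :: int where "a * d - b * c = 1"
    "\<bar>Re ((of_int a * \<tau> + of_int b) / (of_int c * \<tau> + of_int d))\<bar> \<le> 1/2"
    "norm ((of_int a * \<tau> + of_int b) / (of_int c * \<tau> + of_int d)) \<ge> 1"
proof -
  define S where "S = {(c::int, d::int). coprime c d \<and> norm (of_int c * \<tau> + of_int d) \<le> 1}"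
  define g where "g = (\<lambda>(c::int, d::int). norm (of_int c * \<tau> + of_int d))"
  have "finite S"
    by (rule finite_subset[OF _ finite_lattice_le[OF assms, of 1]]) (auto simp: S_def)
  moreover have "(0, 1) \<in> S" by (auto simp: S_def)
  ultimately obtain p where p: "p \<in> S" "\<forall>p'\<in>S. g p \<le> g p'"
    using arg_min_least[of S _ g] arg_min_if_finite(1)[of S g] by blast
  obtain c d where cd: "p = (c, d)" by force
  have cop: "coprime c d" and le1: "norm (of_int c * \<tau> + of_int d) \<le> 1"
    using p cd by (auto simp: S_def)
  have min: "norm (of_int c * \<tau> + of_int d) \<le> norm (of_int c' * \<tau> + of_int d')" if "coprime c' d'" for c' d' :: int
  proof (cases "norm (of_int c' * \<tau> + of_int d') \<le> 1")
    case True
    with that have "(c', d') \<in> S" by (auto simp: S_def)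
    with p cd show ?thesis by (auto simp: g_def)
  qed (use le1 in auto)
  obtain u v where "u * c + v * d = 1" using bezout_int[of c d] cop by auto
  hence det0: "v * d - (-u) * c = 1" by simp
  define n where "n = round (Re ((of_int v * \<tau> + of_int (-u)) / (of_int c * \<tau> + of_int d)))"
  define a where "a = v - n * c"
  define b where "b = - u - n * d"
  have det: "a * d - b * c = 1" using det0 by (simp add: a_def b_def algebra_simps)
  have nz: "of_int c * \<tau> + of_int d \<noteq> 0" by (rule moebius_denom_nonzero[OF det assms])
  have eq: "(of_int a * \<tau> + of_int b) / (of_int c * \<tau> + of_int d) =
      (of_int v * \<tau> + of_int (-u)) / (of_int c * \<tau> + of_int d) - of_int n"
    using nz by (simp add: a_def b_def field_simps)
  have "coprime a b"
    by (rule coprimeI) (metis det dvd_diff dvd_mult2)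
  hence "norm (of_int c * \<tau> + of_int d) \<le> norm (of_int a * \<tau> + of_int b)"
    by (rule min)
  hence "norm ((of_int a * \<tau> + of_int b) / (of_int c * \<tau> + of_int d)) \<ge> 1"
    using nz by (simp add: norm_divide field_simps)
  moreover have "\<bar>Re ((of_int a * \<tau> + of_int b) / (of_int c * \<tau> + of_int d))\<bar> \<le> 1/2"
    unfolding eq n_def by (metis Re_complex_of_real minus_complex.sel(1) of_int_round_abs_le of_real_of_int_eq abs_minus_commute)
  ultimately show ?thesis using that det by blast
qed

lemma Im_fundamental_domain_ge:
  assumes "\<bar>Re z\<bar> \<le> 1/2" "norm z \<ge> 1" "Im z > 0"
  shows "Im z \<ge> sqrt 3 / 2"
proof -
  have "1 \<le> norm z ^ 2" using assms by simp
  also have "\<dots> = \<bar>Re z\<bar>^2 + Im z ^ 2" by (simp add: cmod_power2)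
  also have "\<bar>Re z\<bar>^2 \<le> (1/2)^2" using assms by (intro power_mono) auto
  finally have "Im z ^ 2 \<ge> (sqrt 3 / 2)^2" by (simp add: power_divide power2_eq_square)
  thus ?thesis using assms by (simp add: power2_le_iff_abs_le)
qed

text \<open>Reduction to the fundamental domain confines the search to a strip of height at least
  sqrt 3 / 2, and decay at the cusp cuts the strip to a compact rectangle. Applied to |F|^2 (Im
  \<tau>)^k in \<open>sturm_crude\<close> and to |F^12 / Delta^k| in \<open>sturm\<close>.\<close>

lemma invariant_attains_max:
  fixes u :: "complex \<Rightarrow> real"
  assumes cont: "continuous_on {\<tau>. Im \<tau> > 0} u"
    and inv: "\<And>a b c d \<tau>. a * d - b * c = 1 \<Longrightarrow> Im \<tau> > 0 \<Longrightarrow> u ((of_int a * \<tau> + of_int b) / (of_int c * \<tau> + of_int d)) = u \<tau>"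
    and dec: "\<And>e. e > 0 \<Longrightarrow> \<exists>Y. \<forall>\<tau>. Im \<tau> > Y \<longrightarrow> u \<tau> < e"
    and pos: "Im \<tau>1 > 0" "u \<tau>1 > 0"
  obtains \<tau>0 where "Im \<tau>0 \<ge> sqrt 3 / 2" "\<And>\<tau>. Im \<tau> > 0 \<Longrightarrow> u \<tau> \<le> u \<tau>0"
proof -
  obtain Y where Y: "\<And>\<tau>. Im \<tau> > Y \<Longrightarrow> u \<tau> < u \<tau>1" using dec[OF pos(2)] by blast
  define K where "K = {z. \<bar>Re z\<bar> \<le> 1/2 \<and> sqrt 3 / 2 \<le> Im z \<and> Im z \<le> Y}"
  have red: "\<exists>z. u z = u \<tau> \<and> \<bar>Re z\<bar> \<le> 1/2 \<and> Im z \<ge> sqrt 3 / 2" if \<tau>: "Im \<tau> > 0" for \<tau>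
  proof -
    obtain a b c d :: int where *: "a * d - b * c = 1"
      "\<bar>Re ((of_int a * \<tau> + of_int b) / (of_int c * \<tau> + of_int d))\<bar> \<le> 1/2"
      "norm ((of_int a * \<tau> + of_int b) / (of_int c * \<tau> + of_int d)) \<ge> 1"
      using moebius_to_fundamental_domain[OF \<tau>] by metis
    show ?thesis
      using Im_fundamental_domain_ge[OF *(2,3) Im_moebius_pos[OF *(1) \<tau>]] inv[OF *(1) \<tau>] * by blast
  qed
  have K_box: "K = cbox (Complex (-1/2) (sqrt 3/2)) (Complex (1/2) Y)"
    by (auto simp: K_def in_cbox_complex_iff)
  have "compact K" unfolding K_box by (rule compact_cbox)
  obtain z1 where z1: "u z1 = u \<tau>1" "\<bar>Re z1\<bar> \<le> 1/2" "Im z1 \<ge> sqrt 3 / 2" using red[OF pos(1)] by auto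
  have "z1 \<in> K" using z1 Y[of z1] by (force simp: K_def)
  have "sqrt 3 / 2 > 0" by simp
  hence sub: "K \<subseteq> {\<tau>. Im \<tau> > 0}" unfolding K_def by (smt (verit) mem_Collect_eq subsetI)
  obtain z0 where z0: "z0 \<in> K" "\<And>z. z \<in> K \<Longrightarrow> u z \<le> u z0"
    using continuous_attains_sup[OF \<open>compact K\<close> _ continuous_on_subset[OF cont sub]] \<open>z1 \<in> K\<close> by blast
  show ?thesis
  proof
    show "Im z0 \<ge> sqrt 3 / 2" using z0 by (auto simp: K_def)
    fix \<tau> assume "Im \<tau> > 0"
    then obtain z where z: "u z = u \<tau>" "\<bar>Re z\<bar> \<le> 1/2" "Im z \<ge> sqrt 3 / 2" using red by blast
    show "u \<tau> \<le> u z0"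
    proof (cases "Im z \<le> Y")
      case True
      hence "z \<in> K" using z by (auto simp: K_def)
      thus ?thesis using z0 z by force
    next
      case False
      hence "u z < u \<tau>1" using Y by auto
      thus ?thesis using z0(2)[OF \<open>z1 \<in> K\<close>] z1 z by linarith
    qed
  qed
qed

subsection \<open>Modular power series\<close>

text \<open>The form is encoded by its q-series, so that products, coefficients and inverses live in
  the ring of formal power series. The convergence radius supplies holomorphy, the cusp
  included.\<close>

definition mform :: "nat \<Rightarrow> complex fps \<Rightarrow> bool" where
  "mform k F \<longleftrightarrow> fps_conv_radius F \<ge> 1 \<and>
     (\<forall>a b c d :: int. a * d - b * c = 1 \<longrightarrow> (\<forall>\<tau>. Im \<tau> > 0 \<longrightarrow>
        eval_fps F (qpar ((of_int a * \<tau> + of_int b) / (of_int c * \<tau> + of_int d))) =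
          (of_int c * \<tau> + of_int d) ^ k * eval_fps F (qpar \<tau>)))"

lemma mform_conv: "mform k F \<Longrightarrow> fps_conv_radius F \<ge> 1"
  by (simp add: mform_def)

lemma mform_eq:
  fixes a b c d :: int
  shows "mform k F \<Longrightarrow> a * d - b * c = 1 \<Longrightarrow> Im \<tau> > 0 \<Longrightarrow>
    eval_fps F (qpar ((of_int a * \<tau> + of_int b) / (of_int c * \<tau> + of_int d))) =
          (of_int c * \<tau> + of_int d) ^ k * eval_fps F (qpar \<tau>)"
  unfolding mform_def by blast

lemma less_conv: "1 \<le> r \<Longrightarrow> norm q < 1 \<Longrightarrow> ereal (norm q) < r"
  by (metis less_ereal.simps(1) one_ereal_def order_less_le_trans)

lemma qpar_conv: "1 \<le> r \<Longrightarrow> Im \<tau> > 0 \<Longrightarrow> ereal (norm (qpar \<tau>)) < r"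
  by (intro less_conv norm_qpar_less_1)

lemma mform_const: "mform 0 (fps_const c)"
  by (simp add: mform_def)

lemma conv_radius_mult_ge_1:
  "1 \<le> fps_conv_radius F \<Longrightarrow> 1 \<le> fps_conv_radius G \<Longrightarrow> 1 \<le> fps_conv_radius (F * G)"
  for F G :: "complex fps"
  by (meson fps_conv_radius_mult min.boundedI order_trans)

lemma conv_radius_add_ge_1:
  "1 \<le> fps_conv_radius F \<Longrightarrow> 1 \<le> fps_conv_radius G \<Longrightarrow> 1 \<le> fps_conv_radius (F + G)"
  for F G :: "complex fps"
  by (meson fps_conv_radius_add min.boundedI order_trans)

lemma conv_radius_diff_ge_1:
  "1 \<le> fps_conv_radius F \<Longrightarrow> 1 \<le> fps_conv_radius G \<Longrightarrow> 1 \<le> fps_conv_radius (F - G)"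
  for F G :: "complex fps"
  by (meson fps_conv_radius_diff min.boundedI order_trans)

lemma conv_radius_power_ge_1:
  "1 \<le> fps_conv_radius F \<Longrightarrow> 1 \<le> fps_conv_radius (F ^ n)" for F :: "complex fps"
  by (meson fps_conv_radius_power order_trans)

lemma mform_mult: "mform k F \<Longrightarrow> mform l G \<Longrightarrow> mform (k + l) (F * G)"
  unfolding mform_def
  by (auto simp: conv_radius_mult_ge_1 eval_fps_mult qpar_conv Im_moebius_pos power_add)

lemma mform_add: "mform k F \<Longrightarrow> mform k G \<Longrightarrow> mform k (F + G)"
  unfolding mform_def
  by (auto simp: conv_radius_add_ge_1 eval_fps_add qpar_conv Im_moebius_pos ring_distribs)

lemma mform_diff: "mform k F \<Longrightarrow> mform k G \<Longrightarrow> mform k (F - G)"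
  unfolding mform_def
  by (auto simp: conv_radius_diff_ge_1 eval_fps_diff qpar_conv Im_moebius_pos ring_distribs)

lemma mform_cmult: "mform k F \<Longrightarrow> mform k (fps_const c * F)"
  using mform_mult[OF mform_const] by simp

lemma mform_power: "mform k F \<Longrightarrow> mform (n * k) (F ^ n)"
proof (induction n)
  case 0
  show ?case using mform_const[of 1] by simp
next
  case (Suc n)
  thus ?case using mform_mult[of k F "n * k" "F ^ n"] by simp
qed

lemma eval_fps_unit_disc_eq_0:
  fixes F :: "complex fps"
  assumes "fps_conv_radius F \<ge> 1" "\<And>q. norm q < 1 \<Longrightarrow> q \<noteq> 0 \<Longrightarrow> eval_fps F q = 0"
  shows "F = 0"
proof -
  have conv: "fps_conv_radius F > 0" using assms(1) by (rule less_le_trans[rotated]) simp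
  have "continuous_on (ball 0 1) (eval_fps F)"
    by (rule continuous_on_eval_fps') (use assms(1) in \<open>auto simp: less_conv dist_norm\<close>)
  hence "isCont (eval_fps F) 0" by (simp add: continuous_on_eq_continuous_at)
  hence lim: "(eval_fps F \<longlongrightarrow> eval_fps F 0) (at 0)" by (simp add: isCont_def)
  have "eventually (\<lambda>q. eval_fps F q = 0) (at 0)"
    unfolding eventually_at by (rule exI[of _ 1]) (use assms(2) in \<open>auto simp: dist_norm\<close>)
  hence "(eval_fps F \<longlongrightarrow> 0) (at 0)" by (rule tendsto_eventually)
  with lim have "eval_fps F 0 = 0" using tendsto_unique trivial_limit_at by blast
  hence "eventually (\<lambda>q. eval_fps F q = eval_fps 0 q) (nhds 0)"
    unfolding eventually_nhds_metric by (intro exI[of _ 1]) (use assms(2) in \<open>auto simp: dist_norm\<close>)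
  thus "F = 0" by (intro eval_fps_eqD) (use conv in auto)
qed

lemma mform_eq_0I:
  assumes "fps_conv_radius F \<ge> 1" "\<And>\<tau>. Im \<tau> > 0 \<Longrightarrow> eval_fps F (qpar \<tau>) = 0"
  shows "F = 0"
  using eval_fps_unit_disc_eq_0[OF assms(1)] assms(2) qpar_surj by metis

lemma continuous_on_mform: "fps_conv_radius F \<ge> 1 \<Longrightarrow> continuous_on {\<tau>. Im \<tau> > 0} (\<lambda>\<tau>. eval_fps F (qpar \<tau>))"
  for F :: "complex fps"
  by (intro continuous_on_eval_fps' holomorphic_on_imp_continuous_on holomorphic_qpar) (auto simp: qpar_conv)

lemma holomorphic_on_mform: "fps_conv_radius F \<ge> 1 \<Longrightarrow> (\<lambda>\<tau>. eval_fps F (qpar \<tau>)) holomorphic_on {\<tau>. Im \<tau> > 0}"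
  for F :: "complex fps"
  by (intro holomorphic_on_eval_fps[THEN holomorphic_on_compose_gen[OF holomorphic_qpar _, unfolded o_def]])
     (auto simp: qpar_conv)

subsection \<open>Sturm-type bounds\<close>

lemma eval_fps_shift_mult:
  fixes F :: "complex fps"
  assumes "fps_conv_radius F \<ge> 1" "\<And>n. n < N \<Longrightarrow> fps_nth F n = 0" "norm q < 1"
  shows "eval_fps F q = q ^ N * eval_fps (fps_shift N F) q"
proof (cases "F = 0")
  case False
  have "N \<le> subdegree F"
    using assms(2) False by (intro subdegree_geI) auto
  hence "eval_fps (fps_shift N F) q = (if q = 0 then fps_nth F N else eval_fps F q / q ^ N)"
    by (intro eval_fps_shift) (use assms in \<open>auto simp: less_conv\<close>)
  moreover have "q ^ N * fps_nth F N = eval_fps F q" if "q = 0"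
    using that assms(2)[of 0] by (cases "N = 0") (auto simp: eval_fps_at_0)
  ultimately show ?thesis by auto
qed auto

lemma eval_fps_bounded_near_cusp:
  fixes G :: "complex fps"
  assumes "fps_conv_radius G \<ge> 1"
  obtains C where "C > 0" "\<And>\<tau>. Im \<tau> \<ge> 1 \<Longrightarrow> norm (eval_fps G (qpar \<tau>)) \<le> C"
proof -
  have "continuous_on (cball 0 (exp (-2*pi))) (eval_fps G)"
    by (rule continuous_on_eval_fps') (use assms in \<open>auto intro!: less_conv simp: le_less_trans\<close>)
  hence "compact (eval_fps G ` cball 0 (exp (-2*pi)))"
    by (rule compact_continuous_image) auto
  then obtain C where C: "C > 0" "\<And>x. x \<in> eval_fps G ` cball 0 (exp (-2*pi)) \<Longrightarrow> norm x \<le> C"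
    using compact_imp_bounded bounded_pos by metis
  show ?thesis
  proof (rule that[OF C(1) C(2)])
    fix \<tau> assume "Im \<tau> \<ge> 1"
    thus "eval_fps G (qpar \<tau>) \<in> eval_fps G ` cball 0 (exp (-2*pi))"
      by (intro imageI) (auto simp: norm_qpar)
  qed
qed

text \<open>A bound available before anything is known about Delta; it settles weights up to 10 with
  N = 1 and weight 12 with N = 2. The invariant |F|^2 (Im \<tau>)^k has its maximum at a height of
  at least sqrt 3 / 2. The maximum principle for F / q^N on the disc given by height 4/5 compares
  this maximum with values that it dominates, and the decay of q^N beats the growth of (Im \<tau>)^k
  unless 5 k / 4 \<ge> 4 \<pi> N.\<close>

lemma sturm_crude:
  assumes F: "mform k F" and N: "N \<ge> 1" "k \<le> 10 * N" "\<And>n. n < N \<Longrightarrow> fps_nth F n = 0"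
  shows "F = 0"
proof (rule ccontr)
  assume "F \<noteq> 0"
  have conv: "fps_conv_radius F \<ge> 1" by (rule mform_conv[OF F])
  then obtain \<tau>1 where \<tau>1: "Im \<tau>1 > 0" "eval_fps F (qpar \<tau>1) \<noteq> 0"
    using mform_eq_0I[of F] \<open>F \<noteq> 0\<close> by blast
  define G where "G = fps_shift N F"
  have convG: "fps_conv_radius G \<ge> 1" using conv by (simp add: G_def)
  have FG: "eval_fps F q = q ^ N * eval_fps G q" if "norm q < 1" for q
    unfolding G_def by (rule eval_fps_shift_mult) (use conv N(3) that in auto)
  define u where "u = (\<lambda>\<tau>. norm (eval_fps F (qpar \<tau>)) ^ 2 * Im \<tau> ^ k)"
  have cont: "continuous_on {\<tau>. Im \<tau> > 0} u"
    unfolding u_def by (intro continuous_intros continuous_on_mform conv)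
  have inv: "u ((of_int a * \<tau> + of_int b) / (of_int c * \<tau> + of_int d)) = u \<tau>"
    if det: "a * d - b * c = 1" and \<tau>: "Im \<tau> > 0" for a b c d :: int and \<tau>
  proof -
    have nz: "of_int c * \<tau> + of_int d \<noteq> 0" by (rule moebius_denom_nonzero[OF det \<tau>])
    thus ?thesis
      unfolding u_def mform_eq[OF F det \<tau>] Im_moebius[OF det \<tau>]
      by (simp add: norm_mult norm_power power_mult_distrib power_divide mult.commute[of k 2] flip: power_mult)
  qed
  obtain C where C: "C > 0" "\<And>\<tau>. Im \<tau> \<ge> 1 \<Longrightarrow> norm (eval_fps G (qpar \<tau>)) \<le> C"
    using eval_fps_bounded_near_cusp[OF convG] by metis
  have dec: "\<exists>Y. \<forall>\<tau>. Im \<tau> > Y \<longrightarrow> u \<tau> < e" if e: "e > 0" for e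
  proof -
    have "((\<lambda>y::real. C^2 * (y ^ k / exp y)) \<longlongrightarrow> C^2 * 0) at_top"
      by (intro tendsto_intros tendsto_power_div_exp_0)
    hence "eventually (\<lambda>y. C^2 * (y ^ k / exp y) < e) at_top"
      using order_tendstoD(2)[of _ "C^2 * 0"] e by auto
    then obtain Y where Y: "\<And>y. y \<ge> Y \<Longrightarrow> C^2 * (y ^ k / exp y) < e"
      unfolding eventually_at_top_linorder by blast
    show ?thesis
    proof (rule exI[of _ "max 1 Y"], intro allI impI)
      fix \<tau> assume \<tau>: "Im \<tau> > max 1 Y"
      have "norm (eval_fps F (qpar \<tau>)) = norm (qpar \<tau>) ^ N * norm (eval_fps G (qpar \<tau>))"
        using \<tau> by (subst FG) (auto simp: norm_qpar_less_1 norm_mult norm_power)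
      also have "\<dots> \<le> norm (qpar \<tau>) ^ 1 * C"
        using \<tau> C N norm_qpar_less_1[of \<tau>] by (intro mult_mono power_decreasing) auto
      also have "norm (qpar \<tau>) ^ 1 \<le> exp (- Im \<tau>)"
        using \<tau> pi_gt3 by (simp add: norm_qpar)
      finally have "norm (eval_fps F (qpar \<tau>)) \<le> exp (- Im \<tau>) * C" using C by simp
      hence "norm (eval_fps F (qpar \<tau>)) ^ 2 \<le> (exp (- Im \<tau>) * C)^2" by (intro power_mono) auto
      also have "\<dots> = C ^ 2 * exp (- 2 * Im \<tau>)"
        by (simp add: power_mult_distrib mult.commute flip: exp_of_nat_mult)
      also have "\<dots> \<le> C^2 * exp (- Im \<tau>)" using \<tau> by (intro mult_left_mono) auto
      finally have "u \<tau> \<le> C^2 * exp (- Im \<tau>) * Im \<tau> ^ k"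
        unfolding u_def using \<tau> by (intro mult_right_mono) auto
      also have "\<dots> = C^2 * (Im \<tau> ^ k / exp (Im \<tau>))" by (simp add: exp_minus field_simps)
      also have "\<dots> < e" using \<tau> by (intro Y) auto
      finally show "u \<tau> < e" .
    qed
  qed
  have "u \<tau>1 > 0" using \<tau>1 by (simp add: u_def)
  then obtain \<tau>0 where \<tau>0: "Im \<tau>0 \<ge> sqrt 3 / 2" "\<And>\<tau>. Im \<tau> > 0 \<Longrightarrow> u \<tau> \<le> u \<tau>0"
    using invariant_attains_max[OF cont inv dec \<tau>1(1)] by metis
  have "sqrt 3 > 8 / 5" by (rule real_less_rsqrt) (simp add: power2_eq_square)
  hence y0: "Im \<tau>0 > 4/5" using \<tau>0 by simp
  define M where "M = u \<tau>0"
  have "M > 0" using \<tau>0(2)[OF \<tau>1(1)] \<open>u \<tau>1 > 0\<close> by (simp add: M_def)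
  \<comment> \<open>The radius belongs to height 4/5, a rational below sqrt 3 / 2, so that the
    maximum point lies strictly inside the disc.\<close>
  define r where "r = exp (- (2 * pi * (4/5)))"
  define B where "B = sqrt (M / (4/5)^k) / r ^ N"
  have r: "0 < r" "r < 1" by (auto simp: r_def)
  have holG: "eval_fps G holomorphic_on ball 0 1"
    by (rule holomorphic_on_eval_fps) (use convG in \<open>auto simp: less_conv\<close>)
  have "norm (eval_fps G (qpar \<tau>0)) \<le> B"
  proof (rule maximum_modulus_frontier[of "eval_fps G" "ball 0 r"])
    show "eval_fps G holomorphic_on interior (ball 0 r)"
      using r by (auto intro: holomorphic_on_subset[OF holG])
    show "continuous_on (closure (ball 0 r)) (eval_fps G)"
      using r by (auto intro!: continuous_on_subset[OF holomorphic_on_imp_continuous_on[OF holG]])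
    show "bounded (ball 0 r)" by simp
    show "qpar \<tau>0 \<in> ball 0 r" using y0 by (simp add: norm_qpar r_def)
    fix q assume "q \<in> frontier (ball 0 r :: complex set)"
    hence q: "norm q = r" using r by (simp add: frontier_ball)
    with r obtain \<tau> where \<tau>: "Im \<tau> > 0" "qpar \<tau> = q" using qpar_surj[of q] by (metis norm_eq_zero less_irrefl)
    have "Im \<tau> = 4/5" using q \<tau> by (auto simp: norm_qpar r_def)
    have "norm (eval_fps F q) ^ 2 * (4/5)^k \<le> M"
      using \<tau>0(2)[OF \<tau>(1)] \<open>Im \<tau> = 4/5\<close> \<tau> by (simp add: u_def M_def)
    hence "norm (eval_fps F q) ^ 2 \<le> M / (4/5)^k" by (simp add: field_simps)
    hence "norm (eval_fps F q) \<le> sqrt (M / (4/5)^k)" by (rule real_le_rsqrt)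
    moreover have "norm (eval_fps F q) = r ^ N * norm (eval_fps G q)"
      using q r by (subst FG) (auto simp: norm_mult norm_power)
    ultimately show "norm (eval_fps G q) \<le> B" using r by (simp add: B_def field_simps)
  qed
  hence "norm (eval_fps F (qpar \<tau>0)) \<le> norm (qpar \<tau>0) ^ N * B"
    using norm_qpar_less_1[of \<tau>0] y0 by (subst FG) (auto simp: norm_mult norm_power intro!: mult_left_mono)
  hence "norm (eval_fps F (qpar \<tau>0)) ^ 2 \<le> (norm (qpar \<tau>0) ^ N * B) ^ 2" by (intro power_mono) auto
  also have "\<dots> = (norm (qpar \<tau>0) / r) ^ (2 * N) * (M / (4/5)^k)"
    using \<open>M > 0\<close> by (simp add: B_def power_mult_distrib power_divide field_simps flip: power_mult)
  also have "norm (qpar \<tau>0) / r = exp (- (2 * pi * (Im \<tau>0 - 4/5)))"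
    by (simp add: norm_qpar r_def algebra_simps flip: exp_diff)
  finally have "M \<le> exp (- (2 * pi * (Im \<tau>0 - 4/5))) ^ (2 * N) * (M / (4/5)^k) * Im \<tau>0 ^ k"
    unfolding M_def[symmetric] using y0 by (subst M_def, subst u_def) (intro mult_right_mono, auto simp: M_def)
  also have "\<dots> = M * (exp (- (2 * pi * (Im \<tau>0 - 4/5))) ^ (2 * N) * (Im \<tau>0 / (4/5)) ^ k)"
    by (simp add: power_divide)
  finally have "1 \<le> exp (- (2 * pi * (Im \<tau>0 - 4/5))) ^ (2 * N) * (Im \<tau>0 / (4/5)) ^ k"
    using \<open>M > 0\<close> by simp
  also have "\<dots> \<le> exp (- (2 * pi * (Im \<tau>0 - 4/5))) ^ (2 * N) * exp ((Im \<tau>0 - 4/5) / (4/5)) ^ k"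
  proof (intro mult_left_mono power_mono)
    show "Im \<tau>0 / (4/5) \<le> exp ((Im \<tau>0 - 4/5) / (4/5))"
      using exp_ge_add_one_self[of "(Im \<tau>0 - 4/5) / (4/5)"] by (simp add: field_simps)
  qed (use y0 in auto)
  also have "\<dots> = exp ((Im \<tau>0 - 4/5) * (5/4 * real k - 4 * pi * real N))"
    by (simp add: algebra_simps flip: exp_of_nat_mult exp_add)
  finally have "(Im \<tau>0 - 4/5) * (5/4 * real k - 4 * pi * real N) \<ge> 0" by simp
  hence "5/4 * real k \<ge> 4 * pi * real N" using y0 by (simp add: zero_le_mult_iff)
  moreover have "real k \<le> 10 * real N" using N by linarith
  \<comment> \<open>12.5 = 5/4 * 10, with the 10 of \<open>k \<le> 10 * N\<close>.\<close>
  moreover have "4 * pi * real N > 12.5 * real N" using N pi_approx by (intro mult_strict_right_mono) auto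
  ultimately show False by linarith
qed

subsection \<open>Derivatives and the Rankin--Cohen bracket\<close>

text \<open>The operator q d/dq; on functions of \<open>qpar \<tau>\<close> it is d/d\<tau> divided
  by 2 \<pi> i.\<close>

definition qderiv :: "complex fps \<Rightarrow> complex fps" where
  "qderiv F = fps_X * fps_deriv F"

lemma conv_radius_qderiv: "fps_conv_radius F \<ge> 1 \<Longrightarrow> fps_conv_radius (qderiv F) \<ge> 1"
  unfolding qderiv_def
  by (intro conv_radius_mult_ge_1) (auto intro: order_trans fps_conv_radius_deriv)

lemma qderiv_nth: "fps_nth (qderiv F) n = of_nat n * fps_nth F n"
  by (cases n) (auto simp: qderiv_def)

lemma has_field_derivative_mform:
  assumes "fps_conv_radius F \<ge> 1" "Im \<tau> > 0"
  shows "((\<lambda>\<tau>. eval_fps F (qpar \<tau>)) has_field_derivative (2 * of_real pi * \<i> * eval_fps (qderiv F) (qpar \<tau>))) (at \<tau>)"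
proof -
  have conv: "ereal (norm (qpar \<tau>)) < fps_conv_radius F" using assms by (simp add: qpar_conv)
  have "((\<lambda>\<tau>. eval_fps F (qpar \<tau>)) has_field_derivative (eval_fps (fps_deriv F) (qpar \<tau>) * (2 * of_real pi * \<i> * qpar \<tau>))) (at \<tau>)"
    by (rule DERIV_chain2[OF has_field_derivative_eval_fps deriv_qpar]) (use conv in auto)
  moreover have "eval_fps (qderiv F) (qpar \<tau>) = qpar \<tau> * eval_fps (fps_deriv F) (qpar \<tau>)"
    unfolding qderiv_def
    by (subst eval_fps_mult) (use less_le_trans[OF conv fps_conv_radius_deriv] in auto)
  ultimately show ?thesis by (simp add: mult_ac)
qed

text \<open>Differentiate the transformation law, the Moebius map having derivative 1 / (c \<tau> +
  d)^2. The second summand measures the failure of the derivative to be modular.\<close>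

lemma qderiv_transform:
  assumes F: "mform k F" and det: "a * d - b * c = 1" and \<tau>: "Im \<tau> > 0"
  shows "eval_fps (qderiv F) (qpar ((of_int a * \<tau> + of_int b) / (of_int c * \<tau> + of_int d))) =
    (of_int c * \<tau> + of_int d) ^ (k + 2) * eval_fps (qderiv F) (qpar \<tau>) +
     of_nat k * of_int c * (of_int c * \<tau> + of_int d) ^ (k + 1) * eval_fps F (qpar \<tau>) / (2 * of_real pi * \<i>)"
proof -
  let ?g = "\<lambda>\<tau>. (of_int a * \<tau> + of_int b) / (of_int c * \<tau> + of_int d) :: complex"
  let ?J = "of_int c * \<tau> + of_int d :: complex"
  let ?P = "2 * of_real pi * \<i>" and ?f = "\<lambda>\<tau>. eval_fps F (qpar \<tau>)"
  let ?f' = "\<lambda>\<tau>. eval_fps (qderiv F) (qpar \<tau>)"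
  have conv: "fps_conv_radius F \<ge> 1" by (rule mform_conv[OF F])
  have nz: "?J \<noteq> 0" by (rule moebius_denom_nonzero[OF det \<tau>])
  have "(of_int a * of_int d - of_int b * of_int c :: complex) = of_int (a * d - b * c)" by simp
  hence det': "(of_int a * of_int d - of_int b * of_int c :: complex) = 1" using det by simp
  have dg: "(?g has_field_derivative (1 / ?J ^ 2)) (at \<tau>)"
  proof -
    have "(?g has_field_derivative ((of_int a * of_int d - of_int b * of_int c) / ?J ^ 2)) (at \<tau>)"
      using nz by (auto intro!: derivative_eq_intros simp: power2_eq_square algebra_simps)
    thus ?thesis using det' by simp
  qed
  have d1: "((\<lambda>\<tau>. ?f (?g \<tau>)) has_field_derivative (?P * ?f' (?g \<tau>) * (1 / ?J ^ 2))) (at \<tau>)"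
    by (rule DERIV_chain2[OF has_field_derivative_mform[OF conv Im_moebius_pos[OF det \<tau>]] dg])
  have d2: "((\<lambda>\<tau>. (of_int c * \<tau> + of_int d) ^ k * ?f \<tau>) has_field_derivative
       (?J ^ k * (?P * ?f' \<tau>) + of_nat k * of_int c * ?J ^ (k - 1) * ?f \<tau>)) (at \<tau>)"
  proof -
    have "((\<lambda>\<tau>. (of_int c * \<tau> + of_int d) ^ k) has_field_derivative (of_nat k * of_int c * ?J ^ (k - 1))) (at \<tau>)"
      by (auto intro!: derivative_eq_intros)
    from DERIV_mult[OF this has_field_derivative_mform[OF conv \<tau>]] show ?thesis
      by (simp add: add.commute mult_ac)
  qed
  have d3: "((\<lambda>\<tau>. ?f (?g \<tau>)) has_field_derivative
       (?J ^ k * (?P * ?f' \<tau>) + of_nat k * of_int c * ?J ^ (k - 1) * ?f \<tau>)) (at \<tau>)"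
    by (rule has_field_derivative_transform_within_open[OF d2 open_halfspace_Im_gt[of 0]])
       (use \<tau> mform_eq[OF F det] in auto)
  have "?P * ?f' (?g \<tau>) * (1 / ?J ^ 2) = ?J ^ k * (?P * ?f' \<tau>) + of_nat k * of_int c * ?J ^ (k - 1) * ?f \<tau>"
    by (rule DERIV_unique[OF d1 d3])
  hence "?P * ?f' (?g \<tau>) = ?J ^ (k + 2) * (?P * ?f' \<tau>) + of_nat k * of_int c * (?J ^ (k - 1) * ?J ^ 2) * ?f \<tau>"
  proof -
    have "X = j ^ (k + 2) * Y + n * c * (j ^ (k - 1) * j ^ 2) * Z"
      if "j \<noteq> 0" "X * (1 / j ^ 2) = j ^ k * Y + n * c * j ^ (k - 1) * Z" for j X Y Z n c :: complex
      using that by (simp add: field_simps power_add power2_eq_square)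
    from this[OF nz] show ?thesis using \<open>?P * ?f' (?g \<tau>) * (1 / ?J ^ 2) = _\<close> by blast
  qed
  also have "of_nat k * of_int c * (?J ^ (k - 1) * ?J ^ 2) = of_nat k * of_int c * ?J ^ (k + 1)"
    by (cases k) (auto simp: power2_eq_square)
  finally have eq: "?P * ?f' (?g \<tau>) = ?J ^ (k + 2) * (?P * ?f' \<tau>) + of_nat k * of_int c * ?J ^ (k + 1) * ?f \<tau>" .
  have "Y' = X * Y + B / p" if "p * Y' = X * (p * Y) + B" "p \<noteq> 0" for X Y Y' B p :: complex
    using that by (simp add: field_simps)
  from this[OF eq] show ?thesis by simp
qed

text \<open>The first Rankin-Cohen bracket: the non-modular summands of
  \<open>qderiv_transform\<close> enter both products with the same factor k l and cancel.\<close>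

lemma mform_bracket:
  assumes F: "mform k F" and G: "mform l G"
  shows "mform (k + l + 2) (of_nat k * F * qderiv G - of_nat l * G * qderiv F)"
proof -
  have conv: "fps_conv_radius F \<ge> 1" "fps_conv_radius G \<ge> 1"
    using F G mform_conv by auto
  have conv': "fps_conv_radius (of_nat n :: complex fps) \<ge> 1" for n
    by (simp flip: fps_of_nat)
  note cs = conv conv' conv_radius_qderiv conv_radius_mult_ge_1 conv_radius_diff_ge_1
  have ev: "eval_fps (of_nat k * F * qderiv G - of_nat l * G * qderiv F) (qpar \<tau>) =
      of_nat k * eval_fps F (qpar \<tau>) * eval_fps (qderiv G) (qpar \<tau>) - of_nat l * eval_fps G (qpar \<tau>) * eval_fps (qderiv F) (qpar \<tau>)"
    if "Im \<tau> > 0" for \<tau>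
    using that by (simp add: eval_fps_diff eval_fps_mult qpar_conv cs flip: fps_of_nat)
  have "eval_fps (of_nat k * F * qderiv G - of_nat l * G * qderiv F) (qpar ((of_int a * \<tau> + of_int b) / (of_int c * \<tau> + of_int d))) =
     (of_int c * \<tau> + of_int d) ^ (k + l + 2) * eval_fps (of_nat k * F * qderiv G - of_nat l * G * qderiv F) (qpar \<tau>)"
    if det: "a * d - b * c = 1" and \<tau>: "Im \<tau> > 0" for a b c d :: int and \<tau>
    unfolding ev[OF \<tau>] ev[OF Im_moebius_pos[OF det \<tau>]] mform_eq[OF F det \<tau>] mform_eq[OF G det \<tau>]
      qderiv_transform[OF F det \<tau>] qderiv_transform[OF G det \<tau>]
    by (simp add: algebra_simps power_add add_divide_distrib)
  moreover have "fps_conv_radius (of_nat k * F * qderiv G - of_nat l * G * qderiv F) \<ge> 1"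
    by (intro cs)
  ultimately show ?thesis unfolding mform_def by blast
qed

subsection \<open>The Lipschitz formula\<close>

lemma conv_radius_ge_1I:
  fixes F :: "complex fps"
  assumes "\<And>r::real. 0 < r \<Longrightarrow> r < 1 \<Longrightarrow> summable (\<lambda>n. norm (fps_nth F n) * r ^ n)"
  shows "fps_conv_radius F \<ge> 1"
  unfolding fps_conv_radius_def
proof (rule conv_radius_geI_ex)
  fix r :: real assume r: "r > 0" "ereal r < 1"
  have "summable (\<lambda>n. norm (fps_nth F n * of_real r ^ n))"
    using assms[of r] r by (simp add: norm_mult norm_power)
  hence "summable (\<lambda>n. fps_nth F n * of_real r ^ n)" by (rule summable_norm_cancel)
  thus "\<exists>z. norm z = r \<and> summable (\<lambda>n. fps_nth F n * z ^ n)"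
    using r by (intro exI[of _ "of_real r"]) auto
qed

text \<open>The case \<open>r = 0\<close> is separate because of \<open>0 ^ 0 = 1\<close>: for
  \<open>n = 0\<close> the series must be q / (1 - q).\<close>

definition power_fps :: "nat \<Rightarrow> complex fps" where
  "power_fps n = Abs_fps (\<lambda>r. if r = 0 then 0 else of_nat r ^ n)"

lemma power_fps_Suc: "power_fps (Suc n) = qderiv (power_fps n)"
  by (rule fps_ext) (simp add: power_fps_def qderiv_nth)

lemma conv_radius_power_fps: "fps_conv_radius (power_fps n) \<ge> 1"
proof (induction n)
  case 0
  show ?case
  proof (rule conv_radius_ge_1I)
    fix r :: real assume r: "0 < r" "r < 1"
    show "summable (\<lambda>n. norm (fps_nth (power_fps 0) n) * r ^ n)"
      by (rule summable_comparison_test'[OF summable_geometric[of r]]) (use r in \<open>auto simp: power_fps_def\<close>)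
  qed
next
  case (Suc n)
  thus ?case by (simp add: power_fps_Suc conv_radius_qderiv)
qed

lemma eval_power_fps_0:
  assumes "norm q < 1"
  shows "eval_fps (power_fps 0) q = q / (1 - q)"
proof -
  have "(\<lambda>n. q * q ^ n) sums (q * (1 / (1 - q)))" by (intro sums_mult geometric_sums assms)
  hence "(\<lambda>n. fps_nth (power_fps 0) (Suc n) * q ^ Suc n) sums (q / (1 - q))"
    by (simp add: power_fps_def)
  hence "(\<lambda>n. fps_nth (power_fps 0) n * q ^ n) sums (q / (1 - q))"
    by (subst (asm) sums_Suc_iff) (simp add: power_fps_def)
  thus ?thesis by (simp add: eval_fps_def sums_iff)
qed

lemma nonpos_Ints_Im: "Im z \<noteq> 0 \<Longrightarrow> z \<notin> \<int>\<^sub>\<le>\<^sub>0"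
  by (auto elim!: nonpos_Ints_cases)

text \<open>Logarithmic derivative of the reflection formula of Gamma: the difference is \<pi> cot
  (\<pi> z), which is then written in terms of q.\<close>

lemma Digamma_reflection:
  assumes "Im z > 0"
  shows "Digamma (1 - z) - Digamma z = - of_real pi * \<i> - 2 * of_real pi * \<i> * (qpar z / (1 - qpar z))"
proof -
  have z: "z \<notin> \<int>\<^sub>\<le>\<^sub>0" "1 - z \<notin> \<int>\<^sub>\<le>\<^sub>0" using assms by (auto intro!: nonpos_Ints_Im)
  let ?s = "sin (of_real pi * z)" and ?c = "cos (of_real pi * z)"
  have nz: "?s \<noteq> 0"
  proof
    assume "?s = 0"
    hence "Gamma z * Gamma (1 - z) = 0" by (simp add: Gamma_reflection_complex)
    thus False using z by (auto simp: Gamma_eq_zero_iff)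
  qed
  have "((\<lambda>z. Gamma z * Gamma (1 - z)) has_field_derivative
          (Gamma z * Gamma (1 - z) * (Digamma z - Digamma (1 - z)))) (at z)"
    using z by (auto intro!: derivative_eq_intros simp: algebra_simps)
  moreover have "((\<lambda>z. of_real pi / sin (of_real pi * z)) has_field_derivative
          (- of_real pi * (of_real pi * ?c) / ?s ^ 2)) (at z)"
    using nz by (auto intro!: derivative_eq_intros simp: power2_eq_square)
  ultimately have eq: "of_real pi / ?s * (Digamma z - Digamma (1 - z)) = - of_real pi * (of_real pi * ?c) / ?s ^ 2"
    unfolding Gamma_reflection_complex by (rule DERIV_unique)
  have "Digamma (1 - z) - Digamma z = - (?s / of_real pi) * (of_real pi / ?s * (Digamma z - Digamma (1 - z)))"
    using nz by simp
  also have "\<dots> = of_real pi * (?c / ?s)"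
    unfolding eq using nz by (simp add: power2_eq_square)
  finally have "Digamma (1 - z) - Digamma z = of_real pi * (?c / ?s)" .
  also have "?c / ?s = - \<i> - 2 * \<i> * (qpar z / (1 - qpar z))"
  proof -
    define w where "w = exp (\<i> * (of_real pi * z))"
    have w: "w \<noteq> 0" by (simp add: w_def)
    have q: "qpar z = w ^ 2" unfolding w_def qpar_def by (simp add: mult_ac flip: exp_of_nat_mult)
    have "norm (qpar z) < 1" using assms by (rule norm_qpar_less_1)
    hence w2: "w ^ 2 \<noteq> 1" unfolding q by auto
    have cs: "?c = (w + 1 / w) / 2" "?s = (w - 1 / w) / (2 * \<i>)"
      by (auto simp: cos_exp_eq sin_exp_eq w_def exp_minus field_simps)
    hence "?c / ?s = \<i> * ((w + 1 / w) / (w - 1 / w))"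
    proof -
      have "(X / 2) / (Y / (2 * \<i>)) = \<i> * (X / Y)" for X Y :: complex
        by (cases "Y = 0") (auto simp: field_simps)
      thus ?thesis unfolding cs .
    qed
    also have "(w + 1 / w) / (w - 1 / w) = (w^2 + 1) / (w^2 - 1)"
      using w w2 by (simp add: field_simps power2_eq_square)
    also have "\<i> * \<dots> = - \<i> - 2 * \<i> * (w ^ 2 / (1 - w ^ 2))"
      using w2 by (simp add: field_simps)
    finally show ?thesis by (simp add: q)
  qed
  finally show ?thesis by (simp add: algebra_simps)
qed

text \<open>Repeated differentiation of \<open>Digamma_reflection\<close>: on the right each step is
  2 \<pi> i q d/dq, and the first one removes the constant.\<close>

lemma Polygamma_reflection:
  assumes "Im z > 0"
  shows "(-1) ^ n * Polygamma n (1 - z) - Polygamma n z =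
    (if n = 0 then - of_real pi * \<i> else 0) - (2 * of_real pi * \<i>) ^ Suc n * eval_fps (power_fps n) (qpar z)"
  using assms
proof (induction n arbitrary: z)
  case 0
  thus ?case using Digamma_reflection[of z] by (simp add: eval_power_fps_0 norm_qpar_less_1)
next
  case (Suc n)
  have z: "z \<notin> \<int>\<^sub>\<le>\<^sub>0" "1 - z \<notin> \<int>\<^sub>\<le>\<^sub>0" using Suc.prems by (auto intro!: nonpos_Ints_Im)
  let ?c = "if n = 0 then - of_real pi * \<i> else (0::complex)"
  let ?P = "2 * of_real pi * \<i> :: complex"
  have "((\<lambda>z. (-1) ^ n * Polygamma n (1 - z) - Polygamma n z) has_field_derivative
       ((-1) ^ Suc n * Polygamma (Suc n) (1 - z) - Polygamma (Suc n) z)) (at z)"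
    using z by (auto intro!: derivative_eq_intros)
  moreover have "((\<lambda>z. (-1) ^ n * Polygamma n (1 - z) - Polygamma n z) has_field_derivative
       (- (?P ^ Suc n * (?P * eval_fps (qderiv (power_fps n)) (qpar z))))) (at z)"
  proof (rule has_field_derivative_transform_within_open[OF _ open_halfspace_Im_gt[of 0]])
    show "((\<lambda>z. ?c - ?P ^ Suc n * eval_fps (power_fps n) (qpar z)) has_field_derivative
       (- (?P ^ Suc n * (?P * eval_fps (qderiv (power_fps n)) (qpar z))))) (at z)"
      using DERIV_diff[OF DERIV_const[of ?c] DERIV_cmult[OF has_field_derivative_mform[OF conv_radius_power_fps Suc.prems]]]
      by (simp only: diff_0)
    show "?c - ?P ^ Suc n * eval_fps (power_fps n) (qpar w) = (-1) ^ n * Polygamma n (1 - w) - Polygamma n w"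
      if "w \<in> {x. 0 < Im x}" for w
      using Suc.IH[of w] that by simp
  qed (use Suc.prems in auto)
  ultimately have "(-1) ^ Suc n * Polygamma (Suc n) (1 - z) - Polygamma (Suc n) z =
      - (?P ^ Suc n * (?P * eval_fps (qderiv (power_fps n)) (qpar z)))"
    by (rule DERIV_unique)
  thus ?case by (simp add: power_fps_Suc)
qed

text \<open>The terms with m \<ge> 0 and with m \<le> -1 are the series of
  \<open>Polygamma n z\<close> and \<open>Polygamma n (1 - z)\<close>, which the reflection formula
  joins. The Polygamma series converge as ordered sums, so unconditional summability is assumed
  here; it comes from the rows of the lattice sum.\<close>

lemma lipschitz_formula:
  assumes z: "Im z > 0" and n: "n > 0"
    and summ: "(\<lambda>m::int. 1 / (z + of_int m) ^ Suc n) summable_on UNIV"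
  shows "((\<lambda>m::int. 1 / (z + of_int m) ^ Suc n) has_sum
           ((- 2 * of_real pi * \<i>) ^ Suc n / fact n * eval_fps (power_fps n) (qpar z))) UNIV"
proof -
  let ?f = "\<lambda>m::int. 1 / (z + of_int m) ^ Suc n"
  have nz: "z \<noteq> 0" "1 - z \<noteq> 0" using z by (auto simp: complex_eq_iff)
  have un: "(UNIV :: int set) = range int \<union> range (\<lambda>k. - 1 - int k)"
  proof -
    have "m \<in> range int \<union> range (\<lambda>k. - 1 - int k)" for m :: int
    proof (cases "m \<ge> 0")
      case True
      hence "m = int (nat m)" by simp
      thus ?thesis by blast
    next
      case False
      hence "m = - 1 - int (nat (- 1 - m))" by simp
      thus ?thesis by blast
    qed
    thus ?thesis by blast
  qed
  have inj: "inj int" "inj (\<lambda>k. - 1 - int k)" by (auto simp: inj_on_def)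
  have s1: "(?f has_sum ((-1) ^ Suc n * Polygamma n z / fact n)) (range int)"
  proof -
    have "(?f \<circ> int) summable_on UNIV"
      using summable_on_subset[OF summ, of "range int"] summable_on_reindex[OF inj(1), of ?f] by simp
    then obtain s where s: "((?f \<circ> int) has_sum s) UNIV" by (auto simp: summable_on_def)
    hence "(?f \<circ> int) sums s" by (rule has_sum_imp_sums)
    moreover have "(?f \<circ> int) sums ((-1) ^ Suc n * Polygamma n z / fact n)"
      using Polygamma_LIMSEQ[OF nz(1) n] by (simp add: o_def inverse_eq_divide)
    ultimately have "s = (-1) ^ Suc n * Polygamma n z / fact n" by (rule sums_unique2)
    with s show ?thesis by (subst has_sum_reindex[OF inj(1)]) simp
  qed
  have s2: "(?f has_sum (Polygamma n (1 - z) / fact n)) (range (\<lambda>k. - 1 - int k))"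
  proof -
    have "(?f \<circ> (\<lambda>k. - 1 - int k)) summable_on UNIV"
      using summable_on_subset[OF summ, of "range (\<lambda>k. - 1 - int k)"] summable_on_reindex[OF inj(2), of ?f] by simp
    then obtain s where s: "((?f \<circ> (\<lambda>k. - 1 - int k)) has_sum s) UNIV" by (auto simp: summable_on_def)
    hence "(?f \<circ> (\<lambda>k. - 1 - int k)) sums s" by (rule has_sum_imp_sums)
    moreover have "(?f \<circ> (\<lambda>k. - 1 - int k)) sums ((-1) ^ Suc n * ((-1) ^ Suc n * Polygamma n (1 - z) / fact n))"
    proof -
      have "?f (- 1 - int k) = (-1) ^ Suc n * inverse ((1 - z + of_nat k) ^ Suc n)" for k
      proof -
        have "z + of_int (- 1 - int k) = - 1 * (1 - z + of_nat k)" by simp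
        hence "(z + of_int (- 1 - int k)) ^ Suc n = (-1) ^ Suc n * (1 - z + of_nat k) ^ Suc n"
          by (simp only: power_mult_distrib)
        thus ?thesis by (cases "even n") (auto simp: inverse_eq_divide)
      qed
      thus ?thesis unfolding o_def using sums_mult[OF Polygamma_LIMSEQ[OF nz(2) n], of "(-1) ^ Suc n"]
        by presburger
    qed
    ultimately have "s = (-1) ^ Suc n * ((-1) ^ Suc n * Polygamma n (1 - z) / fact n)" by (rule sums_unique2)
    also have "\<dots> = Polygamma n (1 - z) / fact n" by (cases "even n") auto
    finally show ?thesis using s by (subst has_sum_reindex[OF inj(2)]) simp
  qed
  have "(?f has_sum ((-1) ^ Suc n * Polygamma n z / fact n + Polygamma n (1 - z) / fact n)) UNIV"
    unfolding un by (rule has_sum_Un_disjoint[OF s1 s2]) auto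
  also have "(-1) ^ Suc n * Polygamma n z / fact n + Polygamma n (1 - z) / fact n =
     (-1) ^ n * ((-1) ^ n * Polygamma n (1 - z) - Polygamma n z) / fact n"
    by (cases "even n") (auto simp: diff_divide_distrib add_divide_distrib)
  also have "\<dots> = (-1) ^ Suc n * (2 * of_real pi * \<i>) ^ Suc n / fact n * eval_fps (power_fps n) (qpar z)"
    unfolding Polygamma_reflection[OF z] using n by simp
  also have "(-1) ^ Suc n * (2 * of_real pi * \<i>) ^ Suc n = (- 2 * of_real pi * \<i> :: complex) ^ Suc n"
    by (subst power_mult_distrib [symmetric]) simp
  finally show ?thesis .
qed

subsection \<open>Eisenstein series\<close>

lemma summable_on_int_inverse_squares: "(\<lambda>n::int. 1 / (1 + of_int n ^ 2 :: real)) summable_on UNIV"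
proof -
  have nat: "(\<lambda>n::nat. 1 / (1 + of_nat n ^ 2 :: real)) summable_on UNIV"
  proof (rule norm_summable_imp_summable_on, rule summable_comparison_test'[of _ 1])
    show "summable (\<lambda>n. inverse (real n ^ 2))" by (rule inverse_power_summable) simp
    show "norm (norm (1 / (1 + real n ^ 2))) \<le> inverse (real n ^ 2)" if "n \<ge> 1" for n
      using that by (auto simp: field_simps add_pos_nonneg)
  qed
  have un: "(UNIV :: int set) = range int \<union> range (\<lambda>k. - int k)"
  proof -
    have "m \<in> range int \<union> range (\<lambda>k. - int k)" for m :: int
      by (cases m rule: int_cases2) auto
    thus ?thesis by blast
  qed
  have "(\<lambda>n::int. 1 / (1 + of_int n ^ 2 :: real)) summable_on range int"
    by (subst summable_on_reindex) (use nat in \<open>auto simp: o_def inj_on_def\<close>)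
  moreover have "(\<lambda>n::int. 1 / (1 + of_int n ^ 2 :: real)) summable_on range (\<lambda>k. - int k)"
    by (subst summable_on_reindex) (use nat in \<open>auto simp: o_def inj_on_def\<close>)
  ultimately show ?thesis unfolding un by (rule summable_on_union)
qed

lemma summable_on_product_real:
  fixes f :: "'a \<Rightarrow> real" and g :: "'b \<Rightarrow> real"
  assumes "f summable_on A" "g summable_on B" "\<And>x. x \<in> A \<Longrightarrow> f x \<ge> 0" "\<And>x. x \<in> B \<Longrightarrow> g x \<ge> 0"
  shows "(\<lambda>(x,y). f x * g y) summable_on A \<times> B"
proof (rule summable_on_SigmaI)
  fix x assume "x \<in> A"
  show "((\<lambda>y. case (x, y) of (x, y) \<Rightarrow> f x * g y) has_sum (f x * infsum g B)) B"
    using has_sum_cmult_right[OF has_sum_infsum[OF assms(2)]] by simp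
next
  show "(\<lambda>x. f x * infsum g B) summable_on A" by (intro summable_on_cmult_left assms)
qed (use assms in auto)

definition lattice_pts :: "(int \<times> int) set" where
  "lattice_pts = UNIV - {(0, 0)}"

text \<open>The estimate \<open>quad\<close> compares |m \<tau> + n|^2 with m^2 + n^2. Four of the k
  factors then dominate (1 + m^2) (1 + n^2), whose reciprocal is a product of two convergent
  one-dimensional series; the other k - 4 factors are bounded through \<open>R\<close>.\<close>

lemma summable_on_lattice:
  assumes \<tau>: "Im \<tau> > 0" and k: "k \<ge> 4"
  shows "(\<lambda>(m,n). 1 / (of_int m * \<tau> + of_int n) ^ k :: complex) summable_on lattice_pts"
proof -
  define K where "K = 1 / Im \<tau> ^ 2 + (1 + norm \<tau> / Im \<tau>) ^ 2"
  have "K > 0" using \<tau> by (auto simp: K_def intro!: add_pos_nonneg)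
  define R where "R = sqrt K"
  have "R > 0" "R ^ 2 = K" using \<open>K > 0\<close> by (auto simp: R_def)
  have quad: "of_int m ^ 2 + of_int n ^ 2 \<le> K * norm (of_int m * \<tau> + of_int n) ^ 2" for m n :: int
  proof -
    let ?N = "norm (of_int m * \<tau> + of_int n)"
    have "\<bar>of_int m\<bar> * Im \<tau> = \<bar>Im (of_int m * \<tau> + of_int n)\<bar>" using \<tau> by (simp add: abs_mult)
    also have "\<dots> \<le> ?N" by (rule abs_Im_le_cmod)
    finally have m: "\<bar>of_int m\<bar> \<le> ?N / Im \<tau>" using \<tau> by (simp add: field_simps)
    have "norm (of_int n :: complex) \<le> ?N + norm (of_int m * \<tau>)"
      by (metis add_diff_cancel_left' norm_triangle_ineq4 add.commute)
    also have "norm (of_int m * \<tau>) \<le> ?N / Im \<tau> * norm \<tau>"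
      using mult_right_mono[OF m, of "norm \<tau>"] by (simp add: norm_mult)
    finally have n: "\<bar>of_int n\<bar> \<le> ?N * (1 + norm \<tau> / Im \<tau>)" by (simp add: algebra_simps)
    have "of_int m ^ 2 \<le> (?N / Im \<tau>) ^ 2" using power_mono[OF m, of 2] by simp
    moreover have "of_int n ^ 2 \<le> (?N * (1 + norm \<tau> / Im \<tau>)) ^ 2" using power_mono[OF n, of 2] by simp
    ultimately have "of_int m ^ 2 + of_int n ^ 2 \<le> (?N / Im \<tau>) ^ 2 + (?N * (1 + norm \<tau> / Im \<tau>)) ^ 2" by linarith
    also have "\<dots> = K * ?N ^ 2" unfolding K_def
      by (simp only: power_mult_distrib power_divide distrib_right) (simp add: mult.commute)
    finally show ?thesis .
  qed
  have "(\<lambda>(m,n). 1 / (1 + of_int m ^ 2) * (1 / (1 + of_int n ^ 2)) :: real) summable_on (UNIV :: int set) \<times> (UNIV :: int set)"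
    by (intro summable_on_product_real summable_on_int_inverse_squares) (auto intro: add_nonneg_nonneg)
  hence "(\<lambda>(m,n). 1 / (1 + of_int m ^ 2) * (1 / (1 + of_int n ^ 2)) :: real) summable_on lattice_pts"
    by (rule summable_on_subset) auto
  hence "(\<lambda>x. (R ^ (k - 4) * (3 * K ^ 2)) * (case x of (m,n) \<Rightarrow> 1 / (1 + real_of_int m ^ 2) * (1 / (1 + real_of_int n ^ 2)))) summable_on lattice_pts"
    by (rule summable_on_cmult_right)
  hence "(\<lambda>x. norm (case x of (m,n) \<Rightarrow> 1 / (of_int m * \<tau> + of_int n) ^ k)) summable_on lattice_pts"
  proof (rule Infinite_Sum.abs_summable_on_comparison_test')
    fix x assume "x \<in> lattice_pts"
    then obtain m n where x: "x = (m, n)" "(m, n) \<noteq> (0, 0)" by (cases x) (auto simp: lattice_pts_def)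
    define N where "N = norm (of_int m * \<tau> + of_int n)"
    define s where "s = (of_int (m ^ 2 + n ^ 2) :: real)"
    have "m ^ 2 + n ^ 2 > 0" using x by (auto simp: sum_power2_gt_zero_iff)
    hence s: "s \<ge> 1" unfolding s_def by linarith
    have sK: "s \<le> K * N ^ 2" using quad[of m n] by (simp add: s_def N_def)
    have "N > 0"
    proof (rule ccontr)
      assume "\<not> N > 0"
      hence "N = 0" by (simp add: N_def)
      with sK s show False by simp
    qed
    have "1 \<le> (R * N) ^ 2" using sK s \<open>R ^ 2 = K\<close> by (simp add: power_mult_distrib)
    hence RN: "1 \<le> R * N" using \<open>R > 0\<close> \<open>N > 0\<close> power2_le_imp_le[of 1 "R * N"] by simp
    have "(1 + of_int m ^ 2) * (1 + of_int n ^ 2) \<le> 3 * s ^ 2"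
    proof -
      have "(1 + of_int m ^ 2) * (1 + of_int n ^ 2) = 1 + s + of_int m ^ 2 * of_int n ^ 2"
        by (simp add: s_def algebra_simps)
      also have "of_int m ^ 2 * of_int n ^ 2 \<le> s * s" unfolding s_def by (intro mult_mono) auto
      also have "1 + s + s * s \<le> 3 * s ^ 2"
      proof -
        have "s * 1 \<le> s * s" using s by (intro mult_left_mono) auto
        thus ?thesis using s unfolding power2_eq_square by linarith
      qed
      finally show ?thesis by simp
    qed
    also have "3 * s ^ 2 \<le> 3 * (K * N ^ 2) ^ 2" using sK s by (intro mult_left_mono power_mono) auto
    also have "\<dots> = 3 * K ^ 2 * N ^ 4" by (simp add: power_mult_distrib flip: power_mult)
    finally have prod: "(1 + of_int m ^ 2) * (1 + of_int n ^ 2) \<le> 3 * K ^ 2 * N ^ 4" .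
    define p where "p = (1 + of_int m ^ 2) * (1 + of_int n ^ 2 :: real)"
    have p: "p > 0" unfolding p_def by (intro mult_pos_pos add_pos_nonneg) auto
    have "1 / N ^ k = 1 / N ^ 4 * (1 / N) ^ (k - 4)"
      using k by (simp add: power_divide flip: power_add)
    also have "\<dots> \<le> (3 * K ^ 2 / p) * R ^ (k - 4)"
    proof (intro mult_mono power_mono)
      show "1 / N ^ 4 \<le> 3 * K ^ 2 / p" using prod p \<open>N > 0\<close> by (simp add: p_def[symmetric] field_simps)
      show "1 / N \<le> R" using RN \<open>N > 0\<close> by (simp add: field_simps)
    qed (use p \<open>K > 0\<close> \<open>N > 0\<close> in auto)
    finally show "norm (case x of (m,n) \<Rightarrow> 1 / (of_int m * \<tau> + of_int n) ^ k) \<le>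
      (R ^ (k - 4) * (3 * K ^ 2)) * (case x of (m,n) \<Rightarrow> 1 / (1 + real_of_int m ^ 2) * (1 / (1 + real_of_int n ^ 2)))"
      by (simp add: x N_def p_def norm_divide norm_power mult_ac)
  qed
  thus ?thesis by (simp only: summable_on_iff_abs_summable_on_complex)
qed

definition eisenstein :: "nat \<Rightarrow> complex \<Rightarrow> complex" where
  "eisenstein k \<tau> = (\<Sum>\<^sub>\<infinity>(m,n)\<in>lattice_pts. 1 / (of_int m * \<tau> + of_int n) ^ k)"

text \<open>Multiplying the row (m, n) by the matrix from the right permutes the nonzero lattice
  points.\<close>

lemma eisenstein_modular:
  fixes a b c d :: int
  assumes det: "a * d - b * c = 1" and \<tau>: "Im \<tau> > 0"
  shows "eisenstein k ((of_int a * \<tau> + of_int b) / (of_int c * \<tau> + of_int d)) = (of_int c * \<tau> + of_int d) ^ k * eisenstein k \<tau>"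
proof -
  let ?J = "of_int c * \<tau> + of_int d :: complex"
  let ?f = "\<lambda>(m::int,n::int). 1 / (of_int m * \<tau> + of_int n) ^ k :: complex"
  define g where "g = (\<lambda>(m, n). (m * a + n * c, m * b + n * d))"
  define h where "h = (\<lambda>(m, n). (m * d - n * c, n * a - m * b))"
  have gh: "g (h x) = x" "h (g x) = x" for x
  proof -
    obtain m n where x: "x = (m, n)" by force
    have "(m * d - n * c) * a + (n * a - m * b) * c = m * (a * d - b * c)"
         "(m * d - n * c) * b + (n * a - m * b) * d = n * (a * d - b * c)"
         "(m * a + n * c) * d - (m * b + n * d) * c = m * (a * d - b * c)"
         "(m * b + n * d) * a - (m * a + n * c) * b = n * (a * d - b * c)"
      by (auto simp: algebra_simps)
    thus "g (h x) = x" "h (g x) = x" by (auto simp: g_def h_def x det)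
  qed
  have zero: "g (0, 0) = (0, 0)" "h (0, 0) = (0, 0)" by (auto simp: g_def h_def)
  have bij: "bij_betw g lattice_pts lattice_pts"
  proof (rule bij_betwI[where g = h])
    have "g x \<noteq> (0, 0)" "h x \<noteq> (0, 0)" if "x \<noteq> (0, 0)" for x
      using that gh[of x] zero by metis+
    thus "g \<in> lattice_pts \<rightarrow> lattice_pts" "h \<in> lattice_pts \<rightarrow> lattice_pts"
      by (auto simp: lattice_pts_def)
  qed (auto simp: gh)
  have nz: "?J \<noteq> 0" by (rule moebius_denom_nonzero[OF det \<tau>])
  have "eisenstein k ((of_int a * \<tau> + of_int b) / ?J) = (\<Sum>\<^sub>\<infinity>x\<in>lattice_pts. ?J ^ k * ?f (g x))"
    unfolding eisenstein_def
  proof (intro infsum_cong)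
    fix x :: "int \<times> int"
    obtain m n where x: "x = (m, n)" by force
    have "of_int m * ((of_int a * \<tau> + of_int b) / ?J) + of_int n =
          (of_int m * (of_int a * \<tau> + of_int b) + of_int n * ?J) / ?J" using nz by (simp add: field_simps)
    also have "of_int m * (of_int a * \<tau> + of_int b) + of_int n * ?J =
        of_int (m * a + n * c) * \<tau> + of_int (m * b + n * d)" by (simp add: algebra_simps)
    finally have eq: "of_int m * ((of_int a * \<tau> + of_int b) / ?J) + of_int n =
       (of_int (m * a + n * c) * \<tau> + of_int (m * b + n * d)) / ?J" .
    show "(case x of (m, n) \<Rightarrow> 1 / (of_int m * ((of_int a * \<tau> + of_int b) / ?J) + of_int n) ^ k) = ?J ^ k * ?f (g x)"
      unfolding x prod.case eq g_def by (simp add: power_divide)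
  qed
  also have "\<dots> = ?J ^ k * (\<Sum>\<^sub>\<infinity>x\<in>lattice_pts. ?f (g x))" by (rule infsum_cmult_right')
  also have "(\<Sum>\<^sub>\<infinity>x\<in>lattice_pts. ?f (g x)) = eisenstein k \<tau>"
    unfolding eisenstein_def by (rule infsum_reindex_bij_betw[OF bij])
  finally show ?thesis .
qed

definition divisor_sigma :: "nat \<Rightarrow> nat \<Rightarrow> nat" where
  "divisor_sigma p n = (\<Sum>d | d dvd n. d ^ p)"

text \<open>Every number divides 0, and a sum over an infinite set is 0 by convention.\<close>

lemma divisor_sigma_0 [simp]: "divisor_sigma p 0 = 0"
  by (simp add: divisor_sigma_def)

lemma divisor_sigma_le: "divisor_sigma p n \<le> n ^ (p + 1)"
proof (cases "n = 0")
  case False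
  have "divisor_sigma p n \<le> (\<Sum>d | d dvd n. n ^ p)"
    unfolding divisor_sigma_def using False by (intro sum_mono power_mono) (auto dest: dvd_imp_le)
  also have "\<dots> = card {d. d dvd n} * n ^ p" by simp
  also have "card {d. d dvd n} \<le> card {1..n}"
  proof (rule card_mono)
    show "{d. d dvd n} \<subseteq> {1..n}"
    proof safe
      fix d assume "d dvd n"
      thus "d \<in> {1..n}" using False dvd_imp_le[of d n] by (cases "d = 0") auto
    qed
  qed auto
  finally show ?thesis by simp
qed auto

definition sigma_fps :: "nat \<Rightarrow> complex fps" where
  "sigma_fps p = Abs_fps (\<lambda>n. of_nat (divisor_sigma p n))"

lemma conv_radius_sigma_fps: "fps_conv_radius (sigma_fps p) \<ge> 1"
proof (rule conv_radius_ge_1I)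
  fix r :: real assume r: "0 < r" "r < 1"
  have "ereal (norm (of_real r :: complex)) < fps_conv_radius (power_fps (p + 1))"
    using r by (intro less_conv conv_radius_power_fps) auto
  from norm_summable_fps[OF this]
  have "summable (\<lambda>n. norm (fps_nth (power_fps (p + 1)) n * of_real r ^ n))" .
  thus "summable (\<lambda>n. norm (fps_nth (sigma_fps p) n) * r ^ n)"
  proof (rule summable_comparison_test'[of _ 0])
    fix n :: nat
    have "real (divisor_sigma p n) \<le> real (n ^ (p + 1))" using divisor_sigma_le of_nat_mono by blast
    thus "norm (norm (fps_nth (sigma_fps p) n) * r ^ n) \<le> norm (fps_nth (power_fps (p + 1)) n * of_real r ^ n)"
      using r by (cases "n = 0") (auto simp: sigma_fps_def power_fps_def norm_mult norm_power intro!: mult_right_mono)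
  qed
qed

lemma has_sum_pos_nat_fps:
  fixes F :: "complex fps"
  assumes "fps_conv_radius F \<ge> 1" "norm q < 1" "fps_nth F 0 = 0"
  shows "((\<lambda>n. fps_nth F n * q ^ n) has_sum eval_fps F q) {1..}"
proof -
  have "ereal (norm q) < fps_conv_radius F" using assms by (intro less_conv)
  hence "((\<lambda>n. fps_nth F n * q ^ n) has_sum eval_fps F q) UNIV"
    by (intro norm_summable_imp_has_sum norm_summable_fps sums_eval_fps)
  thus ?thesis
    by (rule has_sum_cong_neutral[THEN iffD1, rotated -1]) (use assms in \<open>auto simp: not_le\<close>)
qed

text \<open>Expand each term as the sum over r of r^p q^(m r) and collect the terms with m r = n,
  where r runs through the divisors of n.\<close>

lemma lambert_series:
  assumes q: "norm q < 1"
  shows "((\<lambda>m. eval_fps (power_fps p) (q ^ m)) has_sum eval_fps (sigma_fps p) q) {1..}"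
proof -
  let ?f = "\<lambda>(m,r). of_nat r ^ p * q ^ (m * r) :: complex"
  have pos: "((\<lambda>r. of_nat r ^ p * q ^ (m * r)) has_sum eval_fps (power_fps p) (q ^ m)) {1..}" if "m \<ge> 1" for m
  proof -
    have "norm (q ^ m) < 1" using q that by (simp add: norm_power power_less_one_iff)
    from has_sum_pos_nat_fps[OF conv_radius_power_fps[of p] this]
    have "((\<lambda>n. fps_nth (power_fps p) n * (q ^ m) ^ n) has_sum eval_fps (power_fps p) (q ^ m)) {1..}"
      by (simp add: power_fps_def)
    thus ?thesis
      by (rule has_sum_cong[THEN iffD1, rotated]) (auto simp: power_fps_def power_mult)
  qed
  have "?f summable_on {1..} \<times> {1..}"
  proof -
    have "((\<lambda>n. fps_nth (power_fps p) n * of_real (norm q) ^ n) has_sum eval_fps (power_fps p) (of_real (norm q))) {1..}"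
      by (rule has_sum_pos_nat_fps[OF conv_radius_power_fps]) (use q in \<open>auto simp: power_fps_def\<close>)
    hence "(\<lambda>n. fps_nth (power_fps p) n * of_real (norm q) ^ n) summable_on {1..}"
      unfolding summable_on_def by blast
    hence "(\<lambda>n. norm (fps_nth (power_fps p) n * of_real (norm q) ^ n)) summable_on {1..}"
      by (simp only: summable_on_iff_abs_summable_on_complex)
    also have "?this \<longleftrightarrow> (\<lambda>n. real n ^ p * norm q ^ n) summable_on {1..}"
      by (intro summable_on_cong) (auto simp: power_fps_def norm_mult norm_power)
    finally have s1: "(\<lambda>n. real n ^ p * norm q ^ n) summable_on {1..}" .
    have "(\<lambda>m. norm q ^ (m - 1)) summable_on {1..}"
    proof -
      have "(\<lambda>m. norm q ^ m) summable_on UNIV"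
        by (rule norm_summable_imp_summable_on) (use q in auto)
      moreover have "range Suc = {1..}" by (auto simp: image_iff Suc_le_eq gr0_conv_Suc)
      ultimately show ?thesis
        using summable_on_reindex[of Suc UNIV "\<lambda>m. norm q ^ (m - 1)"] by (simp add: o_def)
    qed
    hence "(\<lambda>(m,n). norm q ^ (m - 1) * (real n ^ p * norm q ^ n)) summable_on {1..} \<times> {1..}"
      by (rule summable_on_product_real[OF _ s1]) auto
    hence "(\<lambda>x. norm (?f x)) summable_on {1..} \<times> {1..}"
    proof (rule Infinite_Sum.abs_summable_on_comparison_test')
      fix x :: "nat \<times> nat" assume "x \<in> {1..} \<times> {1..}"
      then obtain m r where x: "x = (m, r)" "m \<ge> (1::nat)" "r \<ge> (1::nat)" by auto
      \<comment> \<open>The inequality m - 1 + r \<le> m r lets a product of two convergent series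
        dominate the double series.\<close>
      have "(m - 1) * 1 \<le> (m - 1) * r" using x by (intro mult_left_mono) auto
      hence "m - 1 + r \<le> m * r" using x by (cases m) auto
      hence "norm q ^ (m * r) \<le> norm q ^ (m - 1 + r)"
        using q by (intro power_decreasing) auto
      hence "real r ^ p * norm q ^ (m * r) \<le> real r ^ p * norm q ^ (m - 1 + r)"
        by (intro mult_left_mono) auto
      thus "norm (?f x) \<le> (case x of (m, n) \<Rightarrow> norm q ^ (m - 1) * (real n ^ p * norm q ^ n))"
        by (simp add: x norm_mult norm_power power_add mult_ac)
    qed
    thus ?thesis by (simp only: summable_on_iff_abs_summable_on_complex)
  qed
  then obtain S where S: "(?f has_sum S) ({1..} \<times> {1..})" by (auto simp: summable_on_def)
  have "((\<lambda>m. eval_fps (power_fps p) (q ^ m)) has_sum S) {1..}"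
    by (rule has_sum_SigmaD[OF S]) (use pos in auto)
  moreover have "((\<lambda>(n, d). of_nat d ^ p * q ^ n) has_sum S) (Sigma {1..} (\<lambda>n. {d. d dvd n}))"
    using S
    by (rule has_sum_reindex_bij_witness[where i = "\<lambda>(n, d). (n div d, d)" and j = "\<lambda>(m, r). (m * r, r)", THEN iffD1, rotated -1])
       (auto simp: Suc_le_eq dvd_div_mult_self intro!: Nat.gr0I)
  hence "((\<lambda>n. of_nat (divisor_sigma p n) * q ^ n) has_sum S) {1..}"
  proof (rule has_sum_SigmaD)
    fix n :: nat assume n: "n \<in> {1..}"
    hence "finite {d. d dvd n}" by simp
    thus "((\<lambda>y. case (n, y) of (n, d) \<Rightarrow> of_nat d ^ p * q ^ n) has_sum of_nat (divisor_sigma p n) * q ^ n) {d. d dvd n}"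
      by (intro has_sum_finiteI) (auto simp: divisor_sigma_def sum_distrib_right)
  qed
  moreover have "((\<lambda>n. of_nat (divisor_sigma p n) * q ^ n) has_sum eval_fps (sigma_fps p) q) {1..}"
    using has_sum_pos_nat_fps[OF conv_radius_sigma_fps q, of p] by (simp add: sigma_fps_def)
  ultimately show ?thesis using has_sum_unique by metis
qed

text \<open>The row m = 0 gives the constant. Every other row is a Lipschitz sum at |m| \<tau>, rows
  m and -m agreeing because \<open>k\<close> is even, and the sum over the rows is a Lambert
  series.\<close>

lemma eisenstein_q_expansion:
  assumes \<tau>: "Im \<tau> > 0" and k: "k \<ge> 4" "even k"
  shows "eisenstein k \<tau> = (\<Sum>\<^sub>\<infinity>n\<in>-{0::int}. 1 / of_int n ^ k) +
     2 * ((- 2 * of_real pi * \<i>) ^ k / fact (k - 1)) * eval_fps (sigma_fps (k - 1)) (qpar \<tau>)"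
proof -
  let ?f = "\<lambda>(m,n). 1 / (of_int m * \<tau> + of_int n) ^ k :: complex"
  define C where "C = (- 2 * of_real pi * \<i>) ^ k / fact (k - 1 :: nat)"
  define g where "g = (\<lambda>m. C * eval_fps (power_fps (k - 1)) (qpar \<tau> ^ nat \<bar>m\<bar>))"
  have k1: "k = Suc (k - 1)" using k by simp
  have split: "lattice_pts = {0} \<times> (-{0}) \<union> (-{0}) \<times> UNIV" by (auto simp: lattice_pts_def)
  have summ: "?f summable_on lattice_pts" by (rule summable_on_lattice[OF \<tau> k(1)])
  have summ1: "?f summable_on (-{0}) \<times> UNIV" by (rule summable_on_subset[OF summ]) (auto simp: split)
  have summ0: "?f summable_on {0} \<times> (-{0})" by (rule summable_on_subset[OF summ]) (auto simp: split)
  have row0: "((\<lambda>n::int. ?f (m, n)) has_sum g m) UNIV" if m: "m > 0" for m :: int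
  proof -
    have Im: "Im (of_int m * \<tau>) > 0" using m \<tau> by simp
    have "(\<lambda>n. 1 / (of_int m * \<tau> + of_int n) ^ k) summable_on (UNIV :: int set)"
      using summable_on_SigmaD1[of "\<lambda>m n. 1 / (of_int m * \<tau> + of_int n) ^ k" "-{0::int}" "\<lambda>_. UNIV :: int set" m] summ1 m by simp
    hence "((\<lambda>n. 1 / (of_int m * \<tau> + of_int n) ^ k) has_sum (C * eval_fps (power_fps (k - 1)) (qpar (of_int m * \<tau>)))) UNIV"
      using lipschitz_formula[OF Im, of "k - 1"] k1 k by (simp add: C_def)
    also have "qpar (of_int m * \<tau>) = qpar \<tau> ^ nat \<bar>m\<bar>"
      using m by (simp add: qpar_def mult_ac flip: exp_of_nat_mult)
    finally show ?thesis by (simp add: g_def)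
  qed
  have row: "((\<lambda>n::int. ?f (m, n)) has_sum g m) UNIV" if m: "m \<noteq> 0" for m :: int
  proof (cases "m > 0")
    case False
    have eq2: "(x - y) ^ k = (y - x) ^ k" for x y :: complex
      using k(2) by (metis minus_diff_eq power_minus_even)
    have "((\<lambda>n::int. ?f (- m, n)) has_sum g (- m)) UNIV" using False m by (intro row0) auto
    hence "((\<lambda>n::int. ?f (m, n)) has_sum g (- m)) UNIV"
      by (rule has_sum_reindex_bij_witness[where i = uminus and j = uminus, THEN iffD1, rotated -1])
         (auto simp: eq2)
    thus ?thesis by (simp add: g_def)
  qed (use row0 in auto)
  obtain S where S: "(?f has_sum S) ((-{0}) \<times> UNIV)" using summ1 by (auto simp: summable_on_def)
  have gS: "(g has_sum S) (-{0})" by (rule has_sum_SigmaD[OF S]) (use row in auto)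
  define T where "T = C * eval_fps (sigma_fps (k - 1)) (qpar \<tau>)"
  have lam: "((\<lambda>m. C * eval_fps (power_fps (k - 1)) (qpar \<tau> ^ m)) has_sum T) {1..}"
    unfolding T_def by (intro has_sum_cmult_right lambert_series norm_qpar_less_1 \<tau>)
  have g1: "(g has_sum T) {m. m > 0}"
    using lam by (rule has_sum_reindex_bij_witness[where i = nat and j = int, THEN iffD1, rotated -1]) (auto simp: g_def)
  have g2: "(g has_sum T) {m. m < 0}"
    using lam by (rule has_sum_reindex_bij_witness[where i = "\<lambda>m. nat (- m)" and j = "\<lambda>m. - int m", THEN iffD1, rotated -1]) (auto simp: g_def)
  have "(g has_sum (T + T)) ({m. m > 0} \<union> {m. m < 0})"
    by (rule has_sum_Un_disjoint[OF g1 g2]) auto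
  also have "{m. m > 0} \<union> {m. m < 0} = -{0::int}" by auto
  finally have "S = T + T" using gS has_sum_unique by blast
  have z: "(?f has_sum (\<Sum>\<^sub>\<infinity>n\<in>-{0::int}. 1 / of_int n ^ k)) ({0} \<times> (-{0}))"
  proof -
    have "infsum ?f ({0} \<times> (-{0})) = (\<Sum>\<^sub>\<infinity>n\<in>-{0::int}. ?f (0, n))"
      by (rule infsum_reindex_bij_witness[where i = "\<lambda>n. (0, n)" and j = snd]) auto
    thus ?thesis using has_sum_infsum[OF summ0] by simp
  qed
  have "(?f has_sum ((\<Sum>\<^sub>\<infinity>n\<in>-{0::int}. 1 / of_int n ^ k) + S)) lattice_pts"
    unfolding split by (rule has_sum_Un_disjoint[OF z S]) auto
  hence "eisenstein k \<tau> = (\<Sum>\<^sub>\<infinity>n\<in>-{0::int}. 1 / of_int n ^ k) + S"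
    unfolding eisenstein_def by (rule infsumI)
  thus ?thesis by (simp add: \<open>S = T + T\<close> T_def C_def)
qed

text \<open>The constant term is 2 zeta(k). If it were 0, the form would vanish at the cusp in
  weight at most 10 and hence identically by \<open>sturm_crude\<close>, although its coefficient of
  q is nonzero. The scale \<open>c\<close> is determined later.\<close>

lemma eisenstein_normalized:
  assumes k: "k \<ge> 4" "even k" "k \<le> 10"
  obtains c where "c \<noteq> 0" "mform k (1 + fps_const c * sigma_fps (k - 1))"
proof -
  define Z :: complex where "Z = (\<Sum>\<^sub>\<infinity>n\<in>-{0::int}. 1 / of_int n ^ k)"
  define C :: complex where "C = 2 * ((- 2 * of_real pi * \<i>) ^ k / fact (k - 1))"
  define F where "F = fps_const Z + fps_const C * sigma_fps (k - 1)"
  have "C \<noteq> 0" by (simp add: C_def)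
  have conv: "fps_conv_radius F \<ge> 1"
    unfolding F_def by (intro conv_radius_add_ge_1 conv_radius_mult_ge_1 conv_radius_sigma_fps) auto
  have ev: "eval_fps F (qpar \<tau>) = eisenstein k \<tau>" if "Im \<tau> > 0" for \<tau>
    unfolding eisenstein_q_expansion[OF that k(1,2)] F_def
    using that by (simp add: eval_fps_add eval_fps_mult qpar_conv conv_radius_sigma_fps conv_radius_mult_ge_1 Z_def C_def)
  have F: "mform k F"
    unfolding mform_def using conv by (auto simp: ev Im_moebius_pos eisenstein_modular)
  have "Z \<noteq> 0"
  proof
    assume "Z = 0"
    have "F = 0"
      by (rule sturm_crude[OF F, of 1]) (use k \<open>Z = 0\<close> in \<open>auto simp: F_def sigma_fps_def\<close>)
    moreover have "fps_nth F 1 = C" by (simp add: F_def sigma_fps_def divisor_sigma_def)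
    ultimately show False using \<open>C \<noteq> 0\<close> by simp
  qed
  show ?thesis
  proof (rule that[of "C / Z"])
    show "C / Z \<noteq> 0" using \<open>C \<noteq> 0\<close> \<open>Z \<noteq> 0\<close> by simp
    have "1 + fps_const (C / Z) * sigma_fps (k - 1) = fps_const (1 / Z) * F"
      using \<open>Z \<noteq> 0\<close> by (simp add: F_def fps_eq_iff algebra_simps)
    thus "mform k (1 + fps_const (C / Z) * sigma_fps (k - 1))" using F by (simp add: mform_cmult)
  qed
qed

subsection \<open>The forms of weight 4, 6 and 12\<close>

definition E4 :: "complex fps" where "E4 = 1 + fps_const 240 * sigma_fps 3"

definition E6 :: "complex fps" where "E6 = 1 + fps_const (-504) * sigma_fps 5"

definition Delta :: "complex fps" where "Delta = fps_const (1 / 1728) * (E4 ^ 3 - E6 ^ 2)"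

lemma divisors_2: "{d::nat. d dvd 2} = {1, 2}"
proof (rule set_eqI)
  fix d :: nat
  have "d dvd 2 \<Longrightarrow> d \<le> 2" by (rule dvd_imp_le) auto
  moreover have "d \<le> 2 \<Longrightarrow> d = 0 \<or> d = 1 \<or> d = 2" by arith
  ultimately show "d \<in> {d. d dvd 2} \<longleftrightarrow> d \<in> {1, 2}" by auto
qed

lemma divisors_3: "{d::nat. d dvd 3} = {1, 3}"
proof (rule set_eqI)
  fix d :: nat
  have "d dvd 3 \<Longrightarrow> d \<le> 3" by (rule dvd_imp_le) auto
  moreover have "d \<le> 3 \<Longrightarrow> d = 0 \<or> d = 1 \<or> d = 2 \<or> d = 3" by arith
  ultimately show "d \<in> {d. d dvd 3} \<longleftrightarrow> d \<in> {1, 3}" by auto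
qed

lemma divisor_sigma_1 [simp]: "divisor_sigma p (Suc 0) = 1"
  by (simp add: divisor_sigma_def)

lemma divisor_sigma_2: "divisor_sigma p 2 = 1 + 2 ^ p"
  unfolding divisor_sigma_def divisors_2 by simp

lemma divisor_sigma_3: "divisor_sigma p 3 = 1 + 3 ^ p"
  unfolding divisor_sigma_def divisors_3 by simp

lemma fps_mult_nth_2: "fps_nth (F * G) 2 = fps_nth F 0 * fps_nth G 2 + fps_nth F 1 * fps_nth G 1 + fps_nth F 2 * fps_nth G 0"
  by (simp add: fps_mult_nth numeral_2_eq_2)

text \<open>In weights 8 and 10 a form is determined by its constant term, so the normalized series
  satisfy E4^2 = E8 and E4 E6 = E10. Their coefficients of q and q^2 give two equations for each
  unknown pair of scales, with the nonzero solutions 240 and -504.\<close>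

lemma mform_E4_E6: "mform 4 E4" "mform 6 E6"
proof -
  obtain c4 where c4: "c4 \<noteq> 0" "mform 4 (1 + fps_const c4 * sigma_fps 3)"
    using eisenstein_normalized[of 4] by auto
  obtain c6 where c6: "c6 \<noteq> 0" "mform 6 (1 + fps_const c6 * sigma_fps 5)"
    using eisenstein_normalized[of 6] by auto
  obtain c8 where c8: "c8 \<noteq> 0" "mform 8 (1 + fps_const c8 * sigma_fps 7)"
    using eisenstein_normalized[of 8] by auto
  obtain c10 where c10: "c10 \<noteq> 0" "mform 10 (1 + fps_const c10 * sigma_fps 9)"
    using eisenstein_normalized[of 10] by auto
  define F where "F = (\<lambda>c p. 1 + fps_const c * sigma_fps p)"
  have F: "fps_nth (F c p) 0 = 1" "fps_nth (F c p) 1 = c" "fps_nth (F c p) 2 = c * (1 + 2 ^ p)" for c p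
    by (simp_all add: F_def sigma_fps_def divisor_sigma_2)
  have mF: "mform 4 (F c4 3)" "mform 6 (F c6 5)" "mform 8 (F c8 7)" "mform 10 (F c10 9)"
    using c4 c6 c8 c10 by (auto simp: F_def)
  have "F c4 3 * F c4 3 - F c8 7 = 0"
    by (rule sturm_crude[of 8 _ 1])
       (use mform_diff[OF mform_mult[OF mF(1,1)], of "F c8 7"] mF in \<open>auto simp: F\<close>)
  hence eq: "F c4 3 * F c4 3 = F c8 7" by simp
  have e1: "2 * c4 = c8" using arg_cong[OF eq, of "\<lambda>f. fps_nth f 1"] by (simp add: fps_mult_nth_1 F[simplified])
  \<comment> \<open>18 = 2 (1 + 2^3) and 129 = 1 + 2^7 are made of divisor sums at 2.\<close>
  have e2: "18 * c4 + c4 * c4 = 129 * c8"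
    using arg_cong[OF eq, of "\<lambda>f. fps_nth f 2"] unfolding fps_mult_nth_2 F by (simp add: algebra_simps)
  have "c4 * (c4 - 240) = (18 * c4 + c4 * c4) - 129 * (2 * c4)" by (simp add: algebra_simps)
  hence "c4 * (c4 - 240) = 0" unfolding e1 e2 by simp
  hence c4_eq: "c4 = 240" using c4 by simp
  show "mform 4 E4" using c4(2) by (simp add: c4_eq E4_def)
  have "F c4 3 * F c6 5 - F c10 9 = 0"
    by (rule sturm_crude[of 10 _ 1])
       (use mform_diff[OF mform_mult[OF mF(1,2)], of "F c10 9"] mF in \<open>auto simp: F\<close>)
  hence eq: "F c4 3 * F c6 5 = F c10 9" by simp
  have e3: "c4 + c6 = c10" using arg_cong[OF eq, of "\<lambda>f. fps_nth f 1"] by (simp add: fps_mult_nth_1 F[simplified] add.commute)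
  have e4: "9 * c4 + 33 * c6 + c4 * c6 = 513 * c10"
    using arg_cong[OF eq, of "\<lambda>f. fps_nth f 2"] unfolding fps_mult_nth_2 F by (simp add: algebra_simps)
  have "240 * (c6 + 504) = 513 * (c4 + c6) - (9 * c4 + 33 * c6 + c4 * c6)"
    by (simp add: c4_eq algebra_simps)
  hence "240 * (c6 + 504) = 0" unfolding e3 e4 by simp
  hence "c6 + 504 = 0" by (simp only: mult_eq_0_iff) simp
  hence "c6 = - 504" by (simp only: add_eq_0_iff2)
  thus "mform 6 E6" using c6(2) by (simp add: E6_def)
qed

lemmas mform_E4 = mform_E4_E6(1) and mform_E6 = mform_E4_E6(2)

lemma conv_radius_E4 [simp]: "fps_conv_radius E4 \<ge> 1" and conv_radius_E6 [simp]: "fps_conv_radius E6 \<ge> 1"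
  using mform_conv mform_E4_E6 by auto

lemma mform_Delta: "mform 12 Delta"
  using mform_diff[OF mform_power[OF mform_E4, of 3, simplified] mform_power[OF mform_E6, of 2, simplified]]
  by (auto simp: Delta_def intro!: mform_cmult)

lemma conv_radius_Delta [simp]: "fps_conv_radius Delta \<ge> 1"
  using mform_conv mform_Delta by auto

lemma E4_nth: "fps_nth E4 0 = 1" "fps_nth E4 1 = 240"
  by (simp_all add: E4_def sigma_fps_def)

lemma E6_nth: "fps_nth E6 0 = 1" "fps_nth E6 1 = -504"
  by (simp_all add: E6_def sigma_fps_def)

lemma Delta_nth_0 [simp]: "fps_nth Delta 0 = 0"
  by (simp add: Delta_def E4_nth E6_nth fps_power_zeroth)

lemma Delta_nth_1: "fps_nth Delta (Suc 0) = 1"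
proof -
  have "fps_nth (E4 ^ 3) 1 = 720" "fps_nth (E6 ^ 2) 1 = - 1008"
    using E4_nth E6_nth by (simp_all add: power3_eq_cube power2_eq_square fps_mult_nth_1)
  thus ?thesis by (simp add: Delta_def)
qed

lemma Delta_nonzero_fps: "Delta \<noteq> 0"
  using Delta_nth_1 by auto

lemma qderiv_mult: "qderiv (F * G) = F * qderiv G + qderiv F * G"
  by (simp add: qderiv_def algebra_simps)

lemma qderiv_diff: "qderiv (F - G) = qderiv F - qderiv G"
  by (simp add: qderiv_def algebra_simps)

lemma qderiv_power: "qderiv (F ^ n) = of_nat n * F ^ (n - 1) * qderiv F"
  by (simp add: qderiv_def fps_deriv_power mult_ac fps_of_nat)

lemma qderiv_cmult: "qderiv (fps_const c * F) = fps_const c * qderiv F"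
  by (simp add: qderiv_def mult_ac)

lemma E4_cube_minus_E6_square: "E4 ^ 3 - E6 ^ 2 = fps_const 1728 * Delta"
  by (simp add: Delta_def fps_const_mult flip: mult.assoc)

text \<open>The bracket \<open>B\<close> is a cusp form of weight 12 with q-coefficient -3456, hence
  -3456 Delta by \<open>sturm_crude\<close> with N = 2. It carries what Ramanujan's differential
  equations say about E4 and E6, with E2 eliminated.\<close>

lemma ramanujan_bracket: "2 * E4 * qderiv E6 - 3 * E6 * qderiv E4 = - (fps_const 1728 * Delta)"
proof -
  define B where "B = of_nat 4 * E4 * qderiv E6 - of_nat 6 * E6 * qderiv E4"
  define F where "F = B + fps_const 3456 * Delta"
  have "mform 12 B" using mform_bracket[OF mform_E4 mform_E6] by (simp add: B_def)
  hence F: "mform 12 F" unfolding F_def by (intro mform_add mform_cmult mform_Delta)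
  have "fps_nth B 1 = - 3456"
    using E4_nth E6_nth by (simp add: B_def fps_mult_nth_1 qderiv_nth fps_numeral_nth mult.assoc numeral_fps_const)
  moreover have "fps_nth B 0 = 0" by (simp add: B_def qderiv_nth)
  ultimately have "F = 0"
    by (intro sturm_crude[OF F, of 2]) (auto simp: F_def less_2_cases_iff Delta_nth_1)
  have c: "fps_const 3456 = (2 :: complex fps) * fps_const 1728"
    by (simp add: numeral_fps_const)
  have "F = 2 * (2 * E4 * qderiv E6 - 3 * E6 * qderiv E4 + fps_const 1728 * Delta)"
    unfolding F_def B_def c by (simp add: algebra_simps)
  with \<open>F = 0\<close> have "2 * (2 * E4 * qderiv E6 - 3 * E6 * qderiv E4 + fps_const 1728 * Delta) = 0"
    by (simp only:)
  hence "2 * E4 * qderiv E6 - 3 * E6 * qderiv E4 + fps_const 1728 * Delta = 0"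
    unfolding mult_eq_0_iff by (metis zero_neq_numeral)
  thus ?thesis by (simp only: add_eq_0_iff2)
qed

text \<open>Both lines express q dDelta/dq = E2 Delta: in Ramanujan's equations the two factors in
  front of Delta are E2 E4 and E2 E6. They follow by differentiating E4^3 - E6^2 and inserting
  \<open>ramanujan_bracket\<close>.\<close>

lemma qderiv_Delta:
  "E4 * qderiv Delta = (3 * qderiv E4 + E6) * Delta"
  "E6 * qderiv Delta = (2 * qderiv E6 + E4 ^ 2) * Delta"
proof -
  define D where "D = E4 ^ 3 - E6 ^ 2"
  have D: "D = fps_const 1728 * Delta" unfolding D_def by (rule E4_cube_minus_E6_square)
  have qD: "qderiv D = 3 * E4 ^ 2 * qderiv E4 - 2 * E6 * qderiv E6"
    by (simp add: D_def qderiv_diff qderiv_power)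
  have r: "2 * E4 * qderiv E6 = 3 * E6 * qderiv E4 - D"
    using ramanujan_bracket unfolding D by (simp add: algebra_simps)
  have "E4 * qderiv D = 3 * qderiv E4 * E4 ^ 3 - E6 * (2 * E4 * qderiv E6)"
    unfolding qD by (simp add: algebra_simps power2_eq_square power3_eq_cube)
  also have "\<dots> = (3 * qderiv E4 + E6) * D" unfolding r by (simp add: D_def algebra_simps power2_eq_square power3_eq_cube)
  finally show "E4 * qderiv Delta = (3 * qderiv E4 + E6) * Delta"
    unfolding D qderiv_cmult by (simp add: mult.left_commute)
  have r': "3 * E6 * qderiv E4 = 2 * E4 * qderiv E6 + D" using r by (simp add: algebra_simps)
  have "E6 * qderiv D = E4 ^ 2 * (3 * E6 * qderiv E4) - 2 * E6 ^ 2 * qderiv E6"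
    unfolding qD by (simp add: algebra_simps power2_eq_square)
  also have "\<dots> = (2 * qderiv E6 + E4 ^ 2) * D" unfolding r' by (simp add: D_def algebra_simps power2_eq_square power3_eq_cube)
  finally show "E6 * qderiv Delta = (2 * qderiv E6 + E4 ^ 2) * Delta"
    unfolding D qderiv_cmult by (simp add: mult.left_commute)
qed

subsection \<open>Estimates for power series\<close>

text \<open>The hypothesis on the coefficients majorizes the tail by a geometric series of ratio
  \<open>B * r\<close>.\<close>

lemma eval_fps_tail_bound:
  fixes F :: "complex fps"
  assumes conv: "fps_conv_radius F \<ge> 1" and q: "norm q \<le> r" "r < 1" and B: "0 \<le> B" "B * r < 1"
    and le: "\<And>n. n \<ge> N \<Longrightarrow> norm (fps_nth F n) \<le> A * B ^ (n - N)"
  shows "norm (eval_fps F q - (\<Sum>n<N. fps_nth F n * q ^ n)) \<le> A * r ^ N / (1 - B * r)"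
proof -
  have r: "r \<ge> 0" using q norm_ge_zero order_trans by blast
  have A: "A \<ge> 0" using order_trans[OF norm_ge_zero le[of N]] by simp
  have c: "ereal (norm q) < fps_conv_radius F" using conv q by (intro less_conv) auto
  have summ: "summable (\<lambda>n. fps_nth F n * q ^ n)" by (rule summable_fps[OF c])
  have "eval_fps F q = (\<Sum>n. fps_nth F (n + N) * q ^ (n + N)) + (\<Sum>n<N. fps_nth F n * q ^ n)"
    unfolding eval_fps_def by (rule suminf_split_initial_segment[OF summ])
  hence "eval_fps F q - (\<Sum>n<N. fps_nth F n * q ^ n) = (\<Sum>n. fps_nth F (n + N) * q ^ (n + N))" by simp
  also have "norm \<dots> \<le> (\<Sum>n. (A * r ^ N) * (B * r) ^ n)"
  proof (rule norm_suminf_le)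
    fix n
    have "norm (fps_nth F (n + N) * q ^ (n + N)) \<le> (A * B ^ n) * r ^ (n + N)"
      unfolding norm_mult norm_power using le[of "n + N"] q A B
      by (intro mult_mono power_mono) auto
    thus "norm (fps_nth F (n + N) * q ^ (n + N)) \<le> (A * r ^ N) * (B * r) ^ n"
      by (simp add: power_add power_mult_distrib mult_ac)
    show "summable (\<lambda>n. (A * r ^ N) * (B * r) ^ n)"
      using B r by (intro summable_mult summable_geometric) auto
  qed
  also have "\<dots> = (A * r ^ N) * (1 / (1 - B * r))"
    using B r by (subst suminf_mult) (auto simp: suminf_geometric intro!: summable_geometric)
  finally show ?thesis by simp
qed

text \<open>The growth factor ((n + 1) / n)^p from n to n + 1 is largest at the start n = N.\<close>

lemma pow_le_geometric:
  fixes c b :: real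
  assumes "N > 0" "c \<ge> 0" "real N ^ p \<le> c" "(1 + 1 / real N) ^ p \<le> b" "n \<ge> N"
  shows "real n ^ p \<le> c * b ^ (n - N)"
  using assms(5)
proof (induction n rule: dec_induct)
  case base
  thus ?case using assms by simp
next
  case (step n)
  have "0 \<le> (1 + 1 / real N) ^ p" by simp
  hence b: "b \<ge> 0" using assms(4) by linarith
  have "real (Suc n) ^ p = real n ^ p * (1 + 1 / real n) ^ p"
    using step assms(1) by (simp add: field_simps flip: power_mult_distrib)
  also have "\<dots> \<le> (c * b ^ (n - N)) * (1 + 1 / real N) ^ p"
    using step assms b by (intro mult_mono power_mono add_left_mono divide_left_mono) auto
  also have "\<dots> \<le> (c * b ^ (n - N)) * b"
    using assms b by (intro mult_left_mono) auto
  finally show ?case using step by (simp add: Suc_diff_le mult_ac)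
qed

lemma sigma3_le: "n \<ge> 3 \<Longrightarrow> real (divisor_sigma 3 n) \<le> 28 * 10 ^ (n - 3)"
proof (cases "n = 3")
  case False
  assume "n \<ge> 3"
  hence n: "n \<ge> 4" using False by simp
  have "real (divisor_sigma 3 n) \<le> real n ^ 4"
    using divisor_sigma_le[of 3 n] by (simp flip: of_nat_power)
  \<comment> \<open>280 = 28 * 10 exceeds 4^4 = 256, where 28 is the exact divisor sum at 3; 10 is
    the least integer ratio with this property.\<close>
  also have "\<dots> \<le> 280 * 10 ^ (n - 4)"
    by (rule pow_le_geometric) (use n in \<open>auto simp: power_divide\<close>)
  also have "\<dots> = 28 * 10 ^ (Suc (n - 4))" by simp
  also have "Suc (n - 4) = n - 3" using n by simp
  finally show ?thesis .
qed (simp add: divisor_sigma_3)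

lemma sigma5_le: "n \<ge> 3 \<Longrightarrow> real (divisor_sigma 5 n) \<le> 244 * 17 ^ (n - 3)"
proof (cases "n = 3")
  case False
  assume "n \<ge> 3"
  hence n: "n \<ge> 4" using False by simp
  have "real (divisor_sigma 5 n) \<le> real n ^ 6"
    using divisor_sigma_le[of 5 n] by (simp flip: of_nat_power)
  \<comment> \<open>4148 = 244 * 17 exceeds 4^6 = 4096, whereas 244 * 16 does not.\<close>
  also have "\<dots> \<le> 4148 * 17 ^ (n - 4)"
    by (rule pow_le_geometric) (use n in \<open>auto simp: power_divide\<close>)
  also have "\<dots> = 244 * 17 ^ (Suc (n - 4))" by simp
  also have "Suc (n - 4) = n - 3" using n by simp
  finally show ?thesis .
qed (simp add: divisor_sigma_3)

lemma sum_lessThan_3: "(\<Sum>n<3. f n) = f 0 + f 1 + f (2::nat)" for f :: "nat \<Rightarrow> complex"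
  by (simp add: numeral_3_eq_3 numeral_2_eq_2)

lemma E4_approx:
  assumes "norm q \<le> r" "r \<le> 1/20"
  shows "norm (eval_fps E4 q - (1 + 240 * q + 2160 * q ^ 2)) \<le> 6720 * r ^ 3 / (1 - 10 * r)"
proof -
  have "norm (eval_fps E4 q - (\<Sum>n<3. fps_nth E4 n * q ^ n)) \<le> 6720 * r ^ 3 / (1 - 10 * r)"
  proof (rule eval_fps_tail_bound)
    fix n :: nat assume n: "3 \<le> n"
    thus "norm (fps_nth E4 n) \<le> 6720 * 10 ^ (n - 3)"
      using sigma3_le[OF n] by (simp add: E4_def sigma_fps_def norm_mult)
  qed (use assms in auto)
  moreover have "fps_nth E4 2 = 2160" by (simp add: E4_def sigma_fps_def divisor_sigma_2)
  ultimately show ?thesis by (simp add: sum_lessThan_3 E4_nth[simplified])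
qed

lemma E6_approx:
  assumes "norm q \<le> r" "r \<le> 1/20"
  shows "norm (eval_fps E6 q - (1 - 504 * q - 16632 * q ^ 2)) \<le> 122976 * r ^ 3 / (1 - 17 * r)"
proof -
  have "norm (eval_fps E6 q - (\<Sum>n<3. fps_nth E6 n * q ^ n)) \<le> 122976 * r ^ 3 / (1 - 17 * r)"
  proof (rule eval_fps_tail_bound)
    fix n :: nat assume n: "3 \<le> n"
    thus "norm (fps_nth E6 n) \<le> 122976 * 17 ^ (n - 3)"
      using sigma5_le[OF n] by (simp add: E6_def sigma_fps_def norm_mult)
  qed (use assms in auto)
  moreover have "fps_nth E6 2 = -16632" by (simp add: E6_def sigma_fps_def divisor_sigma_2)
  ultimately show ?thesis by (simp add: sum_lessThan_3 E6_nth[simplified])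
qed

text \<open>Removing the linear term \<open>c * q\<close> leaves a function whose derivative stays
  below |c| in norm, so it cannot make up for a difference in the linear term. \<open>A\<close> and
  \<open>B\<close> control the coefficients of the derivative relative to \<open>c\<close>.\<close>

lemma eval_fps_inj_small_disc:
  fixes F :: "complex fps"
  assumes conv: "fps_conv_radius F \<ge> 1" and c: "fps_nth F 1 \<noteq> 0" and r: "r < 1" and B: "0 \<le> B" "B * r < 1"
    and le: "\<And>n. n \<ge> 1 \<Longrightarrow> norm (fps_nth F (Suc n) * of_nat (Suc n)) \<le> norm (fps_nth F 1) * A * B ^ (n - 1)"
    and lt: "A * r / (1 - B * r) < 1"
    and q: "norm q1 \<le> r" "norm q2 \<le> r" "eval_fps F q1 = eval_fps F q2"
  shows "q1 = q2"
proof -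
  define c where "c = fps_nth F 1"
  have "c \<noteq> 0" using assms by (simp add: c_def)
  define G where "G = (\<lambda>q. eval_fps F q - c * q)"
  have conv': "fps_conv_radius (fps_deriv F) \<ge> 1" using conv fps_conv_radius_deriv order_trans by blast
  have "norm (G q2 - G q1) \<le> (norm c * A * r / (1 - B * r)) * norm (q2 - q1)"
  proof (rule field_differentiable_bound[of "cball 0 r"])
    fix q assume q: "q \<in> cball (0::complex) r"
    show "(G has_field_derivative (eval_fps (fps_deriv F) q - c)) (at q within cball 0 r)"
      unfolding G_def using q r
      by (auto intro!: derivative_eq_intros less_conv conv)
    have "norm (eval_fps (fps_deriv F) q - (\<Sum>n<1. fps_nth (fps_deriv F) n * q ^ n)) \<le> (norm c * A) * r ^ 1 / (1 - B * r)"
      by (rule eval_fps_tail_bound) (use q r B le conv' in \<open>auto simp: c_def mult_ac\<close>)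
    thus "norm (eval_fps (fps_deriv F) q - c) \<le> norm c * A * r / (1 - B * r)" by (simp add: c_def)
  qed (use q in auto)
  also have "G q2 - G q1 = c * (q1 - q2)" using q by (simp add: G_def algebra_simps)
  finally have "norm c * norm (q1 - q2) \<le> norm c * ((A * r / (1 - B * r)) * norm (q1 - q2))"
    by (simp add: norm_mult norm_minus_commute mult_ac)
  hence "norm (q1 - q2) \<le> (A * r / (1 - B * r)) * norm (q1 - q2)"
    using \<open>c \<noteq> 0\<close> by (subst (asm) mult_le_cancel_left_pos) auto
  hence "(1 - A * r / (1 - B * r)) * norm (q1 - q2) \<le> 0" by (simp add: algebra_simps)
  thus ?thesis using lt by (simp add: mult_le_0_iff)
qed

text \<open>The radius 9/2000 exceeds exp (- \<pi> sqrt 3), the largest |q| on the fundamental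
  domain, so a zero of E4 there is unique up to translation. The value A = 18 is 2 (1 + 2^3), the
  first coefficient of the derivative after the constant, relative to 240.\<close>

lemma E4_inj:
  assumes "norm q1 \<le> 9/2000" "norm q2 \<le> 9/2000" "eval_fps E4 q1 = eval_fps E4 q2"
  shows "q1 = q2"
proof (rule eval_fps_inj_small_disc[where B = 8 and A = 18, OF _ _ _ _ _ _ _ assms])
  fix n :: nat assume n: "n \<ge> 1"
  have "real (divisor_sigma 3 (Suc n) * Suc n) \<le> 18 * 8 ^ (n - 1)"
  proof -
    consider "n = 1" | "n = 2" | "n \<ge> 3" using n by linarith
    thus ?thesis
    proof cases
      case 3
      have "divisor_sigma 3 (Suc n) * Suc n \<le> Suc n ^ 4 * Suc n"
        using divisor_sigma_le[of 3 "Suc n"] by (intro mult_right_mono) auto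
      hence "real (divisor_sigma 3 (Suc n) * Suc n) \<le> real (Suc n ^ 4 * Suc n)" by (rule of_nat_mono)
      also have "\<dots> = real (Suc n) ^ 5" by (simp only: of_nat_mult of_nat_power) (simp add: eval_nat_numeral)
      also have "\<dots> \<le> (18 * 64) * 8 ^ (Suc n - 4)"
        by (rule pow_le_geometric) (use 3 in \<open>auto simp: power_divide\<close>)
      also have "\<dots> = 18 * 8 ^ (2 + (Suc n - 4))" by (simp add: power_add)
      also have "2 + (Suc n - 4) = n - 1" using 3 by simp
      finally show ?thesis .
    qed (auto simp: divisor_sigma_2[unfolded numeral_2_eq_2] divisor_sigma_3[unfolded numeral_3_eq_3] numeral_2_eq_2)
  qed
  thus "norm (fps_nth E4 (Suc n) * of_nat (Suc n)) \<le> norm (fps_nth E4 1) * 18 * 8 ^ (n - 1)"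
  proof -
    have "norm (fps_nth E4 (Suc n) * of_nat (Suc n)) = 240 * real (divisor_sigma 3 (Suc n) * Suc n)"
      by (simp add: E4_def sigma_fps_def norm_mult del: of_nat_Suc mult_Suc_right)
    moreover have "norm (fps_nth E4 1) = 240" by (simp add: E4_nth[simplified])
    ultimately show ?thesis using \<open>real (divisor_sigma 3 (Suc n) * Suc n) \<le> _\<close> by simp
  qed
qed (auto simp: E4_nth[simplified])

lemma E6_inj:
  assumes "norm q1 \<le> 9/2000" "norm q2 \<le> 9/2000" "eval_fps E6 q1 = eval_fps E6 q2"
  shows "q1 = q2"
proof (rule eval_fps_inj_small_disc[where B = 16 and A = 66, OF _ _ _ _ _ _ _ assms])
  fix n :: nat assume n: "n \<ge> 1"
  have "real (divisor_sigma 5 (Suc n) * Suc n) \<le> 66 * 16 ^ (n - 1)"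
  proof -
    consider "n = 1" | "n = 2" | "n \<ge> 3" using n by linarith
    thus ?thesis
    proof cases
      case 3
      have "divisor_sigma 5 (Suc n) * Suc n \<le> Suc n ^ 6 * Suc n"
        using divisor_sigma_le[of 5 "Suc n"] by (intro mult_right_mono) auto
      hence "real (divisor_sigma 5 (Suc n) * Suc n) \<le> real (Suc n ^ 6 * Suc n)" by (rule of_nat_mono)
      also have "\<dots> = real (Suc n) ^ 7" by (simp only: of_nat_mult of_nat_power) (simp add: eval_nat_numeral)
      also have "\<dots> \<le> (66 * 256) * 16 ^ (Suc n - 4)"
        by (rule pow_le_geometric) (use 3 in \<open>auto simp: power_divide\<close>)
      also have "\<dots> = 66 * 16 ^ (2 + (Suc n - 4))" by (simp add: power_add)
      also have "2 + (Suc n - 4) = n - 1" using 3 by simp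
      finally show ?thesis .
    qed (auto simp: divisor_sigma_2[unfolded numeral_2_eq_2] divisor_sigma_3[unfolded numeral_3_eq_3] numeral_2_eq_2)
  qed
  thus "norm (fps_nth E6 (Suc n) * of_nat (Suc n)) \<le> norm (fps_nth E6 1) * 66 * 16 ^ (n - 1)"
  proof -
    have "norm (fps_nth E6 (Suc n) * of_nat (Suc n)) = 504 * real (divisor_sigma 5 (Suc n) * Suc n)"
      by (simp add: E6_def sigma_fps_def norm_mult del: of_nat_Suc mult_Suc_right)
    moreover have "norm (fps_nth E6 1) = 504" by (simp add: E6_nth[simplified])
    ultimately show ?thesis using \<open>real (divisor_sigma 5 (Suc n) * Suc n) \<le> _\<close> by simp
  qed
qed (auto simp: E6_nth[simplified])

text \<open>To first order E4 vanishes near q = -1/240 and E6 near q = 1/504, which are far apart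
  compared with the error terms.\<close>

lemma E4_E6_no_common_zero_small:
  assumes "norm q \<le> 9/2000" "eval_fps E4 q = 0" "eval_fps E6 q = 0"
  shows False
proof -
  have q2: "norm (q ^ 2) \<le> (9/2000)^2" unfolding norm_power using assms by (intro power_mono) auto
  have e4: "norm (1 + 240 * q) \<le> 2160 * (9/2000)^2 + 6720 * (9/2000) ^ 3 / (1 - 10 * (9/2000))"
  proof -
    have "1 + 240 * q = - (2160 * q ^ 2) - (0 - (1 + 240 * q + 2160 * q ^ 2))" by simp
    also have "norm \<dots> \<le> norm (2160 * q ^ 2) + norm (0 - (1 + 240 * q + 2160 * q ^ 2))"
      using norm_triangle_ineq4[of "- (2160 * q ^ 2)" "0 - (1 + 240 * q + 2160 * q ^ 2)"] unfolding norm_minus_cancel .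
    also have "\<dots> \<le> 2160 * (9/2000)^2 + 6720 * (9/2000) ^ 3 / (1 - 10 * (9/2000))"
      using E4_approx[OF assms(1)] assms(2) q2 by (intro add_mono) (auto simp: norm_mult)
    finally show ?thesis .
  qed
  have e6: "norm (1 - 504 * q) \<le> 16632 * (9/2000)^2 + 122976 * (9/2000) ^ 3 / (1 - 17 * (9/2000))"
  proof -
    have "1 - 504 * q = 16632 * q ^ 2 - (0 - (1 - 504 * q - 16632 * q ^ 2))" by simp
    also have "norm \<dots> \<le> norm (16632 * q ^ 2) + norm (0 - (1 - 504 * q - 16632 * q ^ 2))"
      by (rule norm_triangle_ineq4)
    also have "\<dots> \<le> 16632 * (9/2000)^2 + 122976 * (9/2000) ^ 3 / (1 - 17 * (9/2000))"
      using E6_approx[OF assms(1)] assms(3) q2 by (intro add_mono) (auto simp: norm_mult)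
    finally show ?thesis .
  qed
  \<comment> \<open>Eliminating q from 1 + 240 q and 1 - 504 q leaves 504 + 240 = 744.\<close>
  have "(744 :: real) = norm (504 * (1 + 240 * q) + 240 * (1 - 504 * q))" by (simp add: algebra_simps)
  also have "\<dots> \<le> norm (504 * (1 + 240 * q)) + norm (240 * (1 - 504 * q))" by (rule norm_triangle_ineq)
  also have "\<dots> = 504 * norm (1 + 240 * q) + 240 * norm (1 - 504 * q)" by (simp only: norm_mult norm_numeral)
  also have "\<dots> \<le> 504 * (1/20) + 240 * (2/5)"
    using order_trans[OF e4, of "1/20"] order_trans[OF e6, of "2/5"]
    by (intro add_mono mult_left_mono) (auto simp: power2_eq_square power3_eq_cube)
  finally show False by simp
qed

subsection \<open>Non-vanishing of the discriminant\<close>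

text \<open>At a zero of order n write f = (z - \<xi>)^n g and cancel (z - \<xi>)^(n - 1); at z =
  \<xi> the equation becomes n a(\<xi>) g(\<xi>) = 0. A nontrivial solution can vanish only at a
  singular point of the equation.\<close>

lemma zero_of_linear_ode:
  fixes f a b :: "complex \<Rightarrow> complex"
  assumes S: "open S" "connected S" and f: "f holomorphic_on S" and ab: "continuous_on S a" "continuous_on S b"
    and ode: "\<And>z. z \<in> S \<Longrightarrow> a z * deriv f z = b z * f z"
    and \<xi>: "\<xi> \<in> S" "f \<xi> = 0" and w: "w \<in> S" "f w \<noteq> 0"
  shows "a \<xi> = 0"
proof -
  have nc: "\<not> f constant_on S"
  proof
    assume "f constant_on S"
    then obtain c where "\<forall>x\<in>S. f x = c" by (auto simp: constant_on_def)
    thus False using \<xi> w by auto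
  qed
  obtain g r n where g: "0 < n" "0 < r" "ball \<xi> r \<subseteq> S" "g holomorphic_on ball \<xi> r"
      "\<And>w. w \<in> ball \<xi> r \<Longrightarrow> f w = (w - \<xi>) ^ n * g w" "\<And>w. w \<in> ball \<xi> r \<Longrightarrow> g w \<noteq> 0"
    using holomorphic_factor_zero_nonconstant[OF f S \<xi> nc] by metis
  have \<xi>b: "\<xi> \<in> ball \<xi> r" using g by simp
  define L where "L = (\<lambda>z. a z * (of_nat n * g z + (z - \<xi>) * deriv g z))"
  define R where "R = (\<lambda>z. b z * ((z - \<xi>) * g z))"
  have eq: "L z = R z" if z: "z \<in> ball \<xi> r - {\<xi>}" for z
  proof -
    have zb: "z \<in> ball \<xi> r" using z by simp
    have dg: "(g has_field_derivative deriv g z) (at z)"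
      using holomorphic_derivI[OF g(4) open_ball zb] .
    have "((\<lambda>z. (z - \<xi>) ^ n * g z) has_field_derivative
             ((z - \<xi>) ^ n * deriv g z + of_nat n * (z - \<xi>) ^ (n - 1) * g z)) (at z)"
      by (auto intro!: derivative_eq_intros dg)
    hence "(f has_field_derivative ((z - \<xi>) ^ n * deriv g z + of_nat n * (z - \<xi>) ^ (n - 1) * g z)) (at z)"
      by (rule has_field_derivative_transform_within_open[OF _ open_ball zb]) (use g in auto)
    hence df: "deriv f z = (z - \<xi>) ^ n * deriv g z + of_nat n * (z - \<xi>) ^ (n - 1) * g z"
      by (rule DERIV_imp_deriv)
    have n: "(z - \<xi>) ^ n = (z - \<xi>) ^ (n - 1) * (z - \<xi>)" using g(1) by (simp flip: power_Suc2)
    have "a z * deriv f z = b z * ((z - \<xi>) ^ n * g z)" using ode[of z] g zb by auto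
    hence "(z - \<xi>) ^ (n - 1) * L z = (z - \<xi>) ^ (n - 1) * R z"
      unfolding df n L_def R_def by (simp add: algebra_simps)
    thus ?thesis using z by simp
  qed
  have cL: "continuous_on (ball \<xi> r) L" unfolding L_def
    by (intro continuous_intros continuous_on_subset[OF ab(1)] holomorphic_on_imp_continuous_on holomorphic_deriv g(4) open_ball g(3))
  have cR: "continuous_on (ball \<xi> r) R" unfolding R_def
    by (intro continuous_intros continuous_on_subset[OF ab(2)] holomorphic_on_imp_continuous_on g(4) g(3))
  have lim: "(L \<longlongrightarrow> L \<xi>) (at \<xi>)" "(R \<longlongrightarrow> R \<xi>) (at \<xi>)"
    using cL cR \<xi>b by (auto simp: continuous_on_eq_continuous_at isCont_def)
  have "eventually (\<lambda>z. L z = R z) (at \<xi>)"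
    unfolding eventually_at using g(2) eq by (intro exI[of _ r]) (auto simp: dist_commute)
  hence "(R \<longlongrightarrow> L \<xi>) (at \<xi>)" using lim(1) by (rule Lim_transform_eventually[rotated])
  hence "L \<xi> = R \<xi>" using lim(2) tendsto_unique trivial_limit_at by blast
  thus ?thesis using g \<xi>b by (auto simp: L_def R_def)
qed

lemma exp_bound_544: "exp (5.44 :: real) \<ge> 2000/9"
proof -
  have e: "exp (1 :: real) \<ge> 2.718" using e_approx_32 by (simp add: abs_if split: if_splits)
  have "exp (5.44 :: real) = exp 1 ^ 5 * exp 0.44" by (simp flip: exp_of_nat_mult exp_add)
  also have "\<dots> \<ge> 2.718 ^ 5 * (1 + 0.44 + 0.44\<^sup>2 / 2)"
    using exp_lower_Taylor_quadratic[of "0.44"] by (intro mult_mono power_mono e) auto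
  finally show ?thesis by (simp add: power2_eq_square eval_nat_numeral)
qed

lemma sqrt3_bounds: "1.732 \<le> sqrt (3::real)" "sqrt (3::real) \<le> 1.7321"
proof -
  show "1.732 \<le> sqrt (3::real)" by (rule real_le_rsqrt) (simp add: power2_eq_square)
  show "sqrt (3::real) \<le> 1.7321" by (rule real_le_lsqrt) (simp_all add: power2_eq_square)
qed

text \<open>Source of the constant 9/2000: \<pi> sqrt 3 \<ge> 5.44 and exp 5.44 \<ge>
  2000/9.\<close>

lemma norm_qpar_le_fundamental:
  assumes "Im \<tau> \<ge> sqrt 3 / 2"
  shows "norm (qpar \<tau>) \<le> 9/2000"
proof -
  have "5.44 \<le> (3.141 :: real) * 1.732" by simp
  also have "\<dots> \<le> pi * sqrt 3" using pi_approx sqrt3_bounds by (intro mult_mono) auto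
  also have "\<dots> \<le> 2 * pi * Im \<tau>" using assms by simp
  finally have "exp (5.44 :: real) \<le> exp (2 * pi * Im \<tau>)" by simp
  hence "2000/9 \<le> exp (2 * pi * Im \<tau>)" using exp_bound_544 by linarith
  thus ?thesis by (simp add: norm_qpar exp_minus field_simps)
qed

text \<open>By the two equations of \<open>qderiv_Delta\<close>, read as linear equations in q, a
  zero of Delta is a common zero of E4 and E6. Modularity moves it into the fundamental domain,
  where |q| is too small for that.\<close>

lemma eval_Delta_nonzero:
  assumes \<tau>: "Im \<tau> > 0"
  shows "eval_fps Delta (qpar \<tau>) \<noteq> 0"
proof
  assume zero: "eval_fps Delta (qpar \<tau>) = 0"
  have conv: "1 \<le> fps_conv_radius F \<Longrightarrow> eval_fps F holomorphic_on ball 0 1" for F :: "complex fps"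
    by (rule holomorphic_on_eval_fps) (auto simp: less_conv)
  have cont: "1 \<le> fps_conv_radius F \<Longrightarrow> continuous_on (ball 0 1) (eval_fps F)" for F :: "complex fps"
    by (intro holomorphic_on_imp_continuous_on conv)
  have ex: "\<exists>w\<in>ball 0 1. eval_fps Delta w \<noteq> 0"
  proof (rule ccontr)
    assume "\<not> ?thesis"
    hence "eval_fps Delta q = 0" if "norm q < 1" for q using that by simp
    hence "Delta = 0" by (intro eval_fps_unit_disc_eq_0) auto
    thus False using Delta_nonzero_fps by simp
  qed
  have ode: "(z * eval_fps E z) * deriv (eval_fps Delta) z = eval_fps H z * eval_fps Delta z"
    if "E * qderiv Delta = H * Delta" "1 \<le> fps_conv_radius E" "1 \<le> fps_conv_radius H" "z \<in> ball 0 1" for E H z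
  proof -
    have z: "1 \<le> fps_conv_radius F \<Longrightarrow> ereal (norm z) < fps_conv_radius F" for F :: "complex fps"
      using that by (intro less_conv) auto
    have dc: "1 \<le> fps_conv_radius (fps_deriv Delta)"
      using conv_radius_Delta fps_conv_radius_deriv order_trans by blast
    have "eval_fps (E * qderiv Delta) z = eval_fps E z * (z * eval_fps (fps_deriv Delta) z)"
      unfolding qderiv_def using that dc by (simp add: eval_fps_mult z conv_radius_mult_ge_1)
    moreover have "eval_fps (H * Delta) z = eval_fps H z * eval_fps Delta z"
      using that by (simp add: eval_fps_mult z)
    moreover have "deriv (eval_fps Delta) z = eval_fps (fps_deriv Delta) z"
      by (intro DERIV_imp_deriv has_field_derivative_eval_fps) (simp add: z)
    ultimately show ?thesis using that(1) by (simp add: mult_ac)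
  qed
  have q: "qpar \<tau> \<in> ball 0 1" using norm_qpar_less_1[OF \<tau>] by simp
  have c3: "1 \<le> fps_conv_radius (numeral n * F)" if "1 \<le> fps_conv_radius F" for n and F :: "complex fps"
    using that by (intro conv_radius_mult_ge_1) auto
  have c4: "1 \<le> fps_conv_radius (3 * qderiv E4 + E6)" "1 \<le> fps_conv_radius (2 * qderiv E6 + E4 ^ 2)"
    by (auto intro!: conv_radius_add_ge_1 c3 conv_radius_qderiv conv_radius_power_ge_1)
  obtain w where w: "w \<in> ball 0 1" "eval_fps Delta w \<noteq> 0" using ex by blast
  have "qpar \<tau> * eval_fps E4 (qpar \<tau>) = 0"
    by (rule zero_of_linear_ode[OF _ _ conv[OF conv_radius_Delta] _ _ ode[OF qderiv_Delta(1)] q zero w])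
       (auto intro!: continuous_intros cont c4)
  hence z4: "eval_fps E4 (qpar \<tau>) = 0" by simp
  have "qpar \<tau> * eval_fps E6 (qpar \<tau>) = 0"
    by (rule zero_of_linear_ode[OF _ _ conv[OF conv_radius_Delta] _ _ ode[OF qderiv_Delta(2)] q zero w])
       (auto intro!: continuous_intros cont c4)
  hence z6: "eval_fps E6 (qpar \<tau>) = 0" by simp
  obtain a b c d :: int where *: "a * d - b * c = 1"
    "\<bar>Re ((of_int a * \<tau> + of_int b) / (of_int c * \<tau> + of_int d))\<bar> \<le> 1/2"
    "norm ((of_int a * \<tau> + of_int b) / (of_int c * \<tau> + of_int d)) \<ge> 1"
    using moebius_to_fundamental_domain[OF \<tau>] by metis
  define q' where "q' = qpar ((of_int a * \<tau> + of_int b) / (of_int c * \<tau> + of_int d))"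
  have "norm q' \<le> 9/2000" unfolding q'_def
    by (intro norm_qpar_le_fundamental Im_fundamental_domain_ge * Im_moebius_pos \<tau>)
  moreover have "eval_fps E4 q' = 0" "eval_fps E6 q' = 0"
    unfolding q'_def using mform_eq[OF mform_E4 *(1) \<tau>] mform_eq[OF mform_E6 *(1) \<tau>] z4 z6 by auto
  ultimately show False by (rule E4_E6_no_common_zero_small)
qed

text \<open>The point \<rho> is fixed by \<tau> \<mapsto> -1 / (\<tau> + 1), and the automorphy
  factor (\<rho> + 1)^4 = \<rho>^2 differs from 1.\<close>

lemma eval_E4_rho: "eval_fps E4 (qpar (Complex (-1/2) (sqrt 3 / 2))) = 0"
proof -
  define \<rho> where "\<rho> = Complex (-1/2) (sqrt 3 / 2)"
  have \<rho>2: "\<rho> ^ 2 = - 1 - \<rho>" "Im \<rho> > 0" by (auto simp: \<rho>_def complex_eq_iff power2_eq_square)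
  have nz: "\<rho> + 1 \<noteq> 0" using \<rho>2(2) by (auto simp: complex_eq_iff)
  have "\<rho> + 1 = - (\<rho> ^ 2)" using \<rho>2(1) by simp
  hence "(\<rho> + 1) ^ 4 = (\<rho> ^ 2) ^ 4" by simp
  also have "\<rho> ^ 3 = \<rho> * \<rho> ^ 2" by (simp add: eval_nat_numeral)
  hence r3: "\<rho> ^ 3 = 1" using \<rho>2(1) by (simp add: algebra_simps flip: power2_eq_square)
  have "(\<rho> ^ 2) ^ 4 = (\<rho> ^ 3) ^ 2 * \<rho> ^ 2" by (simp flip: power_mult power_add)
  also have "\<dots> = \<rho> ^ 2" using r3 by simp
  finally have p4: "(\<rho> + 1) ^ 4 = \<rho> ^ 2" .
  have fixp: "(of_int 0 * \<rho> + of_int (-1)) / (of_int 1 * \<rho> + of_int 1) = \<rho>"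
    using nz \<rho>2(1) by (simp add: field_simps power2_eq_square)
  have "eval_fps E4 (qpar \<rho>) = (\<rho> + 1) ^ 4 * eval_fps E4 (qpar \<rho>)"
    using mform_eq[OF mform_E4, of 0 1 "-1" 1 \<rho>] \<rho>2(2) unfolding fixp by simp
  moreover have "(\<rho> + 1) ^ 4 \<noteq> 1"
    unfolding p4 \<rho>2(1) using \<rho>2(2) by (auto simp: complex_eq_iff)
  ultimately have "eval_fps E4 (qpar \<rho>) = 0" by (simp add: mult_cancel_right1)
  thus ?thesis by (simp add: \<rho>_def)
qed

lemma E4_zero_fundamental:
  assumes "Im z \<ge> sqrt 3 / 2" "eval_fps E4 (qpar z) = 0"
  shows "qpar z = qpar (Complex (-1/2) (sqrt 3 / 2))"
proof -
  have "norm (qpar z) \<le> 9/2000" "norm (qpar (Complex (-1/2) (sqrt 3 / 2))) \<le> 9/2000"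
    by (rule norm_qpar_le_fundamental, use assms in simp)+
  thus ?thesis using assms(2) eval_E4_rho by (intro E4_inj[of "qpar z"]) simp_all
qed

lemma eval_E6_i: "eval_fps E6 (qpar \<i>) = 0"
proof -
  have "eval_fps E6 (qpar \<i>) = \<i> ^ 6 * eval_fps E6 (qpar \<i>)"
    using mform_eq[OF mform_E6, of 0 0 "-1" 1 \<i>] by simp
  moreover have "\<i> ^ 6 = (-1 :: complex)" by (simp add: eval_nat_numeral)
  ultimately show ?thesis by simp
qed

lemma E6_zero_fundamental:
  assumes "Im z \<ge> sqrt 3 / 2" "eval_fps E6 (qpar z) = 0"
  shows "qpar z = qpar \<i>"
proof -
  have "sqrt 3 / 2 \<le> Im \<i>" using sqrt3_bounds by simp
  thus ?thesis
    using assms eval_E6_i E6_inj[OF norm_qpar_le_fundamental norm_qpar_le_fundamental, of z "\<i>"] by simp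
qed

text \<open>F^12 / Delta^k is invariant, holomorphic because Delta has no zeros, and tends to 0 at
  the cusp because 12 N > k. It attains its maximum modulus, so the maximum principle makes it
  constant, which contradicts the decay unless F = 0.\<close>

lemma sturm:
  assumes F: "mform k F" and N: "12 * N > k" "\<And>n. n < N \<Longrightarrow> fps_nth F n = 0"
  shows "F = 0"
proof (rule ccontr)
  assume "F \<noteq> 0"
  have conv: "fps_conv_radius F \<ge> 1" by (rule mform_conv[OF F])
  obtain \<tau>1 where \<tau>1: "Im \<tau>1 > 0" "eval_fps F (qpar \<tau>1) \<noteq> 0"
    using mform_eq_0I[OF conv] \<open>F \<noteq> 0\<close> by blast
  define G where "G = fps_shift N F"
  define \<delta> where "\<delta> = fps_shift 1 Delta"
  have convG: "fps_conv_radius G \<ge> 1" using conv by (simp add: G_def)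
  have conv\<delta>: "fps_conv_radius \<delta> \<ge> 1" by (simp add: \<delta>_def)
  have FG: "eval_fps F q = q ^ N * eval_fps G q" if "norm q < 1" for q
    unfolding G_def by (rule eval_fps_shift_mult) (use conv N that in auto)
  have D\<delta>: "eval_fps Delta q = q * eval_fps \<delta> q" if "norm q < 1" for q
    unfolding \<delta>_def using eval_fps_shift_mult[OF conv_radius_Delta _ that, of 1] by simp
  define h where "h = (\<lambda>\<tau>. eval_fps F (qpar \<tau>) ^ 12 / eval_fps Delta (qpar \<tau>) ^ k)"
  define u where "u = (\<lambda>\<tau>. norm (h \<tau>))"
  have holh: "h holomorphic_on {\<tau>. Im \<tau> > 0}"
    unfolding h_def by (intro holomorphic_intros holomorphic_on_mform conv conv_radius_Delta) (auto simp: eval_Delta_nonzero)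
  have cont: "continuous_on {\<tau>. Im \<tau> > 0} u"
    unfolding u_def by (intro continuous_intros holomorphic_on_imp_continuous_on holh)
  have inv: "u ((of_int a * \<tau> + of_int b) / (of_int c * \<tau> + of_int d)) = u \<tau>"
    if det: "a * d - b * c = 1" and \<tau>: "Im \<tau> > 0" for a b c d :: int and \<tau>
  proof -
    have nz: "of_int c * \<tau> + of_int d \<noteq> 0" by (rule moebius_denom_nonzero[OF det \<tau>])
    thus ?thesis
      unfolding u_def h_def mform_eq[OF F det \<tau>] mform_eq[OF mform_Delta det \<tau>]
      by (simp add: power_mult_distrib mult.commute[of k 12] flip: power_mult)
  qed
  obtain C where C: "C > 0" "\<And>\<tau>. Im \<tau> \<ge> 1 \<Longrightarrow> norm (eval_fps G (qpar \<tau>)) \<le> C"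
    using eval_fps_bounded_near_cusp[OF convG] by metis
  have "isCont (eval_fps \<delta>) 0"
  proof -
    have "eval_fps \<delta> holomorphic_on ball 0 1"
      by (rule holomorphic_on_eval_fps) (use conv\<delta> in \<open>auto simp: less_conv\<close>)
    hence "continuous_on (ball 0 1) (eval_fps \<delta>)" by (rule holomorphic_on_imp_continuous_on)
    thus ?thesis by (simp add: continuous_on_eq_continuous_at)
  qed
  moreover have "eval_fps \<delta> 0 = 1" by (simp add: eval_fps_at_0 \<delta>_def Delta_nth_1)
  ultimately have "((\<lambda>q. norm (eval_fps \<delta> q)) \<longlongrightarrow> norm (1 :: complex)) (at 0)"
    unfolding isCont_def by (intro tendsto_norm) simp
  hence "eventually (\<lambda>q. norm (eval_fps \<delta> q) > 1/2) (at 0)" by (rule order_tendstoD(1)) simp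
  then obtain e0 where e0: "e0 > 0" "\<And>q. q \<noteq> 0 \<Longrightarrow> norm q < e0 \<Longrightarrow> norm (eval_fps \<delta> q) > 1/2"
    unfolding eventually_at by (auto simp: dist_norm)
  have small: "\<exists>Y. \<forall>\<tau>. Im \<tau> > Y \<longrightarrow> norm (qpar \<tau>) < e" if "e > 0" for e
  proof (rule exI[of _ "max 1 (- ln e)"], intro allI impI)
    fix \<tau> assume \<tau>: "Im \<tau> > max 1 (- ln e)"
    have "norm (qpar \<tau>) \<le> exp (- Im \<tau>)" using \<tau> pi_gt3 by (simp add: norm_qpar)
    also have "\<dots> < exp (ln e)" using \<tau> by simp
    finally show "norm (qpar \<tau>) < e" using that by simp
  qed
  have dec: "\<exists>Y. \<forall>\<tau>. Im \<tau> > Y \<longrightarrow> u \<tau> < e" if e: "e > 0" for e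
  proof -
    have "C ^ 12 * 2 ^ k > 0" using C by simp
    hence "min e0 (e / (C ^ 12 * 2 ^ k)) > 0" using e e0 by simp
    from small[OF this] obtain Y where Y: "\<And>\<tau>. Im \<tau> > Y \<Longrightarrow> norm (qpar \<tau>) < min e0 (e / (C ^ 12 * 2 ^ k))" by blast
    show ?thesis
    proof (rule exI[of _ "max 1 Y"], intro allI impI)
      fix \<tau> assume \<tau>: "Im \<tau> > max 1 Y"
      define q where "q = qpar \<tau>"
      have q: "norm q < 1" "q \<noteq> 0" unfolding q_def using \<tau> by (auto intro: norm_qpar_less_1)
      have d: "norm (eval_fps \<delta> q) > 1/2" using Y[of \<tau>] \<tau> e0 by (auto simp: q_def)
      have "norm (eval_fps \<delta> q) > 0" using d by linarith
      hence d2: "1 / norm (eval_fps \<delta> q) \<le> 2" using d by (simp add: divide_le_eq)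
      have "u \<tau> = norm q ^ (12 * N) * norm (eval_fps G q) ^ 12 / (norm q ^ k * norm (eval_fps \<delta> q) ^ k)"
        unfolding u_def h_def q_def[symmetric] FG[OF q(1)] D\<delta>[OF q(1)]
        by (simp add: norm_divide norm_mult norm_power power_mult_distrib mult.commute[of 12 N] flip: power_mult)
      also have "12 * N = k + Suc (12 * N - k - 1)" using N by simp
      also have "norm q ^ (k + Suc (12 * N - k - 1)) * norm (eval_fps G q) ^ 12 / (norm q ^ k * norm (eval_fps \<delta> q) ^ k) =
        norm q ^ Suc (12 * N - k - 1) * norm (eval_fps G q) ^ 12 * (1 / norm (eval_fps \<delta> q)) ^ k"
        using q d unfolding power_add by (simp add: power_divide del: power_Suc)
      also have "\<dots> \<le> norm q ^ 1 * C ^ 12 * 2 ^ k"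
        using q C(1) C(2)[of \<tau>] \<tau> d2 unfolding q_def
        by (intro mult_mono power_mono power_decreasing) auto
      also have "\<dots> < e / (C ^ 12 * 2 ^ k) * C ^ 12 * 2 ^ k"
        using Y[of \<tau>] \<tau> C unfolding q_def by (intro mult_strict_right_mono) auto
      also have "\<dots> = e" using C by simp
      finally show "u \<tau> < e" .
    qed
  qed
  have u1: "u \<tau>1 > 0" using \<tau>1 by (simp add: u_def h_def eval_Delta_nonzero)
  then obtain \<tau>0 where \<tau>0: "Im \<tau>0 \<ge> sqrt 3 / 2" "\<And>\<tau>. Im \<tau> > 0 \<Longrightarrow> u \<tau> \<le> u \<tau>0"
    using invariant_attains_max[OF cont inv dec \<tau>1(1)] by metis
  have "sqrt 3 / 2 > 0" by simp
  hence Im0: "Im \<tau>0 > 0" using \<tau>0(1) by linarith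
  have "h constant_on {\<tau>. Im \<tau> > 0}"
    by (rule maximum_modulus_principle[OF holh, of "{\<tau>. Im \<tau> > 0}" \<tau>0])
       (use Im0 \<tau>0(2) in \<open>auto simp: u_def open_halfspace_Im_gt convex_connected convex_halfspace_Im_gt\<close>)
  then obtain c where c: "\<And>\<tau>. Im \<tau> > 0 \<Longrightarrow> h \<tau> = c" by (auto simp: constant_on_def)
  obtain Y where Y: "\<And>\<tau>. Im \<tau> > Y \<Longrightarrow> u \<tau> < u \<tau>1" using dec[OF u1] by blast
  have "u (Complex 0 (max 1 Y + 1)) = u \<tau>1" using \<tau>1 by (simp add: u_def c)
  moreover have "Y < Im (Complex 0 (max 1 Y + 1))" by simp
  ultimately show False using Y[of "Complex 0 (max 1 Y + 1)"] by linarith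
qed

section \<open>A basis of the cusp forms\<close>

lemma fps_mult_nth_low:
  fixes F G :: "'a :: comm_semiring_1 fps"
  assumes "\<And>n. n < m \<Longrightarrow> fps_nth F n = 0"
  shows "n < m \<Longrightarrow> fps_nth (F * G) n = 0" "fps_nth (F * G) m = fps_nth F m * fps_nth G 0"
proof -
  show "n < m \<Longrightarrow> fps_nth (F * G) n = 0"
    unfolding fps_mult_nth by (rule sum.neutral) (use assms in auto)
  have "fps_nth (F * G) m = (\<Sum>i=0..m. if i = m then fps_nth F m * fps_nth G 0 else 0)"
    unfolding fps_mult_nth by (intro sum.cong) (use assms in \<open>auto simp: le_less\<close>)
  thus "fps_nth (F * G) m = fps_nth F m * fps_nth G 0" by simp
qed

lemma Delta_power_nth: "n < m \<Longrightarrow> fps_nth (Delta ^ m) n = 0" "fps_nth (Delta ^ m) m = 1"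
proof -
  define \<delta> where "\<delta> = fps_shift 1 Delta"
  have "Delta = fps_X * \<delta>"
    by (rule fps_ext) (simp add: \<delta>_def)
  hence eq: "Delta ^ m = fps_X ^ m * \<delta> ^ m" by (metis power_mult_distrib)
  show "n < m \<Longrightarrow> fps_nth (Delta ^ m) n = 0" unfolding eq by (simp add: fps_X_power_mult_nth)
  show "fps_nth (Delta ^ m) m = 1" unfolding eq by (simp add: fps_X_power_mult_nth \<delta>_def Delta_nth_1 fps_power_zeroth)
qed

lemma E4_E6_power_nth_0 [simp]: "fps_nth (E4 ^ n) 0 = 1" "fps_nth (E6 ^ n) 0 = 1"
  by (simp_all add: fps_power_zeroth E4_nth E6_nth)

lemma E4_nonzero: "E4 \<noteq> 0" using E4_nth by auto

text \<open>For (a, b) = (2, 1), weight 12 l + 14, \<open>sturm\<close> asks for one coefficient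
  more; an exception would be Delta^(l + 1) times a form of weight 2. With D = c Delta^(l + 1),
  where c is the next coefficient, comparison in higher weight gives F E4 = D E6 and F E6 = D E4^2.
  Hence D (E4^3 - E6^2) = 0, so that D and F vanish.\<close>

lemma sturm':
  assumes F: "mform (12 * l + 4 * a + 6 * b) F" and ab: "a \<le> 2" "b \<le> 1"
    and zero: "\<And>n. n \<le> l \<Longrightarrow> fps_nth F n = 0"
  shows "F = 0"
proof (cases "a = 2 \<and> b = 1")
  case False
  show ?thesis
    by (rule sturm[OF F, of "Suc l"]) (use False ab zero in auto)
next
  case True
  hence F': "mform (12 * l + 14) F" using F by (simp add: add.commute)
  define c where "c = fps_nth F (Suc l)"
  have zero': "fps_nth F n = 0" if "n < Suc l" for n using zero[of n] that by simp
  define D where "D = fps_const c * Delta ^ Suc l"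
  have D: "mform (12 * l + 12) D"
    using mform_power[OF mform_Delta, of "Suc l"] unfolding D_def by (intro mform_cmult) (simp add: algebra_simps)
  have D0: "fps_nth D n = 0" if "n < Suc l" for n
    using that Delta_power_nth(1)[of n "Suc l"] by (simp add: D_def del: power_Suc)
  have D1: "fps_nth D (Suc l) = c" by (simp add: D_def Delta_power_nth del: power_Suc)
  have *: "fps_nth (F * G - D * H) n = 0" if "n < l + 2" "fps_nth G 0 = 1" "fps_nth H 0 = 1" for n G H
  proof (cases "n < Suc l")
    case True
    thus ?thesis using fps_mult_nth_low(1)[of "Suc l" F n G] fps_mult_nth_low(1)[of "Suc l" D n H] zero' D0 by auto
  next
    case False
    with that have "n = Suc l" by simp
    thus ?thesis using fps_mult_nth_low(2)[of "Suc l" F G] fps_mult_nth_low(2)[of "Suc l" D H] zero' D0 that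
      by (simp add: D1 c_def)
  qed
  have mf: "mform (12 * l + 18) (F * E4)" "mform (12 * l + 18) (D * E6)"
    "mform (12 * l + 20) (F * E6)" "mform (12 * l + 20) (D * E4 ^ 2)"
    using mform_mult[OF F' mform_E4] mform_mult[OF D mform_E6] mform_mult[OF F' mform_E6]
      mform_mult[OF D mform_power[OF mform_E4, of 2]] by (simp_all add: add.commute)
  have "F * E4 - D * E6 = 0"
    by (rule sturm[OF mform_diff[OF mf(1,2)], of "l + 2"]) (use * in \<open>auto simp: E4_nth E6_nth\<close>)
  moreover have "F * E6 - D * E4 ^ 2 = 0"
    by (rule sturm[OF mform_diff[OF mf(3,4)], of "l + 2"]) (use * in \<open>auto simp: E4_nth E6_nth\<close>)
  ultimately have eq: "F * E4 = D * E6" "F * E6 = D * E4 ^ 2" by auto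
  have "D * (E4 ^ 3 - E6 ^ 2) = E4 * (D * E4 ^ 2) - E6 * (D * E6)"
    by (simp add: algebra_simps power2_eq_square power3_eq_cube)
  also have "\<dots> = 0" unfolding eq[symmetric] by (simp add: mult_ac)
  finally have "D = 0"
    unfolding E4_cube_minus_E6_square using Delta_nonzero_fps by simp
  hence "F * E4 = 0" using eq by simp
  thus ?thesis using E4_nonzero by simp
qed

text \<open>Element i is Delta^l E4^a E6^b j^i and begins with q^(l - i). The index i = l is absent
  because F vanishes at the cusp. Once the coefficients up to q^l are eliminated,
  \<open>sturm'\<close> shows that nothing is left.\<close>

lemma cusp_form_decomposition:
  assumes F: "mform (12 * l + 4 * a + 6 * b) F" and ab: "a \<le> 2" "b \<le> 1" and zero: "fps_nth F 0 = 0"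
  obtains c where "F = (\<Sum>i<l. fps_const (c i) * (Delta ^ (l - i) * E4 ^ (3 * i + a) * E6 ^ b))"
proof -
  define B where "B = (\<lambda>i. Delta ^ (l - i) * E4 ^ (3 * i + a) * E6 ^ b)"
  have mB: "mform (12 * l + 4 * a + 6 * b) (B i)" if "i \<le> l" for i
  proof -
    have "mform ((l - i) * 12 + (3 * i + a) * 4 + b * 6) (B i)"
      unfolding B_def by (intro mform_mult mform_power mform_Delta mform_E4 mform_E6)
    moreover have "(l - i) * 12 + (3 * i + a) * 4 + b * 6 = 12 * l + 4 * a + 6 * b"
      using that by (simp add: algebra_simps)
    ultimately show ?thesis by (simp only:)
  qed
  have B0: "fps_nth (B i) n = 0" if "n < l - i" for i n
    unfolding B_def mult.assoc by (rule fps_mult_nth_low(1)[of "l - i"]) (use that Delta_power_nth in auto)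
  have B1: "fps_nth (B i) (l - i) = 1" for i
    unfolding B_def mult.assoc
    by (subst fps_mult_nth_low(2)) (auto simp: Delta_power_nth)
  have mS: "mform (12 * l + 4 * a + 6 * b) (F - (\<Sum>i\<in>A. fps_const (c i) * B i))" if "finite A" "A \<subseteq> {..l}" for A c
    using that
  proof (induction A)
    case empty
    thus ?case using F by simp
  next
    case (insert x A)
    have "F - (\<Sum>i\<in>insert x A. fps_const (c i) * B i) = (F - (\<Sum>i\<in>A. fps_const (c i) * B i)) - fps_const (c x) * B x"
      using insert by (simp add: algebra_simps)
    moreover have "mform (12 * l + 4 * a + 6 * b) (F - (\<Sum>i\<in>A. fps_const (c i) * B i) - fps_const (c x) * B x)"
      using insert by (intro mform_diff[of _ "F - (\<Sum>i\<in>A. fps_const (c i) * B i)"] mform_cmult mB) auto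
    ultimately show ?case by (simp only:)
  qed
  \<comment> \<open>Stage m clears the coefficient of q^m with element l - m; the elements used
    before begin with lower powers and keep their coefficients.\<close>
  have "\<exists>c. \<forall>n\<le>m. fps_nth (F - (\<Sum>i\<in>{l-m..<l}. fps_const (c i) * B i)) n = 0" if "m \<le> l" for m
    using that
  proof (induction m)
    case 0
    thus ?case using zero by simp
  next
    case (Suc m)
    then obtain c where c: "\<And>n. n \<le> m \<Longrightarrow> fps_nth (F - (\<Sum>i\<in>{l-m..<l}. fps_const (c i) * B i)) n = 0" by auto
    define R where "R = F - (\<Sum>i\<in>{l-m..<l}. fps_const (c i) * B i)"
    define j where "j = l - Suc m"
    define c' where "c' = c(j := fps_nth R (Suc m))"
    have j: "l - j = Suc m" using Suc.prems by (simp add: j_def)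
    have ins: "{l - Suc m..<l} = insert j {l-m..<l}" "j \<notin> {l-m..<l}" using Suc.prems by (auto simp: j_def)
    have "(\<Sum>i\<in>{l-m..<l}. fps_const (c' i) * B i) = (\<Sum>i\<in>{l-m..<l}. fps_const (c i) * B i)"
      using ins(2) by (intro sum.cong) (auto simp: c'_def)
    with ins have "F - (\<Sum>i\<in>{l-Suc m..<l}. fps_const (c' i) * B i) = R - fps_const (fps_nth R (Suc m)) * B j"
      by (simp add: c'_def R_def)
    moreover have "fps_nth (R - fps_const (fps_nth R (Suc m)) * B j) n = 0" if "n \<le> Suc m" for n
    proof (cases "n = Suc m")
      case True
      thus ?thesis using B1[of j] j by simp
    next
      case False
      with that have "n \<le> m" by simp
      thus ?thesis using c[of n] B0[of n j] j by (simp add: R_def)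
    qed
    ultimately show ?case by metis
  qed
  from this[of l] obtain c where c: "\<And>n. n \<le> l \<Longrightarrow> fps_nth (F - (\<Sum>i\<in>{0..<l}. fps_const (c i) * B i)) n = 0" by auto
  have "F - (\<Sum>i\<in>{0..<l}. fps_const (c i) * B i) = 0"
    by (rule sturm'[OF mS ab]) (use c in auto)
  thus ?thesis using that[of c] by (simp add: B_def atLeast0LessThan)
qed

subsection \<open>The modular invariant\<close>

definition klein_j :: "complex \<Rightarrow> complex" where
  "klein_j \<tau> = eval_fps E4 (qpar \<tau>) ^ 3 / eval_fps Delta (qpar \<tau>)"

lemma eval_fps_Delta:
  assumes "norm q < 1"
  shows "1728 * eval_fps Delta q = eval_fps E4 q ^ 3 - eval_fps E6 q ^ 2"
proof -
  have c: "1 \<le> fps_conv_radius F \<Longrightarrow> ereal (norm q) < fps_conv_radius F" for F :: "complex fps"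
    using assms by (intro less_conv)
  have "eval_fps (fps_const 1728 * Delta) q = eval_fps (E4 ^ 3 - E6 ^ 2) q"
    by (simp add: E4_cube_minus_E6_square)
  thus ?thesis
    by (simp add: eval_fps_mult eval_fps_diff eval_fps_power c conv_radius_power_ge_1)
qed

lemma holomorphic_klein_j: "klein_j holomorphic_on {\<tau>. Im \<tau> > 0}"
  unfolding klein_j_def by (intro holomorphic_intros holomorphic_on_mform) (auto simp: eval_Delta_nonzero)

lemma klein_j_invariant:
  fixes a b c d :: int
  assumes det: "a * d - b * c = 1" and \<tau>: "Im \<tau> > 0"
  shows "klein_j ((of_int a * \<tau> + of_int b) / (of_int c * \<tau> + of_int d)) = klein_j \<tau>"
  using moebius_denom_nonzero[OF det \<tau>]
  unfolding klein_j_def mform_eq[OF mform_E4 det \<tau>] mform_eq[OF mform_Delta det \<tau>]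
  by (simp add: power_mult_distrib flip: power_mult)

lemma klein_j_minus_1728:
  assumes "Im \<tau> > 0"
  shows "klein_j \<tau> - 1728 = eval_fps E6 (qpar \<tau>) ^ 2 / eval_fps Delta (qpar \<tau>)"
  unfolding klein_j_def
  using eval_fps_Delta[OF norm_qpar_less_1[OF assms]] eval_Delta_nonzero[OF assms] by (simp add: field_simps)

text \<open>The quotient rule simplifies by \<open>qderiv_Delta\<close>. The derivative vanishes
  only where E4 or E6 does, on the arc therefore only at the endpoints.\<close>

lemma has_field_derivative_klein_j:
  assumes \<tau>: "Im \<tau> > 0"
  shows "(klein_j has_field_derivative
           (- (2 * of_real pi * \<i>) * eval_fps E4 (qpar \<tau>) ^ 2 * eval_fps E6 (qpar \<tau>) / eval_fps Delta (qpar \<tau>))) (at \<tau>)"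
proof -
  let ?P = "2 * of_real pi * \<i>"
  define e4 e6 d where "e4 = eval_fps E4 (qpar \<tau>)" and "e6 = eval_fps E6 (qpar \<tau>)" and "d = eval_fps Delta (qpar \<tau>)"
  define t4 td where "t4 = eval_fps (qderiv E4) (qpar \<tau>)" and "td = eval_fps (qderiv Delta) (qpar \<tau>)"
  have d: "d \<noteq> 0" using eval_Delta_nonzero[OF \<tau>] by (simp add: d_def)
  have c: "1 \<le> fps_conv_radius F \<Longrightarrow> ereal (norm (qpar \<tau>)) < fps_conv_radius F" for F :: "complex fps"
    using \<tau> by (intro qpar_conv)
  have "eval_fps (E4 * qderiv Delta) (qpar \<tau>) = eval_fps ((3 * qderiv E4 + E6) * Delta) (qpar \<tau>)"
    by (simp add: qderiv_Delta)
  hence ode: "e4 * td = (3 * t4 + e6) * d"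
    by (simp add: eval_fps_mult eval_fps_add c conv_radius_qderiv conv_radius_mult_ge_1 conv_radius_add_ge_1 e4_def e6_def d_def t4_def td_def)
  have d4: "((\<lambda>\<tau>. eval_fps E4 (qpar \<tau>)) has_field_derivative ?P * t4) (at \<tau>)"
    and dD: "((\<lambda>\<tau>. eval_fps Delta (qpar \<tau>)) has_field_derivative ?P * td) (at \<tau>)"
    unfolding t4_def td_def by (rule has_field_derivative_mform; use \<tau> in simp)+
  have "(klein_j has_field_derivative (((3 * e4 ^ 2 * (?P * t4)) * d - e4 ^ 3 * (?P * td)) / (d * d))) (at \<tau>)"
    using DERIV_divide[OF DERIV_power[OF d4, of 3] dD] d unfolding klein_j_def[abs_def] e4_def d_def
    by (simp add: mult_ac)
  also have "(3 * e4 ^ 2 * (?P * t4)) * d - e4 ^ 3 * (?P * td) = ?P * e4 ^ 2 * (3 * t4 * d - e4 * td)"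
    by (simp add: algebra_simps power2_eq_square power3_eq_cube)
  also have "\<dots> = - ?P * e4 ^ 2 * e6 * d" unfolding ode by (simp add: algebra_simps)
  also have "\<dots> / (d * d) = - ?P * e4 ^ 2 * e6 / d" using d by simp
  finally show ?thesis by (simp add: e4_def e6_def d_def)
qed

lemma not_constant_klein_j: "\<not> klein_j constant_on {\<tau>. Im \<tau> > 0}"
proof
  assume "klein_j constant_on {\<tau>. Im \<tau> > 0}"
  then obtain c where c: "\<And>\<tau>. Im \<tau> > 0 \<Longrightarrow> klein_j \<tau> = c" by (auto simp: constant_on_def)
  have conv: "1 \<le> fps_conv_radius (fps_const c * Delta)" "1 \<le> fps_conv_radius (E4 ^ 3)"
    by (auto intro!: conv_radius_mult_ge_1 conv_radius_power_ge_1)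
  have "E4 ^ 3 - fps_const c * Delta = 0"
  proof (rule mform_eq_0I)
    fix \<tau> assume \<tau>: "Im \<tau> > 0"
    have "eval_fps (E4 ^ 3 - fps_const c * Delta) (qpar \<tau>) = eval_fps E4 (qpar \<tau>) ^ 3 - c * eval_fps Delta (qpar \<tau>)"
      by (simp add: eval_fps_diff eval_fps_power eval_fps_mult qpar_conv \<tau> conv)
    also have "\<dots> = 0" using c[OF \<tau>] eval_Delta_nonzero[OF \<tau>] by (simp add: klein_j_def field_simps)
    finally show "eval_fps (E4 ^ 3 - fps_const c * Delta) (qpar \<tau>) = 0" .
  qed (use conv in \<open>auto intro!: conv_radius_diff_ge_1\<close>)
  hence "fps_nth (E4 ^ 3 - fps_const c * Delta) 0 = 0" by simp
  thus False by simp
qed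

section \<open>Reality of j on the boundary of the half domain and its behaviour at the cusp\<close>

lemma eval_fps_cnj:
  assumes "1 \<le> fps_conv_radius F" "norm q < 1" "\<And>n. cnj (fps_nth F n) = fps_nth F n"
  shows "eval_fps F (cnj q) = cnj (eval_fps F q)"
proof -
  have "(\<lambda>n. fps_nth F n * q ^ n) sums eval_fps F q"
    by (intro sums_eval_fps less_conv assms)
  hence "(\<lambda>n. cnj (fps_nth F n * q ^ n)) sums cnj (eval_fps F q)" by (simp only: sums_cnj)
  hence "(\<lambda>n. fps_nth F n * cnj q ^ n) sums cnj (eval_fps F q)" by (simp add: assms)
  thus ?thesis by (simp add: eval_fps_def sums_iff)
qed

lemma eval_E4_cnj: "norm q < 1 \<Longrightarrow> eval_fps E4 (cnj q) = cnj (eval_fps E4 q)"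
  by (rule eval_fps_cnj[OF conv_radius_E4]) (auto simp: E4_def sigma_fps_def)

lemma eval_E6_cnj: "norm q < 1 \<Longrightarrow> eval_fps E6 (cnj q) = cnj (eval_fps E6 q)"
  by (rule eval_fps_cnj[OF conv_radius_E6]) (auto simp: E6_def sigma_fps_def)

lemma eval_Delta_cnj:
  assumes "norm q < 1"
  shows "eval_fps Delta (cnj q) = cnj (eval_fps Delta q)"
proof -
  have "1728 * eval_fps Delta (cnj q) = cnj (1728 * eval_fps Delta q)"
    using assms eval_fps_Delta[of q] eval_fps_Delta[of "cnj q"] by (simp add: eval_E4_cnj eval_E6_cnj)
  thus ?thesis by simp
qed

lemma klein_j_cnj: "Im \<tau> > 0 \<Longrightarrow> klein_j (- cnj \<tau>) = cnj (klein_j \<tau>)"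
  unfolding klein_j_def qpar_cnj by (simp add: eval_E4_cnj eval_Delta_cnj norm_qpar_less_1)

lemma klein_j_plus_1: "Im \<tau> > 0 \<Longrightarrow> klein_j (\<tau> + 1) = klein_j \<tau>"
  using klein_j_invariant[of 1 1 1 0 \<tau>] by simp

lemma klein_j_S: "Im \<tau> > 0 \<Longrightarrow> klein_j (- 1 / \<tau>) = klein_j \<tau>"
  using klein_j_invariant[of 0 0 "-1" 1 \<tau>] by simp

lemma inverse_unit_circle: "norm z = 1 \<Longrightarrow> - 1 / z = - cnj z"
proof -
  assume "norm z = 1"
  hence e: "z * cnj z = 1" using complex_norm_square[of z] by simp
  hence "z \<noteq> 0" by auto
  thus ?thesis by (simp add: divide_eq_eq e mult.commute[of "cnj z"])
qed

lemma klein_j_real_boundary: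
  assumes "Im z > 0" "norm z = 1 \<or> Re z = 0 \<or> Re z = -1/2"
  shows "cnj (klein_j z) = klein_j z"
  using assms(2)
proof (elim disjE)
  assume "norm z = 1"
  thus ?thesis using klein_j_cnj[OF assms(1)] klein_j_S[OF assms(1)] inverse_unit_circle[of z] by simp
next
  assume "Re z = 0"
  hence "- cnj z = z" by (simp add: complex_eq_iff)
  thus ?thesis using klein_j_cnj[OF assms(1)] by simp
next
  assume "Re z = -1/2"
  hence "- cnj z = z + 1" by (simp add: complex_eq_iff)
  thus ?thesis using klein_j_cnj[OF assms(1)] klein_j_plus_1[OF assms(1)] by simp
qed

lemma Delta_nth_2: "fps_nth Delta 2 = - 24"
proof -
  have E4_2: "fps_nth E4 2 = 2160" and E6_2: "fps_nth E6 2 = - 16632"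
    by (simp_all add: E4_def E6_def sigma_fps_def divisor_sigma_2)
  have a: "fps_nth (E4 * E4) 2 = 61920" "fps_nth (E4 * E4) 1 = 480" "fps_nth (E4 * E4) 0 = 1"
    unfolding fps_mult_nth_2 fps_mult_nth_1 fps_mult_nth_0 E4_2 E4_nth by simp_all
  have "fps_nth (E4 ^ 3) 2 = 179280"
    unfolding power3_eq_cube fps_mult_nth_2[of "E4 * E4"] a E4_2 E4_nth by simp
  moreover have "fps_nth (E6 ^ 2) 2 = 220752"
    unfolding power2_eq_square fps_mult_nth_2 E6_2 E6_nth by simp
  ultimately show ?thesis by (simp add: Delta_def)
qed

lemma klein_j_cusp:
  assumes "e > 0"
  obtains Y where "\<And>\<tau>. Im \<tau> > 0 \<Longrightarrow> Im \<tau> \<ge> Y \<Longrightarrow> norm (klein_j \<tau> - 1 / qpar \<tau> - 744) < e"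
proof -
  define \<delta> where "\<delta> = fps_shift 1 Delta"
  define H where "H = fps_shift 1 (E4 ^ 3 - \<delta>)"
  have conv: "1 \<le> fps_conv_radius \<delta>" "1 \<le> fps_conv_radius (E4 ^ 3)" "1 \<le> fps_conv_radius (E4 ^ 3 - \<delta>)" "1 \<le> fps_conv_radius H"
    unfolding H_def \<delta>_def by (auto intro!: conv_radius_diff_ge_1 conv_radius_power_ge_1)
  have \<delta>0: "fps_nth \<delta> 0 = 1" by (simp add: \<delta>_def Delta_nth_1)
  have D\<delta>: "eval_fps Delta q = q * eval_fps \<delta> q" if "norm q < 1" for q
    unfolding \<delta>_def using eval_fps_shift_mult[OF conv_radius_Delta _ that, of 1] by simp
  have EH: "eval_fps (E4 ^ 3 - \<delta>) q = q * eval_fps H q" if "norm q < 1" for q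
    unfolding H_def using eval_fps_shift_mult[OF conv(3) _ that, of 1] \<delta>0 by simp
  have "fps_nth (E4 ^ 3) 1 = 720"
    using E4_nth by (simp add: power3_eq_cube fps_mult_nth_1)
  \<comment> \<open>744 = 720 + 24, from the q-coefficient of E4^3 and the coefficient -24 of
    Delta.\<close>
  hence H0: "fps_nth H 0 = 744" using Delta_nth_2 by (simp add: H_def \<delta>_def numeral_2_eq_2)
  have cont: "isCont (eval_fps F) 0" if "1 \<le> fps_conv_radius F" for F :: "complex fps"
  proof -
    have "eval_fps F holomorphic_on ball 0 1"
      by (rule holomorphic_on_eval_fps) (use that in \<open>auto simp: less_conv\<close>)
    hence "continuous_on (ball 0 1) (eval_fps F)" by (rule holomorphic_on_imp_continuous_on)
    thus ?thesis by (simp add: continuous_on_eq_continuous_at)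
  qed
  have "((\<lambda>q. eval_fps H q / eval_fps \<delta> q) \<longlongrightarrow> 744 / 1) (at 0)"
    using cont[OF conv(4)] cont[OF conv(1)] unfolding isCont_def
    by (intro tendsto_divide) (auto simp: eval_fps_at_0 H0 \<delta>0)
  hence "eventually (\<lambda>q. dist (eval_fps H q / eval_fps \<delta> q) 744 < e) (at 0)"
    using assms by (auto dest: tendstoD)
  then obtain r where r: "r > 0" "\<And>q. q \<noteq> 0 \<Longrightarrow> norm q < r \<Longrightarrow> norm (eval_fps H q / eval_fps \<delta> q - 744) < e"
    unfolding eventually_at by (auto simp: dist_norm)
  show ?thesis
  proof (rule that[of "max 1 (- ln r + 1)"])
    fix \<tau> assume \<tau>: "Im \<tau> > 0" "Im \<tau> \<ge> max 1 (- ln r + 1)"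
    define q where "q = qpar \<tau>"
    have q: "norm q < 1" "q \<noteq> 0" unfolding q_def using \<tau> by (auto intro: norm_qpar_less_1)
    have "norm q \<le> exp (- Im \<tau>)" using \<tau> pi_gt3 by (simp add: norm_qpar q_def)
    also have "\<dots> < exp (ln r)" using \<tau> by simp
    finally have qr: "norm q < r" using r by simp
    have nz: "eval_fps Delta q \<noteq> 0" unfolding q_def by (rule eval_Delta_nonzero[OF \<tau>(1)])
    hence nz': "eval_fps \<delta> q \<noteq> 0" using D\<delta>[OF q(1)] by auto
    have "eval_fps (E4 ^ 3 - \<delta>) q = eval_fps E4 q ^ 3 - eval_fps \<delta> q"
      using q by (simp add: eval_fps_diff eval_fps_power less_conv conv)
    hence E: "eval_fps E4 q ^ 3 = eval_fps \<delta> q + q * eval_fps H q" using EH[OF q(1)] by simp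
    have "klein_j \<tau> - 1 / q = eval_fps H q / eval_fps \<delta> q"
      unfolding klein_j_def q_def[symmetric] E D\<delta>[OF q(1)] using q nz' by (simp add: field_simps)
    thus "norm (klein_j \<tau> - 1 / qpar \<tau> - 744) < e" using r(2)[OF q(2) qr] by (simp add: q_def)
  qed
qed

lemma inverse_qpar: "1 / qpar \<tau> = exp (2 * pi * Im \<tau>) * cis (- (2 * pi * Re \<tau>))"
proof -
  have "1 / qpar \<tau> = exp (- (2 * of_real pi * \<i> * \<tau>))" by (simp add: qpar_def exp_minus field_simps)
  also have "- (2 * of_real pi * \<i> * \<tau>) = of_real (2 * pi * Im \<tau>) + \<i> * of_real (- (2 * pi * Re \<tau>))"
    by (simp add: complex_eq_iff)
  finally show ?thesis by (simp only: exp_add cis_conv_exp exp_of_real)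
qed

section \<open>Values of j on the fundamental domain\<close>

lemma connected_upper: "connected {\<tau>. Im \<tau> > 0}" and open_upper: "open {\<tau>. Im \<tau> > 0}"
  by (auto simp: open_halfspace_Im_gt convex_connected convex_halfspace_Im_gt)

lemma open_image_klein_j:
  assumes "open U" "U \<subseteq> {\<tau>. Im \<tau> > 0}"
  shows "open (klein_j ` U)"
  using open_mapping_thm[OF holomorphic_klein_j open_upper connected_upper assms not_constant_klein_j] .

lemma open_has_lower_Im:
  assumes "open V" "v \<in> V"
  obtains w where "w \<in> V" "Im w < Im v"
proof -
  obtain r where r: "r > 0" "ball v r \<subseteq> V" using assms by (meson open_contains_ball)
  have "v - \<i> * of_real (r/2) \<in> ball v r" using r(1) by (simp add: dist_norm norm_mult del: of_real_divide)
  hence "v - \<i> * of_real (r/2) \<in> V" using r(2) by blast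
  moreover have "Im (v - \<i> * of_real (r/2)) < Im v" using r(1) by simp
  ultimately show ?thesis by (rule that)
qed

text \<open>Minimize Im j over the closed half domain cut off at a large height. It is 0 on the two
  lines and the circle, and near the cusp Im (1/q) \<ge> 0 keeps it above the assumed negative
  value; so a negative minimum would be interior, against the open mapping theorem. Openness once
  more improves \<ge> to >.\<close>

lemma Im_klein_j_pos:
  assumes z: "-1/2 < Re z" "Re z < 0" "norm z > 1" "Im z > 0"
  shows "Im (klein_j z) > 0"
proof -
  define R where "R = {z. -1/2 < Re z} \<inter> {z. Re z < 0} \<inter> - cball 0 1 \<inter> {z. Im z > 0}"
  have opR: "open R" unfolding R_def
    by (intro open_Int open_halfspace_Re_gt open_halfspace_Re_lt open_halfspace_Im_gt) auto
  have R_iff: "w \<in> R \<longleftrightarrow> -1/2 < Re w \<and> Re w < 0 \<and> norm w > 1 \<and> Im w > 0" for w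
    by (auto simp: R_def)
  have nonneg: "Im (klein_j w) \<ge> 0" if w: "w \<in> R" for w
  proof (rule ccontr)
    assume "\<not> ?thesis"
    define e where "e = - Im (klein_j w)"
    have e: "e > 0" using \<open>\<not> _\<close> by (simp add: e_def)
    obtain Y where Y: "\<And>\<tau>. Im \<tau> > 0 \<Longrightarrow> Im \<tau> \<ge> Y \<Longrightarrow> norm (klein_j \<tau> - 1 / qpar \<tau> - 744) < e"
      using klein_j_cusp[OF e] by metis
    have top: "Im (klein_j p) > - e" if p: "Im p > 0" "Im p \<ge> Y" "-1/2 \<le> Re p" "Re p \<le> 0" for p
    proof -
      have "\<bar>Im (klein_j p - 1 / qpar p - 744)\<bar> < e"
        by (rule le_less_trans[OF abs_Im_le_cmod Y[OF p(1,2)]])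
      moreover have "Im (1 / qpar p) \<ge> 0"
      proof -
        have "(-2 * pi) * (-1/2) \<ge> (-2 * pi) * Re p" using p by (intro mult_left_mono_neg) auto
        moreover have "(-2 * pi) * Re p \<ge> 0" using p by (intro mult_nonpos_nonpos) auto
        ultimately have "sin (- (2 * pi * Re p)) \<ge> 0" by (intro sin_ge_zero) auto
        thus ?thesis unfolding inverse_qpar by (simp add: mult_nonneg_nonpos)
      qed
      ultimately show ?thesis by (simp add: abs_less_iff)
    qed
    define K where "K = {z. -1/2 \<le> Re z} \<inter> {z. Re z \<le> 0} \<inter> - ball 0 1 \<inter> {z. Im z \<ge> sqrt 3 / 2} \<inter> {z. Im z \<le> max Y (Im w)}"
    have K_iff: "p \<in> K \<longleftrightarrow> -1/2 \<le> Re p \<and> Re p \<le> 0 \<and> norm p \<ge> 1 \<and> Im p \<ge> sqrt 3 / 2 \<and> Im p \<le> max Y (Im w)" for p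
      by (auto simp: K_def)
    have "closed K" unfolding K_def
      by (intro closed_Int closed_halfspace_Re_le closed_halfspace_Re_ge closed_halfspace_Im_ge closed_halfspace_Im_le) auto
    moreover have "bounded K"
    proof (rule bounded_subset)
      show "K \<subseteq> cbox (Complex (-1/2) (sqrt 3/2)) (Complex 0 (max Y (Im w)))"
        by (auto simp: K_iff in_cbox_complex_iff)
    qed simp
    ultimately have "compact K" by (simp add: compact_eq_bounded_closed)
    have pos: "Im p > 0" if "p \<in> K" for p
    proof -
      have "sqrt 3 / 2 > 0" by simp
      thus ?thesis using that unfolding K_iff by linarith
    qed
    have wK: "w \<in> K" using w Im_fundamental_domain_ge[of w] by (auto simp: K_iff R_iff)
    have "continuous_on K (\<lambda>p. Im (klein_j p))"
      using pos by (intro continuous_intros continuous_on_subset[OF holomorphic_on_imp_continuous_on[OF holomorphic_klein_j]]) auto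
    then obtain p where p: "p \<in> K" "\<And>p'. p' \<in> K \<Longrightarrow> Im (klein_j p) \<le> Im (klein_j p')"
      using continuous_attains_inf[OF \<open>compact K\<close>] wK by blast
    have le: "Im (klein_j p) \<le> - e" using p(2)[OF wK] by (simp add: e_def)
    have "Im (klein_j p) = 0" if "norm p = 1 \<or> Re p = 0 \<or> Re p = -1/2"
      using klein_j_real_boundary[OF pos[OF p(1)] that] by (simp add: complex_eq_iff)
    hence "p \<in> R" using p(1) pos[OF p(1)] le e unfolding K_iff R_iff by force
    have "Im p < Y"
    proof (rule ccontr)
      assume "\<not> Im p < Y"
      thus False using top[of p] pos[OF p(1)] le \<open>p \<in> R\<close> by (auto simp: R_iff)
    qed
    define U where "U = R \<inter> {z. Im z < Y}"
    have "open U" unfolding U_def by (intro open_Int opR open_halfspace_Im_lt)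
    hence "open (klein_j ` U)" by (intro open_image_klein_j) (auto simp: U_def R_iff)
    moreover have "klein_j p \<in> klein_j ` U" using \<open>p \<in> R\<close> \<open>Im p < Y\<close> by (auto simp: U_def)
    ultimately obtain v where "v \<in> klein_j ` U" "Im v < Im (klein_j p)" by (rule open_has_lower_Im)
    then obtain p' where p': "p' \<in> U" "Im (klein_j p') < Im (klein_j p)" by auto
    have "p' \<in> K" using p' Im_fundamental_domain_ge[of p'] by (auto simp: U_def R_iff K_iff)
    thus False using p(2)[of p'] p' by linarith
  qed
  have zR: "z \<in> R" using z by (simp add: R_iff)
  have "open (klein_j ` R)" by (intro open_image_klein_j opR) (auto simp: R_iff)
  then obtain v where v: "v \<in> klein_j ` R" "Im v < Im (klein_j z)"
    using zR by (elim open_has_lower_Im[of _ "klein_j z"]) auto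
  thus ?thesis using nonneg by force
qed

text \<open>On the axis j is real and large near the cusp. A value of at most 1728 above i would, by
  continuity, give a point with j = 1728 there, a second zero of E6.\<close>

lemma klein_j_imaginary_axis:
  assumes z: "Re z = 0" "Im z > 1"
  shows "Re (klein_j z) > 1728"
proof (rule ccontr)
  assume "\<not> ?thesis"
  define f where "f = (\<lambda>y. Re (klein_j (Complex 0 y)))"
  have real: "klein_j (Complex 0 y) = of_real (f y)" if "y > 0" for y
    using klein_j_real_boundary[of "Complex 0 y"] that by (auto simp: f_def complex_eq_iff)
  have ne: "f y \<noteq> 1728" if y: "y > 1" for y
  proof
    assume "f y = 1728"
    hence "klein_j (Complex 0 y) - 1728 = 0" using real[of y] y by simp
    hence "eval_fps E6 (qpar (Complex 0 y)) = 0"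
      using klein_j_minus_1728[of "Complex 0 y"] eval_Delta_nonzero[of "Complex 0 y"] y by simp
    hence "qpar (Complex 0 y) = qpar \<i>"
      by (intro E6_zero_fundamental) (use y sqrt3_bounds in auto)
    hence "norm (qpar (Complex 0 y)) = norm (qpar \<i>)" by simp
    thus False using y by (simp add: norm_qpar)
  qed
  obtain Y where Y: "\<And>\<tau>. Im \<tau> > 0 \<Longrightarrow> Im \<tau> \<ge> Y \<Longrightarrow> norm (klein_j \<tau> - 1 / qpar \<tau> - 744) < 1"
    using klein_j_cusp[of 1] by auto
  define y where "y = max (Im z) (max Y 1000)"
  have y: "y \<ge> Im z" "y \<ge> Y" "y \<ge> 1000" by (auto simp: y_def)
  have "f y > 1728"
  proof -
    have "\<bar>Re (klein_j (Complex 0 y) - 1 / qpar (Complex 0 y) - 744)\<bar> < 1"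
      by (rule le_less_trans[OF abs_Re_le_cmod Y]) (use y in auto)
    moreover have "Re (1 / qpar (Complex 0 y)) \<ge> 1000"
    proof -
      have "1000 \<le> 2 * pi * y" using y pi_gt3 mult_mono[of 1 "2 * pi" 1000 y] by simp
      also have "\<dots> \<le> exp (2 * pi * y)" using exp_ge_add_one_self[of "2 * pi * y"] by linarith
      finally show ?thesis unfolding inverse_qpar by simp
    qed
    ultimately show ?thesis by (simp add: f_def abs_less_iff)
  qed
  moreover have "f (Im z) \<le> 1728"
  proof -
    have "Complex 0 (Im z) = z" using z by (simp add: complex_eq_iff)
    thus ?thesis using \<open>\<not> Re (klein_j z) > 1728\<close> by (simp add: f_def)
  qed
  moreover have "continuous_on {Im z..y} f"
    unfolding f_def using z
    by (intro continuous_intros continuous_on_compose2[OF holomorphic_on_imp_continuous_on[OF holomorphic_klein_j]])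
       (auto simp: Complex_eq intro!: continuous_intros)
  ultimately obtain t where "t \<ge> Im z" "f t = 1728"
    using IVT'[of f "Im z" 1728 y] y by auto
  thus False using ne[of t] z by simp
qed

lemma klein_j_left_edge:
  assumes z: "Re z = -1/2" "norm z > 1" "Im z > 0"
  shows "Re (klein_j z) < 0"
proof (rule ccontr)
  assume "\<not> ?thesis"
  define f where "f = (\<lambda>y. Re (klein_j (Complex (-1/2) y)))"
  have real: "klein_j (Complex (-1/2) y) = of_real (f y)" if "y > 0" for y
    using klein_j_real_boundary[of "Complex (-1/2) y"] that by (auto simp: f_def complex_eq_iff)
  have Imz: "Im z > sqrt 3 / 2"
  proof -
    have "1 < norm z ^ 2" using z by (simp add: one_less_power)
    also have "norm z ^ 2 = 1/4 + Im z ^ 2" unfolding cmod_power2 z(1) by (simp add: power2_eq_square)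
    finally have "(sqrt 3 / 2) ^ 2 < Im z ^ 2" by (simp add: power_divide)
    thus ?thesis by (rule power2_less_imp_less) (use z in simp)
  qed
  have ne: "f y \<noteq> 0" if y: "y > sqrt 3 / 2" for y
  proof
    assume "f y = 0"
    have y0: "y > 0" using y real_sqrt_ge_0_iff[of 3] by linarith
    have "klein_j (Complex (-1/2) y) = 0" using real[of y] y0 \<open>f y = 0\<close> by simp
    hence "eval_fps E4 (qpar (Complex (-1/2) y)) = 0"
      using eval_Delta_nonzero[of "Complex (-1/2) y"] y0 by (simp add: klein_j_def)
    hence "qpar (Complex (-1/2) y) = qpar (Complex (-1/2) (sqrt 3 / 2))"
      by (intro E4_zero_fundamental) (use y in auto)
    hence "norm (qpar (Complex (-1/2) y)) = norm (qpar (Complex (-1/2) (sqrt 3 / 2)))" by simp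
    thus False using y by (simp add: norm_qpar)
  qed
  obtain Y where Y: "\<And>\<tau>. Im \<tau> > 0 \<Longrightarrow> Im \<tau> \<ge> Y \<Longrightarrow> norm (klein_j \<tau> - 1 / qpar \<tau> - 744) < 1"
    using klein_j_cusp[of 1] by auto
  define y where "y = max (Im z) (max Y 1000)"
  have y: "y \<ge> Im z" "y \<ge> Y" "y \<ge> 1000" by (auto simp: y_def)
  have "f y < 0"
  proof -
    have "\<bar>Re (klein_j (Complex (-1/2) y) - 1 / qpar (Complex (-1/2) y) - 744)\<bar> < 1"
      by (rule le_less_trans[OF abs_Re_le_cmod Y]) (use y in auto)
    moreover have "Re (1 / qpar (Complex (-1/2) y)) \<le> - 1000"
    proof -
      have "1000 \<le> 2 * pi * y" using y pi_gt3 mult_mono[of 1 "2 * pi" 1000 y] by simp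
      also have "\<dots> \<le> exp (2 * pi * y)" using exp_ge_add_one_self[of "2 * pi * y"] by linarith
      finally show ?thesis unfolding inverse_qpar by simp
    qed
    ultimately show ?thesis by (simp add: f_def abs_less_iff)
  qed
  moreover have "f (Im z) \<ge> 0"
  proof -
    have "Complex (-1/2) (Im z) = z" using z by (simp add: complex_eq_iff)
    thus ?thesis using \<open>\<not> Re (klein_j z) < 0\<close> by (simp add: f_def)
  qed
  moreover have "continuous_on {Im z..y} f"
    unfolding f_def using z
    by (intro continuous_intros continuous_on_compose2[OF holomorphic_on_imp_continuous_on[OF holomorphic_klein_j]])
       (auto simp: Complex_eq intro!: continuous_intros)
  ultimately obtain t where "t \<ge> Im z" "f t = 0"
    using IVT2'[of f y 0 "Im z"] y by auto
  thus False using ne[of t] Imz by simp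
qed

text \<open>Off the circle j is nonreal inside the left half, above 1728 on the imaginary axis and
  negative on the left edge. The right half follows by reflection in the imaginary axis.\<close>

lemma klein_j_in_interval_imp_arc:
  assumes z: "\<bar>Re z\<bar> \<le> 1/2" "norm z \<ge> 1" "Im z > 0"
    and j: "klein_j z = of_real x" "0 \<le> x" "x \<le> 1728"
  shows "norm z = 1"
proof (rule ccontr)
  assume "norm z \<noteq> 1"
  hence n: "norm z > 1" using z by simp
  have *: False if w: "-1/2 \<le> Re w" "Re w \<le> 0" "norm w > 1" "Im w > 0" "klein_j w = of_real x" for w
  proof -
    consider "Re w = 0" | "Re w = -1/2" | "-1/2 < Re w" "Re w < 0" using w by linarith
    thus False
    proof cases
      case 1
      hence "Im w > 1" using w by (simp add: cmod_def)
      thus False using klein_j_imaginary_axis[of w] 1 w j by simp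
    next
      case 2
      thus False using klein_j_left_edge[of w] w j by simp
    next
      case 3
      thus False using Im_klein_j_pos[of w] w by simp
    qed
  qed
  show False
  proof (cases "Re z \<le> 0")
    case True
    thus False using *[of z] z n j by auto
  next
    case False
    have "klein_j (- cnj z) = of_real x" using klein_j_cnj[of z] z j by simp
    thus False using *[of "- cnj z"] z n False by auto
  qed
qed

subsection \<open>The modular invariant on the arc\<close>

lemma cos_2pi3: "cos (2 * pi / 3) = - 1 / 2" and sin_2pi3: "sin (2 * pi / 3) = sqrt 3 / 2"
proof -
  have *: "2 * pi / 3 = pi - pi / 3" by simp
  show "cos (2 * pi / 3) = - 1 / 2" unfolding * cos_pi_minus by (simp add: cos_60)
  show "sin (2 * pi / 3) = sqrt 3 / 2" unfolding * sin_pi_minus by (simp add: sin_60)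
qed

lemma arc_bounds:
  assumes "pi / 2 \<le> \<theta>" "\<theta> \<le> 2 * pi / 3"
  shows "-1/2 \<le> cos \<theta>" "cos \<theta> \<le> 0" "sin \<theta> > 0" "sqrt 3 / 2 \<le> sin \<theta>"
proof -
  have "cos (2 * pi / 3) \<le> cos \<theta>" by (rule cos_monotone_0_pi_le) (use assms pi_gt3 in auto)
  thus c1: "-1/2 \<le> cos \<theta>" by (simp add: cos_2pi3)
  have "cos \<theta> \<le> cos (pi / 2)" by (rule cos_monotone_0_pi_le) (use assms pi_gt3 in auto)
  thus c2: "cos \<theta> \<le> 0" by simp
  show s: "sin \<theta> > 0" by (rule sin_gt_zero) (use assms pi_gt3 in auto)
  show "sqrt 3 / 2 \<le> sin \<theta>"
    using Im_fundamental_domain_ge[of "cis \<theta>"] c1 c2 s by simp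
qed

lemma cis_ends: "cis (pi / 2) = \<i>" "cis (2 * pi / 3) = Complex (-1/2) (sqrt 3 / 2)"
  using cos_2pi3 sin_2pi3 by (auto simp: complex_eq_iff)

lemma unit_circle_arc:
  assumes "norm z = 1" "-1/2 \<le> Re z" "Re z \<le> 0" "Im z > 0"
  obtains \<theta> where "pi / 2 \<le> \<theta>" "\<theta> \<le> 2 * pi / 3" "z = cis \<theta>"
proof
  have c: "cos (arccos (Re z)) = Re z" using assms by simp
  have "1 = Re z ^ 2 + Im z ^ 2" using assms(1) by (simp add: cmod_def)
  hence "Im z = sqrt (1 - Re z ^ 2)" using assms(4) by (intro real_sqrt_unique [symmetric]) auto
  hence "sin (arccos (Re z)) = Im z" using assms by (subst sin_arccos) auto
  thus "z = cis (arccos (Re z))" using c by (simp add: complex_eq_iff)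
  have "arccos 0 \<le> arccos (Re z)" using assms by (intro arccos_le_arccos) auto
  thus "pi / 2 \<le> arccos (Re z)" by simp
  have "arccos (Re z) \<le> arccos (- 1 / 2)" using assms by (intro arccos_le_arccos) auto
  also have "arccos (- 1 / 2) = 2 * pi / 3" using arccos_cos[of "2 * pi / 3"] cos_2pi3 pi_gt3 by simp
  finally show "arccos (Re z) \<le> 2 * pi / 3" .
qed

lemma E4_nonzero_arc:
  assumes "pi / 2 \<le> \<theta>" "\<theta> < 2 * pi / 3"
  shows "eval_fps E4 (qpar (cis \<theta>)) \<noteq> 0"
proof
  assume "eval_fps E4 (qpar (cis \<theta>)) = 0"
  hence "qpar (cis \<theta>) = qpar (Complex (-1/2) (sqrt 3 / 2))"
    using arc_bounds[of \<theta>] assms by (intro E4_zero_fundamental) auto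
  hence "norm (qpar (cis \<theta>)) = norm (qpar (Complex (-1/2) (sqrt 3 / 2)))" by simp
  hence s: "sin \<theta> = sqrt 3 / 2" by (simp add: norm_qpar)
  have "cos \<theta> ^ 2 = (1 / 2) ^ 2" unfolding cos_squared_eq s by (simp add: power_divide)
  hence "cos \<theta> = - 1 / 2" using arc_bounds[of \<theta>] assms by (auto simp: power2_eq_iff)
  moreover have "cos (2 * pi / 3) < cos \<theta>" by (rule cos_monotone_0_pi) (use assms pi_gt3 in auto)
  ultimately show False by (simp add: cos_2pi3)
qed

lemma E6_nonzero_arc:
  assumes "pi / 2 < \<theta>" "\<theta> \<le> 2 * pi / 3"
  shows "eval_fps E6 (qpar (cis \<theta>)) \<noteq> 0"
proof
  assume "eval_fps E6 (qpar (cis \<theta>)) = 0"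
  hence "qpar (cis \<theta>) = qpar \<i>"
    using arc_bounds[of \<theta>] assms by (intro E6_zero_fundamental) auto
  hence "norm (qpar (cis \<theta>)) = norm (qpar \<i>)" by simp
  hence "sin \<theta> = 1" by (simp add: norm_qpar)
  hence "cos \<theta> = 0" using sin_cos_squared_add[of \<theta>] by simp
  moreover have "cos \<theta> < cos (pi / 2)" by (rule cos_monotone_0_pi) (use assms pi_gt3 in auto)
  ultimately show False by simp
qed

section \<open>Monotonicity of j along the arc\<close>

definition arc_j :: "real \<Rightarrow> real" where
  "arc_j \<theta> = Re (klein_j (cis \<theta>))"

lemma klein_j_arc:
  assumes "pi / 2 \<le> \<theta>" "\<theta> \<le> 2 * pi / 3"
  shows "klein_j (cis \<theta>) = of_real (arc_j \<theta>)"
  using klein_j_real_boundary[of "cis \<theta>"] arc_bounds(3)[OF assms] by (auto simp: arc_j_def complex_eq_iff)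

lemma arc_j_ends: "arc_j (pi / 2) = 1728" "arc_j (2 * pi / 3) = 0"
proof -
  have "klein_j \<i> - 1728 = 0" by (subst klein_j_minus_1728) (auto simp: eval_E6_i)
  thus "arc_j (pi / 2) = 1728" by (simp add: arc_j_def)
  show "arc_j (2 * pi / 3) = 0" unfolding arc_j_def cis_ends klein_j_def eval_E4_rho by simp
qed

lemma has_field_derivative_klein_j_deriv: "Im z > 0 \<Longrightarrow> (klein_j has_field_derivative deriv klein_j z) (at z)"
  using has_field_derivative_klein_j[of z] DERIV_imp_deriv by metis

lemma has_vector_derivative_cis: "(cis has_vector_derivative (\<i> * cis \<theta>)) (at \<theta>)"
proof -
  have d: "(cos has_real_derivative - sin \<theta>) (at \<theta>)" "(sin has_real_derivative cos \<theta>) (at \<theta>)"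
    by (auto intro!: derivative_eq_intros)
  have "((\<lambda>t. of_real (cos t) + \<i> * of_real (sin t)) has_vector_derivative (of_real (- sin \<theta>) + \<i> * of_real (cos \<theta>))) (at \<theta>)"
    by (intro has_vector_derivative_add has_vector_derivative_mult_right has_vector_derivative_of_real d)
  also have "(\<lambda>t. of_real (cos t) + \<i> * of_real (sin t)) = cis" by (auto simp: complex_eq_iff)
  also have "of_real (- sin \<theta>) + \<i> * of_real (cos \<theta>) = \<i> * cis \<theta>" by (simp add: complex_eq_iff)
  finally show ?thesis .
qed

lemma arc_j_deriv:
  assumes "pi / 2 \<le> \<theta>" "\<theta> \<le> 2 * pi / 3"
  shows "(arc_j has_real_derivative Re (deriv klein_j (cis \<theta>) * (\<i> * cis \<theta>))) (at \<theta>)"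
proof -
  have "((klein_j \<circ> cis) has_vector_derivative (\<i> * cis \<theta> * deriv klein_j (cis \<theta>))) (at \<theta>)"
    by (rule field_vector_diff_chain_at[OF has_vector_derivative_cis]) (use has_field_derivative_klein_j_deriv[of "cis \<theta>"] arc_bounds[OF assms] in simp)
  hence "((\<lambda>t. Re ((klein_j \<circ> cis) t)) has_vector_derivative Re (\<i> * cis \<theta> * deriv klein_j (cis \<theta>))) (at \<theta>)"
    by (rule bounded_linear.has_vector_derivative[OF bounded_linear_Re])
  thus ?thesis
    unfolding has_real_derivative_iff_has_vector_derivative arc_j_def[abs_def] by (simp add: o_def mult.commute)
qed

lemma continuous_on_arc_j: "continuous_on {pi/2..2*pi/3} arc_j"
  using arc_j_deriv by (intro DERIV_continuous_on) (auto intro: DERIV_subset)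

text \<open>Since j is real on the arc, its derivative along the arc is real, and as a complex
  number it is nonzero because E4 and E6 are.\<close>

lemma deriv_klein_j_arc_nonzero:
  assumes "pi / 2 < \<theta>" "\<theta> < 2 * pi / 3"
  shows "Re (deriv klein_j (cis \<theta>) * (\<i> * cis \<theta>)) \<noteq> 0"
proof -
  have Im: "Im (cis \<theta>) > 0" using arc_bounds[of \<theta>] assms by simp
  let ?D = "deriv klein_j (cis \<theta>) * (\<i> * cis \<theta>)"
  have "deriv klein_j (cis \<theta>) = - (2 * of_real pi * \<i>) * eval_fps E4 (qpar (cis \<theta>)) ^ 2 * eval_fps E6 (qpar (cis \<theta>)) / eval_fps Delta (qpar (cis \<theta>))"
    by (rule DERIV_imp_deriv[OF has_field_derivative_klein_j[OF Im]])
  hence nz: "?D \<noteq> 0"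
    using E4_nonzero_arc[of \<theta>] E6_nonzero_arc[of \<theta>] eval_Delta_nonzero[OF Im] assms by simp
  have v: "((klein_j \<circ> cis) has_vector_derivative (\<i> * cis \<theta> * deriv klein_j (cis \<theta>))) (at \<theta>)"
    by (rule field_vector_diff_chain_at[OF has_vector_derivative_cis]) (use has_field_derivative_klein_j_deriv[OF Im] in simp)
  hence "((\<lambda>t. Im ((klein_j \<circ> cis) t)) has_vector_derivative Im (\<i> * cis \<theta> * deriv klein_j (cis \<theta>))) (at \<theta>)"
    by (rule bounded_linear.has_vector_derivative[OF bounded_linear_Im])
  moreover have "((\<lambda>t. Im ((klein_j \<circ> cis) t)) has_vector_derivative 0) (at \<theta>)"
  proof (rule has_vector_derivative_transform_within_open[where S = "{pi/2<..<2*pi/3}"])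
    show "((\<lambda>t. 0 :: real) has_vector_derivative 0) (at \<theta>)" by simp
    show "0 = Im ((klein_j \<circ> cis) t)" if "t \<in> {pi/2<..<2*pi/3}" for t
      using klein_j_arc[of t] that by simp
  qed (use assms in auto)
  ultimately have "Im (\<i> * cis \<theta> * deriv klein_j (cis \<theta>)) = 0" by (rule vector_derivative_unique_at)
  hence "Im ?D = 0" by (simp add: mult.commute)
  with nz show ?thesis by (simp add: complex_eq_iff)
qed

lemma arc_j_neq:
  assumes "pi / 2 \<le> s" "s < t" "t \<le> 2 * pi / 3"
  shows "arc_j s \<noteq> arc_j t"
proof
  assume "arc_j s = arc_j t"
  moreover have "continuous_on {s..t} arc_j"
    by (rule continuous_on_subset[OF continuous_on_arc_j]) (use assms in auto)
  moreover have "arc_j differentiable (at x)" if "s < x" "x < t" for x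
    using arc_j_deriv[of x] that assms by (auto simp: real_differentiable_def)
  ultimately obtain z where z: "s < z" "z < t" "(arc_j has_real_derivative 0) (at z)"
    using Rolle[of s t arc_j] assms by auto
  hence "Re (deriv klein_j (cis z) * (\<i> * cis z)) = 0"
    using arc_j_deriv[of z] assms by (intro DERIV_unique[of arc_j]) auto
  thus False using deriv_klein_j_arc_nonzero[of z] z assms by simp
qed

lemma arc_j_inj:
  assumes "pi / 2 \<le> s" "s \<le> 2 * pi / 3" "pi / 2 \<le> t" "t \<le> 2 * pi / 3" "arc_j s = arc_j t"
  shows "s = t"
  using arc_j_neq[of s t] arc_j_neq[of t s] assms by force

text \<open>Leaving the open interval inside the arc would repeat an endpoint value, by continuity,
  against \<open>arc_j_neq\<close>.\<close>

lemma arc_j_strict_range: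
  assumes "pi / 2 < \<theta>" "\<theta> < 2 * pi / 3"
  shows "0 < arc_j \<theta>" "arc_j \<theta> < 1728"
proof -
  have ne: "arc_j \<theta> \<noteq> 0" "arc_j \<theta> \<noteq> 1728"
    using arc_j_neq[of \<theta> "2*pi/3"] arc_j_neq[of "pi/2" \<theta>] assms by (auto simp: arc_j_ends)
  have "\<not> arc_j \<theta> < 0"
  proof
    assume "arc_j \<theta> < 0"
    then obtain t where "pi/2 \<le> t" "t \<le> \<theta>" "arc_j t = 0"
      using IVT2'[of arc_j \<theta> 0 "pi/2"] continuous_on_subset[OF continuous_on_arc_j, of "{pi/2..\<theta>}"] assms
      by (auto simp: arc_j_ends)
    thus False using arc_j_neq[of t "2*pi/3"] assms by (auto simp: arc_j_ends)
  qed
  moreover have "\<not> arc_j \<theta> > 1728"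
  proof
    assume "arc_j \<theta> > 1728"
    then obtain t where "\<theta> \<le> t" "t \<le> 2*pi/3" "arc_j t = 1728"
      using IVT2'[of arc_j "2*pi/3" 1728 \<theta>] continuous_on_subset[OF continuous_on_arc_j, of "{\<theta>..2*pi/3}"] assms
      by (auto simp: arc_j_ends)
    thus False using arc_j_neq[of "pi/2" t] assms by (auto simp: arc_j_ends)
  qed
  ultimately show "0 < arc_j \<theta>" "arc_j \<theta> < 1728" using ne by linarith+
qed

lemma arc_j_range:
  assumes "pi / 2 \<le> \<theta>" "\<theta> \<le> 2 * pi / 3"
  shows "0 \<le> arc_j \<theta>" "arc_j \<theta> \<le> 1728"
  using arc_j_strict_range[of \<theta>] assms arc_j_ends by (cases "\<theta> = pi/2"; cases "\<theta> = 2*pi/3"; force)+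

text \<open>The maximal value 1728 is taken at \<pi>/2; an increase later on would let a value be
  taken twice.\<close>

lemma arc_j_strict_antimono:
  assumes "pi / 2 \<le> s" "s < t" "t \<le> 2 * pi / 3"
  shows "arc_j t < arc_j s"
proof (rule ccontr)
  assume "\<not> ?thesis"
  hence lt: "arc_j s < arc_j t" using arc_j_neq[OF assms] by simp
  hence s: "s > pi/2" using assms arc_j_range[of t] arc_j_ends(1) by (cases "s = pi/2") auto
  have "arc_j t \<le> arc_j (pi/2)" using arc_j_range[of t] assms arc_j_ends by simp
  then obtain u where "pi/2 \<le> u" "u \<le> s" "arc_j u = arc_j t"
    using IVT2'[of arc_j s "arc_j t" "pi/2"] continuous_on_subset[OF continuous_on_arc_j, of "{pi/2..s}"] assms lt by auto
  thus False using arc_j_neq[of u t] assms by auto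
qed

text \<open>After reduction to the fundamental domain the value of j forces the point onto the
  circle, and injectivity along the arc identifies it up to w \<mapsto> - cnj w, which on the circle
  is the inversion -1/w. The matrix obtained is then inverted.\<close>

lemma klein_j_orbit_arc:
  assumes \<tau>: "Im \<tau> > 0" and \<theta>: "pi / 2 < \<theta>" "\<theta> < 2 * pi / 3" and eq: "klein_j \<tau> = klein_j (cis \<theta>)"
  obtains a b c d :: int where "a * d - b * c = 1"
    "\<tau> = (of_int a * cis \<theta> + of_int b) / (of_int c * cis \<theta> + of_int d)"
proof -
  let ?z = "cis \<theta>"
  have jz: "klein_j ?z = of_real (arc_j \<theta>)" "0 \<le> arc_j \<theta>" "arc_j \<theta> \<le> 1728"
    using \<theta> arc_j_strict_range[OF \<theta>] by (auto intro: klein_j_arc)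
  have uniq: "w = ?z" if w: "norm w = 1" "-1/2 \<le> Re w" "Re w \<le> 0" "Im w > 0" "klein_j w = klein_j ?z" for w
  proof -
    obtain t where t: "pi / 2 \<le> t" "t \<le> 2 * pi / 3" "w = cis t" using unit_circle_arc[OF w(1-4)] by metis
    have "arc_j t = arc_j \<theta>" using w(5) t by (simp add: arc_j_def)
    hence "t = \<theta>" using t \<theta> arc_j_inj[of t \<theta>] by simp
    thus ?thesis using t by simp
  qed
  obtain a b c d :: int where *: "a * d - b * c = 1"
    "\<bar>Re ((of_int a * \<tau> + of_int b) / (of_int c * \<tau> + of_int d))\<bar> \<le> 1/2"
    "norm ((of_int a * \<tau> + of_int b) / (of_int c * \<tau> + of_int d)) \<ge> 1"
    using moebius_to_fundamental_domain[OF \<tau>] by metis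
  define w where "w = (of_int a * \<tau> + of_int b) / (of_int c * \<tau> + of_int d)"
  have w: "Im w > 0" "klein_j w = klein_j ?z"
    unfolding w_def using Im_moebius_pos[OF *(1) \<tau>] klein_j_invariant[OF *(1) \<tau>] eq by auto
  have n1: "norm w = 1"
    by (rule klein_j_in_interval_imp_arc[of w "arc_j \<theta>"]) (use * w jz in \<open>auto simp: w_def\<close>)
  have "\<exists>a b c d :: int. a * d - b * c = 1 \<and> ?z = (of_int a * \<tau> + of_int b) / (of_int c * \<tau> + of_int d)"
  proof (cases "Re w \<le> 0")
    case True
    hence "w = ?z" using n1 w *(2) by (intro uniq) (auto simp: w_def)
    thus ?thesis using *(1) by (intro exI[of _ a] exI[of _ b] exI[of _ c] exI[of _ d]) (simp add: w_def)
  next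
    case False
    have "- cnj w = ?z"
    proof (rule uniq)
      show "klein_j (- cnj w) = klein_j ?z" using klein_j_cnj[OF w(1)] w(2) jz(1) by simp
    qed (use n1 w *(2) False in \<open>auto simp: w_def[symmetric]\<close>)
    hence "?z = - 1 / w" using inverse_unit_circle[OF n1] by simp
    also have "\<dots> = (of_int (- c) * \<tau> + of_int (- d)) / (of_int a * \<tau> + of_int b)" by (simp add: w_def)
    finally have "?z = (of_int (- c) * \<tau> + of_int (- d)) / (of_int a * \<tau> + of_int b)" .
    moreover have "(- c) * b - (- d) * a = 1" using *(1) by (simp add: algebra_simps)
    ultimately show ?thesis by blast
  qed
  then obtain a b c d :: int where det: "a * d - b * c = 1" and z: "?z = (of_int a * \<tau> + of_int b) / (of_int c * \<tau> + of_int d)"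
    by blast
  have nz: "of_int c * \<tau> + of_int d \<noteq> 0" by (rule moebius_denom_nonzero[OF det \<tau>])
  have det': "(of_int a * of_int d - of_int b * of_int c :: complex) = 1"
    using det by (metis of_int_1 of_int_diff of_int_mult)
  have z': "?z * (of_int c * \<tau> + of_int d) = of_int a * \<tau> + of_int b" using z nz by (simp add: field_simps)
  have det2: "d * a - (- b) * (- c) = 1" using det by (simp add: algebra_simps)
  have Imz: "Im ?z > 0" using arc_bounds[of \<theta>] \<theta> by simp
  have nz2: "of_int (- c) * ?z + of_int a \<noteq> 0" by (rule moebius_denom_nonzero[OF det2 Imz])
  have "\<tau> * (of_int (- c) * ?z + of_int a) = of_int d * ?z + of_int (- b)"
    using z' by (simp add: algebra_simps)
  hence "\<tau> = (of_int d * ?z + of_int (- b)) / (of_int (- c) * ?z + of_int a)"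
    using nz2 by (simp add: field_simps)
  thus ?thesis using that[OF det2] by blast
qed

text \<open>Im \<tau> = sin \<theta> / |c z + d|^2 forces |c z + d|^2 < 2, and -1 < 2 cos \<theta> <
  0 leaves only (0, 1), (1, 0) and (1, 1) for (c, d), up to sign. The height 1/2 is that of the
  lower of the two contours.\<close>

lemma qpar_orbit_cases:
  assumes \<theta>: "pi / 2 < \<theta>" "\<theta> < 2 * pi / 3" and det: "a * d - b * c = 1"
    and \<tau>: "\<tau> = (of_int a * cis \<theta> + of_int b) / (of_int c * cis \<theta> + of_int d)" "Im \<tau> \<ge> 1/2"
  shows "qpar \<tau> \<in> {qpar (cis \<theta>), qpar (- 1 / cis \<theta>), qpar (- 1 / (cis \<theta> + 1))}"
proof -
  let ?z = "cis \<theta>"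
  have b: "-1/2 < cos \<theta>" "cos \<theta> < 0" "sin \<theta> > 0"
  proof -
    show "sin \<theta> > 0" using arc_bounds[of \<theta>] \<theta> by simp
    have "cos (2 * pi / 3) < cos \<theta>" by (rule cos_monotone_0_pi) (use \<theta> pi_gt3 in auto)
    thus "-1/2 < cos \<theta>" by (simp add: cos_2pi3)
    have "cos \<theta> < cos (pi / 2)" by (rule cos_monotone_0_pi) (use \<theta> pi_gt3 in auto)
    thus "cos \<theta> < 0" by simp
  qed
  have Imz: "Im ?z > 0" using b by simp
  have nz: "of_int c * ?z + of_int d \<noteq> 0" by (rule moebius_denom_nonzero[OF det Imz])
  define N where "N = norm (of_int c * ?z + of_int d) ^ 2"
  have "N > 0" using nz by (simp add: N_def)
  have "Im \<tau> = sin \<theta> / N" using Im_moebius[OF det Imz] \<tau> by (simp add: N_def)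
  hence "sin \<theta> / N \<ge> 1/2" using \<tau> by simp
  hence "N \<le> 2 * sin \<theta>" using \<open>N > 0\<close> by (simp add: field_simps)
  moreover have "sin \<theta> < 1"
  proof -
    have "cos \<theta> ^ 2 > 0" using b by simp
    hence "sin \<theta> ^ 2 < 1" using sin_cos_squared_add[of \<theta>] by linarith
    thus ?thesis using power2_less_imp_less[of "sin \<theta>" 1] by simp
  qed
  ultimately have "N < 2" by simp
  have N: "N = of_int (c ^ 2 + d ^ 2) + 2 * cos \<theta> * of_int (c * d)"
  proof -
    have "N = (of_int c * cos \<theta> + of_int d) ^ 2 + (of_int c * sin \<theta>) ^ 2" by (simp add: N_def cmod_power2)
    also have "\<dots> = of_int c ^ 2 * (sin \<theta> ^ 2 + cos \<theta> ^ 2) + of_int d ^ 2 + 2 * cos \<theta> * (of_int c * of_int d)"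
    proof -
      have "(c * x + d) ^ 2 + (c * y) ^ 2 = c ^ 2 * (y ^ 2 + x ^ 2) + d ^ 2 + 2 * x * (c * d)" for c d x y :: real
        by (simp add: algebra_simps power2_eq_square)
      thus ?thesis .
    qed
    finally show ?thesis by simp
  qed
  have cases: "c = 0 \<and> \<bar>d\<bar> = 1 \<or> d = 0 \<and> \<bar>c\<bar> = 1 \<or> c = d \<and> \<bar>c\<bar> = 1"
  proof -
    consider "c * d < 0" | "c * d = 0" | "c * d > 0" by linarith
    thus ?thesis
    proof cases
      case 1
      hence "real_of_int (c * d) < 0" by (simp only: of_int_less_0_iff)
      hence "2 * cos \<theta> * of_int (c * d) > 0" using b by (intro mult_neg_neg) auto
      hence "real_of_int (c ^ 2 + d ^ 2) < 2" using N \<open>N < 2\<close> by linarith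
      hence "c ^ 2 + d ^ 2 < 2" by linarith
      moreover have "c ^ 2 \<ge> 1" "d ^ 2 \<ge> 1" using 1 by (auto simp: int_one_le_iff_zero_less)
      ultimately show ?thesis by linarith
    next
      case 2
      have "N = of_int (c ^ 2 + d ^ 2)" unfolding N 2 by simp
      hence "real_of_int (c ^ 2 + d ^ 2) < 2" using \<open>N < 2\<close> by linarith
      hence lt: "c ^ 2 + d ^ 2 < 2" by linarith
      have ne: "c \<noteq> 0 \<or> d \<noteq> 0" using det by auto
      have one: "\<bar>x\<bar> = 1" if "x ^ 2 < 2" "x \<noteq> 0" for x :: int
      proof (rule ccontr)
        assume "\<bar>x\<bar> \<noteq> 1"
        hence "\<bar>x\<bar> \<ge> 2" using that(2) by linarith
        hence "\<bar>x\<bar> ^ 2 \<ge> 2 ^ 2" by (intro power_mono) auto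
        thus False using that by simp
      qed
      show ?thesis using 2 lt ne one[of c] one[of d] by auto
    next
      case 3
      hence "0 \<le> real_of_int (c * d)" by (simp only: of_int_0_le_iff)
      \<comment> \<open>This yields c^2 + d^2 - c d = (c - d)^2 + c d < 2, with c d \<ge> 1.\<close>
      hence "2 * cos \<theta> * of_int (c * d) \<ge> (-1) * of_int (c * d)"
        using b by (intro mult_right_mono) auto
      hence "real_of_int (c ^ 2 + d ^ 2 - c * d) < 2" using N \<open>N < 2\<close> by simp
      hence "c ^ 2 + d ^ 2 - c * d < 2" by linarith
      hence lt: "(c - d) ^ 2 + c * d < 2" by (simp add: power2_eq_square algebra_simps)
      hence "(c - d) ^ 2 < 1" using 3 by linarith
      hence "(c - d) ^ 2 = 0" using zero_le_power2[of "c - d"] by linarith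
      hence cd: "c = d" by simp
      hence "c * c < 2" "c * c > 0" using lt 3 by auto
      hence "c * c = 1" by linarith
      thus ?thesis using cd by (auto simp: zmult_eq_1_iff)
    qed
  qed
  have nz1: "?z \<noteq> 0" "?z + 1 \<noteq> 0" using Imz by (auto simp: complex_eq_iff)
  have shift: "qpar \<tau> = qpar w" if "\<tau> = w + of_int n" for w n using that by simp
  from cases show ?thesis
  proof (elim disjE conjE)
    assume c: "c = 0" "\<bar>d\<bar> = 1"
    have "\<tau> = ?z + of_int (b * d)"
      using c det \<tau>(1) by (cases "d = 1") (auto simp: abs_if split: if_splits)
    thus ?thesis using shift by blast
  next
    assume c: "d = 0" "\<bar>c\<bar> = 1"
    have "\<tau> = - 1 / ?z + of_int (a * c)"
      using c det \<tau>(1) nz1 by (cases "c = 1") (auto simp: abs_if field_simps split: if_splits)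
    thus ?thesis using shift by blast
  next
    assume c: "c = d" "\<bar>c\<bar> = 1"
    have "\<tau> = - 1 / (?z + 1) + of_int (a * c)"
    proof (cases "c = 1")
      case True
      hence "b = a - 1" using det c by simp
      hence "of_int b = (of_int a - 1 :: complex)" by simp
      thus ?thesis using \<tau>(1) nz1 True c by (simp add: field_simps)
    next
      case False
      hence c1: "c = -1" using c by (auto simp: abs_if split: if_splits)
      hence "b = a + 1" using det c by simp
      hence num: "of_int a * ?z + of_int b = of_int a * (?z + 1) + 1" by (simp add: algebra_simps)
      have den: "of_int c * ?z + of_int d = - (?z + 1)" using c1 c by simp
      have "\<tau> = - ((of_int a * (?z + 1) + 1) / (?z + 1))" unfolding \<tau>(1) num den by (rule minus_divide_right [symmetric])
      also have "\<dots> = - 1 / (?z + 1) - of_int a" using nz1(2) by (simp add: add_divide_distrib)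
      finally show ?thesis using c1 by simp
    qed
    thus ?thesis using shift by blast
  qed
qed

subsection \<open>Coefficient formula for the Faber-type polynomial\<close>

text \<open>Delta / q, a unit of the ring of power series.\<close>

definition delta :: "complex fps" where "delta = fps_shift 1 Delta"

lemma Delta_eq: "Delta = fps_X * delta"
  by (rule fps_ext) (simp add: delta_def)

lemma delta_nth_0 [simp]: "fps_nth delta 0 = 1"
  by (simp add: delta_def Delta_nth_1)

text \<open>This is Delta (j - x), free of the pole at the cusp: its zeros in the punctured disc are
  the points with j = x.\<close>

definition jpoly :: "complex \<Rightarrow> complex fps" where
  "jpoly x = E4 ^ 3 - fps_const x * Delta"

lemma jpoly_nth_0 [simp]: "fps_nth (jpoly x) 0 = 1"
  by (simp add: jpoly_def)

text \<open>By Lagrange inversion this is the value at \<open>x\<close> of the polynomial \<open>P\<close> such that the form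
  \<open>q + O(q^(l+1))\<close> of weight \<open>12 l + 4 a + 6 b\<close> equals \<open>\<Delta>^l E4^a E6^b P(j)\<close>.\<close>

definition faber_coeff :: "nat \<Rightarrow> nat \<Rightarrow> nat \<Rightarrow> complex \<Rightarrow> complex" where
  "faber_coeff l a b x = fps_nth (E4 ^ (2 - a) * E6 ^ (1 - b) * inverse (delta ^ l * jpoly x)) (l - 1)"

text \<open>For N = q j the quotient is - q j^i (q dj/dq) / (q (j - x)) times q^i, so the
  coefficient is minus the residue of j^i dj / (j - x) at the cusp. The induction splits one factor
  N into N - x q, which cancels the denominator, and x q, which lowers the exponent.\<close>

lemma lagrange_coeff:
  fixes N :: "complex fps"
  assumes N0: "fps_nth N 0 = 1"
  shows "fps_nth (N ^ i * (N - qderiv N) * inverse (N - fps_const x * fps_X)) i = x ^ i"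
proof (induction i)
  case 0
  show ?case by (simp add: N0 qderiv_nth)
next
  case (Suc i)
  define M where "M = N - fps_const x * fps_X"
  have M: "M * inverse M = 1" by (rule inverse_mult_eq_1') (simp add: M_def N0)
  have "fps_nth (N ^ Suc i * (N - qderiv N) * inverse M) (Suc i) =
        fps_nth (N ^ i * (N - qderiv N) * (M + fps_const x * fps_X) * inverse M) (Suc i)"
    by (simp add: M_def mult_ac)
  also have "N ^ i * (N - qderiv N) * (M + fps_const x * fps_X) * inverse M =
     N ^ i * (N - qderiv N) * (M * inverse M) + fps_const x * (fps_X * (N ^ i * (N - qderiv N) * inverse M))"
    by (simp add: algebra_simps)
  also have "\<dots> = N ^ i * (N - qderiv N) + fps_const x * (fps_X * (N ^ i * (N - qderiv N) * inverse M))"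
    unfolding M by simp
  also have "fps_nth \<dots> (Suc i) = fps_nth (N ^ i * (N - qderiv N)) (Suc i) + x * fps_nth (N ^ i * (N - qderiv N) * inverse M) i"
    by simp
  \<comment> \<open>Multiplied by i + 1 the series is (i + 1) N^(i + 1) - q d/dq N^(i + 1), whose
    coefficient at i + 1 is 0.\<close>
  also have "fps_nth (N ^ i * (N - qderiv N)) (Suc i) = 0"
  proof -
    have "of_nat (Suc i) * (N ^ i * (N - qderiv N)) = of_nat (Suc i) * N ^ Suc i - qderiv (N ^ Suc i)"
      unfolding qderiv_power by (simp add: algebra_simps del: of_nat_Suc)
    hence "fps_nth (fps_const (of_nat (Suc i)) * (N ^ i * (N - qderiv N))) (Suc i) =
           fps_nth (fps_const (of_nat (Suc i)) * N ^ Suc i - qderiv (N ^ Suc i)) (Suc i)"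
      by (simp only: fps_of_nat)
    also have "\<dots> = 0" by (simp only: fps_sub_nth qderiv_nth fps_mult_left_const_nth) simp
    finally have "of_nat (Suc i) * fps_nth (N ^ i * (N - qderiv N)) (Suc i) = (0 :: complex)"
      by (simp only: fps_mult_left_const_nth)
    thus ?thesis by (simp only: mult_eq_0_iff of_nat_eq_0_iff) simp
  qed
  also have "x * fps_nth (N ^ i * (N - qderiv N) * inverse M) i = x ^ Suc i"
    using Suc.IH by (simp add: M_def)
  finally show ?case by (simp add: M_def)
qed

text \<open>Here N is q j. The second identity is - q dj/dq = E4^2 E6 / Delta with all poles
  cleared.\<close>

lemma E4_E6_via_delta:
  defines "N \<equiv> E4 ^ 3 * inverse delta"
  shows "E4 ^ 3 = N * delta" "E4 ^ 2 * E6 = delta * (N - qderiv N)" "jpoly x = delta * (N - fps_const x * fps_X)"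
proof -
  have d: "inverse delta * delta = 1" by (rule inverse_mult_eq_1) simp
  show N: "E4 ^ 3 = N * delta" unfolding N_def mult.assoc d by simp
  show "jpoly x = delta * (N - fps_const x * fps_X)"
    unfolding jpoly_def N Delta_eq by (simp add: algebra_simps)
  have nz: "delta \<noteq> 0" by (metis delta_nth_0 fps_zero_nth zero_neq_one)
  have "qderiv Delta = fps_X * (delta + qderiv delta)"
    unfolding Delta_eq by (simp add: qderiv_def algebra_simps)
  with qderiv_Delta(1) have "fps_X * (E4 * (delta + qderiv delta)) = fps_X * ((3 * qderiv E4 + E6) * delta)"
    unfolding Delta_eq by (simp add: mult_ac)
  hence "E4 * (delta + qderiv delta) = (3 * qderiv E4 + E6) * delta" by simp
  hence "E4 ^ 2 * (E4 * (delta + qderiv delta)) = E4 ^ 2 * ((3 * qderiv E4 + E6) * delta)" by simp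
  hence "E4 ^ 3 * (delta + qderiv delta) = (3 * E4 ^ 2 * qderiv E4 + E4 ^ 2 * E6) * delta"
    by (simp add: algebra_simps power2_eq_square power3_eq_cube)
  also have "3 * E4 ^ 2 * qderiv E4 = qderiv (E4 ^ 3)" by (simp add: qderiv_power)
  finally have "(N * delta) * (delta + qderiv delta) = (N * qderiv delta + qderiv N * delta + E4 ^ 2 * E6) * delta"
    unfolding N qderiv_mult .
  hence "(E4 ^ 2 * E6) * delta = (delta * (N - qderiv N)) * delta" by (simp add: algebra_simps)
  thus "E4 ^ 2 * E6 = delta * (N - qderiv N)" using nz by simp
qed

text \<open>The series \<open>V\<close> completes E4^a E6^b to E4^2 E6, the numerator of the
  derivative of j. Thus the coefficient at l of basis element i times \<open>V\<close> is x^i by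
  \<open>lagrange_coeff\<close>, while F = q + O(q^(l + 1)) lets only the coefficient l - 1 of
  \<open>V\<close> through.\<close>

lemma faber_coeff_eq:
  assumes l: "l \<ge> 1" and ab: "a \<le> 2" "b \<le> 1"
    and F: "F = (\<Sum>i<l. fps_const (c i) * (Delta ^ (l - i) * E4 ^ (3 * i + a) * E6 ^ b))"
    and F0: "fps_nth F 0 = 0" "fps_nth F 1 = 1" "\<And>n. 2 \<le> n \<Longrightarrow> n \<le> l \<Longrightarrow> fps_nth F n = 0"
  shows "(\<Sum>i<l. c i * x ^ i) = faber_coeff l a b x"
proof -
  define N where "N = E4 ^ 3 * inverse delta"
  note NE = E4_E6_via_delta[folded N_def]
  have N0: "fps_nth N 0 = 1" by (simp add: N_def)
  have dd: "delta * inverse delta = 1" by (rule inverse_mult_eq_1') simp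
  define V where "V = E4 ^ (2 - a) * E6 ^ (1 - b) * inverse (delta ^ l * jpoly x)"
  have inv: "inverse (delta ^ l * jpoly x) = inverse delta ^ l * (inverse delta * inverse (N - fps_const x * fps_X))"
    unfolding NE(3) by (simp add: fps_inverse_mult fps_inverse_power)
  have summand: "fps_nth (Delta ^ (l - i) * E4 ^ (3 * i + a) * E6 ^ b * V) l = x ^ i" if i: "i < l" for i
  proof -
    have "E4 ^ (3 * i + a) * E4 ^ (2 - a) = (E4 ^ 3) ^ i * E4 ^ 2"
      using ab by (simp flip: power_add power_mult)
    moreover have "E6 ^ b * E6 ^ (1 - b) = E6" using ab by (simp flip: power_add)
    moreover have "Delta ^ (l - i) * E4 ^ (3 * i + a) * E6 ^ b * V =
       Delta ^ (l - i) * ((E4 ^ (3 * i + a) * E4 ^ (2 - a)) * (E6 ^ b * E6 ^ (1 - b))) * inverse (delta ^ l * jpoly x)"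
      unfolding V_def by (simp add: mult_ac)
    ultimately have "Delta ^ (l - i) * E4 ^ (3 * i + a) * E6 ^ b * V =
        Delta ^ (l - i) * ((E4 ^ 3) ^ i * (E4 ^ 2 * E6)) * inverse (delta ^ l * jpoly x)"
      by (simp add: mult_ac)
    also have "\<dots> = fps_X ^ (l - i) * (delta ^ (l - i) * delta ^ i * inverse delta ^ l) * (delta * inverse delta) *
         (N ^ i * (N - qderiv N) * inverse (N - fps_const x * fps_X))"
      unfolding NE(1,2) inv Delta_eq power_mult_distrib by (simp add: mult_ac)
    also have "delta ^ (l - i) * delta ^ i * inverse delta ^ l = (delta * inverse delta) ^ l"
      using i by (simp add: power_mult_distrib flip: power_add)
    finally have "Delta ^ (l - i) * E4 ^ (3 * i + a) * E6 ^ b * V =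
       fps_X ^ (l - i) * (N ^ i * (N - qderiv N) * inverse (N - fps_const x * fps_X))"
      unfolding dd by simp
    thus ?thesis using i lagrange_coeff[OF N0, of i x] by (simp add: fps_X_power_mult_nth)
  qed
  have "fps_nth (F * V) l = (\<Sum>i<l. c i * fps_nth (Delta ^ (l - i) * E4 ^ (3 * i + a) * E6 ^ b * V) l)"
    unfolding F sum_distrib_right fps_sum_nth by (intro sum.cong) (auto simp: mult.assoc)
  also have "\<dots> = (\<Sum>i<l. c i * x ^ i)" by (intro sum.cong) (auto simp: summand)
  finally have "(\<Sum>i<l. c i * x ^ i) = fps_nth (F * V) l" by simp
  also have "\<dots> = (\<Sum>i=0..l. if i = 1 then fps_nth V (l - 1) else 0)"
    unfolding fps_mult_nth
  proof (intro sum.cong refl)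
    fix i assume "i \<in> {0..l}"
    thus "fps_nth F i * fps_nth V (l - i) = (if i = 1 then fps_nth V (l - 1) else 0)"
      using F0(1,2) F0(3)[of i] by (cases "i = 0"; cases "i = 1") auto
  qed
  also have "\<dots> = fps_nth V (l - 1)" using l by simp
  finally show ?thesis by (simp add: faber_coeff_def V_def)
qed

subsection \<open>Integer power series as lists\<close>

fun lfps :: "int list \<Rightarrow> complex fps" where
  "lfps [] = 0"
| "lfps (x # xs) = fps_const (of_int x) + fps_X * lfps xs"

fun ladd :: "int list \<Rightarrow> int list \<Rightarrow> int list" where
  "ladd [] ys = ys"
| "ladd xs [] = xs"
| "ladd (x # xs) (y # ys) = (x + y) # ladd xs ys"

fun lsmul :: "int \<Rightarrow> int list \<Rightarrow> int list" where
  "lsmul c [] = []"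
| "lsmul c (x # xs) = c * x # lsmul c xs"

fun lmul :: "nat \<Rightarrow> int list \<Rightarrow> int list \<Rightarrow> int list" where
  "lmul 0 xs ys = []"
| "lmul (Suc n) [] ys = []"
| "lmul (Suc n) (x # xs) ys = ladd (lsmul x (take (Suc n) ys)) (0 # lmul n xs ys)"

fun lpow :: "nat \<Rightarrow> int list \<Rightarrow> nat \<Rightarrow> int list" where
  "lpow n xs 0 = [1]"
| "lpow n xs (Suc m) = lmul n xs (lpow n xs m)"

text \<open>Long division by \<open>1 # ds\<close>. The leading 1 of the divisor is left implicit,
  and because of it the quotient is integral.\<close>

fun ldiv :: "nat \<Rightarrow> int list \<Rightarrow> int list \<Rightarrow> int list" where
  "ldiv 0 xs ds = []"
| "ldiv (Suc n) [] ds = []"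
| "ldiv (Suc n) (x # xs) ds = x # ldiv n (ladd xs (lsmul (- x) (take n ds))) ds"

text \<open>Congruence modulo the n-th power of the variable.\<close>

definition fps_cong :: "nat \<Rightarrow> complex fps \<Rightarrow> complex fps \<Rightarrow> bool" where
  "fps_cong n F G \<longleftrightarrow> (\<forall>i<n. fps_nth F i = fps_nth G i)"

lemma fps_cong_refl [simp]: "fps_cong n F F" by (simp add: fps_cong_def)

lemma fps_cong_trans [trans]: "fps_cong n F G \<Longrightarrow> fps_cong n G H \<Longrightarrow> fps_cong n F H" by (simp add: fps_cong_def)

lemma fps_cong_sym: "fps_cong n F G \<Longrightarrow> fps_cong n G F" by (simp add: fps_cong_def)

lemma fps_cong_add: "fps_cong n F G \<Longrightarrow> fps_cong n F' G' \<Longrightarrow> fps_cong n (F + F') (G + G')" by (simp add: fps_cong_def)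

lemma fps_cong_diff: "fps_cong n F G \<Longrightarrow> fps_cong n F' G' \<Longrightarrow> fps_cong n (F - F') (G - G')" by (simp add: fps_cong_def)

lemma fps_cong_mult: "fps_cong n F G \<Longrightarrow> fps_cong n F' G' \<Longrightarrow> fps_cong n (F * F') (G * G')"
  unfolding fps_cong_def fps_mult_nth by (intro allI impI sum.cong) auto

lemma fps_cong_power: "fps_cong n F G \<Longrightarrow> fps_cong n (F ^ m) (G ^ m)"
  by (induction m) (auto intro: fps_cong_mult)

lemma fps_cong_X: "fps_cong n F G \<Longrightarrow> fps_cong (Suc n) (fps_X * F) (fps_X * G)"
  unfolding fps_cong_def by auto

lemma fps_cong_Suc: "fps_cong (Suc n) (fps_const x + fps_X * F) (fps_const x + fps_X * G) \<longleftrightarrow> fps_cong n F G"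
  unfolding fps_cong_def
  by (auto simp: less_Suc_eq_0_disj)

lemma lfps_add: "lfps (ladd xs ys) = lfps xs + lfps ys"
  by (induction xs ys rule: ladd.induct) (auto simp: algebra_simps simp flip: fps_const_add)

lemma lfps_smul: "lfps (lsmul c xs) = fps_const (of_int c) * lfps xs"
  by (induction xs) (auto simp: algebra_simps)

lemma lfps_take: "fps_cong n (lfps (take n xs)) (lfps xs)"
proof (induction n arbitrary: xs)
  case (Suc n)
  thus ?case by (cases xs) (auto simp: fps_cong_Suc)
qed (simp add: fps_cong_def)

lemma lfps_mul: "fps_cong n (lfps (lmul n xs ys)) (lfps xs * lfps ys)"
proof (induction n xs ys rule: lmul.induct)
  case (3 n x xs ys)
  have "fps_cong (Suc n) (fps_const (of_int x) * lfps (take (Suc n) ys) + fps_X * lfps (lmul n xs ys))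
     (fps_const (of_int x) * lfps ys + fps_X * (lfps xs * lfps ys))"
    by (intro fps_cong_add fps_cong_mult fps_cong_X 3 lfps_take fps_cong_refl)
  thus ?case by (simp add: lfps_add lfps_smul algebra_simps)
qed (auto simp: fps_cong_def)

lemma lfps_pow: "fps_cong n (lfps (lpow n xs m)) (lfps xs ^ m)"
proof (induction m)
  case (Suc m)
  show ?case using fps_cong_trans[OF lfps_mul fps_cong_mult[OF fps_cong_refl Suc.IH]] by simp
qed simp

lemma lfps_div: "fps_cong n (lfps (1 # ds) * lfps (ldiv n xs ds)) (lfps xs)"
proof (induction n xs ds rule: ldiv.induct)
  case (3 n x xs ds)
  define Q where "Q = lfps (ldiv n (ladd xs (lsmul (- x) (take n ds))) ds)"
  have "fps_cong n (lfps (1 # ds) * Q) (lfps xs - fps_const (of_int x) * lfps (take n ds))"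
    using 3 by (simp add: Q_def lfps_add lfps_smul flip: fps_const_neg)
  hence "fps_cong n (fps_const (of_int x) * lfps ds + lfps (1 # ds) * Q)
     (fps_const (of_int x) * lfps ds + (lfps xs - fps_const (of_int x) * lfps (take n ds)))"
    by (intro fps_cong_add fps_cong_refl)
  also have "fps_cong n (fps_const (of_int x) * lfps ds + (lfps xs - fps_const (of_int x) * lfps (take n ds)))
     (fps_const (of_int x) * lfps ds + (lfps xs - fps_const (of_int x) * lfps ds))"
    by (intro fps_cong_add fps_cong_diff fps_cong_mult lfps_take fps_cong_refl)
  finally have "fps_cong (Suc n) (fps_const (of_int x) + fps_X * (fps_const (of_int x) * lfps ds + lfps (1 # ds) * Q))
     (fps_const (of_int x) + fps_X * lfps xs)"
    by (simp add: fps_cong_Suc)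
  thus ?case by (simp add: Q_def algebra_simps)
qed (auto simp: fps_cong_def)

lemma lfps_nth: "i < length xs \<Longrightarrow> fps_nth (lfps xs) i = of_int (xs ! i)"
proof (induction xs arbitrary: i)
  case (Cons x xs)
  thus ?case by (cases i) auto
qed simp

lemma fps_cong_inverse_mult:
  assumes "fps_cong n (D * Q) G" "fps_nth D 0 = 1"
  shows "fps_cong n (G * inverse D) Q"
proof -
  have "D * inverse D = 1" by (rule inverse_mult_eq_1') (simp add: assms)
  moreover have "D * Q * inverse D = (D * inverse D) * Q" by (simp only: mult_ac)
  ultimately have eq: "D * Q * inverse D = Q" by (simp only: mult_1)
  show ?thesis using fps_cong_sym[OF fps_cong_mult[OF assms(1) fps_cong_refl, of "inverse D"]]
    unfolding eq .
qed

definition divisor_sigma_list :: "nat \<Rightarrow> nat \<Rightarrow> int" where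
  "divisor_sigma_list p n = sum_list (map (\<lambda>d. int d ^ p) (filter (\<lambda>d. d dvd n) [1..<Suc n]))"

lemma divisor_sigma_list:
  assumes "n > 0"
  shows "of_nat (divisor_sigma p n) = (of_int (divisor_sigma_list p n) :: complex)"
proof -
  have "{d. d dvd n} = set (filter (\<lambda>d. d dvd n) [1..<Suc n])"
    using assms by (auto dest: dvd_imp_le intro!: Nat.gr0I simp: less_Suc_eq_le Suc_le_eq)
  hence "int (divisor_sigma p n) = (\<Sum>d\<in>set (filter (\<lambda>d. d dvd n) [1..<Suc n]). int d ^ p)"
    unfolding divisor_sigma_def by simp
  also have "\<dots> = divisor_sigma_list p n"
    unfolding divisor_sigma_list_def by (rule sum.distinct_set_conv_list) simp
  finally show ?thesis by (metis of_int_of_nat_eq)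
qed

text \<open>Ten entries, because l \<le> 9 calls for nine coefficients of delta and the division of
  Delta by q costs one.\<close>

definition E4_list :: "int list" where
  "E4_list = [1, 240, 2160, 6720, 17520, 30240, 60480, 82560, 140400, 181680]"

definition E6_list :: "int list" where
  "E6_list = [1, -504, -16632, -122976, -532728, -1575504, -4058208, -8471232, -17047800, -29883672]"

text \<open>The values tau(1), ..., tau(9) of Ramanujan's function.\<close>

definition delta_list :: "int list" where
  "delta_list = [1, -24, 252, -1472, 4830, -6048, -16744, 84480, -113643]"

lemma E4_cong: "fps_cong 10 E4 (lfps E4_list)"
proof -
  have "1 # map (\<lambda>n. 240 * divisor_sigma_list 3 n) [1..<10] = E4_list" by code_simp
  hence eq: "E4_list = 1 # map (\<lambda>n. 240 * divisor_sigma_list 3 n) [1..<10]" by simp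
  have "fps_nth E4 i = of_int (E4_list ! i)" if "i < 10" for i
  proof (cases i)
    case (Suc j)
    hence "E4_list ! i = 240 * divisor_sigma_list 3 i" unfolding eq using that by simp
    thus ?thesis using Suc by (simp add: E4_def sigma_fps_def divisor_sigma_list[of "Suc j"])
  qed (simp add: eq E4_nth)
  moreover have "length E4_list = 10" by (simp add: E4_list_def)
  ultimately show ?thesis by (simp add: fps_cong_def lfps_nth)
qed

lemma E6_cong: "fps_cong 10 E6 (lfps E6_list)"
proof -
  have "1 # map (\<lambda>n. -504 * divisor_sigma_list 5 n) [1..<10] = E6_list" by code_simp
  hence eq: "E6_list = 1 # map (\<lambda>n. -504 * divisor_sigma_list 5 n) [1..<10]" by simp
  have "fps_nth E6 i = of_int (E6_list ! i)" if "i < 10" for i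
  proof (cases i)
    case (Suc j)
    hence "E6_list ! i = -504 * divisor_sigma_list 5 i" unfolding eq using that by simp
    thus ?thesis using Suc by (simp add: E6_def sigma_fps_def divisor_sigma_list[of "Suc j"])
  qed (simp add: eq E6_nth)
  moreover have "length E6_list = 10" by (simp add: E6_list_def)
  ultimately show ?thesis by (simp add: fps_cong_def lfps_nth)
qed

text \<open>The identity E4^3 - E6^2 = 1728 q delta is evaluated on the lists to ten terms;
  cancelling 1728 q leaves nine.\<close>

lemma delta_cong: "fps_cong 9 delta (lfps delta_list)"
proof -
  have "ladd (lpow 10 E4_list 3) (lsmul (-1) (lpow 10 E6_list 2)) = lsmul 1728 (0 # delta_list)" by code_simp
  hence "lfps (lpow 10 E4_list 3) - lfps (lpow 10 E6_list 2) = fps_const 1728 * (fps_X * lfps delta_list)"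
    by (metis (no_types, lifting) add.commute diff_conv_add_uminus fps_const_neg fps_const_1_eq_1 lfps.simps(2) lfps_add lfps_smul mult_minus1 of_int_0 fps_const_0_eq_0 add_0 of_int_minus of_int_1 of_int_numeral)
  moreover have "fps_cong 10 (E4 ^ 3 - E6 ^ 2) (lfps (lpow 10 E4_list 3) - lfps (lpow 10 E6_list 2))"
    by (intro fps_cong_diff fps_cong_trans[OF fps_cong_power[OF E4_cong] fps_cong_sym[OF lfps_pow]]
          fps_cong_trans[OF fps_cong_power[OF E6_cong] fps_cong_sym[OF lfps_pow]])
  ultimately have *: "fps_cong 10 (fps_const 1728 * (fps_X * delta)) (fps_const 1728 * (fps_X * lfps delta_list))"
    unfolding E4_cube_minus_E6_square Delta_eq by simp
  show ?thesis unfolding fps_cong_def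
  proof (intro allI impI)
    fix i :: nat assume "i < 9"
    hence "Suc i < 10" by simp
    hence "fps_nth (fps_const 1728 * (fps_X * delta)) (Suc i) = fps_nth (fps_const 1728 * (fps_X * lfps delta_list)) (Suc i)"
      using * unfolding fps_cong_def by blast
    thus "fps_nth delta i = fps_nth (lfps delta_list) i" by simp
  qed
qed

lemma fps_cong_mono: "fps_cong n F G \<Longrightarrow> m \<le> n \<Longrightarrow> fps_cong m F G"
  by (simp add: fps_cong_def)

text \<open>The denominator \<open>delta ^ l * jpoly x\<close> is affine in \<open>x\<close>; its two coefficient lists are shared by all sample points.\<close>

definition faber_num :: "nat \<Rightarrow> nat \<Rightarrow> nat \<Rightarrow> int list" where
  "faber_num l a b = lmul l (lpow l E4_list (2 - a)) (lpow l E6_list (1 - b))"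

definition faber_den0 :: "nat \<Rightarrow> int list" where
  "faber_den0 l = lmul l (lpow l delta_list l) (lpow l E4_list 3)"

text \<open>The part of the denominator multiplied by -x is delta^l Delta = q delta^(l + 1); the
  leading 0 is the factor q.\<close>

definition faber_den1 :: "nat \<Rightarrow> int list" where
  "faber_den1 l = 0 # lpow l delta_list (Suc l)"

fun faber_lists :: "nat \<Rightarrow> int list \<Rightarrow> int list \<Rightarrow> int list \<Rightarrow> int list \<Rightarrow> int list list" where
  "faber_lists l num A B [] = []"
| "faber_lists l num A B (x # xs) = ldiv l num (tl (ladd A (lsmul (- x) B))) # faber_lists l num A B xs"

text \<open>The \<open>tl\<close> removes the leading 1 that \<open>ldiv\<close> presupposes. Among
  the l coefficients of the quotient the wanted one, at q^(l - 1), is the last.\<close>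

lemma faber_coeff_list:
  assumes l: "1 \<le> l" "l \<le> 9"
    and Q: "Qs = ldiv l (faber_num l a b) (tl (ladd (faber_den0 l) (lsmul (- x) (faber_den1 l))))" "length Qs = l"
  shows "faber_coeff l a b (of_int x) = of_int (last Qs)"
proof -
  have cE4: "fps_cong l E4 (lfps E4_list)" and cE6: "fps_cong l E6 (lfps E6_list)" and cd: "fps_cong l delta (lfps delta_list)"
    using l by (auto intro: fps_cong_mono[OF E4_cong] fps_cong_mono[OF E6_cong] fps_cong_mono[OF delta_cong])
  note pow = fps_cong_trans[OF fps_cong_power fps_cong_sym[OF lfps_pow]]
  define D where "D = delta ^ l * jpoly (of_int x)"
  define G where "G = E4 ^ (2 - a) * E6 ^ (1 - b)"
  define ds where "ds = ladd (faber_den0 l) (lsmul (- x) (faber_den1 l))"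
  have "fps_cong l (delta ^ l * E4 ^ 3) (lfps (faber_den0 l))"
    unfolding faber_den0_def
    by (rule fps_cong_trans[OF _ fps_cong_sym[OF lfps_mul]]) (intro fps_cong_mult pow cd cE4)
  moreover have "fps_cong l (fps_X * delta ^ Suc l) (lfps (faber_den1 l))"
    unfolding faber_den1_def lfps.simps of_int_0 fps_const_0_eq_0 add_0
    by (rule fps_cong_mono[OF fps_cong_X[OF pow[OF cd]]]) simp
  ultimately have "fps_cong l (delta ^ l * E4 ^ 3 - fps_const (of_int x) * (fps_X * delta ^ Suc l))
      (lfps (faber_den0 l) - fps_const (of_int x) * lfps (faber_den1 l))"
    by (intro fps_cong_diff fps_cong_mult fps_cong_refl)
  moreover have "delta ^ l * E4 ^ 3 - fps_const (of_int x) * (fps_X * delta ^ Suc l) = D"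
    by (simp add: D_def jpoly_def Delta_eq algebra_simps)
  ultimately have D: "fps_cong l D (lfps ds)"
    by (simp add: ds_def lfps_add lfps_smul flip: fps_const_neg)
  have D0: "fps_nth D 0 = 1" by (simp add: D_def fps_power_zeroth)
  hence "fps_nth (lfps ds) 0 = 1" using D l unfolding fps_cong_def by force
  hence ds: "ds = 1 # tl ds" by (cases ds) auto
  have G: "fps_cong l G (lfps (faber_num l a b))"
    unfolding G_def faber_num_def
    by (rule fps_cong_trans[OF _ fps_cong_sym[OF lfps_mul]]) (intro fps_cong_mult pow cE4 cE6)
  have "fps_cong l (lfps (1 # tl ds) * lfps Qs) (lfps (faber_num l a b))"
    unfolding Q(1) ds_def[symmetric] by (rule lfps_div)
  hence "fps_cong l (lfps ds * lfps Qs) (lfps (faber_num l a b))" using ds by simp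
  hence "fps_cong l (D * lfps Qs) G"
    using fps_cong_trans[OF fps_cong_mult[OF D fps_cong_refl] fps_cong_trans[OF _ fps_cong_sym[OF G]]] by blast
  hence "fps_cong l (G * inverse D) (lfps Qs)" by (rule fps_cong_inverse_mult) (rule D0)
  hence "fps_nth (G * inverse D) (l - 1) = fps_nth (lfps Qs) (l - 1)" using l unfolding fps_cong_def by simp
  also have "\<dots> = of_int (last Qs)"
  proof -
    have "Qs \<noteq> []" using l Q(2) by auto
    thus ?thesis using l Q(2) by (simp add: lfps_nth last_conv_nth)
  qed
  finally show ?thesis by (simp add: faber_coeff_def D_def G_def)
qed

subsection \<open>Real roots from sign changes\<close>

definition real_fps :: "complex fps \<Rightarrow> bool" where
  "real_fps F \<longleftrightarrow> (\<forall>n. fps_nth F n \<in> \<real>)"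

lemma real_fps_mult: "real_fps F \<Longrightarrow> real_fps G \<Longrightarrow> real_fps (F * G)"
  unfolding real_fps_def fps_mult_nth by (intro allI sum_in_Reals Reals_mult) auto

lemma real_fps_diff: "real_fps F \<Longrightarrow> real_fps G \<Longrightarrow> real_fps (F - G)"
  unfolding real_fps_def by auto

lemma real_fps_const: "c \<in> \<real> \<Longrightarrow> real_fps (fps_const c)"
  unfolding real_fps_def by auto

lemma real_fps_power: "real_fps F \<Longrightarrow> real_fps (F ^ n)"
proof (induction n)
  case 0
  show ?case by (auto simp: real_fps_def)
qed (auto intro: real_fps_mult)

lemma real_fps_inverse:
  assumes D: "real_fps D" "fps_nth D 0 = 1"
  shows "real_fps (inverse D)"
  unfolding real_fps_def
proof
  fix n
  show "fps_nth (inverse D) n \<in> \<real>"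
  proof (induction n rule: less_induct)
    case (less n)
    have "D * inverse D = 1" by (rule inverse_mult_eq_1') (simp add: D)
    hence "(\<Sum>i=0..n. fps_nth D i * fps_nth (inverse D) (n - i)) = fps_nth 1 n"
      by (metis fps_mult_nth)
    also have "(\<Sum>i=0..n. fps_nth D i * fps_nth (inverse D) (n - i)) =
        fps_nth (inverse D) n + (\<Sum>i=1..n. fps_nth D i * fps_nth (inverse D) (n - i))"
      by (subst sum.atLeast_Suc_atMost) (auto simp: D)
    finally have "fps_nth (inverse D) n = fps_nth 1 n - (\<Sum>i=1..n. fps_nth D i * fps_nth (inverse D) (n - i))"
      by (simp add: algebra_simps)
    also have "\<dots> \<in> \<real>"
      using less D by (intro Reals_diff sum_in_Reals Reals_mult) (auto simp: real_fps_def)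
    finally show ?case .
  qed
qed

lemma real_fps_forms: "real_fps E4" "real_fps E6" "real_fps delta"
proof -
  show E: "real_fps E4" "real_fps E6"
    by (auto simp: real_fps_def E4_def E6_def sigma_fps_def)
  have "real_fps Delta" unfolding Delta_def
    by (intro real_fps_mult real_fps_diff real_fps_power real_fps_const E) auto
  thus "real_fps delta" by (simp add: real_fps_def delta_def)
qed

lemma faber_coeff_real:
  assumes "x \<in> \<real>"
  shows "faber_coeff l a b x \<in> \<real>"
proof -
  have D: "real_fps Delta" using real_fps_forms(3) unfolding Delta_eq by (simp add: real_fps_def)
  have "real_fps (E4 ^ (2 - a) * E6 ^ (1 - b) * inverse (delta ^ l * jpoly x))"
    unfolding jpoly_def
    by (intro real_fps_mult real_fps_power real_fps_forms real_fps_inverse real_fps_diff real_fps_const assms D)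
       (auto simp: fps_power_zeroth E4_nth)
  thus ?thesis by (simp add: faber_coeff_def real_fps_def)
qed

text \<open>The points descend because j decreases along the arc for growing angle. The factor
  \<open>s\<close> absorbs a global sign, which for large \<open>l\<close> depends on the
  form.\<close>

definition sign_changes :: "nat \<Rightarrow> (real \<Rightarrow> real) \<Rightarrow> bool" where
  "sign_changes l g \<longleftrightarrow> (\<exists>t s. (\<forall>i<l. 0 \<le> t i \<and> t i \<le> 1728) \<and> (\<forall>i. Suc i < l \<longrightarrow> t (Suc i) < t i) \<and>
      (\<forall>i<l. s * (-1) ^ i * g (t i) > (0 :: real)))"

text \<open>A polynomial of degree at most l - 1 that alternates at l points has l - 1 distinct
  zeros between them, so these are all its complex zeros.\<close>

lemma roots_from_sign_changes:
  fixes c :: "nat \<Rightarrow> complex"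
  assumes l: "l \<ge> 1" and g: "\<And>x::real. (\<Sum>i<l. c i * of_real x ^ i) = of_real (g x)"
    and sc: "sign_changes l g" and root: "(\<Sum>i<l. c i * w ^ i) = 0"
  shows "\<exists>x. w = of_real x \<and> 0 \<le> x \<and> x \<le> 1728"
proof -
  obtain t s where t: "\<And>i. i < l \<Longrightarrow> 0 \<le> t i \<and> t i \<le> 1728" "\<And>i. Suc i < l \<Longrightarrow> t (Suc i) < t i"
    "\<And>i. i < l \<Longrightarrow> s * (-1) ^ i * g (t i) > 0"
    using sc unfolding sign_changes_def by blast
  define p where "p = (\<Sum>i<l. monom (c i) i)"
  have poly_p: "poly p z = (\<Sum>i<l. c i * z ^ i)" for z by (simp add: p_def poly_sum poly_monom)
  have deg: "degree p \<le> l - 1"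
    unfolding p_def by (rule degree_sum_le) (auto intro: order_trans[OF degree_monom_le])
  have "g (t 0) \<noteq> 0" using t(3)[of 0] l by auto
  hence "poly p (of_real (t 0)) \<noteq> 0" unfolding poly_p g by simp
  hence "p \<noteq> 0" by auto
  have "continuous_on UNIV (\<lambda>x. Re (poly p (of_real x)))" by (intro continuous_intros)
  hence contg: "continuous_on UNIV g" unfolding poly_p g by simp
  have "\<exists>r. t (Suc i) < r \<and> r < t i \<and> g r = 0" if i: "Suc i < l" for i
  proof -
    have lt: "t (Suc i) < t i" using t(2)[OF i] .
    have c: "continuous_on {t (Suc i)..t i} g" by (rule continuous_on_subset[OF contg]) auto
    have s1: "s * (-1) ^ i * g (t i) > 0" "- (s * (-1) ^ i) * g (t (Suc i)) > 0"
      using t(3)[of i] t(3)[of "Suc i"] i by auto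
    hence ne: "g (t i) \<noteq> 0" "g (t (Suc i)) \<noteq> 0" by auto
    have "\<exists>r. t (Suc i) \<le> r \<and> r \<le> t i \<and> g r = 0"
    proof (cases "s * (-1) ^ i > 0")
      case True
      hence "g (t i) > 0" "g (t (Suc i)) < 0" using s1 by (auto simp: zero_less_mult_iff mult_less_0_iff)
      thus ?thesis using IVT'[of g "t (Suc i)" 0 "t i"] c lt by auto
    next
      case False
      hence "g (t i) < 0" "g (t (Suc i)) > 0" using s1 by (auto simp: zero_less_mult_iff mult_less_0_iff)
      thus ?thesis using IVT2'[of g "t i" 0 "t (Suc i)"] c lt by auto
    qed
    then obtain r where "t (Suc i) \<le> r" "r \<le> t i" "g r = 0" by blast
    thus ?thesis using ne by (intro exI[of _ r]) (auto simp: le_less)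
  qed
  then obtain r where r: "\<And>i. Suc i < l \<Longrightarrow> t (Suc i) < r i \<and> r i < t i \<and> g (r i) = 0" by metis
  have anti: "t j \<le> t i" if "i \<le> j" "j < l" for i j
    using that
  proof (induction j rule: dec_induct)
    case (step j)
    thus ?case using t(2)[of j] by auto
  qed auto
  have lt: "r j < r i" if "i < j" "Suc j < l" for i j
  proof -
    have "r j < t j" "t j \<le> t (Suc i)" "t (Suc i) < r i" using r[of i] r[of j] anti[of "Suc i" j] that by auto
    thus ?thesis by linarith
  qed
  have inj: "inj_on r {..<l - 1}"
  proof (rule inj_onI)
    fix i j assume ij: "i \<in> {..<l - 1}" "j \<in> {..<l - 1}" "r i = r j"
    show "i = j" using lt[of i j] lt[of j i] ij by (cases i j rule: linorder_cases) (auto simp: less_diff_conv)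
  qed
  define R where "R = (\<lambda>i. complex_of_real (r i)) ` {..<l - 1}"
  have "card R = l - 1"
    unfolding R_def using inj by (subst card_image) (auto simp: inj_on_def)
  moreover have sub: "R \<subseteq> {z. poly p z = 0}"
    unfolding R_def poly_p using r g by auto
  moreover have fin: "finite {z. poly p z = 0}" using \<open>p \<noteq> 0\<close> by (rule poly_roots_finite)
  moreover have "card {z. poly p z = 0} \<le> l - 1"
    using card_poly_roots_bound[OF \<open>p \<noteq> 0\<close>] deg by linarith
  ultimately have "R = {z. poly p z = 0}" by (intro card_seteq) auto
  moreover have "w \<in> {z. poly p z = 0}" using root by (simp add: poly_p)
  ultimately obtain i where i: "i < l - 1" "w = of_real (r i)" by (auto simp: R_def)
  hence "Suc i < l" by simp
  hence "0 \<le> r i" "r i \<le> 1728" using r[of i] t(1)[of i] t(1)[of "Suc i"] by auto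
  thus ?thesis using i by blast
qed

subsection \<open>The polynomials of degree at most 8\<close>

fun alternating :: "nat \<Rightarrow> int \<Rightarrow> int list list \<Rightarrow> bool" where
  "alternating l s [] = True"
| "alternating l s (v # vs) = (length v = l \<and> s * last v > 0 \<and> alternating l (- s) vs)"

fun decreasing :: "int \<Rightarrow> int list \<Rightarrow> bool" where
  "decreasing b [] = True"
| "decreasing b (x # xs) = (0 \<le> x \<and> x < b \<and> decreasing x xs)"

text \<open>The comparison in \<open>decreasing\<close> is strict, so 1729 encodes the bound 1728.
  The sign 1 asks for a positive value at the first and largest sample.\<close>

definition sample_check :: "nat \<Rightarrow> nat \<Rightarrow> nat \<Rightarrow> int list \<Rightarrow> bool" where
  "sample_check l a b xs \<longleftrightarrow> length xs = l \<and> decreasing 1729 xs \<and>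
     alternating l 1 (faber_lists l (faber_num l a b) (faber_den0 l) (faber_den1 l) xs)"

lemma alternating_nth:
  "alternating l s vs \<Longrightarrow> i < length vs \<Longrightarrow> length (vs ! i) = l \<and> s * (-1) ^ i * last (vs ! i) > 0"
proof (induction l s vs arbitrary: i rule: alternating.induct)
  case (2 l s v vs)
  thus ?case by (cases i) (use "2.IH"[of "i - 1"] in auto)
qed auto

lemma faber_lists_nth:
  "length (faber_lists l num A B xs) = length xs"
  "i < length xs \<Longrightarrow> faber_lists l num A B xs ! i = ldiv l num (tl (ladd A (lsmul (- (xs ! i)) B)))"
proof -
  show len: "length (faber_lists l num A B xs) = length xs" for xs by (induction xs) auto
  show "i < length xs \<Longrightarrow> faber_lists l num A B xs ! i = ldiv l num (tl (ladd A (lsmul (- (xs ! i)) B)))"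
  proof (induction xs arbitrary: i)
    case (Cons x xs)
    thus ?case by (cases i) auto
  qed simp
qed

lemma decreasing_nth:
  "decreasing b xs \<Longrightarrow> i < length xs \<Longrightarrow> 0 \<le> xs ! i \<and> xs ! i < b"
  "decreasing b xs \<Longrightarrow> Suc i < length xs \<Longrightarrow> xs ! Suc i < xs ! i"
proof -
  show *: "decreasing b xs \<Longrightarrow> i < length xs \<Longrightarrow> 0 \<le> xs ! i \<and> xs ! i < b" for b xs i
  proof (induction b xs arbitrary: i rule: decreasing.induct)
    case (2 b x xs)
    show ?case
    proof (cases i)
      case (Suc j)
      thus ?thesis using "2.IH"[of j] "2.prems" by auto
    qed (use "2.prems" in auto)
  qed auto
  show "decreasing b xs \<Longrightarrow> Suc i < length xs \<Longrightarrow> xs ! Suc i < xs ! i"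
  proof (induction b xs arbitrary: i rule: decreasing.induct)
    case (2 b x xs)
    show ?case
    proof (cases i)
      case 0
      thus ?thesis using *[of x xs 0] "2.prems" by auto
    next
      case (Suc j)
      thus ?thesis using "2.IH"[of j] "2.prems" by auto
    qed
  qed auto
qed

lemma sign_changes_of_sample_check:
  assumes l: "1 \<le> l" "l \<le> 9" and ok: "sample_check l a b xs"
  shows "sign_changes l (\<lambda>x. Re (faber_coeff l a b (of_real x)))"
  unfolding sign_changes_def
proof (intro exI[of _ "\<lambda>i. of_int (xs ! i)"] exI[of _ 1] conjI allI impI)
  have len: "length xs = l" and dec: "decreasing 1729 xs"
    and alt: "alternating l 1 (faber_lists l (faber_num l a b) (faber_den0 l) (faber_den1 l) xs)"
    using ok by (auto simp: sample_check_def)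
  fix i
  show "0 \<le> real_of_int (xs ! i)" "real_of_int (xs ! i) \<le> 1728" if "i < l"
    using decreasing_nth(1)[OF dec, of i] that len by auto
  show "real_of_int (xs ! Suc i) < real_of_int (xs ! i)" if "Suc i < l"
    using decreasing_nth(2)[OF dec, of i] that len by auto
  show "0 < 1 * (- 1) ^ i * Re (faber_coeff l a b (of_real (real_of_int (xs ! i))))" if i: "i < l"
  proof -
    define Qs where "Qs = faber_lists l (faber_num l a b) (faber_den0 l) (faber_den1 l) xs ! i"
    have Qs: "length Qs = l" "1 * (-1) ^ i * last Qs > 0"
      using alternating_nth[OF alt, of i] i len by (auto simp: Qs_def faber_lists_nth)
    have eq: "Qs = ldiv l (faber_num l a b) (tl (ladd (faber_den0 l) (lsmul (- (xs ! i)) (faber_den1 l))))"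
      unfolding Qs_def by (rule faber_lists_nth) (use i len in simp)
    have "faber_coeff l a b (of_int (xs ! i)) = of_int (last Qs)"
      by (rule faber_coeff_list[OF l eq Qs(1)])
    moreover from Qs(2) have "0 < real_of_int (1 * (-1) ^ i * last Qs)" by (simp only: of_int_0_less_iff)
    ultimately show ?thesis by simp
  qed
qed

text \<open>Integers that separate the zeros of the polynomials, found numerically.\<close>

lemma sample_check_1:
  "sample_check 1 0 0 [1728]"
  "sample_check 1 1 0 [1728]"
  "sample_check 1 0 1 [1728]"
  "sample_check 1 2 0 [1728]"
  "sample_check 1 1 1 [1728]"
  "sample_check 1 2 1 [1728]"
  by code_simp+

lemma sample_check_2:
  "sample_check 2 0 0 [1212, 347]"
  "sample_check 2 1 0 [1332, 467]"
  "sample_check 2 0 1 [960, 95]"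
  "sample_check 2 2 0 [1452, 587]"
  "sample_check 2 1 1 [1080, 215]"
  "sample_check 2 2 1 [1200, 335]"
  by code_simp+

lemma sample_check_3:
  "sample_check 3 0 0 [1531, 708, 40]"
  "sample_check 3 1 0 [1578, 828, 114]"
  "sample_check 3 0 1 [1296, 456, 23]"
  "sample_check 3 2 0 [1611, 948, 200]"
  "sample_check 3 1 1 [1373, 576, 67]"
  "sample_check 3 2 1 [1432, 696, 127]"
  by code_simp+

lemma sample_check_4:
  "sample_check 4 0 0 [1635, 1054, 297, 14]"
  "sample_check 4 1 0 [1652, 1145, 400, 42]"
  "sample_check 4 0 1 [1479, 807, 200, 8]"
  "sample_check 4 2 0 [1665, 1222, 507, 85]"
  "sample_check 4 1 1 [1516, 907, 284, 28]"
  "sample_check 4 2 1 [1546, 996, 374, 59]"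
  by code_simp+

lemma sample_check_5:
  "sample_check 5 0 0 [1675, 1287, 611, 141, 6]"
  "sample_check 5 1 0 [1683, 1341, 709, 207, 20]"
  "sample_check 5 0 1 [1570, 1074, 465, 102, 4]"
  "sample_check 5 2 0 [1689, 1386, 799, 281, 43]"
  "sample_check 5 1 1 [1590, 1141, 555, 154, 14]"
  "sample_check 5 2 1 [1606, 1200, 641, 216, 32]"
  by code_simp+

lemma sample_check_6:
  "sample_check 6 0 0 [1694, 1425, 881, 359, 76, 3]"
  "sample_check 6 1 0 [1698, 1457, 955, 439, 118, 11]"
  "sample_check 6 0 1 [1620, 1251, 721, 282, 58, 2]"
  "sample_check 6 2 0 [1701, 1485, 1022, 517, 168, 25]"
  "sample_check 6 1 1 [1631, 1296, 796, 351, 92, 8]"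
  "sample_check 6 2 1 [1641, 1335, 865, 421, 134, 19]"
  by code_simp+

lemma sample_check_7:
  "sample_check 7 0 0 [1704, 1509, 1081, 593, 224, 45, 1]"
  "sample_check 7 1 0 [1707, 1530, 1134, 664, 284, 73, 6]"
  "sample_check 7 0 1 [1649, 1369, 928, 490, 181, 36, 1]"
  "sample_check 7 2 0 [1709, 1548, 1182, 732, 345, 108, 15]"
  "sample_check 7 1 1 [1657, 1400, 985, 556, 232, 59, 5]"
  "sample_check 7 2 1 [1663, 1426, 1037, 620, 286, 88, 12]"
  by code_simp+

lemma sample_check_8:
  "sample_check 8 0 0 [1711, 1564, 1224, 795, 407, 148, 29, 1]"
  "sample_check 8 1 0 [1712, 1577, 1262, 853, 469, 192, 48, 4]"
  "sample_check 8 0 1 [1669, 1451, 1085, 682, 342, 122, 24, 0]"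
  "sample_check 8 2 0 [1713, 1589, 1296, 908, 529, 240, 73, 10]"
  "sample_check 8 1 1 [1673, 1471, 1128, 739, 397, 161, 40, 3]"
  "sample_check 8 2 1 [1678, 1490, 1168, 794, 452, 202, 61, 8]"
  by code_simp+

lemma sample_check_9:
  "sample_check 9 0 0 [1715, 1600, 1327, 958, 586, 289, 102, 20, 0]"
  "sample_check 9 1 0 [1716, 1610, 1355, 1005, 642, 339, 135, 34, 3]"
  "sample_check 9 0 1 [1681, 1507, 1204, 845, 507, 246, 86, 17, 0]"
  "sample_check 9 2 0 [1717, 1618, 1380, 1048, 695, 389, 172, 51, 7]"
  "sample_check 9 1 1 [1685, 1522, 1237, 893, 559, 291, 115, 28, 2]"
  "sample_check 9 2 1 [1688, 1536, 1267, 938, 611, 337, 147, 44, 6]"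
  by code_simp+

lemma sign_changes_small:
  assumes "1 \<le> l" "l \<le> 9" "a \<le> 2" "b \<le> 1"
  shows "sign_changes l (\<lambda>x. Re (faber_coeff l a b (of_real x)))"
proof -
  have ab: "a = 0 \<or> a = 1 \<or> a = 2" "b = 0 \<or> b = 1" using assms by linarith+
  have *: "\<exists>xs. sample_check l a b xs"
    if "l = L" "sample_check L 0 0 x1" "sample_check L 1 0 x2" "sample_check L 0 1 x3"
       "sample_check L 2 0 x4" "sample_check L 1 1 x5" "sample_check L 2 1 x6" for L x1 x2 x3 x4 x5 x6
    using ab that by blast
  consider "l = 1" | "l = 2" | "l = 3" | "l = 4" | "l = 5" | "l = 6" | "l = 7" | "l = 8" | "l = 9"
    using assms by linarith
  hence "\<exists>xs. sample_check l a b xs"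
    by cases (erule *, (rule sample_check_1 sample_check_2 sample_check_3 sample_check_4 sample_check_5
       sample_check_6 sample_check_7 sample_check_8 sample_check_9)+)+
  then obtain xs where "sample_check l a b xs" by blast
  thus ?thesis by (rule sign_changes_of_sample_check[OF assms(1,2)])
qed

subsection \<open>The residue formula\<close>

lemma eval_Delta_nonzero_disc:
  assumes "norm q < 1" "q \<noteq> 0"
  shows "eval_fps Delta q \<noteq> 0"
  using qpar_surj[OF assms(2,1)] eval_Delta_nonzero by metis

lemma conv_radius_jpoly [simp]: "1 \<le> fps_conv_radius (jpoly x)"
  unfolding jpoly_def by (intro conv_radius_diff_ge_1 conv_radius_mult_ge_1 conv_radius_power_ge_1) auto

lemma conv_radius_delta [simp]: "1 \<le> fps_conv_radius delta"
  by (simp add: delta_def)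

lemma eval_jpoly:
  assumes "norm q < 1"
  shows "eval_fps (jpoly x) q = eval_fps E4 q ^ 3 - x * eval_fps Delta q"
  using assms unfolding jpoly_def
  by (simp add: eval_fps_diff eval_fps_mult eval_fps_power less_conv conv_radius_power_ge_1 conv_radius_mult_ge_1)

lemma eval_Delta_delta: "norm q < 1 \<Longrightarrow> eval_fps Delta q = q * eval_fps delta q"
  unfolding delta_def using eval_fps_shift_mult[OF conv_radius_Delta, of 1 q] by simp

lemma holomorphic_on_eval_fps_disc:
  "1 \<le> fps_conv_radius F \<Longrightarrow> eval_fps F holomorphic_on ball 0 1" for F :: "complex fps"
  by (rule holomorphic_on_eval_fps) (auto simp: less_conv)

text \<open>Where j = x, the derivative q d/dq of Delta (j - x) reduces to Delta q dj/dq = - E4^2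
  E6. Excluding the values 0 and 1728 keeps E4 and E6 nonzero, so the zero is simple.\<close>

lemma jpoly_zero_deriv:
  assumes q: "norm q < 1" "q \<noteq> 0" and x: "x \<noteq> 0" "x \<noteq> 1728" and zero: "eval_fps (jpoly x) q = 0"
  shows "(eval_fps (jpoly x) has_field_derivative (- (eval_fps E4 q ^ 2 * eval_fps E6 q / q))) (at q)"
    and "eval_fps E4 q \<noteq> 0" "eval_fps E6 q \<noteq> 0"
proof -
  define e4 e6 d where "e4 = eval_fps E4 q" and "e6 = eval_fps E6 q" and "d = eval_fps Delta q"
  define t4 td where "t4 = eval_fps (qderiv E4) q" and "td = eval_fps (qderiv Delta) q"
  have c: "1 \<le> fps_conv_radius F \<Longrightarrow> ereal (norm q) < fps_conv_radius F" for F :: "complex fps"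
    using q by (intro less_conv)
  have d: "d \<noteq> 0" using eval_Delta_nonzero_disc[OF q] by (simp add: d_def)
  have z: "e4 ^ 3 = x * d" using zero eval_jpoly[OF q(1), of x] by (simp add: e4_def d_def)
  show e4: "eval_fps E4 q \<noteq> 0" using z d x by (auto simp: e4_def)
  have "1728 * d = e4 ^ 3 - e6 ^ 2" using eval_fps_Delta[OF q(1)] by (simp add: d_def e4_def e6_def)
  hence "e6 ^ 2 = (x - 1728) * d" using z by (simp add: algebra_simps)
  thus "eval_fps E6 q \<noteq> 0" using d x by (auto simp: e6_def)
  have ode: "e4 * td = (3 * t4 + e6) * d"
    using arg_cong[OF qderiv_Delta(1), of "\<lambda>F. eval_fps F q"]
    by (simp add: eval_fps_mult eval_fps_add c conv_radius_qderiv conv_radius_mult_ge_1 conv_radius_add_ge_1 e4_def e6_def d_def t4_def td_def)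
  have "qderiv (jpoly x) = 3 * E4 ^ 2 * qderiv E4 - fps_const x * qderiv Delta"
    by (simp add: jpoly_def qderiv_diff qderiv_power qderiv_cmult)
  hence "eval_fps (qderiv (jpoly x)) q = 3 * e4 ^ 2 * t4 - x * td"
    by (simp add: eval_fps_mult eval_fps_diff eval_fps_power c conv_radius_qderiv conv_radius_mult_ge_1 conv_radius_power_ge_1 e4_def t4_def td_def)
  moreover have "3 * e4 ^ 2 * t4 - x * td = - (e4 ^ 2 * e6)"
  proof -
    have "e4 * (3 * e4 ^ 2 * t4 - x * td) = 3 * e4 ^ 3 * t4 - x * (e4 * td)"
      by (simp add: algebra_simps power2_eq_square power3_eq_cube)
    also have "\<dots> = - (x * d) * e6" unfolding ode z by (simp add: algebra_simps)
    also have "\<dots> = - (e4 ^ 3) * e6" by (simp add: z)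
    also have "\<dots> = e4 * (- (e4 ^ 2 * e6))" by (simp add: power2_eq_square power3_eq_cube)
    finally have "e4 * (3 * e4 ^ 2 * t4 - x * td) = e4 * (- (e4 ^ 2 * e6))" .
    thus ?thesis using e4 mult_left_cancel[of e4] unfolding e4_def[symmetric] by blast
  qed
  ultimately have "eval_fps (qderiv (jpoly x)) q = - (e4 ^ 2 * e6)" by simp
  moreover have "eval_fps (qderiv (jpoly x)) q = q * eval_fps (fps_deriv (jpoly x)) q"
    unfolding qderiv_def using less_le_trans[OF c[OF conv_radius_jpoly] fps_conv_radius_deriv]
    by (simp add: eval_fps_mult)
  ultimately have "eval_fps (fps_deriv (jpoly x)) q = - (e4 ^ 2 * e6 / q)"
    using q by (simp add: field_simps)
  thus "(eval_fps (jpoly x) has_field_derivative (- (eval_fps E4 q ^ 2 * eval_fps E6 q / q))) (at q)"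
    using has_field_derivative_eval_fps[OF c[OF conv_radius_jpoly], of x] by (simp add: e4_def e6_def)
qed

text \<open>The series of \<open>faber_coeff\<close> with Delta^l in place of delta^l, that is
  divided by q^l: its coefficient at l - 1 becomes the residue at 0.\<close>

definition faber_kernel :: "nat \<Rightarrow> nat \<Rightarrow> nat \<Rightarrow> complex \<Rightarrow> complex \<Rightarrow> complex" where
  "faber_kernel l a b x q = eval_fps E4 q ^ (2 - a) * eval_fps E6 q ^ (1 - b) / eval_fps Delta q ^ l / eval_fps (jpoly x) q"

text \<open>At a zero of jpoly this is minus the residue of the kernel.\<close>

definition faber_pole :: "nat \<Rightarrow> nat \<Rightarrow> nat \<Rightarrow> complex \<Rightarrow> complex" where
  "faber_pole l a b q = q / (eval_fps Delta q ^ l * eval_fps E4 q ^ a * eval_fps E6 q ^ b)"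

lemma residue_faber_kernel_0:
  assumes l: "l \<ge> 1"
  shows "residue (faber_kernel l a b x) 0 = faber_coeff l a b x"
proof -
  define V where "V = (\<lambda>q. eval_fps E4 q ^ (2 - a) * eval_fps E6 q ^ (1 - b) * inverse (eval_fps delta q ^ l * eval_fps (jpoly x) q))"
  have pos: "1 \<le> fps_conv_radius F \<Longrightarrow> eval_fps F has_fps_expansion F" for F :: "complex fps"
    by (rule eval_fps_has_fps_expansion) (rule less_le_trans[of _ 1], auto)
  have V: "V has_fps_expansion (E4 ^ (2 - a) * E6 ^ (1 - b) * inverse (delta ^ l * jpoly x))"
    unfolding V_def
    by (intro has_fps_expansion_mult has_fps_expansion_power has_fps_expansion_inverse pos) (auto simp: fps_power_zeroth)
  have "residue (faber_kernel l a b x) 0 = residue (\<lambda>q. V q / q ^ Suc (l - 1)) 0"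
  proof (rule residue_cong)
    have "faber_kernel l a b x q = V q / q ^ Suc (l - 1)" if "norm q < 1" for q
      using l eval_Delta_delta[OF that]
      by (simp add: faber_kernel_def V_def power_mult_distrib divide_inverse mult_ac)
    thus "eventually (\<lambda>q. faber_kernel l a b x q = V q / q ^ Suc (l - 1)) (at 0)"
      unfolding eventually_at by (intro exI[of _ 1]) (auto simp: dist_norm)
  qed simp
  also have "\<dots> = faber_coeff l a b x"
    unfolding faber_coeff_def by (rule residue_fps_expansion_over_power_at_0[OF V])
  finally show ?thesis .
qed

lemma residue_faber_kernel_pole:
  assumes q: "norm q < 1" "q \<noteq> 0" and x: "x \<noteq> 0" "x \<noteq> 1728" and zero: "eval_fps (jpoly x) q = 0"
    and ab: "a \<le> 2" "b \<le> 1"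
  shows "residue (faber_kernel l a b x) q = - faber_pole l a b q"
proof -
  define f where "f = (\<lambda>q. eval_fps E4 q ^ (2 - a) * eval_fps E6 q ^ (1 - b) / eval_fps Delta q ^ l)"
  define g' where "g' = - (eval_fps E4 q ^ 2 * eval_fps E6 q / q)"
  note nz = jpoly_zero_deriv(2,3)[OF q x zero] eval_Delta_nonzero_disc[OF q]
  have op: "open (ball 0 1 - {0 :: complex})" by auto
  have conn: "connected (ball 0 1 - {0 :: complex})"
    by (rule connected_open_delete) auto
  have qS: "q \<in> ball 0 1 - {0}" using q by simp
  have hol: "eval_fps F holomorphic_on ball 0 1 - {0}" if "1 \<le> fps_conv_radius F" for F :: "complex fps"
    using holomorphic_on_eval_fps_disc[OF that] by (rule holomorphic_on_subset) auto
  have "residue (\<lambda>q. f q / eval_fps (jpoly x) q) q = f q / g'"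
  proof (rule residue_simple_pole_deriv[OF _ _ op conn qS])
    show "f holomorphic_on ball 0 1 - {0}"
      unfolding f_def by (intro holomorphic_intros hol) (auto simp: eval_Delta_nonzero_disc)
    show "eval_fps (jpoly x) holomorphic_on ball 0 1 - {0}" by (rule hol) simp
    show "(eval_fps (jpoly x) has_field_derivative g') (at q)"
      unfolding g'_def by (rule jpoly_zero_deriv(1)[OF q x zero])
  qed (use nz q zero in \<open>auto simp: f_def g'_def\<close>)
  also have "f q / g' = - faber_pole l a b q"
  proof -
    have "eval_fps E4 q ^ 2 = eval_fps E4 q ^ a * eval_fps E4 q ^ (2 - a)" using ab by (simp flip: power_add)
    moreover have "eval_fps E6 q = eval_fps E6 q ^ b * eval_fps E6 q ^ (1 - b)" using ab by (simp flip: power_add)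
    ultimately have "g' = - (eval_fps E4 q ^ a * eval_fps E4 q ^ (2 - a) * (eval_fps E6 q ^ b * eval_fps E6 q ^ (1 - b)) / q)"
      unfolding g'_def by simp
    moreover have "(X * Y / D) / - (A * X * (B * Y) / q) = - (q / (D * A * B))"
      if "X \<noteq> 0" "Y \<noteq> 0" "D \<noteq> 0" "A \<noteq> 0" "B \<noteq> 0" for X Y D A B :: complex
      using that q by (simp add: field_simps)
    ultimately show ?thesis unfolding f_def faber_pole_def using nz by simp
  qed
  finally show ?thesis by (simp add: f_def faber_kernel_def[abs_def])
qed

text \<open>The residue theorem on |q| = r, inside a slightly larger disc of radius
  \<open>R\<close>; zeros of jpoly outside the circle have winding number 0. The zero
  \<open>q0\<close>, together with the value 1 at the origin, shows that jpoly is not constant and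
  so has finitely many zeros in the closed disc.\<close>

lemma faber_coeff_residues:
  assumes l: "l \<ge> 1" and ab: "a \<le> 2" "b \<le> 1" and x: "x \<noteq> 0" "x \<noteq> 1728" and r: "0 < r" "r < 1"
    and nz: "\<And>q. norm q = r \<Longrightarrow> eval_fps (jpoly x) q \<noteq> 0"
    and ex: "norm q0 < 1" "eval_fps (jpoly x) q0 = 0"
    and B: "\<And>q. norm q = r \<Longrightarrow> norm (faber_kernel l a b x q) \<le> B"
  defines "Z \<equiv> {q. norm q < r \<and> eval_fps (jpoly x) q = 0}"
  shows "norm (faber_coeff l a b x - (\<Sum>q\<in>Z. faber_pole l a b q)) \<le> B * r"
proof -
  let ?J = "eval_fps (jpoly x)" and ?H = "faber_kernel l a b x"
  define R where "R = (1 + r) / 2"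
  have R: "r < R" "R < 1" "0 < R" using r by (auto simp: R_def)
  have J0: "?J 0 = 1" by (simp add: eval_fps_at_0)
  have nconst: "\<not> ?J constant_on ball 0 1"
  proof
    assume "?J constant_on ball 0 1"
    then obtain c where "\<forall>q\<in>ball 0 1. ?J q = c" by (auto simp: constant_on_def)
    hence "?J q0 = ?J 0" using ex by auto
    thus False using ex J0 by simp
  qed
  define P where "P = {q\<in>cball 0 R. ?J q = 0}"
  have finP: "finite P" unfolding P_def
    by (rule holomorphic_compact_finite_zeros[OF holomorphic_on_eval_fps_disc _ _ _ _ nconst]) (use R in auto)
  have P0: "0 \<notin> P" using J0 by (simp add: P_def)
  have finZ: "finite Z" by (rule finite_subset[OF _ finP]) (use R in \<open>auto simp: Z_def P_def\<close>)
  have hol: "eval_fps F holomorphic_on ball 0 R - insert 0 P" if "1 \<le> fps_conv_radius F" for F :: "complex fps"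
    using holomorphic_on_eval_fps_disc[OF that] by (rule holomorphic_on_subset) (use R in auto)
  have holH: "?H holomorphic_on ball 0 R - insert 0 P"
    unfolding faber_kernel_def
    by (intro holomorphic_intros hol) (use R in \<open>auto simp: P_def eval_Delta_nonzero_disc\<close>)
  have path: "path_image (circlepath 0 r) \<subseteq> ball 0 R - insert 0 P"
    using R r nz by (auto simp: P_def)
  have wind: "winding_number (circlepath 0 r) p = (if norm p < r then 1 else 0)" if "norm p \<noteq> r" for p
  proof (cases "norm p < r")
    case True
    thus ?thesis by (simp add: winding_number_circlepath)
  next
    case False
    have "winding_number (circlepath 0 r) p = 0"
      by (rule winding_number_zero_outside[of _ "cball 0 r"]) (use False that r in auto)
    thus ?thesis using False by simp
  qed
  have "contour_integral (circlepath 0 r) ?H = 2 * pi * \<i> * (\<Sum>p\<in>insert 0 P. winding_number (circlepath 0 r) p * residue ?H p)"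
  proof (rule Residue_theorem[of "ball 0 R"])
    show "\<forall>z. z \<notin> ball 0 R \<longrightarrow> winding_number (circlepath 0 r) z = 0"
      using R wind by auto
  qed (use finP holH path in auto)
  also have "(\<Sum>p\<in>insert 0 P. winding_number (circlepath 0 r) p * residue ?H p) =
      faber_coeff l a b x + (\<Sum>p\<in>P. winding_number (circlepath 0 r) p * residue ?H p)"
    using finP P0 r by (simp add: wind residue_faber_kernel_0[OF l])
  also have "(\<Sum>p\<in>P. winding_number (circlepath 0 r) p * residue ?H p) = (\<Sum>p\<in>P. if p \<in> Z then - faber_pole l a b p else 0)"
  proof (intro sum.cong refl)
    fix p assume p: "p \<in> P"
    have "p \<noteq> 0" using p P0 by auto
    have n: "norm p \<noteq> r" "norm p < 1" using p nz R by (auto simp: P_def)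
    show "winding_number (circlepath 0 r) p * residue ?H p = (if p \<in> Z then - faber_pole l a b p else 0)"
      unfolding wind[OF n(1)] using p residue_faber_kernel_pole[OF n(2) \<open>p \<noteq> 0\<close> x _ ab] by (auto simp: P_def Z_def)
  qed
  also have "\<dots> = (\<Sum>p\<in>P \<inter> Z. - faber_pole l a b p)" using finP by (simp add: sum.inter_restrict)
  also have "P \<inter> Z = Z" using R by (auto simp: P_def Z_def)
  also have "(\<Sum>p\<in>Z. - faber_pole l a b p) = - (\<Sum>p\<in>Z. faber_pole l a b p)" by (rule sum_negf)
  finally have ci: "contour_integral (circlepath 0 r) ?H = 2 * pi * \<i> * (faber_coeff l a b x - (\<Sum>p\<in>Z. faber_pole l a b p))"
    by simp
  have "?H contour_integrable_on (circlepath 0 r)"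
    by (rule contour_integrable_holomorphic_simple[OF holH _ _ path])
       (use finP in \<open>auto intro!: open_Diff finite_imp_closed\<close>)
  hence hci: "(?H has_contour_integral (2 * pi * \<i> * (faber_coeff l a b x - (\<Sum>p\<in>Z. faber_pole l a b p)))) (circlepath 0 r)"
    using has_contour_integral_integral ci by metis
  have "norm (of_real r :: complex) = r" using r by simp
  hence B0: "B \<ge> 0" using order_trans[OF norm_ge_zero B] by blast
  define W where "W = faber_coeff l a b x - (\<Sum>p\<in>Z. faber_pole l a b p)"
  have "norm (2 * pi * \<i> * W) \<le> B * (2 * pi * r)"
    unfolding W_def by (rule has_contour_integral_bound_circlepath[OF hci B0 r(1)]) (use B in simp)
  moreover have "norm (2 * pi * \<i> * W) = 2 * pi * norm W" by (simp add: norm_mult)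
  ultimately have "2 * pi * norm W \<le> 2 * pi * (B * r)" by (simp add: mult_ac)
  hence "norm W \<le> B * r" by (subst (asm) mult_le_cancel_left_pos) auto
  thus ?thesis by (simp only: W_def)
qed

subsection \<open>Numerical estimates\<close>

text \<open>Rational bounds: the integer part of the exponent becomes a power of 2.718, the rest a
  quadratic Taylor polynomial.\<close>

lemma exp_lower:
  fixes t s :: real
  assumes "0 \<le> t" "real n + t \<le> s"
  shows "2.718 ^ n * (1 + t + t ^ 2 / 2) \<le> exp s"
proof -
  have e: "exp (1 :: real) \<ge> 2.718" using e_approx_32 by (simp add: abs_if split: if_splits)
  have "2.718 ^ n * (1 + t + t ^ 2 / 2) \<le> exp 1 ^ n * exp t"
    using assms exp_lower_Taylor_quadratic[of t] by (intro mult_mono power_mono e) auto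
  also have "\<dots> = exp (real n + t)" by (simp add: exp_add flip: exp_of_nat_mult)
  also have "\<dots> \<le> exp s" using assms by simp
  finally show ?thesis .
qed

text \<open>The exponent is rounded up to \<open>n\<close> and the excess \<open>t\<close> divided
  out, so that again a lower Taylor bound is what enters.\<close>

lemma exp_upper:
  fixes t s :: real
  assumes "0 \<le> t" "s \<le> real n - t"
  shows "exp s \<le> 2.7183 ^ n / (1 + t + t ^ 2 / 2)"
proof -
  have e: "exp (1 :: real) \<le> 2.7183" using e_approx_32 by (simp add: abs_if split: if_splits)
  have p: "1 + t + t ^ 2 / 2 > 0" using assms by (intro add_pos_nonneg) auto
  have "exp s \<le> exp (real n - t)" using assms by simp
  also have "\<dots> = exp 1 ^ n / exp t" by (simp add: exp_diff flip: exp_of_nat_mult)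
  also have "\<dots> \<le> 2.7183 ^ n / (1 + t + t ^ 2 / 2)"
    using assms exp_lower_Taylor_quadratic[of t] p by (intro frac_le power_mono e) auto
  finally show ?thesis .
qed

lemma two_pi_bounds: "6.28318 \<le> 2 * pi" "2 * pi \<le> 6.2832"
  using pi_approx by auto

lemma norm_qpar_upper:
  assumes "0 \<le> t" "real n + t \<le> 6.28318 * Im \<tau>" "Im \<tau> > 0"
  shows "norm (qpar \<tau>) \<le> 1 / (2.718 ^ n * (1 + t + t ^ 2 / 2))"
proof -
  have "6.28318 * Im \<tau> \<le> 2 * pi * Im \<tau>" using assms two_pi_bounds by (intro mult_right_mono) auto
  hence "real n + t \<le> 2 * pi * Im \<tau>" using assms by linarith
  hence "2.718 ^ n * (1 + t + t ^ 2 / 2) \<le> exp (2 * pi * Im \<tau>)" by (rule exp_lower[OF assms(1)])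
  moreover have "0 < 2.718 ^ n * (1 + t + t ^ 2 / 2)" using assms by (intro mult_pos_pos add_pos_nonneg) auto
  ultimately have "1 / exp (2 * pi * Im \<tau>) \<le> 1 / (2.718 ^ n * (1 + t + t ^ 2 / 2))" by (intro divide_left_mono) auto
  thus ?thesis by (simp add: norm_qpar exp_minus inverse_eq_divide)
qed

lemma norm_qpar_lower:
  assumes "0 \<le> t" "6.2832 * Im \<tau> \<le> real n - t" "Im \<tau> > 0"
  shows "norm (qpar \<tau>) \<ge> (1 + t + t ^ 2 / 2) / 2.7183 ^ n"
proof -
  have "2 * pi * Im \<tau> \<le> 6.2832 * Im \<tau>" using assms two_pi_bounds by (intro mult_right_mono) auto
  hence "2 * pi * Im \<tau> \<le> real n - t" using assms by linarith
  hence "exp (2 * pi * Im \<tau>) \<le> 2.7183 ^ n / (1 + t + t ^ 2 / 2)" by (rule exp_upper[OF assms(1)])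
  moreover have "0 < 1 + t + t ^ 2 / 2" using assms by (intro add_pos_nonneg) auto
  ultimately have "1 / (2.7183 ^ n / (1 + t + t ^ 2 / 2)) \<le> 1 / exp (2 * pi * Im \<tau>)" by (intro divide_left_mono) auto
  thus ?thesis by (simp add: norm_qpar exp_minus inverse_eq_divide)
qed

lemma norm_E4_le:
  assumes "norm q \<le> r" "r \<le> 1/20"
  shows "norm (eval_fps E4 q) \<le> 1 + 240 * r + 2160 * r ^ 2 + 6720 * r ^ 3 / (1 - 10 * r)"
proof -
  have "norm (eval_fps E4 q) \<le> norm (1 + 240 * q + 2160 * q ^ 2) + norm (eval_fps E4 q - (1 + 240 * q + 2160 * q ^ 2))"
    by (metis norm_triangle_sub)
  also have "norm (1 + 240 * q + 2160 * q ^ 2) \<le> norm (1 :: complex) + norm (240 * q) + norm (2160 * q ^ 2)"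
    by (intro norm_triangle_le add_mono norm_triangle_ineq) auto
  also have "\<dots> \<le> 1 + 240 * r + 2160 * r ^ 2"
    using assms by (auto simp: norm_mult norm_power intro!: add_mono power_mono)
  finally show ?thesis using E4_approx[OF assms] by linarith
qed

lemma norm_E6_le:
  assumes "norm q \<le> r" "r \<le> 1/20"
  shows "norm (eval_fps E6 q) \<le> 1 + 504 * r + 16632 * r ^ 2 + 122976 * r ^ 3 / (1 - 17 * r)"
proof -
  have "norm (eval_fps E6 q) \<le> norm (1 - 504 * q - 16632 * q ^ 2) + norm (eval_fps E6 q - (1 - 504 * q - 16632 * q ^ 2))"
    by (metis norm_triangle_sub)
  also have "norm (1 - 504 * q - 16632 * q ^ 2) \<le> norm (1 - 504 * q) + norm (16632 * q ^ 2)" by (rule norm_triangle_ineq4)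
  also have "norm (1 - 504 * q) \<le> norm (1 :: complex) + norm (504 * q)" by (rule norm_triangle_ineq4)
  also have "norm (1 :: complex) + norm (504 * q) + norm (16632 * q ^ 2) \<le> 1 + 504 * r + 16632 * r ^ 2"
    using assms by (auto simp: norm_mult norm_power intro!: add_mono power_mono)
  finally show ?thesis using E6_approx[OF assms] by linarith
qed

text \<open>9/2000 bounds |q| on the fundamental domain, and 0.0024 bounds it at height 0.966, below
  which the inverted contours do not descend.\<close>

lemma E4_E6_caps:
  "norm q \<le> 9/2000 \<Longrightarrow> norm (eval_fps E4 q) \<le> 2.13" "norm q \<le> 9/2000 \<Longrightarrow> norm (eval_fps E6 q) \<le> 3.63"
  "norm q \<le> 0.0024 \<Longrightarrow> norm (eval_fps E4 q) \<le> 1.6" "norm q \<le> 0.0024 \<Longrightarrow> norm (eval_fps E6 q) \<le> 2.4"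
  using norm_E4_le[of q "9/2000"] norm_E6_le[of q "9/2000"] norm_E4_le[of q "0.0024"] norm_E6_le[of q "0.0024"]
  by (simp_all add: power2_eq_square power3_eq_cube)

section \<open>Polynomial approximations of Delta and jpoly\<close>

lemma norm_poly3_le:
  fixes q :: complex and c0 c1 c2 c3 :: real
  assumes "norm q \<le> r" "0 \<le> c0" "0 \<le> c1" "0 \<le> c2" "0 \<le> c3"
  shows "norm (of_real c0 + of_real c1 * q + of_real c2 * q ^ 2 + of_real c3 * q ^ 3) \<le> c0 + c1 * r + c2 * r ^ 2 + c3 * r ^ 3"
proof -
  have "norm (of_real c0 + of_real c1 * q + of_real c2 * q ^ 2 + of_real c3 * q ^ 3) \<le>
    norm (of_real c0 :: complex) + norm (of_real c1 * q) + norm (of_real c2 * q ^ 2) + norm (of_real c3 * q ^ 3)"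
    by (intro norm_triangle_le add_mono norm_triangle_ineq) auto
  also have "\<dots> \<le> c0 + c1 * r + c2 * r ^ 2 + c3 * r ^ 3"
    using assms by (auto simp: norm_mult norm_power intro!: add_mono mult_left_mono power_mono)
  finally show ?thesis .
qed

lemma E4_cube_E6_square_approx:
  assumes q: "norm q \<le> 9/2000"
  shows "norm (eval_fps E4 q ^ 3 - (1 + 240 * q + 2160 * q ^ 2) ^ 3) \<le> 95900 * norm q ^ 3"
    and "norm (eval_fps E6 q ^ 2 - (1 - 504 * q - 16632 * q ^ 2) ^ 2) \<le> 967100 * norm q ^ 3"
proof -
  define e4 p4 e6 p6 where "e4 = eval_fps E4 q" and "p4 = 1 + 240 * q + 2160 * q ^ 2"
    and "e6 = eval_fps E6 q" and "p6 = 1 - 504 * q - 16632 * q ^ 2"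
  have r0: "norm q ^ 3 \<ge> 0" by simp
  have d4: "norm (e4 - p4) \<le> 7040 * norm q ^ 3"
  proof -
    have "norm (e4 - p4) \<le> 6720 * norm q ^ 3 / (1 - 10 * norm q)"
      unfolding e4_def p4_def by (rule E4_approx) (use q in auto)
    also have "\<dots> \<le> 6720 * norm q ^ 3 / (1 - 10 * (9/2000))"
      using q by (intro divide_left_mono) auto
    also have "\<dots> \<le> 7040 * norm q ^ 3" using r0 by simp
    finally show ?thesis .
  qed
  have d6: "norm (e6 - p6) \<le> 133200 * norm q ^ 3"
  proof -
    have "norm (e6 - p6) \<le> 122976 * norm q ^ 3 / (1 - 17 * norm q)"
      unfolding e6_def p6_def by (rule E6_approx) (use q in auto)
    also have "\<dots> \<le> 122976 * norm q ^ 3 / (1 - 17 * (9/2000))"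
      using q by (intro divide_left_mono) auto
    also have "\<dots> \<le> 133200 * norm q ^ 3" using r0 by simp
    finally show ?thesis .
  qed
  have n4: "norm e4 \<le> 2.13" unfolding e4_def by (rule E4_E6_caps(1)[OF q])
  have n6: "norm e6 \<le> 3.63" unfolding e6_def by (rule E4_E6_caps(2)[OF q])
  have np4: "norm p4 \<le> 2.13"
  proof -
    have "norm p4 \<le> 1 + 240 * (9/2000) + 2160 * (9/2000) ^ 2 + 0 * (9/2000) ^ 3"
      using norm_poly3_le[OF q, of 1 240 2160 0] by (simp add: p4_def)
    thus ?thesis by (simp add: power2_eq_square)
  qed
  have np6: "norm p6 \<le> 3.63"
  proof -
    have "norm p6 \<le> norm (1 :: complex) + norm (504 * q) + norm (16632 * q ^ 2)"
      unfolding p6_def by (intro order_trans[OF norm_triangle_ineq4] add_mono norm_triangle_ineq4) auto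
    also have "\<dots> \<le> 1 + 504 * (9/2000) + 16632 * (9/2000) ^ 2"
      unfolding norm_mult norm_power using q by (intro add_mono mult_mono power_mono) auto
    finally show ?thesis by (simp add: power2_eq_square)
  qed
  have "e4 ^ 3 - p4 ^ 3 = (e4 - p4) * (e4 * e4 + e4 * p4 + p4 * p4)"
    by (simp add: algebra_simps power3_eq_cube)
  also have "norm \<dots> \<le> (7040 * norm q ^ 3) * (2.13 * 2.13 + 2.13 * 2.13 + 2.13 * 2.13)"
    unfolding norm_mult[of "e4 - p4"]
  proof (intro mult_mono d4)
    have "norm (e4 * e4 + e4 * p4 + p4 * p4) \<le> norm (e4 * e4) + norm (e4 * p4) + norm (p4 * p4)"
      by (intro norm_triangle_le add_mono norm_triangle_ineq) auto
    also have "\<dots> \<le> 2.13 * 2.13 + 2.13 * 2.13 + 2.13 * 2.13"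
      unfolding norm_mult by (intro add_mono mult_mono n4 np4) auto
    finally show "norm (e4 * e4 + e4 * p4 + p4 * p4) \<le> 2.13 * 2.13 + 2.13 * 2.13 + 2.13 * 2.13" .
  qed auto
  also have "\<dots> \<le> 95900 * norm q ^ 3" using r0 by simp
  finally show "norm (eval_fps E4 q ^ 3 - (1 + 240 * q + 2160 * q ^ 2) ^ 3) \<le> 95900 * norm q ^ 3"
    by (simp only: e4_def p4_def)
  have "e6 ^ 2 - p6 ^ 2 = (e6 - p6) * (e6 + p6)" by (simp add: algebra_simps power2_eq_square)
  also have "norm \<dots> \<le> (133200 * norm q ^ 3) * (3.63 + 3.63)"
    unfolding norm_mult using n6 np6 by (intro mult_mono d6 norm_triangle_le) auto
  also have "\<dots> \<le> 967100 * norm q ^ 3" using r0 by simp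
  finally show "norm (eval_fps E6 q ^ 2 - (1 - 504 * q - 16632 * q ^ 2) ^ 2) \<le> 967100 * norm q ^ 3"
    by (simp only: e6_def p6_def)
qed

lemma poly_expansions:
  fixes q :: complex
  shows "(1 + 240 * q + 2160 * q ^ 2) ^ 3 = 1 + 720 * q + 179280 * q ^ 2 +
           q ^ 3 * (16934400 + 387244800 * q + 3359232000 * q ^ 2 + 10077696000 * q ^ 3)"
    and "(1 - 504 * q - 16632 * q ^ 2) ^ 2 = 1 - 1008 * q + 220752 * q ^ 2 + q ^ 3 * (16765056 + 276623424 * q)"
  by (simp_all add: algebra_simps power2_eq_square power3_eq_cube)

text \<open>With s = x / 1728, jpoly is the convex combination (1 - s) E4^3 + s E6^2, so a cubic
  error bound common to E4^3 and E6^2 holds uniformly in x.\<close>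

lemma jpoly_approx:
  assumes q: "norm q \<le> 9/2000" and x: "0 \<le> x" "x \<le> 1728"
  shows "norm (eval_fps (jpoly (of_real x)) q - (1 + of_real (720 - x) * q + of_real (179280 + 24 * x) * q ^ 2)) \<le> 20000000 * norm q ^ 3"
proof -
  have q1: "norm q < 1" using q by simp
  define s where "s = x / 1728"
  have s: "0 \<le> s" "s \<le> 1" "x = 1728 * s" using x by (auto simp: s_def)
  define A where "A = eval_fps E4 q ^ 3 - (1 + 720 * q + 179280 * q ^ 2)"
  define B where "B = eval_fps E6 q ^ 2 - (1 - 1008 * q + 220752 * q ^ 2)"
  have A: "norm A \<le> 20000000 * norm q ^ 3"
  proof -
    define P where "P = 16934400 + 387244800 * q + 3359232000 * q ^ 2 + 10077696000 * q ^ 3"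
    have "norm P \<le> 16934400 + 387244800 * (9/2000) + 3359232000 * (9/2000) ^ 2 + 10077696000 * (9/2000) ^ 3"
      using norm_poly3_le[OF q, of 16934400 387244800 3359232000 10077696000] by (simp add: P_def)
    hence P: "norm P \<le> 18750000" by (simp add: power2_eq_square power3_eq_cube)
    have "A = (eval_fps E4 q ^ 3 - (1 + 240 * q + 2160 * q ^ 2) ^ 3) + q ^ 3 * P"
      unfolding A_def P_def poly_expansions by simp
    also have "norm \<dots> \<le> 95900 * norm q ^ 3 + norm q ^ 3 * 18750000"
      by (intro norm_triangle_le add_mono E4_cube_E6_square_approx q) (auto simp: norm_mult norm_power intro!: mult_left_mono P)
    also have "\<dots> \<le> 20000000 * norm q ^ 3" by simp
    finally show ?thesis .
  qed
  have B: "norm B \<le> 20000000 * norm q ^ 3"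
  proof -
    define P where "P = 16765056 + 276623424 * q"
    have "norm P \<le> 16765056 + 276623424 * (9/2000) + 0 * (9/2000) ^ 2 + 0 * (9/2000) ^ 3"
      using norm_poly3_le[OF q, of 16765056 276623424 0 0] by (simp add: P_def)
    hence P: "norm P \<le> 18100000" by simp
    have "B = (eval_fps E6 q ^ 2 - (1 - 504 * q - 16632 * q ^ 2) ^ 2) + q ^ 3 * P"
      unfolding B_def P_def poly_expansions by simp
    also have "norm \<dots> \<le> 967100 * norm q ^ 3 + norm q ^ 3 * 18100000"
      by (intro norm_triangle_le add_mono E4_cube_E6_square_approx q) (auto simp: norm_mult norm_power intro!: mult_left_mono P)
    also have "\<dots> \<le> 20000000 * norm q ^ 3" by simp
    finally show ?thesis .
  qed
  have D: "eval_fps E6 q ^ 2 = eval_fps E4 q ^ 3 - 1728 * eval_fps Delta q"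
    using eval_fps_Delta[OF q1] by simp
  have "eval_fps (jpoly (of_real x)) q = of_real (1 - s) * eval_fps E4 q ^ 3 + of_real s * eval_fps E6 q ^ 2"
    unfolding eval_jpoly[OF q1] D s(3) by (simp add: algebra_simps)
  hence "eval_fps (jpoly (of_real x)) q - (1 + of_real (720 - x) * q + of_real (179280 + 24 * x) * q ^ 2)
        = of_real (1 - s) * A + of_real s * B"
    unfolding A_def B_def s(3) by (simp add: algebra_simps)
  also have "norm \<dots> \<le> norm (of_real (1 - s) * A) + norm (of_real s * B)" by (rule norm_triangle_ineq)
  also have "\<dots> = (1 - s) * norm A + s * norm B" using s by (simp add: norm_mult del: of_real_diff)
  also have "\<dots> \<le> (1 - s) * (20000000 * norm q ^ 3) + s * (20000000 * norm q ^ 3)"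
    using s by (intro add_mono mult_left_mono A B) auto
  also have "\<dots> = 20000000 * norm q ^ 3" by (simp add: algebra_simps)
  finally show ?thesis .
qed

text \<open>The difference is governed by the coefficient -24 of q^2, seen as 41472 = 24 * 1728; the
  excess of 29 over 24 pays for the cubic terms.\<close>

lemma Delta_approx:
  assumes q: "norm q \<le> 9/2000"
  shows "norm (eval_fps Delta q - q) \<le> 29 * norm q ^ 2"
proof -
  have q1: "norm q < 1" using q by simp
  define P where "P = 169344 + 110621376 * q + 3359232000 * q ^ 2 + 10077696000 * q ^ 3"
  have "norm P \<le> 169344 + 110621376 * (9/2000) + 3359232000 * (9/2000) ^ 2 + 10077696000 * (9/2000) ^ 3"
    using norm_poly3_le[OF q, of 169344 110621376 3359232000 10077696000] by (simp add: P_def)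
  hence P: "norm P \<le> 737000" by (simp add: power2_eq_square power3_eq_cube)
  have q3: "norm q ^ 3 \<le> 9/2000 * norm q ^ 2"
    using mult_right_mono[OF q, of "norm q ^ 2"] by (simp add: power3_eq_cube power2_eq_square mult.assoc)
  have "1728 * (eval_fps Delta q - q) = (eval_fps E4 q ^ 3 - (1 + 240 * q + 2160 * q ^ 2) ^ 3)
      - (eval_fps E6 q ^ 2 - (1 - 504 * q - 16632 * q ^ 2) ^ 2) + (q ^ 3 * P - 41472 * q ^ 2)"
    unfolding right_diff_distrib eval_fps_Delta[OF q1] poly_expansions P_def by (simp add: algebra_simps)
  also have "norm \<dots> \<le> (95900 * norm q ^ 3 + 967100 * norm q ^ 3) + (norm q ^ 3 * 737000 + 41472 * norm q ^ 2)"
    by (intro order_trans[OF norm_triangle_ineq] add_mono order_trans[OF norm_triangle_ineq4] E4_cube_E6_square_approx q)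
       (auto simp: norm_mult norm_power intro!: mult_left_mono P)
  also have "\<dots> \<le> 1728 * (29 * norm q ^ 2)" using q3 zero_le_power2[of "norm q"] by linarith
  finally have "1728 * norm (eval_fps Delta q - q) \<le> 1728 * (29 * norm q ^ 2)"
    by (simp only: norm_mult norm_numeral)
  thus ?thesis by simp
qed

lemma Delta_bounds:
  "norm q \<le> 9/2000 \<Longrightarrow> norm (eval_fps Delta q) \<le> 0.0051"
  "norm q \<le> 0.0024 \<Longrightarrow> norm (eval_fps Delta q) \<ge> 0.93 * norm q"
proof -
  assume q: "norm q \<le> 9/2000"
  have "norm (eval_fps Delta q) \<le> norm q + norm (eval_fps Delta q - q)" by (metis norm_triangle_sub)
  also have "\<dots> \<le> 9/2000 + 29 * (9/2000) ^ 2"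
    by (intro add_mono q order_trans[OF Delta_approx[OF q] mult_left_mono[OF power_mono[OF q norm_ge_zero]]]) simp
  finally show "norm (eval_fps Delta q) \<le> 0.0051" by (simp add: power2_eq_square)
next
  assume q: "norm q \<le> 0.0024"
  have "norm q \<le> norm (eval_fps Delta q) + norm (eval_fps Delta q - q)"
    by (metis norm_minus_commute norm_triangle_sub)
  also have "norm (eval_fps Delta q - q) \<le> 29 * norm q ^ 2" by (rule Delta_approx) (use q in simp)
  also have "norm q ^ 2 \<le> 3/1250 * norm q" using mult_right_mono[OF q, of "norm q"] by (simp add: power2_eq_square)
  finally have "93/100 * norm q \<le> norm (eval_fps Delta q)" using norm_ge_zero[of q] by linarith
  thus "norm (eval_fps Delta q) \<ge> 0.93 * norm q" by simp
qed

lemma jpoly_lower_small_q: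
  assumes q: "norm q \<le> r" "r \<le> 9/2000" and x: "0 \<le> x" "x \<le> 1728" and m: "\<bar>720 - x\<bar> \<le> m"
  shows "norm (eval_fps (jpoly (of_real x)) q) \<ge> 1 - m * r - 220752 * r ^ 2 - 20000000 * r ^ 3"
proof -
  have q': "norm q \<le> 9/2000" using q by simp
  have r: "0 \<le> r" using q(1) norm_ge_zero order_trans by blast
  define J where "J = eval_fps (jpoly (of_real x)) q"
  define Q where "Q = 1 + of_real (720 - x) * q + of_real (179280 + 24 * x) * q ^ 2"
  have "1 = Q - of_real (720 - x) * q - of_real (179280 + 24 * x) * q ^ 2" by (simp add: Q_def)
  hence "1 = norm (Q - of_real (720 - x) * q - of_real (179280 + 24 * x) * q ^ 2)" by (metis norm_one)
  also have "\<dots> \<le> norm Q + norm (of_real (720 - x) * q) + norm (of_real (179280 + 24 * x) * q ^ 2)"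
    by (intro order_trans[OF norm_triangle_ineq4] add_mono norm_triangle_ineq4) auto
  also have "norm (of_real (720 - x) * q) \<le> m * r"
    using m q r by (simp only: norm_mult norm_of_real) (intro mult_mono, auto)
  also have "norm (of_real (179280 + 24 * x) * q ^ 2) \<le> 220752 * r ^ 2"
    using x q r by (simp only: norm_mult norm_of_real norm_power) (intro mult_mono power_mono, auto)
  also have "norm Q \<le> norm J + norm (J - Q)"
    by (metis norm_minus_commute norm_triangle_sub)
  also have "norm (J - Q) \<le> 20000000 * norm q ^ 3" unfolding J_def Q_def by (rule jpoly_approx[OF q' x])
  also have "\<dots> \<le> 20000000 * r ^ 3" using q by (intro mult_left_mono power_mono) auto
  finally show ?thesis by (simp add: J_def)
qed

text \<open>Divide by q: Re (1/q), (179280 + 24 x) Re q and 720 - x \<le> -580 all have the same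
  sign, so nothing cancels.\<close>

lemma jpoly_lower_neg:
  assumes q: "norm q \<le> 9/2000" "q \<noteq> 0" "Re q \<le> 0" and x: "1300 \<le> x" "x \<le> 1728"
  shows "norm (eval_fps (jpoly (of_real x)) q) \<ge> norm q * (580 - 20000000 * norm q ^ 2)"
proof -
  define J where "J = eval_fps (jpoly (of_real x)) q"
  define Q where "Q = 1 + of_real (720 - x) * q + of_real (179280 + 24 * x) * q ^ 2"
  have JQ: "norm (J - Q) \<le> 20000000 * norm q ^ 3" unfolding J_def Q_def by (rule jpoly_approx) (use q x in auto)
  have "Q / q = inverse q + of_real (720 - x) + of_real (179280 + 24 * x) * q"
    using q by (simp add: Q_def add_divide_distrib power2_eq_square inverse_eq_divide)
  hence "Re (Q / q) = Re (inverse q) + (720 - x) + (179280 + 24 * x) * Re q" by simp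
  moreover have "Re (inverse q) \<le> 0" using q by (simp add: divide_nonpos_nonneg)
  moreover have "(179280 + 24 * x) * Re q \<le> 0" using q x by (intro mult_nonneg_nonpos) auto
  ultimately have "580 \<le> - Re (Q / q)" using x by linarith
  also have "\<dots> \<le> norm (Q / q)" by (metis abs_Re_le_cmod abs_le_D2)
  finally have "580 * norm q \<le> norm Q" using q by (simp add: norm_divide field_simps)
  also have "norm Q \<le> norm J + norm (J - Q)" by (metis norm_minus_commute norm_triangle_sub)
  finally have "580 * norm q \<le> norm J + 20000000 * norm q ^ 3" using JQ by linarith
  thus ?thesis by (simp add: J_def algebra_simps power2_eq_square power3_eq_cube)
qed

lemma Re_qpar: "Re (qpar w) = norm (qpar w) * cos (2 * pi * Re w)"
proof -
  have "qpar w = exp (of_real (- (2 * pi * Im w)) + \<i> * of_real (2 * pi * Re w))"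
    unfolding qpar_def by (rule arg_cong[of _ _ exp]) (simp add: complex_eq_iff)
  thus ?thesis unfolding norm_qpar by (simp add: exp_add Re_exp)
qed

text \<open>The inverted contour of height 1/2 is the circle |w - i| = 1. Above height 1.2 the
  constant term 1 prevails. Below, Re w is close to 1 or -1, q is nearly a positive real r, and the
  value is close to a quadratic in r. The restriction x \<le> 1300 keeps its linear coefficient
  above -580 and its discriminant negative.\<close>

lemma jpoly_lower_I:
  assumes w: "1 \<le> Im w" "Im w \<le> 2" "Re w ^ 2 = 2 * Im w - Im w ^ 2" and x: "0 \<le> x" "x \<le> 1300"
  shows "norm (eval_fps (jpoly (of_real x)) (qpar w)) \<ge> 0.36"
proof (cases "Im w \<ge> 1.2")
  case True
  have "norm (qpar w) \<le> 1 / (2.718 ^ 7 * (1 + 0.539 + 0.539 ^ 2 / 2))"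
    by (rule norm_qpar_upper) (use True in auto)
  also have "\<dots> \<le> 0.00055" by (simp add: power2_eq_square eval_nat_numeral)
  finally have "norm (eval_fps (jpoly (of_real x)) (qpar w)) \<ge> 1 - 720 * 0.00055 - 220752 * 0.00055 ^ 2 - 20000000 * 0.00055 ^ 3"
    using x by (intro jpoly_lower_small_q) auto
  thus ?thesis by (simp add: power2_eq_square power3_eq_cube)
next
  case False
  define q where "q = qpar w"
  define r where "r = norm q"
  define c where "c = Re q"
  have r: "0 < r" by (simp add: r_def q_def)
  have "r \<le> 1 / (2.718 ^ 6 * (1 + 0.283 + 0.283 ^ 2 / 2))"
    unfolding r_def q_def by (rule norm_qpar_upper) (use w in auto)
  also have "\<dots> \<le> 0.0019" by (simp add: power2_eq_square eval_nat_numeral)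
  finally have r19: "r \<le> 0.0019" .
  have cosb: "cos (2 * pi * Re w) \<ge> 0.99"
  proof -
    define u where "u = \<bar>Re w\<bar>"
    \<comment> \<open>The roots 1.2 and 0.8 are symmetric about 1, so this says 2 Im w - (Im w)^2
      \<ge> 0.96.\<close>
    have "0 \<le> (1.2 - Im w) * (Im w - 0.8)" using False w by (intro mult_nonneg_nonneg) auto
    hence "0.96 \<le> Re w ^ 2" unfolding w(3) by (simp add: algebra_simps power2_eq_square)
    hence "0.9797 ^ 2 \<le> u ^ 2" by (simp add: u_def power2_eq_square)
    hence u: "0.9797 \<le> u" by (rule power2_le_imp_le) (simp add: u_def)
    have "0 \<le> (Im w - 1) ^ 2" by simp
    hence "u ^ 2 \<le> 1 ^ 2" unfolding u_def using w(3) by (simp add: power2_eq_square algebra_simps)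
    hence u1: "u \<le> 1" by (rule power2_le_imp_le) simp
    have "cos (2 * pi * Re w) = cos (2 * pi * u)"
      by (cases "Re w \<ge> 0") (auto simp: u_def)
    also have "\<dots> = cos (2 * pi * (1 - u))" by (simp add: right_diff_distrib cos_diff)
    also have "\<dots> = 1 - 2 * sin (pi * (1 - u)) ^ 2" using cos_double_sin[of "pi * (1 - u)"] by (simp add: mult_ac)
    finally have eq: "cos (2 * pi * Re w) = 1 - 2 * sin (pi * (1 - u)) ^ 2" .
    have "\<bar>sin (pi * (1 - u))\<bar> \<le> \<bar>pi * (1 - u)\<bar>" by (rule abs_sin_x_le_abs_x)
    also have "\<dots> = pi * (1 - u)" using u1 by simp
    also have "\<dots> \<le> 3.1416 * 0.0203" using u u1 pi_approx by (intro mult_mono) auto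
    finally have "\<bar>sin (pi * (1 - u))\<bar> ^ 2 \<le> (3.1416 * 0.0203) ^ 2" by (intro power_mono) auto
    thus ?thesis unfolding eq by (simp add: power2_eq_square)
  qed
  have c: "0.99 * r \<le> c" "c \<le> r"
    using cosb r cos_le_one[of "2 * pi * Re w"] unfolding c_def r_def q_def Re_qpar by auto
  have c2: "Re (q ^ 2) \<ge> 0.96 * r ^ 2"
  proof -
    have "r ^ 2 = Re q ^ 2 + Im q ^ 2" by (simp add: r_def cmod_power2)
    hence "Re (q ^ 2) = 2 * c ^ 2 - r ^ 2" by (simp add: c_def power2_eq_square)
    moreover have "(0.99 * r) ^ 2 \<le> c ^ 2" using c r by (intro power_mono) auto
    hence "9801/10000 * r ^ 2 \<le> c ^ 2" by (simp add: power_mult_distrib power2_eq_square)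
    moreover have "0 \<le> r ^ 2" by simp
    ultimately have "24/25 * r ^ 2 \<le> Re (q ^ 2)" by linarith
    thus ?thesis by simp
  qed
  define J where "J = eval_fps (jpoly (of_real x)) q"
  define Q where "Q = 1 + of_real (720 - x) * q + of_real (179280 + 24 * x) * q ^ 2"
  have JQ: "norm (J - Q) \<le> 20000000 * r ^ 3" unfolding J_def Q_def r_def
    by (rule jpoly_approx) (use r19 x in \<open>auto simp: r_def\<close>)
  have "Re Q = 1 + (720 - x) * c + (179280 + 24 * x) * Re (q ^ 2)" by (simp add: Q_def c_def)
  moreover have "(720 - x) * c \<ge> - 580 * c" using x c r by (intro mult_right_mono) auto
  moreover have "(179280 + 24 * x) * Re (q ^ 2) \<ge> 179280 * (0.96 * r ^ 2)"
    using c2 x by (intro mult_mono) auto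
  ultimately have "Re Q \<ge> 1 - 580 * r + 172108.8 * r ^ 2" using c by simp
  moreover have "20000000 * r ^ 3 \<le> 38000 * r ^ 2"
    using r19 mult_right_mono[OF r19, of "r ^ 2"] by (simp add: power2_eq_square power3_eq_cube)
  moreover have "norm J \<ge> Re Q - norm (J - Q)"
    using abs_Re_le_cmod[of J] abs_Re_le_cmod[of "J - Q"] by (simp add: abs_le_iff)
  ultimately have "norm J \<ge> 1 - 580 * r + 134108 * r ^ 2" using JQ zero_le_power2[of r] by linarith
  moreover have "1 - 580 * r + 134108 * r ^ 2 \<ge> 0.36"
  proof -
    \<comment> \<open>0.00216 is close to 290 / 134108, where the quadratic is smallest.\<close>
    have "0 \<le> 134108 * (r - 0.00216) ^ 2" by simp
    thus ?thesis using r r19 by (simp add: power2_eq_square algebra_simps)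
  qed
  ultimately show ?thesis by (simp add: J_def q_def)
qed

lemma cos_nonpos_quarter:
  assumes "1/4 \<le> \<bar>u\<bar>" "\<bar>u\<bar> \<le> 3/4"
  shows "cos (2 * pi * u) \<le> 0"
proof -
  have "cos (2 * pi * u) = cos (2 * pi * \<bar>u\<bar>)" by (cases "u \<ge> 0") auto
  also have "\<dots> = - cos (2 * pi * \<bar>u\<bar> - pi)" by (simp add: cos_diff)
  finally have "cos (2 * pi * u) = - cos (2 * pi * \<bar>u\<bar> - pi)" .
  moreover have "cos (2 * pi * \<bar>u\<bar> - pi) \<ge> 0"
  proof (rule cos_ge_zero)
    have "2 * pi * (1/4) \<le> 2 * pi * \<bar>u\<bar>" using assms by (intro mult_left_mono) auto
    thus "- (pi / 2) \<le> 2 * pi * \<bar>u\<bar> - pi" by linarith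
    have "2 * pi * \<bar>u\<bar> \<le> 2 * pi * (3/4)" using assms by (intro mult_left_mono) auto
    thus "2 * pi * \<bar>u\<bar> - pi \<le> pi / 2" by linarith
  qed
  ultimately show ?thesis by linarith
qed

text \<open>The inverted contour of height 13/20 is the circle of radius 10/13 about 10 i / 13.
  Above height 1.3 the constant term prevails; below, 1/4 \<le> |Re w| \<le> 3/4 makes Re q \<le> 0,
  and \<open>jpoly_lower_neg\<close> gives 0.00026 * 464 > 0.12.\<close>

lemma jpoly_lower_II:
  assumes w: "0.966 \<le> Im w" "Im w \<le> 20/13" "Re w ^ 2 = 20/13 * Im w - Im w ^ 2" and x: "1300 \<le> x" "x \<le> 1728"
  shows "norm (eval_fps (jpoly (of_real x)) (qpar w)) \<ge> 0.12"
proof (cases "Im w \<ge> 1.3")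
  case True
  show ?thesis
  proof -
    have "norm (qpar w) \<le> 1 / (2.718 ^ 8 * (1 + 0.168 + 0.168 ^ 2 / 2))"
      by (rule norm_qpar_upper) (use True in auto)
    also have "\<dots> \<le> 0.0003" by (simp add: power2_eq_square eval_nat_numeral)
    finally have "norm (eval_fps (jpoly (of_real x)) (qpar w)) \<ge> 1 - 1008 * 0.0003 - 220752 * 0.0003 ^ 2 - 20000000 * 0.0003 ^ 3"
      using x by (intro jpoly_lower_small_q) auto
    thus ?thesis by (simp add: power2_eq_square power3_eq_cube)
  qed
next
  case False
  define q where "q = qpar w"
  have "norm q \<le> 1 / (2.718 ^ 6 * (1 + 0.069 + 0.069 ^ 2 / 2))"
    unfolding q_def by (rule norm_qpar_upper) (use w in auto)
  also have "\<dots> \<le> 0.0024" by (simp add: power2_eq_square eval_nat_numeral)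
  finally have r24: "norm q \<le> 0.0024" .
  have "norm q \<ge> (1 + 0.83 + 0.83 ^ 2 / 2) / 2.7183 ^ 9"
    unfolding q_def by (rule norm_qpar_lower) (use False w in auto)
  moreover have "(1 + 0.83 + 0.83 ^ 2 / 2) / 2.7183 ^ 9 \<ge> (0.00026 :: real)"
    by (simp add: power2_eq_square eval_nat_numeral)
  ultimately have r27: "norm q \<ge> 0.00026" by linarith
  have "Re q \<le> 0"
  proof -
    \<comment> \<open>Such products bound (Re w)^2 = 20/13 Im w - (Im w)^2 below by 1/16, as far as
      height 1.3, and above by 9/16, from height 0.966 on.\<close>
    have "0 \<le> (Im w - 0.966) * (1.3 - Im w)" using False w by (intro mult_nonneg_nonneg) auto
    moreover have "(Im w - 0.966) * (1.3 - Im w) = 1133/500 * Im w - Im w ^ 2 - 6279/5000"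
      by (simp add: field_simps power2_eq_square)
    ultimately have "Im w ^ 2 \<le> 1133/500 * Im w - 6279/5000" by linarith
    hence "1/16 \<le> Re w ^ 2" unfolding w(3) using False by simp
    hence "(1/4) ^ 2 \<le> Re w ^ 2" by (simp add: power2_eq_square)
    hence lo: "1/4 \<le> \<bar>Re w\<bar>" by (simp add: abs_le_square_iff [symmetric])
    have "0 \<le> (Im w - 0.966) * (Im w - (20/13 - 0.966))" using w by (intro mult_nonneg_nonneg) auto
    moreover have "(Im w - 0.966) * (Im w - (20/13 - 0.966)) = Im w ^ 2 - 20/13 * Im w + 1797243/3250000"
      by (simp add: field_simps power2_eq_square)
    ultimately have "Re w ^ 2 \<le> (3/4) ^ 2" unfolding w(3) by (simp add: power2_eq_square)
    hence "\<bar>Re w\<bar> \<le> 3/4" by (simp add: abs_le_square_iff [symmetric])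
    with lo have "cos (2 * pi * Re w) \<le> 0" by (rule cos_nonpos_quarter)
    thus ?thesis unfolding q_def Re_qpar by (intro mult_nonneg_nonpos) auto
  qed
  hence "norm (eval_fps (jpoly (of_real x)) q) \<ge> norm q * (580 - 20000000 * norm q ^ 2)"
    using r24 x by (intro jpoly_lower_neg) (auto simp: q_def)
  moreover have "norm q * (580 - 20000000 * norm q ^ 2) \<ge> 0.00026 * 464"
  proof (intro mult_mono r27)
    have "norm q ^ 2 \<le> 0.0024 ^ 2" using r24 by (intro power_mono) auto
    thus "464 \<le> 580 - 20000000 * norm q ^ 2" by (simp add: power2_eq_square)
  qed auto
  ultimately show ?thesis by (simp add: q_def)
qed

subsection \<open>Estimates on the arc\<close>

lemma mform_S: "mform k F \<Longrightarrow> Im w > 0 \<Longrightarrow> eval_fps F (qpar (- 1 / w)) = w ^ k * eval_fps F (qpar w)"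
  using mform_eq[of k F 0 0 "-1" 1 w] by simp

text \<open>Take q = q(\<tau>) with Im \<tau> = h, |Re \<tau>| \<le> 1/2, and w = -1/\<tau>. On the
  contour itself |q| is too large for the Taylor estimates, whereas w has height at least h / (1/4 +
  h^2).\<close>

lemma circle_point:
  assumes q: "norm q = exp (- (2 * pi * h))" and h: "h > 0"
  obtains w where "Im w > 0" "q = qpar (- 1 / w)" "Im w = h * norm w ^ 2"
    "1 / (1/4 + h ^ 2) \<le> norm w ^ 2" "norm w ^ 2 \<le> 1 / h ^ 2"
proof -
  have "q \<noteq> 0" using q by auto
  moreover have "norm q < 1" using q h by simp
  ultimately obtain \<tau> where \<tau>: "Im \<tau> > 0" "\<bar>Re \<tau>\<bar> \<le> 1/2" "qpar \<tau> = q" by (rule qpar_surj)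
  have "exp (- (2 * pi * Im \<tau>)) = exp (- (2 * pi * h))" using q \<tau>(3) norm_qpar by metis
  hence im: "Im \<tau> = h" by simp
  define w where "w = - 1 / \<tau>"
  have n: "norm \<tau> ^ 2 = Re \<tau> ^ 2 + h ^ 2" unfolding cmod_power2 im ..
  have n0: "norm \<tau> ^ 2 > 0" using \<tau>(1) by auto
  have nw: "norm w ^ 2 = 1 / norm \<tau> ^ 2" by (simp add: w_def norm_divide power_divide)
  have w0: "\<tau> \<noteq> 0" using \<tau>(1) by auto
  have imw: "Im w = h * norm w ^ 2"
    unfolding nw unfolding w_def n by (simp add: Im_divide im)
  have "\<bar>Re \<tau>\<bar> ^ 2 \<le> (1/2) ^ 2" using \<tau>(2) by (intro power_mono) auto
  hence "norm \<tau> ^ 2 \<le> 1/4 + h ^ 2" unfolding n by (simp add: power2_eq_square)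
  hence lo: "1 / (1/4 + h ^ 2) \<le> norm w ^ 2" unfolding nw using n0 by (intro divide_left_mono) (auto intro!: mult_pos_pos add_pos_nonneg)
  have "h ^ 2 \<le> norm \<tau> ^ 2" unfolding n by simp
  hence hi: "norm w ^ 2 \<le> 1 / h ^ 2" unfolding nw using n0 h by (intro divide_left_mono) auto
  show ?thesis
  proof (rule that[of w])
    show "Im w > 0" unfolding imw nw using h n0 by simp
    show "q = qpar (- 1 / w)" using \<tau>(3) w0 by (simp add: w_def)
  qed (fact imw lo hi)+
qed

text \<open>With v = Im w one has |w|^12 |q(w)| = (v / h)^6 exp (- 2 \<pi> v), which decreases once
  v > 3 / \<pi> = 0.955. As v \<ge> 0.966, it is smallest at the top v = 1/h of the circle. The
  factor 0.93 passes from q to Delta.\<close>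

lemma Delta_lower_inversion:
  assumes h: "h > 0" and w: "Im w = h * norm w ^ 2" "0.966 \<le> Im w" "norm w ^ 2 \<le> 1 / h ^ 2"
  shows "0.93 * (exp (- (2 * pi / h)) / h ^ 12) \<le> norm w ^ 12 * norm (eval_fps Delta (qpar w))"
proof -
  define v where "v = Im w"
  have v: "0.966 \<le> v" using w by (simp add: v_def)
  have W: "norm w ^ 2 = v / h" using w h by (simp add: v_def)
  have "v / h \<le> 1 / h ^ 2" using w W by simp
  hence vh: "v \<le> 1 / h" using h by (simp add: field_simps power2_eq_square)
  have "norm (qpar w) \<le> 1 / (2.718 ^ 6 * (1 + 0.069 + 0.069 ^ 2 / 2))"
    by (rule norm_qpar_upper) (use w in auto)
  also have "\<dots> \<le> 0.0024" by (simp add: power2_eq_square eval_nat_numeral)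
  finally have D: "0.93 * norm (qpar w) \<le> norm (eval_fps Delta (qpar w))" by (rule Delta_bounds)
  \<comment> \<open>Monotonicity in v comes from 1 + t \<le> exp t with t = (1/h - v) / v, and 6 /
    0.966 \<le> 2 \<pi>.\<close>
  have "1 / (h * v) = 1 + (1 / h - v) / v" using h v by (simp add: field_simps)
  also have "\<dots> \<le> exp ((1 / h - v) / v)" by (rule exp_ge_add_one_self)
  finally have "(1 / (h * v)) ^ 6 \<le> exp ((1 / h - v) / v) ^ 6" using h v by (intro power_mono) auto
  also have "\<dots> = exp (6 / v * (1 / h - v))" by (simp flip: exp_of_nat_mult)
  also have "\<dots> \<le> exp (2 * pi * (1 / h - v))"
  proof -
    have "6 / v \<le> 6 / 0.966" using v by (intro divide_left_mono) auto
    also have "\<dots> \<le> 2 * pi" using two_pi_bounds by simp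
    finally show ?thesis unfolding exp_le_cancel_iff using vh by (intro mult_right_mono) auto
  qed
  also have "\<dots> = exp (2 * pi / h) * exp (- (2 * pi * v))" by (simp add: right_diff_distrib exp_diff exp_minus field_simps)
  finally have "1 / (h ^ 6 * v ^ 6) \<le> exp (2 * pi / h) * exp (- (2 * pi * v))" by (simp add: power_divide power_mult_distrib)
  hence "1 \<le> exp (2 * pi / h) * exp (- (2 * pi * v)) * (h ^ 6 * v ^ 6)"
    using h v by (simp add: pos_divide_le_eq)
  hence "exp (- (2 * pi / h)) / h ^ 12 * 1 \<le> exp (- (2 * pi / h)) / h ^ 12 * (exp (2 * pi / h) * exp (- (2 * pi * v)) * (h ^ 6 * v ^ 6))"
    using h by (intro mult_left_mono) auto
  also have "\<dots> = (v / h) ^ 6 * exp (- (2 * pi * v))"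
    using h power_add[of h 6 6] by (simp add: exp_minus power_divide field_simps)
  also have "\<dots> = norm w ^ 12 * norm (qpar w)"
    unfolding norm_qpar v_def[symmetric] W[symmetric] by (simp flip: power_mult)
  finally have "0.93 * (exp (- (2 * pi / h)) / h ^ 12) \<le> 0.93 * (norm w ^ 12 * norm (qpar w))" by simp
  also have "\<dots> = norm w ^ 12 * (0.93 * norm (qpar w))" by simp
  also have "\<dots> \<le> norm w ^ 12 * norm (eval_fps Delta (qpar w))" using D by (intro mult_left_mono) auto
  finally show ?thesis .
qed

lemma jpoly_inversion:
  assumes "Im w > 0"
  shows "eval_fps (jpoly x) (qpar (- 1 / w)) = w ^ 12 * eval_fps (jpoly x) (qpar w)"
proof -
  have im: "Im (- 1 / w) > 0"
    using Im_moebius_pos[of 0 0 "-1" 1 w] assms by simp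
  show ?thesis
    unfolding eval_jpoly[OF norm_qpar_less_1[OF im]] eval_jpoly[OF norm_qpar_less_1[OF assms]]
      mform_S[OF mform_E4 assms] mform_S[OF mform_Delta assms]
    by (simp add: power_mult_distrib right_diff_distrib flip: power_mult)
qed

lemma power_mix_le:
  fixes x y c :: real
  assumes "0 \<le> x" "x \<le> c" "0 \<le> y" "y \<le> c" "i \<le> n"
  shows "x ^ (n - i) * y ^ i \<le> c ^ n"
proof -
  have "x ^ (n - i) * y ^ i \<le> c ^ (n - i) * c ^ i" using assms by (intro mult_mono power_mono) auto
  also have "\<dots> = c ^ n" using assms by (simp flip: power_add)
  finally show ?thesis .
qed

text \<open>6.144 = 1.6^2 * 2.4 serves all a and b at once: as |w|^2 \<ge> 1.48, the caps 2.13 and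
  3.63 at \<open>p\<close> lie below 1.6 |w|^4 and 2.4 |w|^6, so factors E4 and E6 taken at
  \<open>p\<close> or on the contour have a common bound. The weights leave |w|^14 / |w|^12, and
  0.0051 bounds Delta at \<open>p\<close>.\<close>

lemma faber_kernel_bound:
  assumes w: "Im w > 0" "1.48 \<le> norm w ^ 2" "norm (qpar w) \<le> 0.0024" and p: "norm p \<le> 9/2000"
    and D: "0 < e" "e \<le> norm (eval_fps (jpoly x) (qpar w))"
    and m: "0 < m" "m \<le> norm w ^ 12 * norm (eval_fps Delta (qpar w))" and ab: "a \<le> 2" "b \<le> 1"
  shows "norm (faber_kernel l a b x (qpar (- 1 / w))) * norm (eval_fps Delta p ^ l * eval_fps E4 p ^ a * eval_fps E6 p ^ b)
    \<le> 6.144 * norm w ^ 2 / e * (0.0051 / m) ^ l"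
proof -
  define W where "W = norm w"
  define e4 e6 d J where "e4 = norm (eval_fps E4 (qpar w))" and "e6 = norm (eval_fps E6 (qpar w))"
    and "d = norm (eval_fps Delta (qpar w))" and "J = norm (eval_fps (jpoly x) (qpar w))"
  define z4 z6 dz where "z4 = norm (eval_fps E4 p)" and "z6 = norm (eval_fps E6 p)" and "dz = norm (eval_fps Delta p)"
  note defs = e4_def e6_def d_def J_def z4_def z6_def dz_def W_def
  have W0: "W > 0" using w(1) by (auto simp: W_def)
  have W2: "1.48 \<le> W ^ 2" using w by (simp add: W_def)
  have W4: "1.48 ^ 2 \<le> W ^ 4" using power_mono[OF W2, of 2] by (simp flip: power_mult)
  have W6: "1.48 ^ 3 \<le> W ^ 6" using power_mono[OF W2, of 3] by (simp flip: power_mult)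
  have K: "norm (faber_kernel l a b x (qpar (- 1 / w))) = (W ^ 4 * e4) ^ (2 - a) * (W ^ 6 * e6) ^ (1 - b) / (W ^ 12 * d) ^ l / (W ^ 12 * J)"
    unfolding faber_kernel_def mform_S[OF mform_E4 w(1)] mform_S[OF mform_E6 w(1)] mform_S[OF mform_Delta w(1)] jpoly_inversion[OF w(1)]
    by (simp add: norm_divide norm_mult norm_power defs)
  have e4: "W ^ 4 * e4 \<le> 1.6 * W ^ 4" using E4_E6_caps(3)[OF w(3)] W0 by (simp add: e4_def mult.commute mult_right_mono)
  have e6: "W ^ 6 * e6 \<le> 2.4 * W ^ 6" using E4_E6_caps(4)[OF w(3)] W0 by (simp add: e6_def mult.commute mult_right_mono)
  have z4: "z4 \<le> 1.6 * W ^ 4" using E4_E6_caps(1)[OF p] W4 by (simp add: z4_def power2_eq_square)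
  have z6: "z6 \<le> 2.4 * W ^ 6" using E4_E6_caps(2)[OF p] W6 by (simp add: z6_def power3_eq_cube)
  have "(W ^ 4 * e4) ^ (2 - a) * z4 ^ a \<le> (1.6 * W ^ 4) ^ 2"
    by (rule power_mix_le) (use e4 z4 ab W0 in \<open>auto simp: defs\<close>)
  moreover have "(W ^ 6 * e6) ^ (1 - b) * z6 ^ b \<le> (2.4 * W ^ 6) ^ 1"
    by (rule power_mix_le) (use e6 z6 ab W0 in \<open>auto simp: defs\<close>)
  ultimately have "((W ^ 4 * e4) ^ (2 - a) * z4 ^ a) * ((W ^ 6 * e6) ^ (1 - b) * z6 ^ b) \<le> (1.6 * W ^ 4) ^ 2 * (2.4 * W ^ 6) ^ 1"
    by (intro mult_mono) (auto simp: defs)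
  also have "\<dots> = 6.144 * W ^ 14" by (simp add: power2_eq_square flip: power_add)
  finally have num: "((W ^ 4 * e4) ^ (2 - a) * z4 ^ a) * ((W ^ 6 * e6) ^ (1 - b) * z6 ^ b) \<le> 6.144 * W ^ 14" .
  have md: "m \<le> W ^ 12 * d" using m by (simp add: defs)
  have "dz / (W ^ 12 * d) \<le> 0.0051 / m"
    using Delta_bounds(1)[OF p] m(1) md by (intro frac_le) (auto simp: dz_def)
  hence rho: "(dz / (W ^ 12 * d)) ^ l \<le> (0.0051 / m) ^ l" using m(1) md by (intro power_mono) (auto simp: defs)
  have "norm (faber_kernel l a b x (qpar (- 1 / w))) * (dz ^ l * z4 ^ a * z6 ^ b)
      = (((W ^ 4 * e4) ^ (2 - a) * z4 ^ a) * ((W ^ 6 * e6) ^ (1 - b) * z6 ^ b)) / (W ^ 12 * J) * (dz / (W ^ 12 * d)) ^ l"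
    unfolding K by (simp add: power_divide mult_ac)
  also have "\<dots> \<le> (6.144 * W ^ 14) / (W ^ 12 * e) * (0.0051 / m) ^ l"
    using D W0 m(1) by (intro mult_mono frac_le num rho mult_left_mono) (auto simp: defs)
  also have "6.144 * W ^ 14 = W ^ 12 * (6.144 * W ^ 2)" using power_add[of W 12 2] by simp
  also have "W ^ 12 * (6.144 * W ^ 2) / (W ^ 12 * e) = 6.144 * W ^ 2 / e" by (rule mult_divide_mult_cancel_left) (use W0 in simp)
  finally show ?thesis by (simp add: norm_mult norm_power defs)
qed

text \<open>A form of weight \<open>2 K\<close> times \<open>z^K\<close> is real on the unit circle, and the exponential scales the
  contributions of the two poles \<open>z\<close> and \<open>-1/z\<close> to modulus 1.\<close>

definition arc_factor :: "nat \<Rightarrow> nat \<Rightarrow> nat \<Rightarrow> real \<Rightarrow> complex" where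
  "arc_factor l a b \<theta> = eval_fps Delta (qpar (cis \<theta>)) ^ l * eval_fps E4 (qpar (cis \<theta>)) ^ a * eval_fps E6 (qpar (cis \<theta>)) ^ b
     * cis (real (6 * l + 2 * a + 3 * b) * \<theta>) * of_real (exp (2 * pi * sin \<theta>))"

lemma arc_factor_nonzero:
  assumes "pi / 2 < \<theta>" "\<theta> < 2 * pi / 3"
  shows "arc_factor l a b \<theta> \<noteq> 0"
  using E4_nonzero_arc[of \<theta>] E6_nonzero_arc[of \<theta>] eval_Delta_nonzero[of "cis \<theta>"] arc_bounds(3)[of \<theta>] assms
  by (simp add: arc_factor_def)

lemma jpoly_zero_iff:
  assumes "Im \<tau> > 0"
  shows "eval_fps (jpoly x) (qpar \<tau>) = 0 \<longleftrightarrow> klein_j \<tau> = x"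
  using eval_Delta_nonzero[OF assms] unfolding klein_j_def eval_jpoly[OF norm_qpar_less_1[OF assms]]
  by (simp add: field_simps)

text \<open>Common frame for the two contours. \<open>h\<close> is the height of the contour,
  \<open>e\<close> a lower bound for jpoly on the inverted contour, \<open>m\<close> one for Delta
  on the contour, \<open>\<rho>\<close> bounds the ratio of Delta at z to Delta on the contour, and
  \<open>E\<close> bounds exp (2 \<pi> (sin \<theta> - h)), the quotient of the radius by
  |q(z)|.\<close>

lemma arc_remainder:
  fixes h e m \<rho> E :: real
  assumes \<theta>: "pi / 2 < \<theta>" "\<theta> < 2 * pi / 3" and l: "l \<ge> 10" and ab: "a \<le> 2" "b \<le> 1"
    and h: "0 < h" "h \<le> 13/20" "0.966 \<le> h * (1 / (1/4 + h ^ 2))"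
    and D: "0 < e" "\<And>w. h * (1 / (1/4 + h ^ 2)) \<le> Im w \<Longrightarrow> Im w \<le> 1 / h \<Longrightarrow> Re w ^ 2 = 1 / h * Im w - Im w ^ 2 \<Longrightarrow>
              e \<le> norm (eval_fps (jpoly (of_real (arc_j \<theta>))) (qpar w))"
    and m: "0 < m" "m \<le> 0.93 * (exp (- (2 * pi / h)) / h ^ 12)" "0.0051 / m \<le> \<rho>" "\<rho> \<le> 1"
    and E: "exp (2 * pi * (1 - h)) \<le> E"
  shows "norm ((faber_coeff l a b (of_real (arc_j \<theta>)) -
    (\<Sum>q\<in>{q. norm q < exp (- (2 * pi * h)) \<and> eval_fps (jpoly (of_real (arc_j \<theta>))) q = 0}. faber_pole l a b q)) * arc_factor l a b \<theta>)
      \<le> 6.144 * (1 / h ^ 2) / e * \<rho> ^ 10 * E"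
proof -
  define x where "x = complex_of_real (arc_j \<theta>)"
  define p where "p = qpar (cis \<theta>)"
  define N where "N = norm (eval_fps Delta p ^ l * eval_fps E4 p ^ a * eval_fps E6 p ^ b)"
  define C where "C = 6.144 * (1 / h ^ 2) / e * \<rho> ^ 10"
  define r where "r = exp (- (2 * pi * h))"
  have r: "0 < r" "r < 1" using h by (auto simp: r_def)
  have sn: "sqrt 3 / 2 \<le> sin \<theta>" "sin \<theta> > 0" using arc_bounds[of \<theta>] \<theta> by auto
  have p: "norm p \<le> 9/2000" unfolding p_def by (rule norm_qpar_le_fundamental) (use sn in simp)
  have "norm (arc_factor l a b \<theta>) = N * exp (2 * pi * sin \<theta>)"
    by (simp add: arc_factor_def N_def p_def norm_mult)
  moreover have "arc_factor l a b \<theta> \<noteq> 0" using arc_factor_nonzero \<theta> by blast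
  moreover have "N \<ge> 0" by (simp add: N_def)
  ultimately have N: "N > 0" "norm (arc_factor l a b \<theta>) = N * exp (2 * pi * sin \<theta>)"
    by (cases "N = 0"; simp)+
  have \<rho>0: "0 \<le> \<rho>" using order_trans[OF _ m(3), of 0] m(1) by simp
  have circle: "eval_fps (jpoly x) q \<noteq> 0 \<and> norm (faber_kernel l a b x q) \<le> C / N" if nq: "norm q = r" for q
  proof -
    obtain w where w: "Im w > 0" "q = qpar (- 1 / w)" "Im w = h * norm w ^ 2" "1 / (1/4 + h ^ 2) \<le> norm w ^ 2" "norm w ^ 2 \<le> 1 / h ^ 2"
      using circle_point[OF nq[unfolded r_def] h(1)] .
    have v0: "h * (1 / (1/4 + h ^ 2)) \<le> Im w" unfolding w(3) using w(4) h by (intro mult_left_mono) auto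
    hence v: "0.966 \<le> Im w" using h by linarith
    have "h * norm w ^ 2 \<le> h * (1 / h ^ 2)" using w(5) h by (intro mult_left_mono) auto
    hence v1: "Im w \<le> 1 / h" using w(3) h by (simp add: power2_eq_square)
    have "Re w ^ 2 = norm w ^ 2 - Im w ^ 2" by (simp add: cmod_power2)
    hence "Re w ^ 2 = 1 / h * Im w - Im w ^ 2" using w(3) h by simp
    hence J: "e \<le> norm (eval_fps (jpoly x) (qpar w))" unfolding x_def using D v0 v1 by blast
    have W: "1.48 \<le> norm w ^ 2"
    proof -
      have "h * norm w ^ 2 \<le> 13/20 * norm w ^ 2" using h by (intro mult_right_mono) auto
      thus ?thesis using v w(3) by simp
    qed
    have "norm (qpar w) \<le> 1 / (2.718 ^ 6 * (1 + 0.069 + 0.069 ^ 2 / 2))"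
      by (rule norm_qpar_upper) (use v w(1) in auto)
    also have "\<dots> \<le> 0.0024" by (simp add: power2_eq_square eval_nat_numeral)
    finally have qw: "norm (qpar w) \<le> 0.0024" .
    have mw: "m \<le> norm w ^ 12 * norm (eval_fps Delta (qpar w))"
      using Delta_lower_inversion[OF h(1) w(3) v w(5)] m(2) by linarith
    have "norm (faber_kernel l a b x q) * N \<le> 6.144 * norm w ^ 2 / e * (0.0051 / m) ^ l"
      unfolding w(2) N_def by (rule faber_kernel_bound) (fact w W qw p D(1) J m(1) mw ab)+
    also have "\<dots> \<le> 6.144 * (1 / h ^ 2) / e * \<rho> ^ 10"
    proof (intro mult_mono divide_right_mono w)
      have "(0.0051 / m) ^ l \<le> \<rho> ^ l" using m by (intro power_mono) auto
      also have "\<dots> \<le> \<rho> ^ 10" using l \<rho>0 m by (intro power_decreasing) auto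
      finally show "(0.0051 / m) ^ l \<le> \<rho> ^ 10" .
    qed (use D m h in auto)
    finally have "norm (faber_kernel l a b x q) \<le> C / N"
      unfolding C_def[symmetric] using N(1) by (simp add: pos_le_divide_eq)
    moreover have "eval_fps (jpoly x) q \<noteq> 0"
      unfolding w(2) jpoly_inversion[OF w(1)] using J D(1) w(1) by auto
    ultimately show ?thesis by blast
  qed
  have x: "x \<noteq> 0" "x \<noteq> 1728" using arc_j_strict_range[OF \<theta>] unfolding x_def by (auto simp: complex_eq_iff)
  have zero: "eval_fps (jpoly x) p = 0"
    unfolding p_def x_def using klein_j_arc[of \<theta>] \<theta> sn by (subst jpoly_zero_iff) auto
  have "norm (faber_coeff l a b x - (\<Sum>q\<in>{q. norm q < r \<and> eval_fps (jpoly x) q = 0}. faber_pole l a b q)) \<le> C / N * r"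
    by (rule faber_coeff_residues[OF _ ab x r _ _ zero]) (use l circle p in auto)
  hence "norm (faber_coeff l a b x - (\<Sum>q\<in>{q. norm q < r \<and> eval_fps (jpoly x) q = 0}. faber_pole l a b q)) * norm (arc_factor l a b \<theta>)
      \<le> C / N * r * (N * exp (2 * pi * sin \<theta>))"
    unfolding N(2) using N(1) by (intro mult_right_mono) auto
  also have "\<dots> = C * exp (2 * pi * (sin \<theta> - h))" using N(1) by (simp add: r_def right_diff_distrib exp_diff exp_minus field_simps)
  also have "\<dots> \<le> C * E"
  proof (intro mult_left_mono)
    have "2 * pi * (sin \<theta> - h) \<le> 2 * pi * (1 - h)" by (intro mult_left_mono) auto
    thus "exp (2 * pi * (sin \<theta> - h)) \<le> E" using E by (meson exp_le_cancel_iff order_trans)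
    show "0 \<le> C" unfolding C_def using D \<rho>0 h by simp
  qed
  finally show ?thesis by (simp add: norm_mult C_def x_def r_def)
qed

text \<open>The ratio 0.0051 / 0.013 is below 0.4, and 25 exceeds exp \<pi>. The result 0.2 leaves
  room for a third pole whose contribution may be as large as 1.\<close>

lemma arc_remainder_I:
  assumes \<theta>: "pi / 2 < \<theta>" "\<theta> < 2 * pi / 3" and l: "l \<ge> 10" and ab: "a \<le> 2" "b \<le> 1" and x: "arc_j \<theta> \<le> 1300"
  shows "norm ((faber_coeff l a b (of_real (arc_j \<theta>)) -
    (\<Sum>q\<in>{q. norm q < exp (- (2 * pi * (1/2))) \<and> eval_fps (jpoly (of_real (arc_j \<theta>))) q = 0}. faber_pole l a b q)) * arc_factor l a b \<theta>) \<le> 0.2"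
proof -
  have "norm ((faber_coeff l a b (of_real (arc_j \<theta>)) -
    (\<Sum>q\<in>{q. norm q < exp (- (2 * pi * (1/2))) \<and> eval_fps (jpoly (of_real (arc_j \<theta>))) q = 0}. faber_pole l a b q)) * arc_factor l a b \<theta>)
     \<le> 6.144 * (1 / (1/2) ^ 2) / 0.36 * 0.4 ^ 10 * 25"
  proof (rule arc_remainder[OF \<theta> l ab, where m = "0.013"])
    fix w assume "1/2 * (1 / (1/4 + (1/2) ^ 2)) \<le> Im w" "Im w \<le> 1 / (1/2)" "Re w ^ 2 = 1 / (1/2) * Im w - Im w ^ 2"
    thus "0.36 \<le> norm (eval_fps (jpoly (of_real (arc_j \<theta>))) (qpar w))"
      using x arc_j_strict_range[OF \<theta>] by (intro jpoly_lower_I) (auto simp: power2_eq_square)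
  next
    have "exp (4 * pi) \<le> 2.7183 ^ 13 / (1 + 0.4336 + 0.4336 ^ 2 / 2)" by (rule exp_upper) (use two_pi_bounds in auto)
    from le_imp_inverse_le[OF this exp_gt_zero] have "1 / (2.7183 ^ 13 / (1 + 0.4336 + 0.4336 ^ 2 / 2)) \<le> 1 / exp (4 * pi)" by (simp only: inverse_eq_divide)
    moreover have "0.013 \<le> 0.93 * (1 / (2.7183 ^ 13 / (1 + 0.4336 + 0.4336 ^ 2 / 2)) / (1/2) ^ 12 :: real)"
      by (simp add: power2_eq_square eval_nat_numeral)
    ultimately have "0.013 \<le> 0.93 * (1 / exp (4 * pi) / (1/2) ^ 12)"
      by (elim order_trans, intro mult_left_mono divide_right_mono) simp_all
    thus "0.013 \<le> 0.93 * (exp (- (2 * pi / (1/2))) / (1/2) ^ 12)" by (simp add: exp_minus inverse_eq_divide)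
  next
    have "exp (2 * pi * (1 - 1/2)) \<le> 2.7183 ^ 4 / (1 + 0.8584 + 0.8584 ^ 2 / 2)" by (rule exp_upper) (use two_pi_bounds in auto)
    also have "\<dots> \<le> 25" by (simp add: power2_eq_square eval_nat_numeral)
    finally show "exp (2 * pi * (1 - 1/2)) \<le> 25" .
  qed (auto simp: power2_eq_square)
  also have "\<dots> \<le> 0.2" by (simp add: power2_eq_square eval_nat_numeral)
  finally show ?thesis .
qed

text \<open>The ratio 0.0051 / 0.0102 is 1/2, and 10 exceeds exp (0.7 \<pi>). With a general
  exponent l the bound is about 1212 * 2^(-l), which is below 2 from l = 10 on; this is the origin
  of the limit between the two ranges of l.\<close>

lemma arc_remainder_II:
  assumes \<theta>: "pi / 2 < \<theta>" "\<theta> < 2 * pi / 3" and l: "l \<ge> 10" and ab: "a \<le> 2" "b \<le> 1" and x: "1300 \<le> arc_j \<theta>"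
  shows "norm ((faber_coeff l a b (of_real (arc_j \<theta>)) -
    (\<Sum>q\<in>{q. norm q < exp (- (2 * pi * (13/20))) \<and> eval_fps (jpoly (of_real (arc_j \<theta>))) q = 0}. faber_pole l a b q)) * arc_factor l a b \<theta>) \<le> 1.2"
proof -
  have "norm ((faber_coeff l a b (of_real (arc_j \<theta>)) -
    (\<Sum>q\<in>{q. norm q < exp (- (2 * pi * (13/20))) \<and> eval_fps (jpoly (of_real (arc_j \<theta>))) q = 0}. faber_pole l a b q)) * arc_factor l a b \<theta>)
     \<le> 6.144 * (1 / (13/20) ^ 2) / 0.12 * 0.5 ^ 10 * 10"
  proof (rule arc_remainder[OF \<theta> l ab, where m = "0.0102"])
    fix w assume w: "13/20 * (1 / (1/4 + (13/20) ^ 2)) \<le> Im w" "Im w \<le> 1 / (13/20)" "Re w ^ 2 = 1 / (13/20) * Im w - Im w ^ 2"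
    show "0.12 \<le> norm (eval_fps (jpoly (of_real (arc_j \<theta>))) (qpar w))"
      using x w arc_j_strict_range[OF \<theta>] by (intro jpoly_lower_II) (auto simp: power2_eq_square)
  next
    have "exp (2 * pi / (13/20)) \<le> 2.7183 ^ 10 / (1 + 0.3335 + 0.3335 ^ 2 / 2)" by (rule exp_upper) (use two_pi_bounds in auto)
    from le_imp_inverse_le[OF this exp_gt_zero] have "1 / (2.7183 ^ 10 / (1 + 0.3335 + 0.3335 ^ 2 / 2)) \<le> 1 / exp (2 * pi / (13/20))" by (simp only: inverse_eq_divide)
    moreover have "0.0102 \<le> 0.93 * (1 / (2.7183 ^ 10 / (1 + 0.3335 + 0.3335 ^ 2 / 2)) / (13/20) ^ 12 :: real)"
      by (simp add: power2_eq_square eval_nat_numeral)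
    ultimately have "0.0102 \<le> 0.93 * (1 / exp (2 * pi / (13/20)) / (13/20) ^ 12)"
      by (elim order_trans, intro mult_left_mono divide_right_mono) simp_all
    thus "0.0102 \<le> 0.93 * (exp (- (2 * pi / (13/20))) / (13/20) ^ 12)" by (simp add: exp_minus inverse_eq_divide)
  next
    have "exp (2 * pi * (1 - 13/20)) \<le> 2.7183 ^ 3 / (1 + 0.8008 + 0.8008 ^ 2 / 2)" by (rule exp_upper) (use two_pi_bounds in auto)
    also have "\<dots> \<le> 10" by (simp add: power2_eq_square eval_nat_numeral)
    finally show "exp (2 * pi * (1 - 13/20)) \<le> 10" .
  qed (auto simp: power2_eq_square)
  also have "\<dots> \<le> 1.2" by (simp add: power2_eq_square eval_nat_numeral)
  finally show ?thesis .
qed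

section \<open>The poles inside the two contours\<close>

lemma jpoly_zero_orbit:
  assumes \<theta>: "pi / 2 < \<theta>" "\<theta> < 2 * pi / 3" and h: "1/2 \<le> h"
    and q: "norm q < exp (- (2 * pi * h))" "eval_fps (jpoly (of_real (arc_j \<theta>))) q = 0"
  shows "q \<in> {qpar (cis \<theta>), qpar (- 1 / cis \<theta>), qpar (- 1 / (cis \<theta> + 1))}"
proof -
  have q0: "q \<noteq> 0" using q(2) by (auto simp: eval_fps_at_0 jpoly_def E4_nth Delta_nth_0)
  have "exp (- (2 * pi * h)) < 1" using h by simp
  with q(1) have "norm q < 1" by linarith
  with q0 obtain \<tau> where \<tau>: "Im \<tau> > 0" "\<bar>Re \<tau>\<bar> \<le> 1/2" "qpar \<tau> = q" by (rule qpar_surj)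
  have im: "h < Im \<tau>" using q(1) unfolding \<tau>(3)[symmetric] norm_qpar by simp
  have "klein_j \<tau> = klein_j (cis \<theta>)"
    using q(2) \<tau>(3) jpoly_zero_iff[OF \<tau>(1)] klein_j_arc[of \<theta>] \<theta> by simp
  then obtain a b c d :: int where "a * d - b * c = 1" "\<tau> = (of_int a * cis \<theta> + of_int b) / (of_int c * cis \<theta> + of_int d)"
    using klein_j_orbit_arc[OF \<tau>(1) \<theta>] by blast
  thus ?thesis using qpar_orbit_cases[OF \<theta>, of a d b c \<tau>] im h \<tau>(3) by simp
qed

text \<open>Everything is expressed by u = 1 + cos \<theta>, between 1/2 and 1: |z + 1|^2 = 2 u, and
  u < sin \<theta> puts the third pole above height 1/2.\<close>

lemma arc_orbit_points:
  assumes \<theta>: "pi / 2 < \<theta>" "\<theta> < 2 * pi / 3"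
  defines "u \<equiv> 1 + cos \<theta>"
  shows "- 1 / cis \<theta> = Complex (- cos \<theta>) (sin \<theta>)" "Im (- 1 / (cis \<theta> + 1)) = sin \<theta> / (2 * u)"
    "norm (cis \<theta> + 1) ^ 2 = 2 * u" "1/2 < u" "u < 1" "sin \<theta> ^ 2 = 2 * u - u ^ 2" "sin \<theta> > 0"
    "u < sin \<theta>"
proof -
  have "cos (2 * pi / 3) < cos \<theta>" "cos \<theta> < cos (pi / 2)"
    by (rule cos_monotone_0_pi; use \<theta> pi_gt3 in simp)+
  thus u: "1/2 < u" "u < 1" by (auto simp: u_def cos_2pi3)
  show s: "sin \<theta> > 0" using arc_bounds(3)[of \<theta>] \<theta> by simp
  show s2: "sin \<theta> ^ 2 = 2 * u - u ^ 2" unfolding sin_squared_eq u_def by (simp add: power2_eq_square algebra_simps)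
  show "- 1 / cis \<theta> = Complex (- cos \<theta>) (sin \<theta>)" using inverse_unit_circle[of "cis \<theta>"] by (simp add: complex_eq_iff)
  show n: "norm (cis \<theta> + 1) ^ 2 = 2 * u" unfolding cmod_power2 using s2 by (simp add: u_def power2_eq_square algebra_simps)
  have "Im (- 1 / (cis \<theta> + 1)) = sin \<theta> / norm (cis \<theta> + 1) ^ 2" unfolding cmod_power2 by (simp add: Im_divide)
  thus "Im (- 1 / (cis \<theta> + 1)) = sin \<theta> / (2 * u)" unfolding n .
  have "u * u < u * 1" using u by (intro mult_strict_left_mono) auto
  hence "u ^ 2 < sin \<theta> ^ 2" unfolding s2 by (simp add: power2_eq_square)
  thus "u < sin \<theta>" by (rule power2_less_imp_less) (use s in simp)
qed

lemma norm_qpar_less_iff: "norm (qpar z) < exp (- (2 * pi * h)) \<longleftrightarrow> h < Im z"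
  by (simp add: norm_qpar)

lemma qpar_neq_norm: "Im z \<noteq> Im w \<Longrightarrow> qpar z \<noteq> qpar w"
  by (auto simp: qpar_eq_iff)

lemma arc_orbit_distinct:
  assumes \<theta>: "pi / 2 < \<theta>" "\<theta> < 2 * pi / 3"
  shows "qpar (cis \<theta>) \<noteq> qpar (- 1 / cis \<theta>)" "qpar (cis \<theta>) \<noteq> qpar (- 1 / (cis \<theta> + 1))"
    "qpar (- 1 / cis \<theta>) \<noteq> qpar (- 1 / (cis \<theta> + 1))"
proof -
  note o = arc_orbit_points[OF \<theta>]
  show "qpar (cis \<theta>) \<noteq> qpar (- 1 / cis \<theta>)"
  proof
    assume "qpar (cis \<theta>) = qpar (- 1 / cis \<theta>)"
    then obtain n :: int where "cis \<theta> = - 1 / cis \<theta> + of_int n" unfolding qpar_eq_iff by blast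
    hence "cos \<theta> = - cos \<theta> + of_int n" unfolding o(1) by (simp add: complex_eq_iff)
    hence "of_int n = 2 * cos \<theta>" by simp
    moreover have "-1 < 2 * cos \<theta>" "2 * cos \<theta> < 0" using o(4,5) by auto
    ultimately have "real_of_int (-1) < of_int n" "real_of_int n < of_int 0" by auto
    thus False unfolding of_int_less_iff by simp
  qed
  have "sin \<theta> / (2 * (1 + cos \<theta>)) < sin \<theta>"
    using mult_strict_left_mono[of 1 "2 * (1 + cos \<theta>)" "sin \<theta>"] o by (subst pos_divide_less_eq) auto
  thus "qpar (cis \<theta>) \<noteq> qpar (- 1 / (cis \<theta> + 1))" "qpar (- 1 / cis \<theta>) \<noteq> qpar (- 1 / (cis \<theta> + 1))"
    by (intro qpar_neq_norm; unfold o(2); simp add: o(1) del: divide_minus_left)+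
qed

lemma jpoly_orbit_zero:
  assumes \<theta>: "pi / 2 < \<theta>" "\<theta> < 2 * pi / 3" and q: "q \<in> {qpar (cis \<theta>), qpar (- 1 / cis \<theta>), qpar (- 1 / (cis \<theta> + 1))}"
  shows "eval_fps (jpoly (of_real (arc_j \<theta>))) q = 0"
proof -
  have s: "Im (cis \<theta>) > 0" using arc_orbit_points(7)[OF \<theta>] by simp
  have z: "eval_fps (jpoly (of_real (arc_j \<theta>))) (qpar (cis \<theta>)) = 0"
    using klein_j_arc[of \<theta>] \<theta> by (subst jpoly_zero_iff[OF s]) auto
  have "qpar (cis \<theta> + 1) = qpar (cis \<theta>)" using qpar_eq_iff[of "cis \<theta> + 1" "cis \<theta>"] by (auto intro: exI[of _ 1])
  moreover have "Im (cis \<theta> + 1) > 0" using s by simp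
  ultimately show ?thesis using q z jpoly_inversion[OF s] jpoly_inversion[of "cis \<theta> + 1"] by auto
qed

lemma jpoly_zeros_I:
  assumes \<theta>: "pi / 2 < \<theta>" "\<theta> < 2 * pi / 3"
  shows "{q. norm q < exp (- (2 * pi * (1/2))) \<and> eval_fps (jpoly (of_real (arc_j \<theta>))) q = 0}
    = {qpar (cis \<theta>), qpar (- 1 / cis \<theta>), qpar (- 1 / (cis \<theta> + 1))}" (is "?A = ?B")
proof (intro equalityI subsetI)
  fix q assume "q \<in> ?A"
  thus "q \<in> ?B" using jpoly_zero_orbit[OF \<theta>, of "1/2" q] by simp
next
  note o = arc_orbit_points[OF \<theta>]
  fix q assume q: "q \<in> ?B"
  have "1/2 < sin \<theta>" using o(4,8) by linarith
  hence "1/2 < Im (cis \<theta>)" "1/2 < Im (- 1 / cis \<theta>)" unfolding o(1) by simp_all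
  moreover have "1/2 < Im (- 1 / (cis \<theta> + 1))" unfolding o(2) using o(4,8) by (subst pos_less_divide_eq) auto
  ultimately have "norm q < exp (- (2 * pi * (1/2)))"
    using q by (elim insertE emptyE; simp only: norm_qpar_less_iff)
  thus "q \<in> ?A" using jpoly_orbit_zero[OF \<theta> q] by simp
qed

text \<open>The third pole is below the contour as soon as u = 1 + cos \<theta> > 3/4. If u \<le>
  3/4, then Re q(z) \<le> 0, and \<open>jpoly_lower_neg\<close> for x \<ge> 1300 shows that jpoly is
  nonzero at q(z), where it vanishes by construction.\<close>

lemma jpoly_zeros_II:
  assumes \<theta>: "pi / 2 < \<theta>" "\<theta> < 2 * pi / 3" and x: "1300 \<le> arc_j \<theta>"
  shows "{q. norm q < exp (- (2 * pi * (13/20))) \<and> eval_fps (jpoly (of_real (arc_j \<theta>))) q = 0}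
    = {qpar (cis \<theta>), qpar (- 1 / cis \<theta>)}" (is "?A = ?B")
proof (intro equalityI subsetI)
  note o = arc_orbit_points[OF \<theta>]
  define u where "u = 1 + cos \<theta>"
  have "3/4 < u"
  proof (rule ccontr)
    assume "\<not> 3/4 < u"
    hence "cos (2 * pi * u) \<le> 0" using o(4) by (intro cos_nonpos_quarter) (auto simp: u_def)
    hence "cos (2 * pi * cos \<theta>) \<le> 0" by (simp add: u_def distrib_left cos_add)
    hence re: "Re (qpar (cis \<theta>)) \<le> 0" unfolding Re_qpar by (intro mult_nonneg_nonpos) auto
    have n: "norm (qpar (cis \<theta>)) \<le> 9/2000" by (rule norm_qpar_le_fundamental) (use arc_bounds[of \<theta>] \<theta> in simp)
    have "norm (qpar (cis \<theta>)) ^ 2 \<le> (9/2000) ^ 2" by (intro power_mono n) auto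
    hence "0 < norm (qpar (cis \<theta>)) * (580 - 20000000 * norm (qpar (cis \<theta>)) ^ 2)"
      by (intro mult_pos_pos) (auto simp: power2_eq_square)
    also have "\<dots> \<le> norm (eval_fps (jpoly (of_real (arc_j \<theta>))) (qpar (cis \<theta>)))"
      using n re x arc_j_strict_range[OF \<theta>] by (intro jpoly_lower_neg) auto
    finally show False using jpoly_orbit_zero[OF \<theta>, of "qpar (cis \<theta>)"] by simp
  qed
  hence im3: "sin \<theta> / (2 * u) \<le> 13/20"
  proof -
    assume u: "3/4 < u"
    have "0 \<le> (u - 3/4) * u" using u by (intro mult_nonneg_nonneg) auto
    hence "3/4 * u \<le> u ^ 2" by (simp add: power2_eq_square algebra_simps)
    moreover have "(13/10 * u) ^ 2 = 169/100 * u ^ 2" by (simp add: power2_eq_square)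
    \<comment> \<open>This holds from u = 2 / 2.69 on, a value just below 3/4.\<close>
    ultimately have "2 * u - u ^ 2 \<le> (13/10 * u) ^ 2" using u by linarith
    hence "sin \<theta> ^ 2 \<le> (13/10 * u) ^ 2" using o(6) by (simp add: u_def)
    hence "sin \<theta> \<le> 13/10 * u" by (rule power2_le_imp_le) (use u in simp)
    thus ?thesis using u by (simp add: pos_divide_le_eq)
  qed
  fix q assume q: "q \<in> ?A"
  have "q \<noteq> qpar (- 1 / (cis \<theta> + 1))"
  proof
    assume "q = qpar (- 1 / (cis \<theta> + 1))"
    hence "13/20 < Im (- 1 / (cis \<theta> + 1))" using q by (simp only: mem_Collect_eq norm_qpar_less_iff)
    hence "13/20 < sin \<theta> / (2 * u)" unfolding o(2) u_def .
    thus False using im3 by simp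
  qed
  thus "q \<in> ?B" using jpoly_zero_orbit[OF \<theta>, of "13/20" q] q by simp
next
  note o = arc_orbit_points[OF \<theta>]
  fix q assume q: "q \<in> ?B"
  have "13/20 < sqrt 3 / 2" using sqrt3_bounds by simp
  also have "\<dots> \<le> sin \<theta>" using arc_bounds[of \<theta>] \<theta> by simp
  finally have "norm q < exp (- (2 * pi * (13/20)))"
    using q by (elim insertE emptyE) (simp_all add: norm_qpar o(1) del: divide_minus_left)
  moreover have "q \<in> {qpar (cis \<theta>), qpar (- 1 / cis \<theta>), qpar (- 1 / (cis \<theta> + 1))}" using q by blast
  ultimately show "q \<in> ?A" using jpoly_orbit_zero[OF \<theta>] by blast
qed

lemma faber_pole_eq:
  assumes w: "Im w > 0" and p: "eval_fps E4 (qpar w) = eval_fps E4 p" "eval_fps E6 (qpar w) = eval_fps E6 p" "eval_fps Delta (qpar w) = eval_fps Delta p"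
  shows "faber_pole l a b (qpar (- 1 / w)) = qpar (- 1 / w) / w ^ (2 * (6 * l + 2 * a + 3 * b)) / (eval_fps Delta p ^ l * eval_fps E4 p ^ a * eval_fps E6 p ^ b)"
proof -
  have e: "w ^ (2 * (6 * l + 2 * a + 3 * b)) = (w ^ 12) ^ l * (w ^ 4) ^ a * (w ^ 6) ^ b"
    by (simp add: algebra_simps flip: power_mult power_add)
  show ?thesis
    unfolding faber_pole_def mform_S[OF mform_E4 w] mform_S[OF mform_E6 w] mform_S[OF mform_Delta w] p e
    by (simp add: power_mult_distrib mult_ac)
qed

section \<open>Contributions of the poles\<close>

lemma qpar_Complex: "qpar (Complex x y) = cis (2 * pi * x) * of_real (exp (- (2 * pi * y)))"
proof -
  have "qpar (Complex x y) = exp (\<i> * of_real (2 * pi * x)) * exp (of_real (- (2 * pi * y)))"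
    unfolding qpar_def exp_add[symmetric] by (rule arg_cong[of _ _ exp]) (simp add: complex_eq_iff)
  thus ?thesis by (simp only: cis_conv_exp exp_of_real)
qed

text \<open>The pole z contributes cis y, where y is the argument of the cosine. At -1/z the value
  of q is conjugate and the form gains z^(2 K), which with the factor cis (K \<theta>) turns the
  contribution into cis (-y).\<close>

lemma arc_main_terms:
  assumes \<theta>: "pi / 2 < \<theta>" "\<theta> < 2 * pi / 3"
  shows "(faber_pole l a b (qpar (cis \<theta>)) + faber_pole l a b (qpar (- 1 / cis \<theta>))) * arc_factor l a b \<theta> =
     of_real (2 * cos (real (6 * l + 2 * a + 3 * b) * \<theta> + 2 * pi * cos \<theta>))"
proof -
  define K where "K = 6 * l + 2 * a + 3 * b"
  define y where "y = real K * \<theta> + 2 * pi * cos \<theta>"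
  define X where "X = eval_fps Delta (qpar (cis \<theta>)) ^ l * eval_fps E4 (qpar (cis \<theta>)) ^ a * eval_fps E6 (qpar (cis \<theta>)) ^ b"
  define E where "E = complex_of_real (exp (2 * pi * sin \<theta>))"
  have fac: "arc_factor l a b \<theta> = X * cis (real K * \<theta>) * E" by (simp add: arc_factor_def X_def K_def E_def)
  have X: "X \<noteq> 0" using arc_factor_nonzero[OF \<theta>, of l a b] unfolding fac by auto
  have E: "E \<noteq> 0" by (simp add: E_def)
  have s: "Im (cis \<theta>) > 0" using arc_orbit_points(7)[OF \<theta>] by simp
  have q1: "qpar (cis \<theta>) = cis (2 * pi * cos \<theta>) / E"
    using qpar_Complex[of "cos \<theta>" "sin \<theta>"] by (simp add: E_def exp_minus cis.code field_simps)
  have q2: "qpar (- 1 / cis \<theta>) = cis (- (2 * pi * cos \<theta>)) / E"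
    unfolding arc_orbit_points(1)[OF \<theta>] qpar_Complex by (simp add: E_def exp_minus field_simps)
  have "faber_pole l a b (qpar (cis \<theta>)) * arc_factor l a b \<theta> = cis y"
    unfolding faber_pole_def X_def[symmetric] fac unfolding q1 using X E by (simp add: y_def cis_mult add.commute)
  moreover have "faber_pole l a b (qpar (- 1 / cis \<theta>)) * arc_factor l a b \<theta> = cis (- y)"
  proof -
    have "faber_pole l a b (qpar (- 1 / cis \<theta>)) = qpar (- 1 / cis \<theta>) / cis \<theta> ^ (2 * K) / X"
      unfolding K_def X_def by (rule faber_pole_eq[OF s]) simp_all
    also have "\<dots> = cis (- (2 * pi * cos \<theta>)) * cis (- (2 * (real K * \<theta>))) / E / X"
    proof -
      have "cis \<theta> ^ (2 * K) = cis (2 * (real K * \<theta>))" using Complex.DeMoivre[of \<theta> "2 * K"] by (simp add: mult.assoc)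
      thus ?thesis unfolding q2 by (simp only: divide_inverse cis_inverse mult_ac)
    qed
    finally have "faber_pole l a b (qpar (- 1 / cis \<theta>)) * arc_factor l a b \<theta> = cis (- (2 * pi * cos \<theta>)) * cis (- (2 * (real K * \<theta>))) * cis (real K * \<theta>)"
      unfolding fac using X E by simp
    also have "\<dots> = cis (- y)" by (simp add: cis_mult y_def mult.commute[of \<theta>])
    finally show ?thesis .
  qed
  ultimately show ?thesis
    by (simp add: distrib_right y_def[symmetric] K_def[symmetric] complex_eq_iff)
qed

text \<open>With s = 2 (1 + cos \<theta>) > 1 the automorphy factor has norm s^K, while the height
  drops from sin \<theta> to sin \<theta> / s. The inequality 1/s \<le> exp (-(1 - 1/s)) makes the
  two comparable, and K \<ge> 60 > 2 \<pi> decides. The bound 1 is approached for \<theta> near 2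
  \<pi>/3, where s tends to 1.\<close>

lemma arc_third_term:
  assumes \<theta>: "pi / 2 < \<theta>" "\<theta> < 2 * pi / 3" and l: "l \<ge> 10"
  shows "norm (faber_pole l a b (qpar (- 1 / (cis \<theta> + 1))) * arc_factor l a b \<theta>) \<le> 1"
proof -
  note o = arc_orbit_points[OF \<theta>]
  define K where "K = 6 * l + 2 * a + 3 * b"
  define s where "s = 2 * (1 + cos \<theta>)"
  define X where "X = eval_fps Delta (qpar (cis \<theta>)) ^ l * eval_fps E4 (qpar (cis \<theta>)) ^ a * eval_fps E6 (qpar (cis \<theta>)) ^ b"
  have s: "1 < s" using o(4) by (simp add: s_def)
  have X: "X \<noteq> 0" using arc_factor_nonzero[OF \<theta>, of l a b] unfolding arc_factor_def X_def by auto
  have per: "qpar (cis \<theta> + 1) = qpar (cis \<theta>)" using qpar_eq_iff[of "cis \<theta> + 1" "cis \<theta>"] by (auto intro: exI[of _ 1])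
  have "faber_pole l a b (qpar (- 1 / (cis \<theta> + 1))) = qpar (- 1 / (cis \<theta> + 1)) / (cis \<theta> + 1) ^ (2 * K) / X"
    unfolding K_def X_def by (rule faber_pole_eq) (use o(7) per in simp_all)
  moreover have "norm (arc_factor l a b \<theta>) = norm X * exp (2 * pi * sin \<theta>)"
    by (simp add: arc_factor_def X_def norm_mult)
  ultimately have "norm (faber_pole l a b (qpar (- 1 / (cis \<theta> + 1))) * arc_factor l a b \<theta>)
      = norm (qpar (- 1 / (cis \<theta> + 1))) / norm (cis \<theta> + 1) ^ (2 * K) * exp (2 * pi * sin \<theta>)"
    using X by (simp add: norm_mult norm_divide norm_power del: divide_minus_left)
  also have "\<dots> = exp (- (2 * pi * (sin \<theta> / s))) / s ^ K * exp (2 * pi * sin \<theta>)"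
    unfolding norm_qpar o(2) power_mult o(3) s_def ..
  also have "\<dots> = (1 / s) ^ K * exp (2 * pi * sin \<theta> * (1 - 1 / s))"
    by (simp add: right_diff_distrib exp_diff exp_minus power_divide field_simps)
  also have "\<dots> \<le> exp (- (1 - 1 / s)) ^ K * exp (2 * pi * sin \<theta> * (1 - 1 / s))"
  proof (intro mult_right_mono power_mono)
    show "1 / s \<le> exp (- (1 - 1 / s))" using exp_ge_add_one_self[of "- (1 - 1 / s)"] by simp
  qed (use s in auto)
  also have "\<dots> = exp ((2 * pi * sin \<theta> - real K) * (1 - 1 / s))"
    by (simp add: algebra_simps flip: exp_of_nat_mult exp_add)
  also have "\<dots> \<le> 1"
  proof -
    have "2 * pi * sin \<theta> \<le> 2 * pi * 1" by (intro mult_left_mono) auto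
    moreover have "60 \<le> real K" using l by (simp add: K_def)
    moreover have "2 * pi \<le> 7" using two_pi_bounds(2) by simp
    ultimately have "2 * pi * sin \<theta> - real K \<le> 0" by linarith
    moreover have "0 \<le> 1 - 1 / s" using s by simp
    ultimately have "(2 * pi * sin \<theta> - real K) * (1 - 1 / s) \<le> 0" by (rule mult_nonpos_nonneg)
    thus ?thesis by simp
  qed
  finally show ?thesis .
qed

text \<open>The error is 0.2 + 1 when the third pole is inside the contour, and 1.2 directly when it
  is not.\<close>

lemma faber_arc_estimate:
  assumes \<theta>: "pi / 2 < \<theta>" "\<theta> < 2 * pi / 3" and l: "l \<ge> 10" and ab: "a \<le> 2" "b \<le> 1"
  shows "norm (faber_coeff l a b (of_real (arc_j \<theta>)) * arc_factor l a b \<theta> -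
     of_real (2 * cos (real (6 * l + 2 * a + 3 * b) * \<theta> + 2 * pi * cos \<theta>))) \<le> 1.2" (is "norm (?c * ?f - ?m) \<le> _")
proof (cases "arc_j \<theta> \<le> 1300")
  case True
  let ?T = "faber_pole l a b (qpar (- 1 / (cis \<theta> + 1))) * ?f"
  have "norm ((?c - (\<Sum>q\<in>{qpar (cis \<theta>), qpar (- 1 / cis \<theta>), qpar (- 1 / (cis \<theta> + 1))}. faber_pole l a b q)) * ?f) \<le> 0.2"
    using arc_remainder_I[OF \<theta> l ab True] unfolding jpoly_zeros_I[OF \<theta>] .
  also have "(\<Sum>q\<in>{qpar (cis \<theta>), qpar (- 1 / cis \<theta>), qpar (- 1 / (cis \<theta> + 1))}. faber_pole l a b q)
      = (faber_pole l a b (qpar (cis \<theta>)) + faber_pole l a b (qpar (- 1 / cis \<theta>))) + faber_pole l a b (qpar (- 1 / (cis \<theta> + 1)))"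
    using arc_orbit_distinct[OF \<theta>] by (simp add: add.assoc del: divide_minus_left)
  also have "(?c - \<dots>) * ?f = ?c * ?f - ?m - ?T"
    unfolding left_diff_distrib distrib_right[of "_ + _"] arc_main_terms[OF \<theta>] by (simp add: algebra_simps)
  finally have "norm (?c * ?f - ?m - ?T) \<le> 0.2" .
  moreover have "norm (?c * ?f - ?m) \<le> norm (?c * ?f - ?m - ?T) + norm ?T" using norm_triangle_ineq[of "?c * ?f - ?m - ?T" ?T] by simp
  ultimately show ?thesis using arc_third_term[OF \<theta> l, of a b] by simp
next
  case False
  have "norm ((?c - (\<Sum>q\<in>{qpar (cis \<theta>), qpar (- 1 / cis \<theta>)}. faber_pole l a b q)) * ?f) \<le> 1.2"
    using arc_remainder_II[OF \<theta> l ab] False jpoly_zeros_II[OF \<theta>] by simp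
  also have "(\<Sum>q\<in>{qpar (cis \<theta>), qpar (- 1 / cis \<theta>)}. faber_pole l a b q)
      = faber_pole l a b (qpar (cis \<theta>)) + faber_pole l a b (qpar (- 1 / cis \<theta>))"
    using arc_orbit_distinct[OF \<theta>] by (simp del: divide_minus_left)
  finally show ?thesis unfolding left_diff_distrib arc_main_terms[OF \<theta>] .
qed

subsection \<open>Sign changes and the theorem\<close>

lemma eval_fps_sum_ge_1:
  fixes n :: nat
  assumes "norm q < 1" "\<And>i. i < n \<Longrightarrow> 1 \<le> fps_conv_radius (F i)"
  shows "1 \<le> fps_conv_radius (\<Sum>i<n. F i) \<and> eval_fps (\<Sum>i<n. F i) q = (\<Sum>i<n. eval_fps (F i) q :: complex)"
  using assms(2)
proof (induction n)
  case (Suc n)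
  have "1 \<le> fps_conv_radius (\<Sum>i<n. F i)" "1 \<le> fps_conv_radius (F n)" using Suc by auto
  thus ?case using Suc assms(1) by (simp add: conv_radius_add_ge_1 eval_fps_add less_conv)
qed simp

section \<open>The real factor on the closed arc\<close>

lemma arc_factor_real:
  assumes "pi / 2 \<le> \<theta>" "\<theta> \<le> 2 * pi / 3"
  shows "arc_factor l a b \<theta> = of_real (Re (arc_factor l a b \<theta>))"
proof -
  have s: "Im (cis \<theta>) > 0" using arc_bounds(3)[OF assms] by simp
  have q: "norm (qpar (cis \<theta>)) < 1" by (rule norm_qpar_less_1[OF s])
  have S: "qpar (- 1 / cis \<theta>) = cnj (qpar (cis \<theta>))" using inverse_unit_circle[of "cis \<theta>"] qpar_cnj[of "cis \<theta>"] by simp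
  define e4 e6 d where "e4 = eval_fps E4 (qpar (cis \<theta>))" and "e6 = eval_fps E6 (qpar (cis \<theta>))" and "d = eval_fps Delta (qpar (cis \<theta>))"
  define K where "K = 6 * l + 2 * a + 3 * b"
  have e: "cnj e4 = cis \<theta> ^ 4 * e4" "cnj e6 = cis \<theta> ^ 6 * e6" "cnj d = cis \<theta> ^ 12 * d"
    unfolding e4_def e6_def d_def mform_S[OF mform_E4 s, symmetric] mform_S[OF mform_E6 s, symmetric] mform_S[OF mform_Delta s, symmetric] S
    by (simp_all add: eval_E4_cnj eval_E6_cnj eval_Delta_cnj q)
  have "(cis \<theta> ^ 12) ^ l * (cis \<theta> ^ 4) ^ a * (cis \<theta> ^ 6) ^ b = cis \<theta> ^ (2 * K)"
    unfolding power_mult[symmetric] power_add[symmetric] K_def by (rule arg_cong[of _ _ "power (cis \<theta>)"]) simp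
  also have "\<dots> = cis (2 * (real K * \<theta>))" using Complex.DeMoivre[of \<theta> "2 * K"] by (simp add: mult.assoc)
  finally have z: "(cis \<theta> ^ 12) ^ l * (cis \<theta> ^ 4) ^ a * (cis \<theta> ^ 6) ^ b * cis (- (real K * \<theta>)) = cis (real K * \<theta>)"
    by (simp add: cis_mult mult.commute[of \<theta>])
  have f: "arc_factor l a b \<theta> = d ^ l * e4 ^ a * e6 ^ b * cis (real K * \<theta>) * of_real (exp (2 * pi * sin \<theta>))"
    by (simp add: arc_factor_def e4_def e6_def d_def K_def)
  have "cnj (arc_factor l a b \<theta>) = d ^ l * e4 ^ a * e6 ^ b * ((cis \<theta> ^ 12) ^ l * (cis \<theta> ^ 4) ^ a * (cis \<theta> ^ 6) ^ b * cis (- (real K * \<theta>))) * of_real (exp (2 * pi * sin \<theta>))"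
    unfolding f by (simp add: e cis_cnj power_mult_distrib mult_ac del: power_mult)
  also have "\<dots> = arc_factor l a b \<theta>" unfolding z f ..
  finally show ?thesis by (metis Reals_cnj_iff complex_is_Real_iff of_real_Re)
qed

lemma continuous_on_arc_factor: "continuous_on {pi/2..2*pi/3} (arc_factor l a b)"
proof -
  have c: "continuous_on {pi/2..2*pi/3} (\<lambda>\<theta>. eval_fps F (qpar (cis \<theta>)))" if "1 \<le> fps_conv_radius F" for F
  proof (rule continuous_on_compose2[of "ball 0 1" "eval_fps F"])
    show "continuous_on (ball 0 1) (eval_fps F)"
      by (intro holomorphic_on_imp_continuous_on holomorphic_on_eval_fps_disc that)
    show "continuous_on {pi/2..2*pi/3} (\<lambda>\<theta>. qpar (cis \<theta>))" unfolding qpar_def by (intro continuous_intros)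
    show "(\<lambda>\<theta>. qpar (cis \<theta>)) ` {pi/2..2*pi/3} \<subseteq> ball 0 1" using arc_bounds(3) by (auto intro!: norm_qpar_less_1)
  qed
  show ?thesis unfolding arc_factor_def by (intro continuous_intros c) auto
qed

text \<open>A change of sign would give a zero strictly between, hence on the open arc. Zeros are
  possible only at the endpoints, from E4 at \<rho> or from E6 at i.\<close>

lemma arc_factor_sign_less:
  assumes "pi / 2 \<le> s" "s < t" "t \<le> 2 * pi / 3"
  shows "\<not> Re (arc_factor l a b s) * Re (arc_factor l a b t) < 0"
proof
  let ?g = "\<lambda>u. Re (arc_factor l a b s) * Re (arc_factor l a b u)"
  assume neg: "?g t < 0"
  have "continuous_on {s..t} ?g"
    by (intro continuous_intros continuous_on_subset[OF continuous_on_arc_factor]) (use assms in auto)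
  moreover have "0 \<le> ?g s" by simp
  ultimately obtain u where u: "s \<le> u" "u \<le> t" "?g u = 0"
    using IVT2'[of ?g t 0 s] neg assms by auto
  have s0: "Re (arc_factor l a b s) \<noteq> 0" using neg by auto
  hence "Re (arc_factor l a b u) = 0" using u(3) by simp
  moreover from this have "u \<noteq> s" "u \<noteq> t" using s0 neg by auto
  ultimately show False
    using arc_factor_nonzero[of u l a b] arc_factor_real[of u l a b] u assms by auto
qed

lemma arc_factor_sign:
  assumes "pi / 2 \<le> s" "s \<le> 2 * pi / 3" "pi / 2 \<le> t" "t \<le> 2 * pi / 3"
    and "Re (arc_factor l a b s) \<noteq> 0" "Re (arc_factor l a b t) \<noteq> 0"
  shows "Re (arc_factor l a b s) * Re (arc_factor l a b t) > 0"
proof -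
  have "\<not> Re (arc_factor l a b s) * Re (arc_factor l a b t) < 0"
  proof (cases s t rule: linorder_cases)
    case less
    thus ?thesis using arc_factor_sign_less assms by blast
  next
    case equal
    thus ?thesis by simp
  next
    case greater
    thus ?thesis using arc_factor_sign_less[of t s] assms by (simp add: mult.commute)
  qed
  moreover have "Re (arc_factor l a b s) * Re (arc_factor l a b t) \<noteq> 0" using assms(5,6) by simp
  ultimately show ?thesis by linarith
qed

text \<open>Continuity extends the estimate; the polynomial form of the coefficient supplies it.
  Endpoints do occur as samples: \<pi>/2 for b = 0 and 2 \<pi>/3 for a = 0.\<close>

lemma faber_arc_estimate_closed:
  assumes \<theta>: "pi / 2 \<le> \<theta>" "\<theta> \<le> 2 * pi / 3" and l: "l \<ge> 10" and ab: "a \<le> 2" "b \<le> 1"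
    and c: "\<And>x. (\<Sum>i<l. c i * x ^ i) = faber_coeff l a b x"
  shows "norm (faber_coeff l a b (of_real (arc_j \<theta>)) * arc_factor l a b \<theta> -
     of_real (2 * cos (real (6 * l + 2 * a + 3 * b) * \<theta> + 2 * pi * cos \<theta>))) \<le> 1.2"
proof -
  let ?f = "\<lambda>\<theta>. faber_coeff l a b (of_real (arc_j \<theta>)) * arc_factor l a b \<theta> -
     of_real (2 * cos (real (6 * l + 2 * a + 3 * b) * \<theta> + 2 * pi * cos \<theta>))"
  have cl: "closure {pi/2<..<2*pi/3} = {pi/2..2*pi/3}" by (rule closure_greaterThanLessThan) simp
  have "continuous_on {pi/2..2*pi/3} ?f"
    unfolding c[symmetric] by (intro continuous_intros continuous_on_arc_j continuous_on_arc_factor)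
  thus ?thesis
    using continuous_on_closure_norm_le[of "{pi/2<..<2*pi/3}" ?f "1.2" \<theta>] faber_arc_estimate[OF _ _ l ab] \<theta>
    unfolding cl by auto
qed

text \<open>The intermediate value theorem for the phase; at 2 \<pi>/3 the term 2 \<pi> cos \<theta>
  equals -\<pi>, whence the upper limit.\<close>

lemma sample_angle:
  assumes "K \<ge> 7" and y: "real K * (pi / 2) \<le> y" "y \<le> real K * (2 * pi / 3) - pi"
  obtains \<theta> where "pi / 2 \<le> \<theta>" "\<theta> \<le> 2 * pi / 3" "real K * \<theta> + 2 * pi * cos \<theta> = y"
proof -
  have "continuous_on {pi/2..2*pi/3} (\<lambda>\<theta>. real K * \<theta> + 2 * pi * cos \<theta>)" by (intro continuous_intros)
  moreover have "real K * (pi/2) + 2 * pi * cos (pi/2) \<le> y" "y \<le> real K * (2*pi/3) + 2 * pi * cos (2*pi/3)"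
    using y unfolding cos_2pi3 by simp_all
  ultimately show ?thesis using IVT'[of "\<lambda>\<theta>. real K * \<theta> + 2 * pi * cos \<theta>" "pi/2" y "2*pi/3"] that by auto
qed

text \<open>K \<ge> 7 > 2 \<pi> makes the phase nondecreasing.\<close>

lemma sample_angle_mono:
  assumes K: "K \<ge> 7" and st: "real K * s + 2 * pi * cos s < real K * t + 2 * pi * cos t"
  shows "s < t"
proof (rule ccontr)
  assume "\<not> s < t"
  hence le: "t \<le> s" by simp
  have "real K * t + 2 * pi * cos t \<le> real K * s + 2 * pi * cos s"
  proof (rule DERIV_nonneg_imp_nondecreasing[OF le])
    fix u :: real
    have "2 * pi * sin u \<le> 2 * pi * 1" by (intro mult_left_mono) auto
    moreover have "2 * pi \<le> 7" using two_pi_bounds(2) by simp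
    moreover have "7 \<le> real K" using K by simp
    ultimately have "0 \<le> real K - 2 * pi * sin u" by linarith
    moreover have "((\<lambda>u. real K * u + 2 * pi * cos u) has_real_derivative (real K - 2 * pi * sin u)) (at u)"
      by (auto intro!: derivative_eq_intros)
    ultimately show "\<exists>y. ((\<lambda>u. real K * u + 2 * pi * cos u) has_real_derivative y) (at u) \<and> 0 \<le> y" by blast
  qed
  thus False using st by simp
qed

lemma sign_changes_large:
  assumes l: "l \<ge> 10" and ab: "a \<le> 2" "b \<le> 1"
    and c: "\<And>x. (\<Sum>i<l. c i * x ^ i) = faber_coeff l a b x"
  shows "sign_changes l (\<lambda>x. Re (faber_coeff l a b (of_real x)))"
proof -
  define K where "K = 6 * l + 2 * a + 3 * b"
  \<comment> \<open>The least integer \<ge> K/2, since the phase starts at K \<pi>/2. It ends at (2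
    K/3 - 1) \<pi>, and n0 + l - 1 = 4 l + a + 2 b - 1 still fits.\<close>
  define n0 where "n0 = 3 * l + a + 2 * b"
  have K: "K \<ge> 7" using l by (simp add: K_def)
  have "\<exists>\<theta>. pi / 2 \<le> \<theta> \<and> \<theta> \<le> 2 * pi / 3 \<and> real K * \<theta> + 2 * pi * cos \<theta> = real (n0 + i) * pi" if i: "i < l" for i
  proof -
    have "real K * (1/2) \<le> real (n0 + i)" by (simp add: K_def n0_def)
    hence "real K * (1/2) * pi \<le> real (n0 + i) * pi" by (intro mult_right_mono) auto
    moreover have "real (n0 + i) \<le> real K * (2/3) - 1"
    proof -
      have "real i \<le> real l - 1" using i by linarith
      moreover have "0 \<le> real a" by simp
      ultimately show ?thesis unfolding K_def n0_def of_nat_add of_nat_mult of_nat_numeral distrib_right by linarith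
    qed
    hence "real (n0 + i) * pi \<le> (real K * (2/3) - 1) * pi" by (intro mult_right_mono) auto
    ultimately show ?thesis using sample_angle[OF K, of "real (n0 + i) * pi"] by (auto simp: algebra_simps)
  qed
  then obtain \<theta> where \<theta>: "\<And>i. i < l \<Longrightarrow> pi / 2 \<le> \<theta> i" "\<And>i. i < l \<Longrightarrow> \<theta> i \<le> 2 * pi / 3"
    "\<And>i. i < l \<Longrightarrow> real K * \<theta> i + 2 * pi * cos (\<theta> i) = real (n0 + i) * pi" by metis
  define P where "P = (\<lambda>i. Re (faber_coeff l a b (of_real (arc_j (\<theta> i)))))"
  define g where "g = (\<lambda>i. Re (arc_factor l a b (\<theta> i)))"
  have pos: "(-1) ^ (n0 + i) * (P i * g i) > 0" if i: "i < l" for i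
  proof -
    have "faber_coeff l a b (of_real (arc_j (\<theta> i))) = of_real (P i)"
      unfolding P_def by (rule of_real_Re[symmetric]) (simp add: faber_coeff_real)
    moreover have "arc_factor l a b (\<theta> i) = of_real (g i)" unfolding g_def by (rule arc_factor_real) (use \<theta> i in auto)
    ultimately have "norm (complex_of_real (P i * g i - 2 * cos (real (n0 + i) * pi))) \<le> 1.2"
      using faber_arc_estimate_closed[OF \<theta>(1,2)[OF i] l ab c] unfolding K_def[symmetric] \<theta>(3)[OF i] by simp
    hence "\<bar>P i * g i - 2 * cos (real (n0 + i) * pi)\<bar> \<le> 1.2" unfolding norm_of_real .
    hence "\<bar>P i * g i - 2 * (-1) ^ (n0 + i)\<bar> \<le> 6/5" unfolding cos_npi by simp
    hence "P i * g i - 2 * (-1) ^ (n0 + i) \<le> 6/5" "- (P i * g i - 2 * (-1) ^ (n0 + i)) \<le> 6/5"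
      unfolding abs_le_iff by blast+
    thus ?thesis by (cases "even (n0 + i)") (simp_all del: even_add)
  qed
  show ?thesis unfolding sign_changes_def
  \<comment> \<open>The real factor has one sign at all samples, so its value at the first one can
    serve as the global sign.\<close>
  proof (intro exI[of _ "\<lambda>i. arc_j (\<theta> i)"] exI[of _ "(-1) ^ n0 * g 0"] conjI allI impI)
    fix i assume i: "i < l"
    thus "0 \<le> arc_j (\<theta> i)" "arc_j (\<theta> i) \<le> 1728" using arc_j_range \<theta> by auto
    have "g i \<noteq> 0" "g 0 \<noteq> 0" using pos[OF i] pos[of 0] l by auto
    hence "g 0 * g i > 0" unfolding g_def by (intro arc_factor_sign) (use \<theta> i l in auto)
    hence "(g 0 * g i) * ((-1) ^ (n0 + i) * (P i * g i)) > 0" using pos[OF i] by (rule mult_pos_pos)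
    hence "((-1) ^ n0 * g 0 * (-1) ^ i * P i) * (g i) ^ 2 > 0" by (simp add: power_add power2_eq_square mult_ac)
    hence "(-1) ^ n0 * g 0 * (-1) ^ i * P i > 0" by (rule zero_less_mult_pos2) (use \<open>g i \<noteq> 0\<close> in simp)
    thus "(-1) ^ n0 * g 0 * (-1) ^ i * Re (faber_coeff l a b (of_real (arc_j (\<theta> i)))) > 0"
      unfolding P_def .
  next
    fix i assume i: "Suc i < l"
    have "\<theta> i < \<theta> (Suc i)"
      by (rule sample_angle_mono[OF K]) (use \<theta>(3)[of i] \<theta>(3)[OF i] i in simp)
    thus "arc_j (\<theta> (Suc i)) < arc_j (\<theta> i)" using \<theta> i by (intro arc_j_strict_antimono) auto
  qed
qed

section \<open>From the modular form to the polynomial\<close>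

lemma weight_decomposition:
  assumes "even k" "k \<noteq> 2" "ell k \<ge> 1"
  obtains a b where "a \<le> 2" "b \<le> 1" "k = 12 * ell k + 4 * a + 6 * b"
proof -
  have k: "k = 12 * (k div 12) + k mod 12" by simp
  have "even (k mod 12)" using assms(1) by (simp add: dvd_mod_iff)
  moreover have "k mod 12 < 12" by simp
  ultimately have "k mod 12 \<in> {0, 2, 4, 6, 8, 10}" by (auto elim!: evenE)
  then consider "k mod 12 = 0" | "k mod 12 = 2" | "k mod 12 = 4" | "k mod 12 = 6" | "k mod 12 = 8" | "k mod 12 = 10" by auto
  thus ?thesis
  proof cases
    case 1 thus ?thesis using that[of 0 0] k by (simp add: ell_def)
  next
    \<comment> \<open>The residue 2 stands for k' = 14 = 4 * 2 + 6 * 1, one multiple of 12 having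
      been given back by \<open>ell\<close>.\<close>
    case 2 thus ?thesis using that[of 2 1] k assms(3) by (simp add: ell_def)
  next
    case 3 thus ?thesis using that[of 1 0] k by (simp add: ell_def)
  next
    case 4 thus ?thesis using that[of 0 1] k by (simp add: ell_def)
  next
    case 5 thus ?thesis using that[of 2 0] k by (simp add: ell_def)
  next
    case 6 thus ?thesis using that[of 1 1] k by (simp add: ell_def)
  qed
qed

text \<open>Every point of the punctured disc is q(\<tau>) for some \<tau>, so convergence on the
  upper half plane yields radius at least 1.\<close>

lemma q_expansion_mform:
  assumes mf: "modular_form k f" and qe: "has_q_expansion f a"
  shows "mform k (Abs_fps a)" "\<And>\<tau>. Im \<tau> > 0 \<Longrightarrow> f \<tau> = eval_fps (Abs_fps a) (qpar \<tau>)"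
proof -
  have sums: "(\<lambda>n. a n * qpar \<tau> ^ n) sums f \<tau>" if "Im \<tau> > 0" for \<tau>
    using qe that by (simp add: has_q_expansion_def upper_half_plane_def)
  show f: "f \<tau> = eval_fps (Abs_fps a) (qpar \<tau>)" if "Im \<tau> > 0" for \<tau>
    using sums_unique[OF sums[OF that]] by (simp add: eval_fps_def)
  have "1 \<le> conv_radius a"
  proof (rule conv_radius_geI_ex)
    fix r :: real assume r: "0 < r" "ereal r < 1"
    hence "(of_real r :: complex) \<noteq> 0" "norm (of_real r :: complex) < 1" by auto
    then obtain \<tau> where "Im \<tau> > 0" "qpar \<tau> = of_real r" using qpar_surj by metis
    thus "\<exists>z. norm z = r \<and> summable (\<lambda>n. a n * z ^ n)"
      using sums[of \<tau>] r by (intro exI[of _ "of_real r"]) (auto simp: sums_iff)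
  qed
  moreover have "fps_nth (Abs_fps a) = a" by auto
  ultimately have conv: "1 \<le> fps_conv_radius (Abs_fps a)" by (simp add: fps_conv_radius_def)
  show "mform k (Abs_fps a)" unfolding mform_def
  proof (intro conjI allI impI conv)
    fix a' b c d :: int and \<tau> assume det: "a' * d - b * c = 1" and \<tau>: "Im \<tau> > 0"
    show "eval_fps (Abs_fps a) (qpar ((of_int a' * \<tau> + of_int b) / (of_int c * \<tau> + of_int d))) =
          (of_int c * \<tau> + of_int d) ^ k * eval_fps (Abs_fps a) (qpar \<tau>)"
      using mf det \<tau> f[OF \<tau>] f[OF Im_moebius_pos[OF det \<tau>]]
      by (simp add: modular_form_def upper_half_plane_def)
  qed
qed

lemma qpar_eq_imp_eq:
  assumes "qpar z = qpar w" "-1/2 \<le> Re z" "Re z < 1/2" "-1/2 \<le> Re w" "Re w < 1/2"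
  shows "z = w"
proof -
  obtain n :: int where n: "z = w + of_int n" using assms(1) unfolding qpar_eq_iff by blast
  hence "real_of_int n = Re z - Re w" by simp
  hence "real_of_int (-1) < of_int n" "real_of_int n < of_int 1" using assms by auto
  hence "n = 0" unfolding of_int_less_iff by simp
  thus ?thesis using n by simp
qed

theorem theorem1p2:
  fixes k :: nat and f :: "complex \<Rightarrow> complex" and a :: "nat \<Rightarrow> complex"
  assumes "even k" and "k \<noteq> 2"
    and "ell k \<ge> 1"
    and "modular_form k f"
    and "has_q_expansion f a"
    and "a 0 = 0" and "a 1 = 1"
    and "\<And>n. 2 \<le> n \<Longrightarrow> n \<le> ell k \<Longrightarrow> a n = 0"
  shows "\<forall>z\<in>fund_domain. f z = 0 \<longrightarrow> z \<in> arc_A"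
proof (intro ballI impI)
  fix z assume z: "z \<in> fund_domain" and fz: "f z = 0"
  define l where "l = ell k"
  define F where "F = Abs_fps a"
  obtain u v where uv: "u \<le> 2" "v \<le> 1" "k = 12 * l + 4 * u + 6 * v"
    using weight_decomposition[OF assms(1-3)] unfolding l_def .
  have F: "mform k F" "\<And>\<tau>. Im \<tau> > 0 \<Longrightarrow> f \<tau> = eval_fps F (qpar \<tau>)"
    unfolding F_def using q_expansion_mform[OF assms(4,5)] by auto
  have mF: "mform (12 * l + 4 * u + 6 * v) F" "fps_nth F 0 = 0" using F(1) uv(3) assms(6) by (simp_all add: F_def)
  obtain c where c: "F = (\<Sum>i<l. fps_const (c i) * (Delta ^ (l - i) * E4 ^ (3 * i + u) * E6 ^ v))"
    using cusp_form_decomposition[OF mF(1) uv(1,2) mF(2)] .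
  have l: "l \<ge> 1" using assms(3) by (simp add: l_def)
  have P: "(\<Sum>i<l. c i * x ^ i) = faber_coeff l u v x" for x
    by (rule faber_coeff_eq[OF l uv(1,2) c]) (use assms(6-8) in \<open>simp_all add: F_def l_def\<close>)
  have sc: "sign_changes l (\<lambda>x. Re (faber_coeff l u v (of_real x)))"
  proof (cases "l \<le> 9")
    case True
    thus ?thesis using sign_changes_small l uv by blast
  next
    case False
    thus ?thesis using sign_changes_large[of l u v c] uv P by simp
  qed
  \<comment> \<open>The asymmetric boundary of \<open>fund_domain\<close> puts its points on the
    unit circle into the left half, and its half-open strip makes q injective.\<close>
  have z': "-1/2 \<le> Re z" "Re z < 1/2" "norm z \<ge> 1" "Im z > 0" "norm z = 1 \<Longrightarrow> Re z \<le> 0"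
    using z by (auto simp: fund_domain_def)
  have im: "Im z \<ge> sqrt 3 / 2" by (rule Im_fundamental_domain_ge) (use z' in auto)
  define e4 e6 d where "e4 = eval_fps E4 (qpar z)" and "e6 = eval_fps E6 (qpar z)" and "d = eval_fps Delta (qpar z)"
  have q: "norm (qpar z) < 1" using z'(4) by (rule norm_qpar_less_1)
  have d: "d \<noteq> 0" using eval_Delta_nonzero[OF z'(4)] by (simp add: d_def)
  \<comment> \<open>Zeros of E4 or E6 in the domain are the corners \<rho> and i of the arc.
    Elsewhere Delta^l E4^u E6^v is nonzero and cancels, so j(z) is a zero of the polynomial.\<close>
  have "norm z = 1"
  proof (cases "e4 = 0 \<or> e6 = 0")
    case True
    have "z = cis (2 * pi / 3) \<or> z = cis (pi / 2)"
      using True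
    proof
      assume "e4 = 0"
      hence "qpar z = qpar (Complex (-1/2) (sqrt 3 / 2))" using E4_zero_fundamental[OF im] by (simp add: e4_def)
      hence "z = Complex (-1/2) (sqrt 3 / 2)" by (rule qpar_eq_imp_eq) (use z' in auto)
      thus ?thesis unfolding cis_ends by simp
    next
      assume "e6 = 0"
      hence "qpar z = qpar \<i>" using E6_zero_fundamental[OF im] by (simp add: e6_def)
      hence "z = \<i>" by (rule qpar_eq_imp_eq) (use z' in auto)
      thus ?thesis unfolding cis_ends by simp
    qed
    thus ?thesis by auto
  next
    case False
    have conv: "1 \<le> fps_conv_radius (fps_const (c i) * (Delta ^ (l - i) * E4 ^ (3 * i + u) * E6 ^ v))" for i
      by (intro conv_radius_mult_ge_1 conv_radius_power_ge_1) auto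
    have "0 = eval_fps F (qpar z)" using fz F(2)[OF z'(4)] by simp
    also have "\<dots> = (\<Sum>i<l. eval_fps (fps_const (c i) * (Delta ^ (l - i) * E4 ^ (3 * i + u) * E6 ^ v)) (qpar z))"
      unfolding c using eval_fps_sum_ge_1[OF q, of l "\<lambda>i. fps_const (c i) * (Delta ^ (l - i) * E4 ^ (3 * i + u) * E6 ^ v)"] conv by blast
    also have "\<dots> = (\<Sum>i<l. c i * (d ^ (l - i) * e4 ^ (3 * i + u) * e6 ^ v))"
      using q by (simp add: eval_fps_mult eval_fps_power less_conv conv_radius_mult_ge_1 conv_radius_power_ge_1 d_def e4_def e6_def)
    also have "\<dots> = (\<Sum>i<l. d ^ l * e4 ^ u * e6 ^ v * (c i * klein_j z ^ i))"
    proof (intro sum.cong refl)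
      fix i assume "i \<in> {..<l}"
      hence "d ^ l = d ^ (l - i) * d ^ i" by (simp flip: power_add)
      moreover have "klein_j z ^ i = e4 ^ (3 * i) / d ^ i" by (simp add: klein_j_def e4_def d_def power_divide power_mult)
      ultimately show "c i * (d ^ (l - i) * e4 ^ (3 * i + u) * e6 ^ v) = d ^ l * e4 ^ u * e6 ^ v * (c i * klein_j z ^ i)"
        using d by (simp add: power_add)
    qed
    also have "\<dots> = d ^ l * e4 ^ u * e6 ^ v * (\<Sum>i<l. c i * klein_j z ^ i)" by (rule sum_distrib_left[symmetric])
    finally have "(\<Sum>i<l. c i * klein_j z ^ i) = 0" using False d by simp
    moreover have "(\<Sum>i<l. c i * of_real x ^ i) = of_real (Re (faber_coeff l u v (of_real x)))" for x
      unfolding P by (rule of_real_Re[symmetric]) (simp add: faber_coeff_real)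
    ultimately obtain x where "klein_j z = of_real x" "0 \<le> x" "x \<le> 1728"
      using roots_from_sign_changes[OF l _ sc] by blast
    thus ?thesis using klein_j_in_interval_imp_arc[of z x] z' by auto
  qed
  then obtain \<theta> where "pi / 2 \<le> \<theta>" "\<theta> \<le> 2 * pi / 3" "z = cis \<theta>"
    using unit_circle_arc[of z] z' by blast
  thus "z \<in> arc_A" unfolding arc_A_def cis_conv_exp by blast
qed

end
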